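(* Let $1\le p,p_1,p_2\le\infty$ and $s_0,s_1,s_2\in\mathbb{R}$. Let $\frac1p\le\frac1{p_1}+\frac1{p_2}$, $1<q\le\infty$, $0\le s_0\le\min(s_1,s_2)$ and $s_1+s_2-s_0>n/q'$. Then there exists a constant $c$ such that $$\|f\cdot g\|_{M^{s_0}_{p,q}}\le c\,\|f\|_{M^{s_1}_{p_1,q}}\,\|g\|_{M^{s_2}_{p_2,q}}$$ holds for all $f\in M^{s_1}_{p_1,q}$ and all $g\in M^{s_2}_{p_2,q}$ (in particular, the product $f\cdot g$ exists for all such $f,g$).
   Context: All function spaces are on $\mathbb{R}^n$; $\langle\xi\rangle:=(1+|\xi|^2)^{1/2}$; $q'$ is the conjugate exponent, $\frac1q+\frac1{q'}=1$ (with $1/\infty=0$). For a nontrivial $\phi\in\mathcal{S}$ (Schwartz space) and $f\in\mathcal{S}'$ the short-time Fourier transform is $V_\phi f(x,\xi)=(2\pi)^{-n/2}\int_{\mathbb{R}^n} f(s)\overline{\phi(s-x)}e^{-is\cdot\xi}\,ds$. For $1\le p,q\le\infty$, $s\in\mathbb{R}$, the weighted modulation space $M^s_{p,q}$ is the set of all $f\in\mathcal{S}'$ with $\|f\|_{M^s_{p,q}}=\big(\int(\int|V_\phi f(x,\xi)\langle\xi\rangle^s|^p\,dx)^{q/p}d\xi\big)^{1/q}<\infty$ (usual modifications if $p$ or $q$ is $\infty$), $\phi$ being a fixed window; different windows give the same space with equivalent norms. The product of $f,g\in\mathcal{S}'$ is $f\cdot g:=\lim_{j\to\infty}S^jf\cdot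 S^jg$ whenever this limit exists in $\mathcal{S}'$, where $S^jf=\mathcal{F}^{-1}[\psi(2^{-j}\xi)\mathcal{F}f(\xi)]$ for a fixed $\psi\in C_0^\infty(\mathbb{R}^n)$ equal to $1$ in a neighbourhood of the origin. *)

theory Defs
  imports "HOL-Probability.Essential_Supremum"
begin

text \<open>The underlying space is an arbitrary Euclidean space; for the type \<open>real ^ 'n\<close> the
  elements of \<open>Basis\<close> are the standard unit vectors and \<open>DIM('a) = CARD('n)\<close>.\<close>


text \<open>\<open>partials [b\<^sub>1, \<dots>, b\<^sub>k] f\<close> is the iterated directional derivative
  of \<open>f\<close> along \<open>b\<^sub>k\<close>, \dots, \<open>b\<^sub>1\<close>.  With entries from \<open>Basis\<close> these are the
  partial derivatives \<open>\<partial>\<^sup>\<alpha> f\<close>, where \<open>\<alpha>\<close> counts the occurrences of each basis vector,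
  so that \<open>\<bar>\<alpha>\<bar>\<close> is the length of the list.\<close>

fun partials :: "'a list \<Rightarrow> ('a::euclidean_space \<Rightarrow> complex) \<Rightarrow> 'a \<Rightarrow> complex" where
  "partials [] f = f"
| "partials (b # bs) f = (\<lambda>x. frechet_derivative (partials bs f) (at x) b)"

text \<open>\<open>C\<^sup>\<infinity>\<close>: all iterated partial derivatives exist and are (totally) differentiable,
  hence continuous.\<close>

definition smooth :: "('a::euclidean_space \<Rightarrow> complex) \<Rightarrow> bool" where
  "smooth f \<longleftrightarrow> (\<forall>bs. set bs \<subseteq> Basis \<longrightarrow> partials bs f differentiable_on UNIV)"

definition schwartz_space :: "('a::euclidean_space \<Rightarrow> complex) set" where
  "schwartz_space = {f. smooth f \<and>
     (\<forall>k bs. set bs \<subseteq> Basis \<longrightarrow> bounded (range (\<lambda>x. (1 + norm x) ^ k *\<^sub>R partials bs f x)))}"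

text \<open>The increasing family of norms defining the topology of the Schwartz space.\<close>

definition schwartz_norm :: "nat \<Rightarrow> ('a::euclidean_space \<Rightarrow> complex) \<Rightarrow> real" where
  "schwartz_norm N f =
     (SUP (x, bs) \<in> UNIV \<times> {bs. set bs \<subseteq> Basis \<and> length bs \<le> N}.
        (1 + norm x) ^ N * norm (partials bs f x))"

definition test_functions :: "('a::euclidean_space \<Rightarrow> complex) set" where
  "test_functions = {f. smooth f \<and> compact (closure {x. f x \<noteq> 0})}"


text \<open>A tempered distribution is a continuous linear functional on the Schwartz space.
  Its values outside the Schwartz space are fixed to be \<^const>\<open>undefined\<close>, so that
  HOL equality is equality of distributions.  The pairing with test functions is bilinear
  (no complex conjugation).\<close>

type_synonym 'a functional = "('a \<Rightarrow> complex) \<Rightarrow> complex"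

definition tempered_distributions :: "'a::euclidean_space functional set" where
  "tempered_distributions = {u. u \<in> extensional schwartz_space
     \<and> (\<forall>\<phi>\<in>schwartz_space. \<forall>\<eta>\<in>schwartz_space. u (\<lambda>x. \<phi> x + \<eta> x) = u \<phi> + u \<eta>)
     \<and> (\<forall>a. \<forall>\<phi>\<in>schwartz_space. u (\<lambda>x. a * \<phi> x) = a * u \<phi>)
     \<and> (\<exists>C N. \<forall>\<phi>\<in>schwartz_space. norm (u \<phi>) \<le> C * schwartz_norm N \<phi>)}"

definition fourier :: "('a::euclidean_space \<Rightarrow> complex) \<Rightarrow> 'a \<Rightarrow> complex" where
  "fourier f \<xi> = complex_of_real ((2 * pi) powr (- real DIM('a) / 2))
     * (\<integral>x. f x * exp (- \<i> * complex_of_real (x \<bullet> \<xi>)) \<partial>lborel)"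

definition inverse_fourier :: "('a::euclidean_space \<Rightarrow> complex) \<Rightarrow> 'a \<Rightarrow> complex" where
  "inverse_fourier f x = complex_of_real ((2 * pi) powr (- real DIM('a) / 2))
     * (\<integral>\<xi>. f \<xi> * exp (\<i> * complex_of_real (x \<bullet> \<xi>)) \<partial>lborel)"

definition dist_fourier :: "'a::euclidean_space functional \<Rightarrow> 'a functional" where
  "dist_fourier u = (\<lambda>\<phi>\<in>schwartz_space. u (fourier \<phi>))"

definition dist_inverse_fourier :: "'a::euclidean_space functional \<Rightarrow> 'a functional" where
  "dist_inverse_fourier u = (\<lambda>\<phi>\<in>schwartz_space. u (inverse_fourier \<phi>))"

definition dist_mult :: "('a::euclidean_space \<Rightarrow> complex) \<Rightarrow> 'a functional \<Rightarrow> 'a functional" where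
  "dist_mult m u = (\<lambda>\<phi>\<in>schwartz_space. u (\<lambda>x. m x * \<phi> x))"

definition dist_of_fun :: "('a::euclidean_space \<Rightarrow> complex) \<Rightarrow> 'a functional" where
  "dist_of_fun F = (\<lambda>\<phi>\<in>schwartz_space. \<integral>x. F x * \<phi> x \<partial>lborel)"

text \<open>The continuous function of at most polynomial growth that represents a distribution.
  It is unique if it exists, and it exists whenever the Fourier transform of the
  distribution has compact support (Paley-Wiener-Schwartz).\<close>

definition fun_of_dist :: "'a::euclidean_space functional \<Rightarrow> 'a \<Rightarrow> complex" where
  "fun_of_dist u = (THE F. continuous_on UNIV F
     \<and> (\<exists>C N. \<forall>x. norm (F x) \<le> C * (1 + norm x) ^ N) \<and> u = dist_of_fun F)"


definition cutoff_function :: "('a::euclidean_space \<Rightarrow> complex) \<Rightarrow> bool" where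
  "cutoff_function \<psi> \<longleftrightarrow> \<psi> \<in> test_functions \<and> (\<forall>\<^sub>F \<xi> in nhds 0. \<psi> \<xi> = 1)"

definition low_pass ::
  "('a::euclidean_space \<Rightarrow> complex) \<Rightarrow> nat \<Rightarrow> 'a functional \<Rightarrow> 'a functional" where
  "low_pass \<psi> j f = dist_inverse_fourier (dist_mult (\<lambda>\<xi>. \<psi> (\<xi> /\<^sub>R 2 ^ j)) (dist_fourier f))"

text \<open>\<open>S\<^sup>j f \<cdot> S\<^sup>j g\<close>, the pointwise product of two functions, as a distribution.\<close>

definition low_pass_product :: "('a::euclidean_space \<Rightarrow> complex) \<Rightarrow> nat \<Rightarrow>
    'a functional \<Rightarrow> 'a functional \<Rightarrow> 'a functional" where
  "low_pass_product \<psi> j f g =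
     dist_of_fun (\<lambda>x. fun_of_dist (low_pass \<psi> j f) x * fun_of_dist (low_pass \<psi> j g) x)"

text \<open>Convergence of the sequence is in the weak-* topology of the space of
  tempered distributions.\<close>

definition is_product :: "('a::euclidean_space \<Rightarrow> complex) \<Rightarrow>
    'a functional \<Rightarrow> 'a functional \<Rightarrow> 'a functional \<Rightarrow> bool" where
  "is_product \<psi> f g h \<longleftrightarrow> h \<in> tempered_distributions
     \<and> (\<forall>\<phi>\<in>schwartz_space. (\<lambda>j. low_pass_product \<psi> j f g \<phi>) \<longlonglongrightarrow> h \<phi>)"

definition product_exists :: "('a::euclidean_space \<Rightarrow> complex) \<Rightarrow>
    'a functional \<Rightarrow> 'a functional \<Rightarrow> bool" where
  "product_exists \<psi> f g \<longleftrightarrow> (\<exists>h. is_product \<psi> f g h)"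

definition dist_product :: "('a::euclidean_space \<Rightarrow> complex) \<Rightarrow>
    'a functional \<Rightarrow> 'a functional \<Rightarrow> 'a functional" where
  "dist_product \<psi> f g = (THE h. is_product \<psi> f g h)"

lemma is_product_unique:
  assumes "is_product \<psi> f g h" "is_product \<psi> f g h'"
  shows "h = h'"
proof (rule extensionalityI[where A = schwartz_space])
  show "h \<in> extensional schwartz_space" "h' \<in> extensional schwartz_space"
    using assms by (auto simp: is_product_def tempered_distributions_def)
  show "h \<phi> = h' \<phi>" if "\<phi> \<in> schwartz_space" for \<phi>
    using assms that LIMSEQ_unique unfolding is_product_def by blast
qed

lemma dist_product_eq: "is_product \<psi> f g h \<Longrightarrow> dist_product \<psi> f g = h"
  unfolding dist_product_def using is_product_unique by blast


definition window :: "('a::euclidean_space \<Rightarrow> complex) \<Rightarrow> bool" where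
  "window \<phi> \<longleftrightarrow> \<phi> \<in> schwartz_space \<and> \<phi> \<noteq> (\<lambda>x. 0)"

definition stft ::
  "('a::euclidean_space \<Rightarrow> complex) \<Rightarrow> 'a functional \<Rightarrow> 'a \<Rightarrow> 'a \<Rightarrow> complex" where
  "stft \<phi> f x \<xi> = complex_of_real ((2 * pi) powr (- real DIM('a) / 2))
     * f (\<lambda>t. cnj (\<phi> (t - x)) * exp (- \<i> * complex_of_real (t \<bullet> \<xi>)))"

definition japanese_bracket :: "'a::euclidean_space \<Rightarrow> real" where
  "japanese_bracket \<xi> = sqrt (1 + (norm \<xi>)\<^sup>2)"

text \<open>Powers with exponent \<open>a > 0\<close> on \<open>[0, \<infinity>]\<close>.\<close>

definition ennreal_power :: "ennreal \<Rightarrow> real \<Rightarrow> ennreal" where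
  "ennreal_power x a = (if x = \<infinity> then \<infinity> else ennreal (enn2real x powr a))"

text \<open>Meaningful for \<open>1 \<le> p \<le> \<infinity>\<close> and measurable \<open>h\<close>.\<close>

definition Lp_norm :: "ennreal \<Rightarrow> ('a::euclidean_space \<Rightarrow> ennreal) \<Rightarrow> ennreal" where
  "Lp_norm p h = (if p = \<infinity> then esssup lborel h
     else ennreal_power (\<integral>\<^sup>+x. ennreal_power (h x) (enn2real p) \<partial>lborel) (1 / enn2real p))"

definition modulation_norm :: "('a::euclidean_space \<Rightarrow> complex) \<Rightarrow> real \<Rightarrow> ennreal \<Rightarrow> ennreal \<Rightarrow>
    'a functional \<Rightarrow> ennreal" where
  "modulation_norm \<phi> s p q f =
     Lp_norm q (\<lambda>\<xi>. Lp_norm p (\<lambda>x.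
       ennreal (norm (stft \<phi> f x \<xi> * complex_of_real (japanese_bracket \<xi> powr s)))))"

definition modulation_space :: "('a::euclidean_space \<Rightarrow> complex) \<Rightarrow> real \<Rightarrow> ennreal \<Rightarrow> ennreal \<Rightarrow>
    'a functional set" where
  "modulation_space \<phi> s p q = {f \<in> tempered_distributions. modulation_norm \<phi> s p q f < \<infinity>}"

end

theory Submission
  imports Defs "HOL-Probability.Characteristic_Functions"
begin

text \<open>Write \<open>A\<^sub>f\<close> for the average of \<open>\<bar>V\<^sub>\<phi> f\<bar>\<close> over phase space against a rapidly decaying polynomial kernel.  By the
  reproducing formula of the short-time Fourier transform, \<open>\<bar>V\<^sub>\<theta> f\<bar> \<le> C A\<^sub>f\<close> for every Schwartz window \<open>\<theta>\<close>, and the same bound holds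
  for all low-pass approximations \<open>S\<^sup>j f\<close> uniformly in \<open>j\<close>.  With \<open>\<theta> = \<bar>\<phi>\<bar>\<^sup>2\<close>, inserting \<open>\<theta>(t - x)\<^sup>3\<close> and applying
  Parseval's formula twice expresses \<open>\<integral> S\<^sup>j f S\<^sup>j g \<rho>\<close> as an integral of
  \<open>V\<^sub>\<theta> S\<^sup>j f (x, \<xi>) V\<^sub>\<theta> S\<^sup>j g (x, \<eta>) (\<rho> \<theta>(\<cdot> - x))^(- \<xi> - \<eta>)\<close>
  over \<open>x, \<xi>, \<eta>\<close>.  This is dominated by \<open>A\<^sub>f(x, \<xi>) A\<^sub>g(x, \<eta>)\<close> times a kernel, so the limit \<open>j \<rightarrow> \<infinity>\<close> exists; since
  \<open>A\<^sub>f\<close> and \<open>A\<^sub>g\<close> vary slowly, testing against time-frequency shifts of \<open>\<phi>\<close> gives the pointwise bound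
  \<open>\<bar>V\<^sub>\<phi> (f g) (y, \<zeta>)\<bar> \<le> C \<integral> A\<^sub>f(y, \<xi>) A\<^sub>g(y, \<zeta> - \<xi>) d\<xi>\<close>.  What remains is an estimate for nonnegative functions:
  the Minkowski and Hoelder inequalities in \<open>x\<close> (slow variation provides the embeddings \<open>L\<^sup>p \<subseteq> L\<^sup>r\<close> for \<open>p \<le> r\<close>)
  and, in \<open>\<xi>\<close>, a weighted convolution estimate, in which Hoelder's inequality uses up the surplus
  \<open>s\<^sub>1 + s\<^sub>2 - s\<^sub>0 > n/q'\<close> of the weights.\<close>

section \<open>Lebesgue norms of nonnegative functions\<close>

text \<open>If one of the exponents is infinite, Schwartz functions are not dense in the
  corresponding modulation space, so the product cannot be extended from a dense class. Instead the
  low-pass products become absolutely convergent integrals over (x, \<xi>, \<eta>) with a majorant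
  independent of j, and dominated convergence gives the limit. The integral of this majorant is
  controlled by \<open>smear_product m V W y \<zeta>\<close>, whose finiteness has to be known
  beforehand. By slow variation it is finite either everywhere or nowhere; were it infinite
  everywhere, its weighted norm would be infinite, against the norm estimate. Thus one inequality
  for nonnegative functions yields both existence and the bound.

  The window is |\<phi>|^2 and not \<phi> because the normalising constant is the integral of its
  cube: this is the integral of |\<phi>|^6, which is positive, whereas the integral of \<phi>^3 may
  vanish. The order m of the averaging kernel is chosen larger than n + s1 and n + s2, where n is
  the dimension, so that the weights can be moved through the average.\<close>

lemma ennreal_power_0 [simp]: "ennreal_power 0 a = 0"
  by (simp add: ennreal_power_def)

lemma ennreal_power_top [simp]: "ennreal_power \<infinity> a = \<infinity>" "ennreal_power top a = top"
  by (simp_all add: ennreal_power_def)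

lemma ennreal_power_ennreal: "0 \<le> r \<Longrightarrow> ennreal_power (ennreal r) a = ennreal (r powr a)"
  by (simp add: ennreal_power_def)

lemma ennreal_power_one [simp]: "ennreal_power 1 a = 1"
  by (simp add: ennreal_power_def)

lemma ennreal_power_by_1 [simp]: "ennreal_power x 1 = x"
  by (cases x) (simp_all add: ennreal_power_ennreal)

lemma ennreal_power_mono: "x \<le> y \<Longrightarrow> 0 \<le> a \<Longrightarrow> ennreal_power x a \<le> ennreal_power y a"
  by (cases x; cases y) (auto simp: ennreal_power_ennreal powr_mono2 top_unique ennreal_leI)

lemma ennreal_power_eq_0_iff [simp]: "ennreal_power x a = 0 \<longleftrightarrow> x = 0"
  by (cases x) (auto simp: ennreal_power_ennreal)

lemma ennreal_power_mult: "ennreal_power (x * y) a = ennreal_power x a * ennreal_power y a"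
proof (cases "x = 0 \<or> y = 0")
  case False
  then show ?thesis
    by (cases x; cases y)
       (auto simp: ennreal_power_ennreal powr_mult ennreal_mult[symmetric] ennreal_mult_top ennreal_top_mult)
qed auto

lemma ennreal_power_power: "ennreal_power (ennreal_power x a) b = ennreal_power x (a * b)"
  by (cases x) (auto simp: ennreal_power_ennreal powr_powr)

lemma ennreal_power_add:
  "ennreal_power x (a + b) = ennreal_power x a * ennreal_power x b"
  by (cases x) (auto simp: ennreal_power_ennreal powr_add ennreal_mult[symmetric] ennreal_top_mult)

lemma ennreal_power_measurable [measurable]:
  assumes [measurable]: "f \<in> borel_measurable M"
  shows "(\<lambda>x. ennreal_power (f x) a) \<in> borel_measurable M"
  unfolding ennreal_power_def by measurable

section \<open>The inequalities of Hoelder and Minkowski\<close>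

lemma ennreal_power_weighted_AM_GM:
  assumes "0 < a" "0 < b" "a + b = 1"
  shows "ennreal_power x a * ennreal_power y b \<le> ennreal a * x + ennreal b * y"
proof (cases "x = 0 \<or> y = 0 \<or> x = top \<or> y = top")
  case True
  then show ?thesis using assms by (auto simp: ennreal_mult_top)
next
  case False
  then obtain r s where rs: "x = ennreal r" "y = ennreal s" "0 < r" "0 < s"
    by (cases x; cases y) (auto simp: ennreal_eq_0_iff less_le)
  then show ?thesis using assms Youngs_inequality_0[of a b r s]
    by (simp add: ennreal_power_ennreal ennreal_mult[symmetric] ennreal_plus[symmetric] ennreal_leI del: ennreal_plus)
qed

text \<open>The weighted arithmetic-geometric mean inequality is applied pointwise to the powers of
  u and v divided by their integrals U and V; after integration the right-hand side is a + b = 1.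
  Since 0 times \<infinity> is 0 in \<open>ennreal\<close>, the cases U = 0 and V = 0 are settled
  before those with an infinite integral.\<close>

lemma nn_integral_Hoelder:
  assumes [measurable]: "u \<in> borel_measurable M" "v \<in> borel_measurable M"
    and ab: "0 < a" "0 < b" "a + b = 1"
  shows "(\<integral>\<^sup>+x. u x * v x \<partial>M) \<le> ennreal_power (\<integral>\<^sup>+x. ennreal_power (u x) (1/a) \<partial>M) a
           * ennreal_power (\<integral>\<^sup>+x. ennreal_power (v x) (1/b) \<partial>M) b"
    (is "_ \<le> ennreal_power ?U a * ennreal_power ?V b")
proof -
  consider "?U = 0" | "?V = 0" | "?U \<noteq> 0" "?V \<noteq> 0" "?U = top \<or> ?V = top"
    | "?U \<noteq> 0" "?V \<noteq> 0" "?U \<noteq> top" "?V \<noteq> top" by blast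
  then show ?thesis
  proof cases
    case 1
    then have "AE x in M. u x = 0" by (simp add: nn_integral_0_iff_AE)
    then have "(\<integral>\<^sup>+x. u x * v x \<partial>M) = (\<integral>\<^sup>+x. 0 \<partial>M)" by (intro nn_integral_cong_AE) auto
    then show ?thesis by simp
  next
    case 2
    then have "AE x in M. v x = 0" by (simp add: nn_integral_0_iff_AE)
    then have "(\<integral>\<^sup>+x. u x * v x \<partial>M) = (\<integral>\<^sup>+x. 0 \<partial>M)" by (intro nn_integral_cong_AE) auto
    then show ?thesis by simp
  next
    case 3
    then show ?thesis by (auto simp: ennreal_mult_top ennreal_top_mult)
  next
    case 4
    then obtain U V where U: "?U = ennreal U" "0 < U" and V: "?V = ennreal V" "0 < V"
      by (metis ennreal_cases ennreal_0 ennreal_eq_0_iff linorder_not_less order_le_less)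
    define k where "k = ennreal (inverse (U powr a * V powr b))"
    have pw: "k * (u x * v x) \<le> ennreal (a / U) * ennreal_power (u x) (1/a)
        + ennreal (b / V) * ennreal_power (v x) (1/b)" for x
    proof -
      have "ennreal_power (ennreal (inverse U) * ennreal_power (u x) (1/a)) a
          * ennreal_power (ennreal (inverse V) * ennreal_power (v x) (1/b)) b
        \<le> ennreal a * (ennreal (inverse U) * ennreal_power (u x) (1/a))
          + ennreal b * (ennreal (inverse V) * ennreal_power (v x) (1/b))"
        by (rule ennreal_power_weighted_AM_GM[OF ab])
      also have "\<dots> = ennreal (a / U) * ennreal_power (u x) (1/a)
        + ennreal (b / V) * ennreal_power (v x) (1/b)"
        using ab U V by (simp add: mult.assoc[symmetric] ennreal_mult[symmetric] divide_inverse)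
      also have "ennreal_power (ennreal (inverse U) * ennreal_power (u x) (1/a)) a
          * ennreal_power (ennreal (inverse V) * ennreal_power (v x) (1/b)) b = k * (u x * v x)"
        using ab U V by (simp add: ennreal_power_mult ennreal_power_power ennreal_power_ennreal k_def
            ennreal_mult powr_mult inverse_powr mult_ac)
      finally show ?thesis .
    qed
    have "k * (\<integral>\<^sup>+x. u x * v x \<partial>M) = (\<integral>\<^sup>+x. k * (u x * v x) \<partial>M)"
      by (simp add: nn_integral_cmult)
    also have "\<dots> \<le> (\<integral>\<^sup>+x. ennreal (a / U) * ennreal_power (u x) (1/a)
        + ennreal (b / V) * ennreal_power (v x) (1/b) \<partial>M)"
      by (intro nn_integral_mono pw)
    also have "\<dots> = ennreal (a / U) * ?U + ennreal (b / V) * ?V"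
      by (simp add: nn_integral_add nn_integral_cmult)
    also have "\<dots> = 1"
      using U V ab by (simp add: ennreal_mult[symmetric] ennreal_plus[symmetric] del: ennreal_plus)
    finally have le: "k * (\<integral>\<^sup>+x. u x * v x \<partial>M) \<le> 1" .
    define K where "K = ennreal (U powr a * V powr b)"
    have Kk: "K * k = 1" using U V by (simp add: K_def k_def ennreal_mult[symmetric] field_simps)
    have "(\<integral>\<^sup>+x. u x * v x \<partial>M) = K * (k * (\<integral>\<^sup>+x. u x * v x \<partial>M))"
      by (simp add: mult.assoc[symmetric] Kk)
    also have "\<dots> \<le> K * 1" by (intro mult_left_mono le) simp
    also have "K * 1 = ennreal_power ?U a * ennreal_power ?V b"
      using U V by (simp add: ennreal_power_ennreal K_def ennreal_mult)
    finally show ?thesis .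
  qed
qed

text \<open>The exponent is \<open>1/a\<close>, and \<open>a = 0\<close> stands for \<open>L\<^sup>\<infinity>\<close>: in this parametrisation Hoelder's inequality adds
  the indices, and no case distinctions are needed for infinite exponents.\<close>

definition Lnorm :: "'b measure \<Rightarrow> real \<Rightarrow> ('b \<Rightarrow> ennreal) \<Rightarrow> ennreal" where
  "Lnorm M a h = (if a = 0 then esssup M h
     else ennreal_power (\<integral>\<^sup>+x. ennreal_power (h x) (1 / a) \<partial>M) a)"

lemma Lp_norm_eq_Lnorm:
  assumes "1 \<le> p" shows "Lp_norm p h = Lnorm lborel (enn2real (1 / p)) h"
proof (cases p)
  case (real r)
  then have r: "1 \<le> r" using assms by (simp add: ennreal_1[symmetric] del: ennreal_1)
  then have "1 / p = ennreal (1 / r)"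
    using real by (simp add: divide_ennreal[symmetric])
  then show ?thesis using real r by (simp add: Lp_norm_def Lnorm_def)
next
  case top
  then show ?thesis by (simp add: Lp_norm_def Lnorm_def)
qed

lemma Lnorm_mono_AE:
  assumes [measurable]: "f \<in> borel_measurable M" and "AE x in M. f x \<le> g x" "0 \<le> a"
  shows "Lnorm M a f \<le> Lnorm M a g"
  using assms unfolding Lnorm_def
  by (auto intro!: esssup_AE_mono ennreal_power_mono nn_integral_mono_AE elim!: eventually_mono)

lemma Lnorm_mono:
  assumes [measurable]: "f \<in> borel_measurable M" and "\<And>x. f x \<le> g x" "0 \<le> a"
  shows "Lnorm M a f \<le> Lnorm M a g"
  using assms by (intro Lnorm_mono_AE) auto

text \<open>With c = a + b the weights a/c and b/c add up to 1, and Hoelder's inequality with these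
  weights is applied to the powers of u and v with exponent 1/c.\<close>

lemma Lnorm_Hoelder:
  assumes [measurable]: "u \<in> borel_measurable M" "v \<in> borel_measurable M"
    and ab: "0 \<le> a" "0 \<le> b"
  shows "Lnorm M (a + b) (\<lambda>x. u x * v x) \<le> Lnorm M a u * Lnorm M b v"
proof -
  \<comment> \<open>The endpoint at which one factor is measured in L^\<infinity>. It is stated for
    arbitrary functions because it is applied with u and v exchanged as well.\<close>
  have zero: "Lnorm M b (\<lambda>x. u x * v x) \<le> Lnorm M 0 u * Lnorm M b v"
    if "0 \<le> b" and [measurable]: "u \<in> borel_measurable M" "v \<in> borel_measurable M" for b and u v :: "'a \<Rightarrow> ennreal"
  proof -
    have AE: "AE x in M. u x * v x \<le> esssup M u * v x"
      using esssup_AE[of u M] by (auto elim!: eventually_mono intro: mult_right_mono)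
    show ?thesis
    proof (cases "b = 0")
      case True
      have "AE x in M. u x * v x \<le> esssup M u * esssup M v"
        using esssup_AE[of u M] esssup_AE[of v M] by eventually_elim (auto intro: mult_mono)
      then show ?thesis using True by (auto simp: Lnorm_def intro!: esssup_I)
    next
      case False
      have "Lnorm M b (\<lambda>x. u x * v x) \<le> Lnorm M b (\<lambda>x. esssup M u * v x)"
        by (rule Lnorm_mono_AE) (use AE that in auto)
      also have "\<dots> = esssup M u * Lnorm M b v"
        using False that
        by (simp add: Lnorm_def ennreal_power_mult nn_integral_cmult ennreal_power_power)
      finally show ?thesis by (simp add: Lnorm_def)
    qed
  qed
  consider "a = 0" | "b = 0" | "0 < a" "0 < b" using ab by linarith
  then show ?thesis
  proof cases
    case 1 then show ?thesis using zero[OF ab(2), of u v] by simp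
  next
    case 2 then show ?thesis using zero[OF ab(1), of v u] by (simp add: mult.commute)
  next
    case 3
    define c where "c = a + b"
    have c: "0 < c" and ac: "a / c + b / c = 1" using 3 by (auto simp: c_def add_divide_distrib[symmetric])
    have "(\<integral>\<^sup>+x. ennreal_power (u x * v x) (1/c) \<partial>M)
        = (\<integral>\<^sup>+x. ennreal_power (u x) (1/c) * ennreal_power (v x) (1/c) \<partial>M)"
      by (simp add: ennreal_power_mult)
    also have "\<dots> \<le> ennreal_power (\<integral>\<^sup>+x. ennreal_power (ennreal_power (u x) (1/c)) (1/(a/c)) \<partial>M) (a/c)
        * ennreal_power (\<integral>\<^sup>+x. ennreal_power (ennreal_power (v x) (1/c)) (1/(b/c)) \<partial>M) (b/c)"
      by (rule nn_integral_Hoelder) (use 3 c ac in auto)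
    finally have "ennreal_power (\<integral>\<^sup>+x. ennreal_power (u x * v x) (1/c) \<partial>M) c \<le>
       ennreal_power (ennreal_power (\<integral>\<^sup>+x. ennreal_power (u x) (1/a) \<partial>M) (a/c)
        * ennreal_power (\<integral>\<^sup>+x. ennreal_power (v x) (1/b) \<partial>M) (b/c)) c"
      using c 3 by (intro ennreal_power_mono) (auto simp: ennreal_power_power)
    then show ?thesis using c 3
      by (simp add: Lnorm_def ennreal_power_mult ennreal_power_power c_def[symmetric])
  qed
qed

lemma Lnorm_cmult:
  assumes [measurable]: "v \<in> borel_measurable M" and "0 \<le> a"
  shows "Lnorm M a (\<lambda>x. c * v x) \<le> c * Lnorm M a v"
proof -
  have "Lnorm M 0 (\<lambda>x. c) \<le> c" by (auto simp: Lnorm_def intro!: esssup_I)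
  then show ?thesis
    using Lnorm_Hoelder[of "\<lambda>x. c" M v 0 a] assms by (auto intro: order_trans[OF _ mult_right_mono])
qed

text \<open>The essential supremum of a section is at most t exactly if the section of the
  superlevel set is null, and for sigma-finite measures the measure of a section depends measurably
  on the parameter.\<close>

lemma (in sigma_finite_measure) esssup_measurable [measurable]:
  fixes H :: "'b \<Rightarrow> 'a \<Rightarrow> ennreal"
  assumes [measurable]: "case_prod H \<in> borel_measurable (N \<Otimes>\<^sub>M M)"
  shows "(\<lambda>z. esssup M (H z)) \<in> borel_measurable N"
proof (rule borel_measurableI_le)
  fix t
  have eq: "esssup M (H z) \<le> t \<longleftrightarrow> emeasure M {x \<in> space M. t < H z x} = 0" if z: "z \<in> space N" for z
  proof -
    have [measurable]: "H z \<in> borel_measurable M"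
      using measurable_compose[OF measurable_Pair1'[OF z] assms] by simp
    have "esssup M (H z) \<le> t \<longleftrightarrow> (AE x in M. H z x \<le> t)"
      using esssup_AE[of "H z" M] by (auto intro: esssup_I elim!: eventually_mono)
    also have "\<dots> \<longleftrightarrow> emeasure M {x \<in> space M. t < H z x} = 0"
      by (subst AE_iff_measurable[OF _ refl]) (auto simp: not_le)
    finally show ?thesis .
  qed
  have "{z \<in> space N. emeasure M {x \<in> space M. t < H z x} = 0} \<in> sets N"
    by measurable
  also have "{z \<in> space N. emeasure M {x \<in> space M. t < H z x} = 0} = {z \<in> space N. esssup M (H z) \<le> t}"
    using eq by auto
  finally show "{z \<in> space N. esssup M (H z) \<le> t} \<in> sets N" .
qed

lemma (in sigma_finite_measure) Lnorm_measurable [measurable]: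
  assumes [measurable]: "case_prod H \<in> borel_measurable (N \<Otimes>\<^sub>M M)"
  shows "(\<lambda>z. Lnorm M a (H z)) \<in> borel_measurable N"
  unfolding Lnorm_def by (cases "a = 0") (simp_all, measurable)

text \<open>At 0 and at \<infinity> the product is 0, otherwise 1; the inequality covers all cases
  at once.\<close>

lemma ennreal_inverse_mult_le_1: "(x::ennreal) * inverse x \<le> 1"
  by (cases "x = 0 \<or> x = top") (auto simp: divide_ennreal_def[symmetric] less_top)

text \<open>Let c z be the norm of the section at z and C its integral. For 0 < a < 1, Hoelder's
  inequality for the quotient H / c against the measure with density c, whose total mass is C,
  bounds the power 1/a of the integral of H by C^(b/a) times the integral of c (H / c)^(1/a), with b
  = 1 - a. When this is integrated in x, the power of the quotient contributes at most 1 for each z,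
  which leaves C^(1 + b/a) = C^(1/a).\<close>

lemma Lnorm_Minkowski:
  assumes "sigma_finite_measure M" "sigma_finite_measure N"
    and [measurable]: "(\<lambda>(x, z). H x z) \<in> borel_measurable (M \<Otimes>\<^sub>M N)" and a: "0 \<le> a" "a \<le> 1"
  shows "Lnorm M a (\<lambda>x. \<integral>\<^sup>+z. H x z \<partial>N) \<le> (\<integral>\<^sup>+z. Lnorm M a (\<lambda>x. H x z) \<partial>N)"
proof -
  interpret M: sigma_finite_measure M by fact
  interpret N: sigma_finite_measure N by fact
  interpret MN: pair_sigma_finite M N ..
  interpret NM: pair_sigma_finite N M ..
  have Hm [measurable]: "(\<lambda>z. H x z) \<in> borel_measurable N" if "x \<in> space M" for x
    using measurable_compose[OF measurable_Pair1'[OF that] assms(3)] by simp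
  have Hm' [measurable]: "(\<lambda>x. H x z) \<in> borel_measurable M" if "z \<in> space N" for z
    using measurable_compose[OF measurable_Pair2'[OF that] assms(3)] by simp
  have [measurable]: "(\<lambda>(z, x). H x z) \<in> borel_measurable (N \<Otimes>\<^sub>M M)"
    using measurable_compose[OF measurable_pair_swap' assms(3)] by (simp add: case_prod_beta')
  define c where "c z = Lnorm M a (\<lambda>x. H x z)" for z
  have [measurable]: "c \<in> borel_measurable N" unfolding c_def by measurable
  define C where "C = (\<integral>\<^sup>+z. c z \<partial>N)"
  consider "a = 0" | "C = top" | "0 < a" "C \<noteq> top" "a = 1" | "0 < a" "C \<noteq> top" "a < 1" using a by linarith
  then have "Lnorm M a (\<lambda>x. \<integral>\<^sup>+z. H x z \<partial>N) \<le> C"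
  proof cases
    case 1
    have "AE z in N. AE x in M. H x z \<le> c z"
      by (rule always_eventually, rule allI) (use 1 esssup_AE[of "\<lambda>x. H x _" M] in \<open>simp add: c_def Lnorm_def\<close>)
    then have "AE x in M. AE z in N. H x z \<le> c z"
      by (subst MN.AE_commute) auto
    then have "AE x in M. (\<integral>\<^sup>+z. H x z \<partial>N) \<le> C"
      unfolding C_def by (auto elim!: eventually_mono intro!: nn_integral_mono_AE)
    then show ?thesis using 1 by (auto simp: Lnorm_def intro!: esssup_I)
  next
    case 2 then show ?thesis by simp
  next
    case 3
    then show ?thesis by (simp add: C_def c_def Lnorm_def MN.Fubini')
  next
    case 4
    define b where "b = 1 - a"
    have b: "0 < b" "a + b = 1" using 4 by (auto simp: b_def)
    have cpow: "(\<integral>\<^sup>+x. ennreal_power (H x z) (1/a) \<partial>M) = ennreal_power (c z) (1/a)" for z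
      using 4 by (simp add: c_def Lnorm_def ennreal_power_power)
    define K where "K x z = H x z * inverse (c z)" for x z
    have [measurable]: "(\<lambda>(x, z). K x z) \<in> borel_measurable (M \<Otimes>\<^sub>M N)" unfolding K_def by measurable
    have [measurable]: "(\<lambda>z. K x z) \<in> borel_measurable N" if "x \<in> space M" for x
      unfolding K_def using that by measurable
    \<comment> \<open>The factorisation of H into c and the quotient \<open>K\<close> holds where c
      z is finite and H vanishes whenever c z does. Both are true almost everywhere, and Fubini
      moves the exceptional set from the z-sections to the x-sections.\<close>
    have fin: "AE z in N. c z \<noteq> \<infinity>"
      using 4 by (intro nn_integral_PInf_AE) (auto simp: C_def)
    have zero: "AE x in M. c z = 0 \<longrightarrow> H x z = 0" if "z \<in> space N" for z
    proof (cases "c z = 0")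
      case True
      then have "(\<integral>\<^sup>+x. ennreal_power (H x z) (1/a) \<partial>M) = 0" by (simp add: cpow)
      then show ?thesis using that by (simp add: nn_integral_0_iff_AE)
    qed auto
    have "AE z in N. AE x in M. c z \<noteq> \<infinity> \<and> (c z = 0 \<longrightarrow> H x z = 0)"
      using fin AE_space
    proof eventually_elim
      case (elim z)
      then show ?case using zero[of z] by auto
    qed
    then have AE: "AE x in M. AE z in N. c z \<noteq> \<infinity> \<and> (c z = 0 \<longrightarrow> H x z = 0)"
      by (subst MN.AE_commute) auto
    have AE2: "AE x in M. ennreal_power (\<integral>\<^sup>+z. H x z \<partial>N) (1/a)
        \<le> (\<integral>\<^sup>+z. c z * ennreal_power (K x z) (1/a) \<partial>N) * ennreal_power C (b / a)"
      using AE AE_space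
    proof eventually_elim
      fix x assume x: "AE z in N. c z \<noteq> \<infinity> \<and> (c z = 0 \<longrightarrow> H x z = 0)" and [measurable]: "x \<in> space M"
      have "(\<integral>\<^sup>+z. H x z \<partial>N) = (\<integral>\<^sup>+z. c z * (K x z * 1) \<partial>N)"
        using x
      proof (intro nn_integral_cong_AE, eventually_elim)
        fix z assume "c z \<noteq> \<infinity> \<and> (c z = 0 \<longrightarrow> H x z = 0)"
        then show "H x z = c z * (K x z * 1)"
        proof (cases "c z = 0")
          case False
          then have "c z * inverse (c z) = 1"
            using \<open>c z \<noteq> \<infinity> \<and> _\<close> by (simp add: divide_ennreal_def[symmetric] less_top)
          then show ?thesis by (simp add: K_def mult.left_commute[of "c z"])
        qed (use \<open>c z \<noteq> \<infinity> \<and> _\<close> in simp)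
      qed
      also have "\<dots> = (\<integral>\<^sup>+z. K x z * 1 \<partial>density N c)"
        by (subst nn_integral_density) auto
      also have "\<dots> \<le> ennreal_power (\<integral>\<^sup>+z. ennreal_power (K x z) (1/a) \<partial>density N c) a
         * ennreal_power (\<integral>\<^sup>+z. ennreal_power 1 (1/b) \<partial>density N c) b"
        by (intro nn_integral_Hoelder) (use 4 b in auto)
      also have "\<dots> = ennreal_power (\<integral>\<^sup>+z. c z * ennreal_power (K x z) (1/a) \<partial>N) a * ennreal_power C b"
        by (simp add: nn_integral_density emeasure_density C_def cong: nn_integral_cong)
      finally have "ennreal_power (\<integral>\<^sup>+z. H x z \<partial>N) (1/a) \<le>
         ennreal_power (ennreal_power (\<integral>\<^sup>+z. c z * ennreal_power (K x z) (1/a) \<partial>N) a * ennreal_power C b) (1/a)"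
        using 4 by (intro ennreal_power_mono) auto
      then show "ennreal_power (\<integral>\<^sup>+z. H x z \<partial>N) (1/a)
        \<le> (\<integral>\<^sup>+z. c z * ennreal_power (K x z) (1/a) \<partial>N) * ennreal_power C (b / a)"
        using 4 by (simp add: ennreal_power_mult ennreal_power_power)
    qed
    have "(\<integral>\<^sup>+x. ennreal_power (\<integral>\<^sup>+z. H x z \<partial>N) (1/a) \<partial>M)
        \<le> (\<integral>\<^sup>+x. (\<integral>\<^sup>+z. c z * ennreal_power (K x z) (1/a) \<partial>N) * ennreal_power C (b / a) \<partial>M)"
      by (rule nn_integral_mono_AE[OF AE2])
    also have "\<dots> = (\<integral>\<^sup>+x. (\<integral>\<^sup>+z. c z * ennreal_power (K x z) (1/a) \<partial>N) \<partial>M) * ennreal_power C (b / a)"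
      by (rule nn_integral_multc) measurable
    also have "(\<integral>\<^sup>+x. (\<integral>\<^sup>+z. c z * ennreal_power (K x z) (1/a) \<partial>N) \<partial>M)
       = (\<integral>\<^sup>+z. (\<integral>\<^sup>+x. c z * ennreal_power (K x z) (1/a) \<partial>M) \<partial>N)"
      by (rule MN.Fubini'[symmetric]) measurable
    also have "\<dots> = (\<integral>\<^sup>+z. c z * (ennreal_power (c z) (1/a) * ennreal_power (inverse (c z)) (1/a)) \<partial>N)"
      by (intro nn_integral_cong)
         (simp add: K_def ennreal_power_mult nn_integral_cmult nn_integral_multc cpow)
    also have "\<dots> \<le> (\<integral>\<^sup>+z. c z * 1 \<partial>N)"
      using 4 by (intro nn_integral_mono mult_left_mono)
         (auto simp: ennreal_power_mult[symmetric] intro!: order_trans[OF ennreal_power_mono[OF ennreal_inverse_mult_le_1]])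
    finally have "(\<integral>\<^sup>+x. ennreal_power (\<integral>\<^sup>+z. H x z \<partial>N) (1/a) \<partial>M) \<le> C * ennreal_power C (b / a)"
      by (simp add: C_def mult_right_mono)
    also have "\<dots> = ennreal_power C (1 + b / a)"
      by (simp add: ennreal_power_add)
    also have "1 + b / a = 1 / a" using 4 b by (simp add: field_simps)
    finally have "ennreal_power (\<integral>\<^sup>+x. ennreal_power (\<integral>\<^sup>+z. H x z \<partial>N) (1/a) \<partial>M) a \<le> ennreal_power (ennreal_power C (1/a)) a"
      using 4 by (intro ennreal_power_mono) auto
    then show ?thesis using 4 by (simp add: Lnorm_def ennreal_power_power)
  qed
  then show ?thesis by (simp add: C_def c_def)
qed

section \<open>Translations of Lebesgue measure, slowly varying functions and convolution
  products\<close>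

lemma nn_integral_lborel_affine:
  fixes f :: "'a::euclidean_space \<Rightarrow> ennreal"
  assumes [measurable]: "f \<in> borel_measurable borel" and "c \<noteq> 0"
  shows "(\<integral>\<^sup>+x. f x \<partial>lborel) = ennreal (\<bar>c\<bar> ^ DIM('a)) * (\<integral>\<^sup>+x. f (t + c *\<^sub>R x) \<partial>lborel)"
  by (subst lborel_affine[OF \<open>c \<noteq> 0\<close>, of t])
     (simp add: nn_integral_density nn_integral_distr nn_integral_cmult)

lemma nn_integral_lborel_shift:
  fixes f :: "'a::euclidean_space \<Rightarrow> ennreal"
  assumes [measurable]: "f \<in> borel_measurable borel"
  shows "(\<integral>\<^sup>+x. f (x + c) \<partial>lborel) = (\<integral>\<^sup>+x. f x \<partial>lborel)"
    "(\<integral>\<^sup>+x. f (x - c) \<partial>lborel) = (\<integral>\<^sup>+x. f x \<partial>lborel)"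
    "(\<integral>\<^sup>+x. f (c - x) \<partial>lborel) = (\<integral>\<^sup>+x. f x \<partial>lborel)"
  using nn_integral_lborel_affine[of f 1 c, symmetric] nn_integral_lborel_affine[of f 1 "- c", symmetric]
    nn_integral_lborel_affine[of f "-1" c, symmetric] assms by (simp_all add: add.commute)

lemma lborel_distr_shift:
  "distr lborel borel (\<lambda>x. x - c) = (lborel :: 'a::euclidean_space measure)"
  "distr lborel borel (\<lambda>x. c - x) = (lborel :: 'a::euclidean_space measure)"
proof -
  have "density (distr lborel borel (\<lambda>x. - c + 1 *\<^sub>R x)) (\<lambda>_. ennreal (\<bar>1\<bar> ^ DIM('a))) = (lborel :: 'a measure)"
    by (rule lborel_affine[symmetric]) simp
  then show "distr lborel borel (\<lambda>x. x - c) = (lborel :: 'a measure)"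
    by (simp add: density_1)
  have "density (distr lborel borel (\<lambda>x. c + (-1) *\<^sub>R x)) (\<lambda>_. ennreal (\<bar>-1\<bar> ^ DIM('a))) = (lborel :: 'a measure)"
    by (rule lborel_affine[symmetric]) simp
  then show "distr lborel borel (\<lambda>x. c - x) = (lborel :: 'a measure)"
    by (simp add: density_1)
qed

lemma AE_lborel_shift:
  fixes c :: "'a::euclidean_space"
  assumes "AE x in lborel. P x"
  shows "AE x in lborel. P (x - c)" "AE x in lborel. P (c - x)"
proof -
  obtain N where N: "{x. \<not> P x} \<subseteq> N" "N \<in> null_sets lborel"
    using assms by (auto simp: eventually_ae_filter)
  have "AE x in lborel. x \<notin> N" using N(2) by (rule AE_not_in)
  then have *: "AE x in lborel. x - c \<notin> N" "AE x in lborel. c - x \<notin> N"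
    using AE_distrD[of "\<lambda>x. x - c" lborel borel "\<lambda>x. x \<notin> N", unfolded lborel_distr_shift]
      AE_distrD[of "\<lambda>x. c - x" lborel borel "\<lambda>x. x \<notin> N", unfolded lborel_distr_shift] by simp_all
  show "AE x in lborel. P (x - c)" "AE x in lborel. P (c - x)"
    using *(1) N(1) apply (auto elim!: eventually_mono)[1]
    using *(2) N(1) apply (auto elim!: eventually_mono)[1]
    done
qed

lemma Lnorm_lborel_shift:
  fixes f :: "'a::euclidean_space \<Rightarrow> ennreal"
  assumes [measurable]: "f \<in> borel_measurable borel"
  shows "Lnorm lborel a (\<lambda>x. f (x - c)) \<le> Lnorm lborel a f"
proof (cases "a = 0")
  case True
  have "AE x in lborel. f (x - c) \<le> esssup lborel f"
    using AE_lborel_shift(1)[OF esssup_AE] .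
  then show ?thesis using True by (auto simp: Lnorm_def intro!: esssup_I)
next
  case False
  then show ?thesis using nn_integral_lborel_shift(2)[of "\<lambda>x. ennreal_power (f x) (1/a)" c]
    by (simp add: Lnorm_def)
qed

lemma Lnorm_cmult_real:
  assumes [measurable]: "v \<in> borel_measurable M" and "0 \<le> a" "0 < r"
  shows "Lnorm M a (\<lambda>x. v x * ennreal r) = ennreal r * Lnorm M a v"
proof (rule antisym)
  show "Lnorm M a (\<lambda>x. v x * ennreal r) \<le> ennreal r * Lnorm M a v"
    using Lnorm_cmult[of v M a "ennreal r"] assms by (simp add: mult.commute)
  have "Lnorm M a v = Lnorm M a (\<lambda>x. ennreal (1 / r) * (v x * ennreal r))"
    using assms by (simp add: mult.left_commute[of "ennreal (1/r)"] ennreal_mult[symmetric])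
  also have "\<dots> \<le> ennreal (1 / r) * Lnorm M a (\<lambda>x. v x * ennreal r)"
    using assms by (intro Lnorm_cmult) auto
  finally have "ennreal r * Lnorm M a v \<le> ennreal r * (ennreal (1 / r) * Lnorm M a (\<lambda>x. v x * ennreal r))"
    by (rule mult_left_mono) simp
  then show "ennreal r * Lnorm M a v \<le> Lnorm M a (\<lambda>x. v x * ennreal r)"
    using assms by (simp add: mult.assoc[symmetric] ennreal_mult[symmetric])
qed

lemma Lnorm_1: "Lnorm M 1 h = (\<integral>\<^sup>+x. h x \<partial>M)"
  by (simp add: Lnorm_def)

lemma nn_integral_indicator_ball_shift:
  fixes x :: "'a::euclidean_space"
  shows "(\<integral>\<^sup>+y. c * indicator (ball 0 r) (y - x) \<partial>lborel) = c * emeasure lborel (ball (0::'a) r)"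
proof -
  have [measurable]: "ball (0::'a) r \<in> sets borel" by simp
  have "(\<integral>\<^sup>+y. c * indicator (ball 0 r) (y - x) \<partial>lborel) = (\<integral>\<^sup>+y. c * indicator (ball (0::'a) r) y \<partial>lborel)"
    by (rule nn_integral_lborel_shift(2)[where f = "\<lambda>y. c * indicator (ball 0 r) y"]) measurable
  also have "\<dots> = c * emeasure lborel (ball (0::'a) r)"
    by (rule nn_integral_cmult_indicator) simp
  finally show ?thesis .
qed

text \<open>A slowly varying function is controlled at a point by its averages, so that for such functions
  the \<open>L\<^sup>p\<close> norms increase with \<open>1/p\<close>, as for sequences.\<close>

lemma Lnorm_slowly_varying:
  fixes f :: "'a::euclidean_space \<Rightarrow> ennreal"
  assumes "0 \<le> a'" "a' \<le> a" "a \<le> 1"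
  obtains C :: real where "0 < C"
    "\<And>f :: 'a \<Rightarrow> ennreal. f \<in> borel_measurable borel \<Longrightarrow>
       (\<And>x u. f (x + u) \<le> ennreal ((1 + norm u) ^ m) * f x) \<Longrightarrow>
       Lnorm lborel a' f \<le> ennreal C * Lnorm lborel a f"
proof (cases "a = a'")
  case True
  then show ?thesis by (intro that[of 1]) auto
next
  case False
  then have a: "0 < a" "a' < a" using assms by auto
  define V where "V = measure lborel (ball (0::'a) 1)"
  have V: "emeasure lborel (ball (0::'a) 1) = ennreal V" "0 < V"
    using content_ball_pos[of 1 "0::'a"] emeasure_lborel_ball_finite[of "0::'a" 1]
      emeasure_eq_ennreal_measure[of lborel "ball (0::'a) 1"]
    by (simp_all add: V_def)
  \<comment> \<open>The factor 2^m bounds the variation of f over a unit ball and V is the volume of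
    that ball: f x is compared with the integral of the power 1/a of f over the ball around
    x.\<close>
  define C where "C = 2 ^ m * (1 / V) powr a"
  have C: "0 < C" using V by (auto simp: C_def)
  have sup: "f x \<le> ennreal C * Lnorm lborel a f"
    if [measurable]: "f \<in> borel_measurable borel"
      and slow: "\<And>x u. f (x + u) \<le> ennreal ((1 + norm u) ^ m) * f x" for f :: "'a \<Rightarrow> ennreal" and x
  proof -
    define I where "I = (\<integral>\<^sup>+y. ennreal_power (f y) (1/a) \<partial>lborel)"
    have "ennreal_power (f x) (1/a) * ennreal V
       = (\<integral>\<^sup>+y. ennreal_power (f x) (1/a) * indicator (ball (0::'a) 1) (y - x) \<partial>lborel)"
      unfolding nn_integral_indicator_ball_shift V(1) ..
    also have "\<dots> \<le> (\<integral>\<^sup>+y. ennreal_power (ennreal (2 ^ m)) (1/a) * ennreal_power (f y) (1/a) \<partial>lborel)"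
    proof (intro nn_integral_mono)
      fix y
      have "f x \<le> ennreal (2 ^ m) * f y" if y: "norm (y - x) < 1"
      proof -
        have "f (y + (x - y)) \<le> ennreal ((1 + norm (x - y)) ^ m) * f y" by (rule slow)
        also have "\<dots> \<le> ennreal (2 ^ m) * f y"
          using y by (intro mult_right_mono ennreal_leI power_mono) (auto simp: norm_minus_commute)
        finally show ?thesis by simp
      qed
      then show "ennreal_power (f x) (1/a) * indicator (ball (0::'a) 1) (y - x)
         \<le> ennreal_power (ennreal (2 ^ m)) (1/a) * ennreal_power (f y) (1/a)"
        using a by (auto simp: indicator_def dist_norm ennreal_power_mult[symmetric] norm_minus_commute
            intro!: ennreal_power_mono)
    qed
    also have "\<dots> = ennreal_power (ennreal (2 ^ m)) (1/a) * I"
      by (simp add: nn_integral_cmult I_def)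
    finally have *: "ennreal_power (f x) (1/a) * ennreal V \<le> ennreal_power (ennreal (2 ^ m)) (1/a) * I" .
    have "ennreal_power (ennreal_power (f x) (1/a) * ennreal V) a
       \<le> ennreal_power (ennreal_power (ennreal (2 ^ m)) (1/a) * I) a"
      using a by (intro ennreal_power_mono[OF *]) auto
    then have "f x * ennreal (V powr a) \<le> ennreal (2 ^ m) * ennreal_power I a"
      using a V by (simp add: ennreal_power_mult ennreal_power_power ennreal_power_ennreal powr_powr)
    then have "ennreal ((1 / V) powr a) * (f x * ennreal (V powr a))
       \<le> ennreal ((1 / V) powr a) * (ennreal (2 ^ m) * ennreal_power I a)"
      by (rule mult_left_mono) simp
    also have "ennreal ((1 / V) powr a) * (f x * ennreal (V powr a)) = f x"
      using V by (simp add: mult.left_commute[of _ "f x"] ennreal_mult[symmetric] powr_mult[symmetric])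
    also have "ennreal ((1 / V) powr a) * (ennreal (2 ^ m) * ennreal_power I a) = ennreal C * Lnorm lborel a f"
      using a V by (simp add: C_def Lnorm_def I_def ennreal_mult mult_ac)
    finally show ?thesis .
  qed
  show ?thesis
  proof (cases "a' = 0")
    case True
    show ?thesis
    proof (rule that[OF C])
      fix f :: "'a \<Rightarrow> ennreal"
      assume f: "f \<in> borel_measurable borel"
        "\<And>x u. f (x + u) \<le> ennreal ((1 + norm u) ^ m) * f x"
      show "Lnorm lborel a' f \<le> ennreal C * Lnorm lborel a f"
        using True sup[OF f] f(1) by (auto simp: Lnorm_def intro!: esssup_I)
    qed
  next
    case False
    then have a': "0 < a'" using assms by auto
    \<comment> \<open>Interpolation with the supremum bound: of the power 1/a', the part d is
      estimated pointwise by \<open>sup\<close>, and the part 1/a is integrated.\<close>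
    define d where "d = 1/a' - 1/a"
    have d: "0 < d" "1/a' = d + 1/a" using a a' by (auto simp: d_def field_simps)
    show ?thesis
    proof (rule that[of "C powr (d * a')"])
      show "0 < C powr (d * a')" using C by simp
      fix f :: "'a \<Rightarrow> ennreal"
      assume f: "f \<in> borel_measurable borel"
        and slow: "\<And>x u. f (x + u) \<le> ennreal ((1 + norm u) ^ m) * f x"
      note [measurable] = f
      define N where "N = Lnorm lborel a f"
      have "(\<integral>\<^sup>+y. ennreal_power (f y) (1/a') \<partial>lborel)
          = (\<integral>\<^sup>+y. ennreal_power (f y) d * ennreal_power (f y) (1/a) \<partial>lborel)"
        by (simp add: d(2) ennreal_power_add)
      also have "\<dots> \<le> (\<integral>\<^sup>+y. ennreal_power (ennreal C * N) d * ennreal_power (f y) (1/a) \<partial>lborel)"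
        using sup[OF f slow] d by (intro nn_integral_mono mult_right_mono ennreal_power_mono) (auto simp: N_def)
      also have "\<dots> = ennreal_power (ennreal C * N) d * ennreal_power N (1/a)"
        using a by (simp add: nn_integral_cmult N_def Lnorm_def ennreal_power_power)
      also have "\<dots> = ennreal (C powr d) * ennreal_power N (1/a')"
        using C by (simp add: ennreal_power_mult d(2) ennreal_power_add ennreal_power_ennreal mult_ac)
      finally have "ennreal_power (\<integral>\<^sup>+y. ennreal_power (f y) (1/a') \<partial>lborel) a'
         \<le> ennreal_power (ennreal (C powr d) * ennreal_power N (1/a')) a'"
        using a' by (intro ennreal_power_mono) auto
      also have "\<dots> = ennreal (C powr (d * a')) * N"
        using C a' by (simp add: ennreal_power_mult ennreal_power_power ennreal_power_ennreal powr_powr)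
      finally show "Lnorm lborel a' f \<le> ennreal (C powr (d * a')) * Lnorm lborel a f"
        using a' by (simp add: Lnorm_def N_def)
    qed
  qed
qed

text \<open>The inner and the outer norm have the same exponent, so the double integral of the
  powers factorises by Fubini's theorem and translation invariance.\<close>

lemma Lnorm_convolution_product:
  fixes \<alpha> \<beta> :: "'a::euclidean_space \<Rightarrow> ennreal"
  assumes [measurable]: "\<alpha> \<in> borel_measurable borel" "\<beta> \<in> borel_measurable borel" and b: "0 \<le> b"
  shows "Lnorm lborel b (\<lambda>\<zeta>. Lnorm lborel b (\<lambda>\<xi>. \<alpha> \<xi> * \<beta> (\<zeta> - \<xi>)))
    \<le> Lnorm lborel b \<alpha> * Lnorm lborel b \<beta>"
proof (cases "b = 0")
  case True
  have "esssup lborel (\<lambda>\<xi>. \<alpha> \<xi> * \<beta> (\<zeta> - \<xi>)) \<le> esssup lborel \<alpha> * esssup lborel \<beta>" for \<zeta>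
  proof (rule esssup_I)
    show "AE \<xi> in lborel. \<alpha> \<xi> * \<beta> (\<zeta> - \<xi>) \<le> esssup lborel \<alpha> * esssup lborel \<beta>"
      using esssup_AE[of \<alpha> lborel] AE_lborel_shift(2)[OF esssup_AE[of \<beta> lborel], of \<zeta>]
      by eventually_elim (intro mult_mono, auto)
  qed measurable
  then show ?thesis using True by (auto simp: Lnorm_def intro!: esssup_I lborel.esssup_measurable)
next
  case False
  have "(\<integral>\<^sup>+\<zeta>. (\<integral>\<^sup>+\<xi>. ennreal_power (\<alpha> \<xi>) (1/b) * ennreal_power (\<beta> (\<zeta> - \<xi>)) (1/b) \<partial>lborel) \<partial>lborel)
     = (\<integral>\<^sup>+\<xi>. (\<integral>\<^sup>+\<zeta>. ennreal_power (\<alpha> \<xi>) (1/b) * ennreal_power (\<beta> (\<zeta> - \<xi>)) (1/b) \<partial>lborel) \<partial>lborel)"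
    by (rule lborel_pair.Fubini'[symmetric]) measurable
  also have "\<dots> = (\<integral>\<^sup>+\<xi>. ennreal_power (\<alpha> \<xi>) (1/b) * (\<integral>\<^sup>+\<zeta>. ennreal_power (\<beta> \<zeta>) (1/b) \<partial>lborel) \<partial>lborel)"
    using nn_integral_lborel_shift(2)[of "\<lambda>\<zeta>. ennreal_power (\<beta> \<zeta>) (1/b)"]
    by (simp add: nn_integral_cmult)
  also have "\<dots> = (\<integral>\<^sup>+\<xi>. ennreal_power (\<alpha> \<xi>) (1/b) \<partial>lborel) * (\<integral>\<^sup>+\<zeta>. ennreal_power (\<beta> \<zeta>) (1/b) \<partial>lborel)"
    by (simp add: nn_integral_multc)
  finally show ?thesis using False b
    by (simp add: Lnorm_def ennreal_power_mult ennreal_power_power)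
qed

section \<open>Polynomial weights and averages over phase space\<close>

definition decay :: "nat \<Rightarrow> 'a::real_normed_vector \<Rightarrow> real" where
  "decay m x = 1 / (1 + norm x) ^ m"

lemma decay_pos: "0 < decay m x" and decay_nonneg [simp]: "0 \<le> decay m x" and decay_le_1: "decay m x \<le> 1"
  using norm_ge_zero[of x] by (auto simp: decay_def add_pos_nonneg simp del: norm_ge_zero)

lemma decay_measurable [measurable]: "decay m \<in> borel_measurable (borel :: 'a::real_normed_vector measure)"
  unfolding decay_def by measurable

lemma decay_minus_commute: "decay m (x - y) = decay m (y - x)"
  by (simp add: decay_def norm_minus_commute)

lemma decay_minus [simp]: "decay m (- x) = decay m x"
  by (simp add: decay_def)

lemma decay_add: "decay (m + k) x = decay m x * decay k x"
  by (simp add: decay_def power_add)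

lemma decay_mono: "k \<le> m \<Longrightarrow> decay m x \<le> decay k x"
  by (auto simp: decay_def intro!: divide_left_mono power_increasing mult_pos_pos zero_less_power add_pos_nonneg)

lemma one_plus_norm_add_le: "1 + norm (x + y) \<le> (1 + norm x) * (1 + norm y)"
proof -
  have "norm (x + y) \<le> norm x + norm y" by (rule norm_triangle_ineq)
  moreover have "0 \<le> norm x * norm y" by (intro mult_nonneg_nonneg norm_ge_zero)
  ultimately show ?thesis unfolding distrib_left distrib_right by linarith
qed

lemma one_plus_norm_power_add_le: "(1 + norm (x + y)) ^ m \<le> (1 + norm x) ^ m * (1 + norm y) ^ m"
  unfolding power_mult_distrib[symmetric] by (intro power_mono one_plus_norm_add_le) simp

lemma decay_peetre: "decay m (x + u) \<le> (1 + norm u) ^ m * decay m x"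
proof -
  have "(1 + norm x) ^ m \<le> (1 + norm (x + u)) ^ m * (1 + norm u) ^ m"
    using one_plus_norm_power_add_le[of "x + u" "- u" m] by simp
  moreover have "0 < (1 + norm x) ^ m" "0 < (1 + norm (x + u)) ^ m" by (simp_all add: add_pos_nonneg)
  ultimately show ?thesis by (simp add: decay_def field_simps)
qed

lemma decay_cancel: "(1 + norm x) ^ m * decay (m + k) x = decay k x"
proof -
  have "(1 + norm x) \<noteq> 0" using norm_ge_zero[of x] by linarith
  then show ?thesis by (simp add: decay_def power_add)
qed

section \<open>Integrability of polynomial weights\<close>

lemma nn_integral_powr_decay_real:
  assumes "1 < s" shows "(\<integral>\<^sup>+x. ennreal ((1 + \<bar>x\<bar>) powr - s) \<partial>lborel) < \<infinity>"
proof -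
  define f where "f x = ennreal (x powr - s) * indicator {1..} x" for x :: real
  have [measurable]: "f \<in> borel_measurable borel" unfolding f_def by measurable
  have "((\<lambda>x. x powr - s) has_integral -(1 powr (- s + 1)) / (- s + 1)) {1..}"
    using assms by (intro has_integral_powr_to_inf) auto
  then have "(\<integral>\<^sup>+x. f x \<partial>lborel) = ennreal (-(1 powr (- s + 1)) / (- s + 1))"
    unfolding f_def by (intro nn_integral_has_integral_lebesgue') auto
  then have fin: "(\<integral>\<^sup>+x. f x \<partial>lborel) < \<infinity>" by simp
  \<comment> \<open>For x >= 0 the first translate of f equals the integrand, for x <= 0 the second
    one does.\<close>
  have "(\<integral>\<^sup>+x. ennreal ((1 + \<bar>x\<bar>) powr - s) \<partial>lborel) \<le> (\<integral>\<^sup>+x. f (x + 1) + f (1 - x) \<partial>lborel)"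
    by (intro nn_integral_mono) (auto simp: f_def indicator_def abs_if add.commute)
  also have "\<dots> = (\<integral>\<^sup>+x. f (x + 1) \<partial>lborel) + (\<integral>\<^sup>+x. f (1 - x) \<partial>lborel)"
    by (intro nn_integral_add) measurable
  also have "\<dots> < \<infinity>" using fin
    by (simp add: nn_integral_lborel_shift(1)[of f 1] nn_integral_lborel_shift(3)[of f 1])
  finally show ?thesis .
qed

text \<open>As every coordinate is at most the norm, the weight is dominated by a product of
  one-dimensional weights with exponent r divided by the dimension, which exceeds 1.\<close>

lemma nn_integral_powr_decay:
  assumes "real DIM('a) < r"
  shows "(\<integral>\<^sup>+x. ennreal ((1 + norm (x::'a::euclidean_space)) powr - r) \<partial>lborel) < \<infinity>"
proof -
  define s where "s = r / DIM('a)"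
  have s: "1 < s" "s * DIM('a) = r" using assms by (auto simp: s_def)
  have "ennreal ((1 + norm x) powr - r) \<le> (\<Prod>b\<in>Basis. ennreal ((1 + \<bar>x \<bullet> b\<bar>) powr - s))" for x :: 'a
  proof -
    have "1 + norm x \<noteq> 0" using norm_ge_zero[of x] by linarith
    then have "(1 + norm x) powr - r = (\<Prod>b\<in>(Basis::'a set). (1 + norm x) powr - s)"
      using s by (simp add: powr_power mult.commute)
    also have "\<dots> \<le> (\<Prod>b\<in>Basis. (1 + \<bar>x \<bullet> b\<bar>) powr - s)"
      using s Basis_le_norm[of _ x] by (intro prod_mono conjI powr_mono2') auto
    finally show ?thesis by (simp add: prod_ennreal ennreal_leI)
  qed
  then have "(\<integral>\<^sup>+x. ennreal ((1 + norm (x::'a)) powr - r) \<partial>lborel)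
     \<le> (\<integral>\<^sup>+x. (\<Prod>b\<in>Basis. ennreal ((1 + \<bar>(x::'a) \<bullet> b\<bar>) powr - s)) \<partial>lborel)"
    by (intro nn_integral_mono)
  also have "\<dots> = (\<Prod>b\<in>(Basis::'a set). (\<integral>\<^sup>+x. ennreal ((1 + \<bar>x\<bar>) powr - s) \<partial>lborel))"
    by (rule nn_integral_lborel_prod) auto
  also have "\<dots> < \<infinity>"
    using nn_integral_powr_decay_real[OF s(1)] by (simp add: power_less_top_ennreal)
  finally show ?thesis .
qed

lemma decay_eq_powr: "decay m x = (1 + norm x) powr - real m"
  by (simp add: decay_def powr_minus_divide powr_realpow add_pos_nonneg)

lemma nn_integral_decay:
  assumes "DIM('a) < m" shows "(\<integral>\<^sup>+x. ennreal (decay m (x::'a::euclidean_space)) \<partial>lborel) < \<infinity>"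
  unfolding decay_eq_powr by (rule nn_integral_powr_decay) (use assms in simp)

lemma integrable_decay:
  assumes "DIM('a) < m" shows "integrable lborel (decay m :: 'a::euclidean_space \<Rightarrow> real)"
  using nn_integral_decay[OF assms] by (intro integrableI_bounded) auto

section \<open>The Japanese bracket and its weights\<close>

lemma japanese_bracket_ge_1: "1 \<le> japanese_bracket x"
  by (simp add: japanese_bracket_def)

lemma japanese_bracket_pos [simp]: "0 < japanese_bracket x"
  using japanese_bracket_ge_1[of x] by linarith

lemma japanese_bracket_neq_0 [simp]: "japanese_bracket x \<noteq> 0"
  using japanese_bracket_pos[of x] by linarith

lemma japanese_bracket_measurable [measurable]:
  "japanese_bracket \<in> borel_measurable (borel :: 'a::euclidean_space measure)"
  unfolding japanese_bracket_def by measurable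

text \<open>The bracket of x is the Euclidean norm of the pair (1, x), and (1, x + y) is the sum of
  (1, x) and (0, y).\<close>

lemma japanese_bracket_triangle: "japanese_bracket (x + y) \<le> japanese_bracket x + norm y"
proof -
  have "norm (1::real, x + y) \<le> norm (1::real, x) + norm (0::real, y)"
    using norm_triangle_ineq[of "(1::real, x)" "(0, y)"] by simp
  then show ?thesis by (simp add: japanese_bracket_def norm_Pair)
qed

lemma norm_le_japanese_bracket: "norm x \<le> japanese_bracket x"
  by (simp add: japanese_bracket_def real_le_rsqrt)

lemma japanese_bracket_add_le: "japanese_bracket (x + y) \<le> japanese_bracket x * (1 + norm y)"
proof -
  have "norm y \<le> japanese_bracket x * norm y"
    using japanese_bracket_ge_1[of x] mult_right_mono[of 1 "japanese_bracket x" "norm y"] by simp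
  then show ?thesis using japanese_bracket_triangle[of x y] by (simp add: algebra_simps)
qed

lemma one_plus_norm_le_japanese_bracket: "1 + norm x \<le> 2 * japanese_bracket x"
  using japanese_bracket_ge_1[of x] norm_le_japanese_bracket[of x] by linarith

text \<open>Where \<open>\<langle>\<xi>\<rangle> \<le> \<langle>\<zeta> - \<xi>\<rangle>\<close>, the weight \<open>\<langle>\<zeta>\<rangle>\<^sup>s\<^sup>0\<close> is absorbed by \<open>\<langle>\<zeta> - \<xi>\<rangle>\<close>, and the nonpositive power of
  \<open>\<langle>\<zeta> - \<xi>\<rangle>\<close> that remains is traded for the same power of \<open>\<langle>\<xi>\<rangle>\<close>.\<close>

lemma japanese_bracket_weight:
  assumes "0 \<le> s0" "s0 \<le> s1" "s0 \<le> s2"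
  shows "japanese_bracket \<zeta> powr s0 * japanese_bracket \<xi> powr - s1 * japanese_bracket (\<zeta> - \<xi>) powr - s2
    \<le> 2 powr s0 * max (japanese_bracket \<xi> powr - (s1 + s2 - s0)) (japanese_bracket (\<zeta> - \<xi>) powr - (s1 + s2 - s0))"
proof -
  \<comment> \<open>The two cases differ by exchanging \<xi> with \<zeta> - \<xi> and s1 with s2.
    \<open>key\<close> treats both, with x the smaller and y the larger of the two brackets, so that
    z <= 2 y.\<close>
  have key: "z powr s0 * x powr - u * y powr - v \<le> 2 powr s0 * x powr - (u + v - s0)"
    if "0 < z" "z \<le> x + y" "0 < x" "x \<le> y" "s0 \<le> v" for x y z u v :: real
  proof -
    have "z powr s0 \<le> (2 * y) powr s0" using that assms by (intro powr_mono2) auto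
    then have "z powr s0 * x powr - u * y powr - v \<le> (2 * y) powr s0 * x powr - u * y powr - v"
      by (intro mult_right_mono) auto
    also have "\<dots> = 2 powr s0 * x powr - u * y powr (s0 - v)"
      using that by (simp add: powr_mult powr_add[symmetric] powr_diff powr_minus divide_inverse)
    also have "\<dots> \<le> 2 powr s0 * x powr - u * x powr (s0 - v)"
      using that by (intro mult_left_mono powr_mono2') auto
    also have "\<dots> = 2 powr s0 * x powr - (u + v - s0)"
      using that by (simp add: powr_add[symmetric] algebra_simps)
    finally show ?thesis .
  qed
  have le: "japanese_bracket \<zeta> \<le> japanese_bracket \<xi> + japanese_bracket (\<zeta> - \<xi>)"
    using japanese_bracket_triangle[of \<xi> "\<zeta> - \<xi>"] norm_le_japanese_bracket[of "\<zeta> - \<xi>"] by simp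
  show ?thesis
  proof (cases "japanese_bracket \<xi> \<le> japanese_bracket (\<zeta> - \<xi>)")
    case True
    then show ?thesis
      using key[of "japanese_bracket \<zeta>" "japanese_bracket \<xi>" "japanese_bracket (\<zeta> - \<xi>)" s2 s1] le assms
      by (intro order_trans[OF _ mult_left_mono[OF max.cobounded1]]) auto
  next
    case False
    then have "japanese_bracket \<zeta> powr s0 * japanese_bracket (\<zeta> - \<xi>) powr - s2 * japanese_bracket \<xi> powr - s1
       \<le> 2 powr s0 * japanese_bracket (\<zeta> - \<xi>) powr - (s2 + s1 - s0)"
      using key[of "japanese_bracket \<zeta>" "japanese_bracket (\<zeta> - \<xi>)" "japanese_bracket \<xi>" s1 s2] le assms
      by (auto simp: add.commute)
    then show ?thesis
      by (intro order_trans[OF _ mult_left_mono[OF max.cobounded2]]) (auto simp: mult_ac add.commute)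
  qed
qed

text \<open>Here the surplus t = s1 + s2 - s0 is spent. The parameter b plays the role of 1/q', so 0
  < b corresponds to q > 1, and t / b exceeds the dimension, which makes the power - t / b of the
  bracket integrable. The maximum of two such powers is at most their sum, and the substitution of
  \<zeta> - \<xi> for \<xi> gives both the same integral; hence the bound is uniform in
  \<zeta>.\<close>

lemma Lnorm_japanese_bracket_weight:
  fixes s0 s1 s2 b :: real
  assumes "0 \<le> s0" "s0 \<le> s1" "s0 \<le> s2" "0 < b" "b \<le> 1" "real DIM('a) * b < s1 + s2 - s0"
  obtains C :: real where "0 < C" "\<And>\<zeta> :: 'a::euclidean_space.
    Lnorm lborel b (\<lambda>\<xi>. ennreal (japanese_bracket \<zeta> powr s0 * japanese_bracket \<xi> powr - s1
      * japanese_bracket (\<zeta> - \<xi>) powr - s2)) \<le> ennreal C"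
proof -
  define t where "t = s1 + s2 - s0"
  have t: "0 < t" "real DIM('a) < t / b" using assms by (auto simp: t_def field_simps intro: le_less_trans[rotated])
  define g where "g \<xi> = ennreal ((2 * (1 + norm \<xi>)) powr - (t / b)) * ennreal (4 powr (t / b))" for \<xi> :: 'a
  define I where "I = (\<integral>\<^sup>+\<xi>. ennreal (japanese_bracket (\<xi>::'a) powr - (t / b)) \<partial>lborel)"
  have "I \<le> (\<integral>\<^sup>+\<xi>. ennreal (2 powr (t / b)) * ennreal ((1 + norm (\<xi>::'a)) powr - (t / b)) \<partial>lborel)"
    unfolding I_def
  proof (intro nn_integral_mono)
    fix \<xi> :: 'a
    have "japanese_bracket \<xi> powr - (t / b) = 2 powr (t / b) * (2 * japanese_bracket \<xi>) powr - (t / b)"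
      by (simp add: powr_mult powr_minus)
    also have "\<dots> \<le> 2 powr (t / b) * (1 + norm \<xi>) powr - (t / b)"
      using one_plus_norm_le_japanese_bracket[of \<xi>] t assms
      by (intro mult_left_mono powr_mono2') (auto simp: add_pos_nonneg)
    finally show "ennreal (japanese_bracket \<xi> powr - (t / b))
      \<le> ennreal (2 powr (t / b)) * ennreal ((1 + norm \<xi>) powr - (t / b))"
      by (simp add: ennreal_mult[symmetric] ennreal_leI)
  qed
  also have "\<dots> < \<infinity>"
    using nn_integral_powr_decay[OF t(2)] by (simp add: nn_integral_cmult ennreal_mult_less_top)
  finally obtain J where J: "I = ennreal J" "0 \<le> J" by (cases I) auto
  define C where "C = 2 powr s0 * (2 * J) powr b + 1"
  show ?thesis
  proof
    show "0 < C" using J by (auto simp: C_def intro!: add_nonneg_pos)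
    fix \<zeta> :: 'a
    let ?w = "\<lambda>\<xi>. japanese_bracket \<zeta> powr s0 * japanese_bracket \<xi> powr - s1 * japanese_bracket (\<zeta> - \<xi>) powr - s2"
    have "ennreal_power (ennreal (?w \<xi>)) (1/b) \<le> ennreal ((2 powr s0) powr (1/b)) *
        (ennreal (japanese_bracket \<xi> powr - (t / b)) + ennreal (japanese_bracket (\<zeta> - \<xi>) powr - (t / b)))" for \<xi>
    proof -
      let ?m = "max (japanese_bracket \<xi> powr - t) (japanese_bracket (\<zeta> - \<xi>) powr - t)"
      have "ennreal_power (ennreal (?w \<xi>)) (1/b) = ennreal (?w \<xi> powr (1/b))"
        by (simp add: ennreal_power_ennreal)
      also have "\<dots> \<le> ennreal ((2 powr s0 * ?m) powr (1/b))"
        using japanese_bracket_weight[OF assms(1-3), of \<zeta> \<xi>] assms(4)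
        by (intro ennreal_leI powr_mono2) (auto simp: t_def)
      also have "(2 powr s0 * ?m) powr (1/b) = (2 powr s0) powr (1/b) * ?m powr (1/b)"
        by (simp add: powr_mult le_max_iff_disj)
      also have "?m powr (1/b) \<le> japanese_bracket \<xi> powr - (t / b) + japanese_bracket (\<zeta> - \<xi>) powr - (t / b)"
        by (auto simp: max_def powr_powr)
      finally show ?thesis
        by (simp add: ennreal_mult[symmetric] ennreal_plus[symmetric] mult_left_mono ennreal_leI del: ennreal_plus)
    qed
    then have "(\<integral>\<^sup>+\<xi>. ennreal_power (ennreal (?w \<xi>)) (1/b) \<partial>lborel) \<le> (\<integral>\<^sup>+\<xi>. ennreal ((2 powr s0) powr (1/b)) *
        (ennreal (japanese_bracket \<xi> powr - (t / b)) + ennreal (japanese_bracket (\<zeta> - \<xi>) powr - (t / b))) \<partial>lborel)"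
      by (intro nn_integral_mono)
    also have "\<dots> = ennreal ((2 powr s0) powr (1/b)) * (I +
        (\<integral>\<^sup>+\<xi>. ennreal (japanese_bracket (\<zeta> - \<xi>) powr - (t / b)) \<partial>lborel))"
      by (simp add: nn_integral_cmult nn_integral_add I_def)
    also have "(\<integral>\<^sup>+\<xi>. ennreal (japanese_bracket (\<zeta> - \<xi>) powr - (t / b)) \<partial>lborel) = I"
      unfolding I_def by (rule nn_integral_lborel_shift(3)[where f = "\<lambda>\<xi>. ennreal (japanese_bracket \<xi> powr - (t / b))"]) measurable
    also have "ennreal ((2 powr s0) powr (1/b)) * (I + I) = ennreal ((2 powr s0) powr (1/b) * (2 * J))"
      using J by (simp add: ennreal_mult[symmetric] ennreal_plus[symmetric] del: ennreal_plus)
    finally have "Lnorm lborel b (\<lambda>\<xi>. ennreal (?w \<xi>)) \<le> ennreal_power (ennreal ((2 powr s0) powr (1/b) * (2 * J))) b"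
      using assms(4) by (simp add: Lnorm_def ennreal_power_mono)
    also have "\<dots> = ennreal (2 powr s0 * (2 * J) powr b)"
      using J assms(4) by (simp add: ennreal_power_ennreal powr_mult powr_powr)
    also have "\<dots> \<le> ennreal C" by (intro ennreal_leI) (simp add: C_def)
    finally show "Lnorm lborel b (\<lambda>\<xi>. ennreal (?w \<xi>)) \<le> ennreal C" .
  qed
qed

text \<open>The average of \<open>V\<close> over the phase space with a polynomially decaying kernel is slowly varying in both
  variables, which \<open>V\<close> itself need not be.\<close>

definition smear :: "nat \<Rightarrow> ('a::euclidean_space \<Rightarrow> 'a \<Rightarrow> ennreal) \<Rightarrow> 'a \<Rightarrow> 'a \<Rightarrow> ennreal" where
  "smear m V x \<xi> = (\<integral>\<^sup>+y. (\<integral>\<^sup>+\<eta>. V y \<eta> * ennreal (decay m (x - y) * decay m (\<xi> - \<eta>)) \<partial>lborel) \<partial>lborel)"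

text \<open>In this form the kernel is fixed and V is translated, so that norms pass through the
  integrals by Minkowski's inequality and translation invariance.\<close>

lemma smear_alt:
  fixes V :: "'a::euclidean_space \<Rightarrow> 'a \<Rightarrow> ennreal"
  assumes [measurable]: "case_prod V \<in> borel_measurable (borel \<Otimes>\<^sub>M borel)"
  shows "smear m V x \<xi> = (\<integral>\<^sup>+v. (\<integral>\<^sup>+u. V (x - u) (\<xi> - v) * ennreal (decay m u * decay m v) \<partial>lborel) \<partial>lborel)"
proof -
  have "(\<integral>\<^sup>+\<eta>. V y \<eta> * ennreal (decay m (x - y) * decay m (\<xi> - \<eta>)) \<partial>lborel)
     = (\<integral>\<^sup>+v. V y (\<xi> - v) * ennreal (decay m (x - y) * decay m v) \<partial>lborel)" for y
    using nn_integral_lborel_shift(3)[where c = \<xi> and f = "\<lambda>v. V y (\<xi> - v) * ennreal (decay m (x - y) * decay m v)"]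
    by simp
  then have "smear m V x \<xi> = (\<integral>\<^sup>+y. (\<integral>\<^sup>+v. V y (\<xi> - v) * ennreal (decay m (x - y) * decay m v) \<partial>lborel) \<partial>lborel)"
    by (simp add: smear_def)
  also have "\<dots> = (\<integral>\<^sup>+u. (\<integral>\<^sup>+v. V (x - u) (\<xi> - v) * ennreal (decay m u * decay m v) \<partial>lborel) \<partial>lborel)"
    using nn_integral_lborel_shift(3)[where c = x and f = "\<lambda>u. (\<integral>\<^sup>+v. V (x - u) (\<xi> - v) * ennreal (decay m u * decay m v) \<partial>lborel)"]
    by simp
  also have "\<dots> = (\<integral>\<^sup>+v. (\<integral>\<^sup>+u. V (x - u) (\<xi> - v) * ennreal (decay m u * decay m v) \<partial>lborel) \<partial>lborel)"
    by (rule lborel_pair.Fubini'[symmetric]) measurable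
  finally show ?thesis .
qed

lemma smear_measurable [measurable]:
  fixes V :: "'a::euclidean_space \<Rightarrow> 'a \<Rightarrow> ennreal"
  assumes [measurable]: "case_prod V \<in> borel_measurable (borel \<Otimes>\<^sub>M borel)"
    and [measurable]: "f \<in> borel_measurable M" "g \<in> borel_measurable M"
  shows "(\<lambda>z. smear m V (f z) (g z)) \<in> borel_measurable M"
  unfolding smear_def by measurable

text \<open>Peetre's inequality for the kernel, in each variable, passes to averages of a merely
  measurable V.\<close>

lemma smear_slowly_varying:
  fixes V :: "'a::euclidean_space \<Rightarrow> 'a \<Rightarrow> ennreal"
  assumes [measurable]: "case_prod V \<in> borel_measurable (borel \<Otimes>\<^sub>M borel)"
  shows "smear m V (x + u) (\<xi> + v) \<le> ennreal ((1 + norm u) ^ m * (1 + norm v) ^ m) * smear m V x \<xi>"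
proof -
  have "V y \<eta> * ennreal (decay m (x + u - y) * decay m (\<xi> + v - \<eta>))
     \<le> ennreal ((1 + norm u) ^ m * (1 + norm v) ^ m) * (V y \<eta> * ennreal (decay m (x - y) * decay m (\<xi> - \<eta>)))" for y \<eta>
  proof -
    have "decay m (x + u - y) * decay m (\<xi> + v - \<eta>)
       \<le> ((1 + norm u) ^ m * decay m (x - y)) * ((1 + norm v) ^ m * decay m (\<xi> - \<eta>))"
      using decay_peetre[of m "x - y" u] decay_peetre[of m "\<xi> - \<eta>" v]
      by (intro mult_mono) (auto simp: algebra_simps)
    then have "ennreal (decay m (x + u - y) * decay m (\<xi> + v - \<eta>))
      \<le> ennreal (((1 + norm u) ^ m * (1 + norm v) ^ m) * (decay m (x - y) * decay m (\<xi> - \<eta>)))"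
      by (intro ennreal_leI) (simp add: mult_ac)
    then have "V y \<eta> * ennreal (decay m (x + u - y) * decay m (\<xi> + v - \<eta>))
      \<le> V y \<eta> * ennreal (((1 + norm u) ^ m * (1 + norm v) ^ m) * (decay m (x - y) * decay m (\<xi> - \<eta>)))"
      by (rule mult_left_mono) simp
    also have "\<dots> = ennreal ((1 + norm u) ^ m * (1 + norm v) ^ m) * (V y \<eta> * ennreal (decay m (x - y) * decay m (\<xi> - \<eta>)))"
      by (subst ennreal_mult) (auto simp: mult_ac)
    finally show ?thesis .
  qed
  then have "smear m V (x + u) (\<xi> + v) \<le> (\<integral>\<^sup>+y. (\<integral>\<^sup>+\<eta>. ennreal ((1 + norm u) ^ m * (1 + norm v) ^ m) *
     (V y \<eta> * ennreal (decay m (x - y) * decay m (\<xi> - \<eta>))) \<partial>lborel) \<partial>lborel)"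
    unfolding smear_def by (intro nn_integral_mono)
  also have "\<dots> = ennreal ((1 + norm u) ^ m * (1 + norm v) ^ m) * smear m V x \<xi>"
    unfolding smear_def by (simp add: nn_integral_cmult)
  finally show ?thesis .
qed

text \<open>Slow variation in \<open>x\<close> lets the exponent of the inner norm increase at no cost.\<close>

lemma Lnorm_smear:
  fixes a a' b s :: real
  assumes "0 \<le> a'" "a' \<le> a" "a \<le> 1" "0 \<le> b" "b \<le> 1" "0 \<le> s" "real DIM('a) + s < real m"
  obtains C :: real where "0 < C"
    "\<And>V :: 'a::euclidean_space \<Rightarrow> 'a \<Rightarrow> ennreal. case_prod V \<in> borel_measurable (borel \<Otimes>\<^sub>M borel) \<Longrightarrow>
       Lnorm lborel b (\<lambda>\<omega>. Lnorm lborel a' (\<lambda>x. smear m V x \<omega>) * ennreal (japanese_bracket \<omega> powr s))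
       \<le> ennreal C * Lnorm lborel b (\<lambda>\<omega>. Lnorm lborel a (\<lambda>x. V x \<omega>) * ennreal (japanese_bracket \<omega> powr s))"
proof -
  obtain C1 where C1: "0 < C1" "\<And>f :: 'a \<Rightarrow> ennreal. f \<in> borel_measurable borel \<Longrightarrow>
       (\<And>x u. f (x + u) \<le> ennreal ((1 + norm u) ^ m) * f x) \<Longrightarrow>
       Lnorm lborel a' f \<le> ennreal C1 * Lnorm lborel a f"
    using Lnorm_slowly_varying[OF assms(1-3)] by metis
  have "(\<integral>\<^sup>+u. ennreal (decay m (u::'a)) \<partial>lborel) < \<infinity>"
    by (rule nn_integral_decay) (use assms in simp)
  then obtain D where D: "(\<integral>\<^sup>+u. ennreal (decay m (u::'a)) \<partial>lborel) = ennreal D" "0 \<le> D"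
    by (cases "(\<integral>\<^sup>+u. ennreal (decay m (u::'a)) \<partial>lborel)") auto
  \<comment> \<open>Moving the weight from \<omega> to \<omega> - v costs (1 + |v|)^s. The constant
    D' is the integral of the kernel with this cost included, finite because m exceeds the dimension
    by more than s.\<close>
  have "(\<integral>\<^sup>+u. ennreal (decay m (u::'a) * (1 + norm u) powr s) \<partial>lborel)
      = (\<integral>\<^sup>+u. ennreal ((1 + norm (u::'a)) powr - (real m - s)) \<partial>lborel)"
    by (simp add: decay_eq_powr powr_add[symmetric])
  also have "\<dots> < \<infinity>" by (rule nn_integral_powr_decay) (use assms in simp)
  finally obtain D' where D': "(\<integral>\<^sup>+u. ennreal (decay m (u::'a) * (1 + norm u) powr s) \<partial>lborel) = ennreal D'" "0 \<le> D'"
    by (cases "(\<integral>\<^sup>+u. ennreal (decay m (u::'a) * (1 + norm u) powr s) \<partial>lborel)") auto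
  show ?thesis
  proof (rule that[of "C1 * D * D' + 1"])
    show "0 < C1 * D * D' + 1" using C1 D D' by (simp add: add_nonneg_pos)
    fix V :: "'a \<Rightarrow> 'a \<Rightarrow> ennreal"
    assume [measurable]: "case_prod V \<in> borel_measurable (borel \<Otimes>\<^sub>M borel)"
    define N where "N \<omega> = Lnorm lborel a (\<lambda>x. V x \<omega>)" for \<omega>
    define J where "J \<omega> = ennreal (japanese_bracket (\<omega>::'a) powr s)" for \<omega>
    have [measurable]: "J \<in> borel_measurable borel" unfolding J_def by measurable
    have [measurable]: "N \<in> borel_measurable borel"
      unfolding N_def by (rule lborel.Lnorm_measurable) measurable
    have shift: "Lnorm lborel a (\<lambda>x. V (x - u) \<omega>) \<le> N \<omega>" for u \<omega>
      unfolding N_def by (rule Lnorm_lborel_shift[where f = "\<lambda>x. V x \<omega>"]) measurable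
    \<comment> \<open>Minkowski's inequality in x, once for each integral in
      \<open>smear_alt\<close>. The translation by u does not increase the norm, so the integral
      over u contributes just D.\<close>
    have smear: "Lnorm lborel a (\<lambda>x. smear m V x \<omega>) \<le> (\<integral>\<^sup>+v. ennreal D * (ennreal (decay m v) * N (\<omega> - v)) \<partial>lborel)" for \<omega>
    proof -
      have "Lnorm lborel a (\<lambda>x. smear m V x \<omega>)
         = Lnorm lborel a (\<lambda>x. \<integral>\<^sup>+v. (\<integral>\<^sup>+u. V (x - u) (\<omega> - v) * ennreal (decay m u * decay m v) \<partial>lborel) \<partial>lborel)"
        by (subst smear_alt) auto
      also have "\<dots> \<le> (\<integral>\<^sup>+v. Lnorm lborel a (\<lambda>x. \<integral>\<^sup>+u. V (x - u) (\<omega> - v) * ennreal (decay m u * decay m v) \<partial>lborel) \<partial>lborel)"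
        using assms by (intro Lnorm_Minkowski lborel.sigma_finite_measure_axioms) auto
      also have "\<dots> \<le> (\<integral>\<^sup>+v. (\<integral>\<^sup>+u. Lnorm lborel a (\<lambda>x. V (x - u) (\<omega> - v) * ennreal (decay m u * decay m v)) \<partial>lborel) \<partial>lborel)"
        using assms by (intro nn_integral_mono Lnorm_Minkowski lborel.sigma_finite_measure_axioms) auto
      also have "\<dots> \<le> (\<integral>\<^sup>+v. (\<integral>\<^sup>+u. ennreal (decay m (u::'a)) * (ennreal (decay m v) * N (\<omega> - v)) \<partial>lborel) \<partial>lborel)"
      proof (intro nn_integral_mono)
        fix u v :: 'a
        have "Lnorm lborel a (\<lambda>x. V (x - u) (\<omega> - v) * ennreal (decay m u * decay m v))
           = ennreal (decay m u * decay m v) * Lnorm lborel a (\<lambda>x. V (x - u) (\<omega> - v))"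
          using assms by (intro Lnorm_cmult_real mult_pos_pos decay_pos) auto
        also have "\<dots> \<le> ennreal (decay m u * decay m v) * N (\<omega> - v)"
          by (intro mult_left_mono shift) simp
        finally show "Lnorm lborel a (\<lambda>x. V (x - u) (\<omega> - v) * ennreal (decay m u * decay m v))
           \<le> ennreal (decay m u) * (ennreal (decay m v) * N (\<omega> - v))"
          by (simp add: ennreal_mult mult.assoc)
      qed
      also have "\<dots> = (\<integral>\<^sup>+v. ennreal D * (ennreal (decay m v) * N (\<omega> - v)) \<partial>lborel)"
        by (simp add: nn_integral_multc D)
      finally show ?thesis .
    qed
    have "Lnorm lborel a' (\<lambda>x. smear m V x \<omega>) * J \<omega>
      \<le> (\<integral>\<^sup>+v. ennreal (C1 * D) * (ennreal (decay m v * (1 + norm v) powr s) * (N (\<omega> - v) * J (\<omega> - v))) \<partial>lborel)" for \<omega>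
    proof -
      have "Lnorm lborel a' (\<lambda>x. smear m V x \<omega>) \<le> ennreal C1 * Lnorm lborel a (\<lambda>x. smear m V x \<omega>)"
      proof (rule C1(2))
        show "smear m V (x + u) \<omega> \<le> ennreal ((1 + norm u) ^ m) * smear m V x \<omega>" for x u
          using smear_slowly_varying[of V m x u \<omega> 0] by simp
      qed measurable
      also have "\<dots> \<le> ennreal C1 * (\<integral>\<^sup>+v. ennreal D * (ennreal (decay m v) * N (\<omega> - v)) \<partial>lborel)"
        by (intro mult_left_mono smear) simp
      finally have "Lnorm lborel a' (\<lambda>x. smear m V x \<omega>) * J \<omega>
        \<le> ennreal C1 * (\<integral>\<^sup>+v. ennreal D * (ennreal (decay m v) * N (\<omega> - v)) \<partial>lborel) * J \<omega>"
        by (rule mult_right_mono) simp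
      also have "\<dots> = (\<integral>\<^sup>+v. ennreal C1 * (ennreal D * (ennreal (decay m v) * N (\<omega> - v))) * J \<omega> \<partial>lborel)"
        by (subst nn_integral_cmult[symmetric], measurable) (subst nn_integral_multc[symmetric], auto)
      also have "\<dots> \<le> (\<integral>\<^sup>+v. ennreal (C1 * D) * (ennreal (decay m v * (1 + norm v) powr s) * (N (\<omega> - v) * J (\<omega> - v))) \<partial>lborel)"
      proof (intro nn_integral_mono)
        fix v
        have "japanese_bracket \<omega> powr s \<le> (japanese_bracket (\<omega> - v) * (1 + norm v)) powr s"
          using japanese_bracket_add_le[of "\<omega> - v" v] assms by (intro powr_mono2) (auto intro: less_imp_le)
        then have "J \<omega> \<le> ennreal ((1 + norm v) powr s) * J (\<omega> - v)"
          by (simp add: J_def ennreal_mult[symmetric] powr_mult mult.commute ennreal_leI)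
        then have "ennreal C1 * (ennreal D * (ennreal (decay m v) * N (\<omega> - v))) * J \<omega>
          \<le> ennreal C1 * (ennreal D * (ennreal (decay m v) * N (\<omega> - v))) * (ennreal ((1 + norm v) powr s) * J (\<omega> - v))"
          by (rule mult_left_mono) simp
        also have "\<dots> = ennreal (C1 * D) * (ennreal (decay m v * (1 + norm v) powr s) * (N (\<omega> - v) * J (\<omega> - v)))"
          using C1 D by (simp add: ennreal_mult mult_ac)
        finally show "ennreal C1 * (ennreal D * (ennreal (decay m v) * N (\<omega> - v))) * J \<omega>
          \<le> ennreal (C1 * D) * (ennreal (decay m v * (1 + norm v) powr s) * (N (\<omega> - v) * J (\<omega> - v)))" .
      qed
      finally show ?thesis .
    qed
    then have "Lnorm lborel b (\<lambda>\<omega>. Lnorm lborel a' (\<lambda>x. smear m V x \<omega>) * J \<omega>)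
      \<le> Lnorm lborel b (\<lambda>\<omega>. \<integral>\<^sup>+v. ennreal (C1 * D) * (ennreal (decay m v * (1 + norm v) powr s) * (N (\<omega> - v) * J (\<omega> - v))) \<partial>lborel)"
      using assms by (intro Lnorm_mono borel_measurable_times_ennreal lborel.Lnorm_measurable) auto
    also have "\<dots> \<le> (\<integral>\<^sup>+v. Lnorm lborel b (\<lambda>\<omega>. ennreal (C1 * D) * (ennreal (decay m v * (1 + norm v) powr s) * (N (\<omega> - v) * J (\<omega> - v)))) \<partial>lborel)"
      using assms by (intro Lnorm_Minkowski lborel.sigma_finite_measure_axioms) auto
    also have "\<dots> \<le> (\<integral>\<^sup>+v. ennreal (C1 * D) * (ennreal (decay m (v::'a) * (1 + norm v) powr s) * Lnorm lborel b (\<lambda>\<omega>. N \<omega> * J \<omega>)) \<partial>lborel)"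
    proof (intro nn_integral_mono)
      fix v
      have "Lnorm lborel b (\<lambda>\<omega>. ennreal (C1 * D) * (ennreal (decay m v * (1 + norm v) powr s) * (N (\<omega> - v) * J (\<omega> - v))))
        \<le> ennreal (C1 * D) * Lnorm lborel b (\<lambda>\<omega>. ennreal (decay m v * (1 + norm v) powr s) * (N (\<omega> - v) * J (\<omega> - v)))"
        using assms by (intro Lnorm_cmult) auto
      also have "\<dots> \<le> ennreal (C1 * D) * (ennreal (decay m v * (1 + norm v) powr s) * Lnorm lborel b (\<lambda>\<omega>. N (\<omega> - v) * J (\<omega> - v)))"
        using assms by (intro mult_left_mono Lnorm_cmult) auto
      also have "\<dots> \<le> ennreal (C1 * D) * (ennreal (decay m v * (1 + norm v) powr s) * Lnorm lborel b (\<lambda>\<omega>. N \<omega> * J \<omega>))"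
        using Lnorm_lborel_shift[where f = "\<lambda>\<omega>. N \<omega> * J \<omega>" and c = v] by (intro mult_left_mono) auto
      finally show "Lnorm lborel b (\<lambda>\<omega>. ennreal (C1 * D) * (ennreal (decay m v * (1 + norm v) powr s) * (N (\<omega> - v) * J (\<omega> - v))))
        \<le> ennreal (C1 * D) * (ennreal (decay m v * (1 + norm v) powr s) * Lnorm lborel b (\<lambda>\<omega>. N \<omega> * J \<omega>))" .
    qed
    also have "\<dots> = ennreal (C1 * D) * (ennreal D' * Lnorm lborel b (\<lambda>\<omega>. N \<omega> * J \<omega>))"
      by (simp add: nn_integral_cmult nn_integral_multc D')
    also have "\<dots> \<le> ennreal (C1 * D * D' + 1) * Lnorm lborel b (\<lambda>\<omega>. N \<omega> * J \<omega>)"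
      using C1 D D' by (simp add: mult.assoc[symmetric] ennreal_mult[symmetric] mult_right_mono ennreal_leI del: ennreal_plus)
    finally show "Lnorm lborel b (\<lambda>\<omega>. Lnorm lborel a' (\<lambda>x. smear m V x \<omega>) * ennreal (japanese_bracket \<omega> powr s))
       \<le> ennreal (C1 * D * D' + 1) * Lnorm lborel b (\<lambda>\<omega>. Lnorm lborel a (\<lambda>x. V x \<omega>) * ennreal (japanese_bracket \<omega> powr s))"
      by (simp add: N_def J_def)
  qed
qed

text \<open>Only a <= a1 + a2 is available for Hoelder's inequality in x, not equality. The gap is
  closed by slow variation: a is split as c1 + c2 with c1 = min a1 a <= a1 and c2 <= a2, Hoelder is
  used with c1 and c2, and \<open>Lnorm_smear\<close> leads back to a1 and a2.\<close>

proposition Lnorm_smear_product: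
  fixes a a1 a2 b s0 s1 s2 :: real
  assumes "0 \<le> a" "a \<le> 1" "0 \<le> a1" "a1 \<le> 1" "0 \<le> a2" "a2 \<le> 1" "a \<le> a1 + a2" "0 \<le> b" "b < 1"
    "0 \<le> s0" "s0 \<le> s1" "s0 \<le> s2" "real DIM('a) * (1 - b) < s1 + s2 - s0"
    "real DIM('a) + s1 < real m" "real DIM('a) + s2 < real m"
  obtains C :: real where "0 < C"
    "\<And>V W :: 'a::euclidean_space \<Rightarrow> 'a \<Rightarrow> ennreal.
       case_prod V \<in> borel_measurable (borel \<Otimes>\<^sub>M borel) \<Longrightarrow> case_prod W \<in> borel_measurable (borel \<Otimes>\<^sub>M borel) \<Longrightarrow>
       Lnorm lborel b (\<lambda>\<zeta>. Lnorm lborel a (\<lambda>x. \<integral>\<^sup>+\<xi>. smear m V x \<xi> * smear m W x (\<zeta> - \<xi>) \<partial>lborel)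
          * ennreal (japanese_bracket \<zeta> powr s0))
       \<le> ennreal C * Lnorm lborel b (\<lambda>\<omega>. Lnorm lborel a1 (\<lambda>x. V x \<omega>) * ennreal (japanese_bracket \<omega> powr s1))
         * Lnorm lborel b (\<lambda>\<omega>. Lnorm lborel a2 (\<lambda>x. W x \<omega>) * ennreal (japanese_bracket \<omega> powr s2))"
proof -
  define c1 c2 where "c1 = min a1 a" and "c2 = a - c1"
  have c: "0 \<le> c1" "c1 \<le> a1" "0 \<le> c2" "c2 \<le> a2" "a = c1 + c2"
    using assms by (auto simp: c1_def c2_def)
  define \<alpha> where "\<alpha> V \<omega> = Lnorm lborel c1 (\<lambda>x. smear m V x \<omega>) * ennreal (japanese_bracket \<omega> powr s1)" for V and \<omega> :: 'a
  define \<beta> where "\<beta> V \<omega> = Lnorm lborel c2 (\<lambda>x. smear m V x \<omega>) * ennreal (japanese_bracket \<omega> powr s2)" for V and \<omega> :: 'a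
  obtain C1 where C1: "0 < C1" "\<And>V. case_prod V \<in> borel_measurable (borel \<Otimes>\<^sub>M borel) \<Longrightarrow>
       Lnorm lborel b (\<alpha> V) \<le> ennreal C1 * Lnorm lborel b (\<lambda>\<omega>. Lnorm lborel a1 (\<lambda>x. V x \<omega>) * ennreal (japanese_bracket \<omega> powr s1))"
    unfolding \<alpha>_def by (rule Lnorm_smear[of c1 a1 b s1 m, where ?'a = 'a]) (use assms c in auto)
  obtain C2 where C2: "0 < C2" "\<And>V. case_prod V \<in> borel_measurable (borel \<Otimes>\<^sub>M borel) \<Longrightarrow>
       Lnorm lborel b (\<beta> V) \<le> ennreal C2 * Lnorm lborel b (\<lambda>\<omega>. Lnorm lborel a2 (\<lambda>x. V x \<omega>) * ennreal (japanese_bracket \<omega> powr s2))"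
    unfolding \<beta>_def by (rule Lnorm_smear[of c2 a2 b s2 m, where ?'a = 'a]) (use assms c in auto)
  obtain C0 where C0: "0 < C0" "\<And>\<zeta> :: 'a. Lnorm lborel (1 - b) (\<lambda>\<xi>. ennreal (japanese_bracket \<zeta> powr s0
      * japanese_bracket \<xi> powr - s1 * japanese_bracket (\<zeta> - \<xi>) powr - s2)) \<le> ennreal C0"
    by (rule Lnorm_japanese_bracket_weight[of s0 s1 s2 "1 - b", where ?'a = 'a]) (use assms in auto)
  show ?thesis
  proof (rule that[of "C0 * (C1 * C2)"])
    show "0 < C0 * (C1 * C2)" using C0 C1 C2 by simp
    fix V W :: "'a \<Rightarrow> 'a \<Rightarrow> ennreal"
    assume VW [measurable]: "case_prod V \<in> borel_measurable (borel \<Otimes>\<^sub>M borel)" "case_prod W \<in> borel_measurable (borel \<Otimes>\<^sub>M borel)"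
    let ?N1 = "Lnorm lborel b (\<lambda>\<omega>. Lnorm lborel a1 (\<lambda>x. V x \<omega>) * ennreal (japanese_bracket \<omega> powr s1))"
    let ?N2 = "Lnorm lborel b (\<lambda>\<omega>. Lnorm lborel a2 (\<lambda>x. W x \<omega>) * ennreal (japanese_bracket \<omega> powr s2))"
    have [measurable]: "(\<lambda>\<omega>. Lnorm lborel r (\<lambda>x. smear m U x \<omega>)) \<in> borel_measurable borel"
      if [measurable]: "case_prod U \<in> borel_measurable (borel \<Otimes>\<^sub>M borel)" for r and U :: "'a \<Rightarrow> 'a \<Rightarrow> ennreal"
      by (rule lborel.Lnorm_measurable) measurable
    have [measurable]: "\<alpha> V \<in> borel_measurable borel" "\<beta> W \<in> borel_measurable borel"
      unfolding \<alpha>_def \<beta>_def by measurable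
    have "Lnorm lborel a (\<lambda>x. \<integral>\<^sup>+\<xi>. smear m V x \<xi> * smear m W x (\<zeta> - \<xi>) \<partial>lborel) * ennreal (japanese_bracket \<zeta> powr s0)
      \<le> ennreal C0 * Lnorm lborel b (\<lambda>\<xi>. \<alpha> V \<xi> * \<beta> W (\<zeta> - \<xi>))" for \<zeta>
    proof -
      let ?w = "\<lambda>\<xi>. japanese_bracket \<zeta> powr s0 * japanese_bracket \<xi> powr - s1 * japanese_bracket (\<zeta> - \<xi>) powr - s2"
      have "Lnorm lborel a (\<lambda>x. \<integral>\<^sup>+\<xi>. smear m V x \<xi> * smear m W x (\<zeta> - \<xi>) \<partial>lborel)
         \<le> (\<integral>\<^sup>+\<xi>. Lnorm lborel a (\<lambda>x. smear m V x \<xi> * smear m W x (\<zeta> - \<xi>)) \<partial>lborel)"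
        using assms by (intro Lnorm_Minkowski lborel.sigma_finite_measure_axioms) auto
      also have "\<dots> \<le> (\<integral>\<^sup>+\<xi>. Lnorm lborel c1 (\<lambda>x. smear m V x \<xi>) * Lnorm lborel c2 (\<lambda>x. smear m W x (\<zeta> - \<xi>)) \<partial>lborel)"
        unfolding c(5) using c by (intro nn_integral_mono Lnorm_Hoelder) auto
      finally have "Lnorm lborel a (\<lambda>x. \<integral>\<^sup>+\<xi>. smear m V x \<xi> * smear m W x (\<zeta> - \<xi>) \<partial>lborel) * ennreal (japanese_bracket \<zeta> powr s0)
         \<le> (\<integral>\<^sup>+\<xi>. Lnorm lborel c1 (\<lambda>x. smear m V x \<xi>) * Lnorm lborel c2 (\<lambda>x. smear m W x (\<zeta> - \<xi>)) \<partial>lborel) * ennreal (japanese_bracket \<zeta> powr s0)"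
        by (rule mult_right_mono) simp
      also have "\<dots> = (\<integral>\<^sup>+\<xi>. Lnorm lborel c1 (\<lambda>x. smear m V x \<xi>) * Lnorm lborel c2 (\<lambda>x. smear m W x (\<zeta> - \<xi>)) * ennreal (japanese_bracket \<zeta> powr s0) \<partial>lborel)"
        by (rule nn_integral_multc[symmetric]) measurable
      \<comment> \<open>The weights with exponents s1 and s2 are inserted together with their
        reciprocals; the reciprocals and the power s0 of the bracket of \<zeta> form
        \<open>?w\<close>.\<close>
      also have "\<dots> = (\<integral>\<^sup>+\<xi>. ennreal (?w \<xi>) * (\<alpha> V \<xi> * \<beta> W (\<zeta> - \<xi>)) \<partial>lborel)"
      proof (intro nn_integral_cong)
        fix \<xi> :: 'a
        have cancel: "ennreal (japanese_bracket x powr - s) * ennreal (japanese_bracket x powr s) = 1" for x :: 'a and s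
          by (simp add: ennreal_mult[symmetric] powr_add[symmetric])
        have "ennreal (?w \<xi>) * (\<alpha> V \<xi> * \<beta> W (\<zeta> - \<xi>))
          = (Lnorm lborel c1 (\<lambda>x. smear m V x \<xi>) * Lnorm lborel c2 (\<lambda>x. smear m W x (\<zeta> - \<xi>)) * ennreal (japanese_bracket \<zeta> powr s0))
           * ((ennreal (japanese_bracket \<xi> powr - s1) * ennreal (japanese_bracket \<xi> powr s1))
            * (ennreal (japanese_bracket (\<zeta> - \<xi>) powr - s2) * ennreal (japanese_bracket (\<zeta> - \<xi>) powr s2)))"
          by (simp add: \<alpha>_def \<beta>_def ennreal_mult mult_ac)
        then show "Lnorm lborel c1 (\<lambda>x. smear m V x \<xi>) * Lnorm lborel c2 (\<lambda>x. smear m W x (\<zeta> - \<xi>)) * ennreal (japanese_bracket \<zeta> powr s0)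
          = ennreal (?w \<xi>) * (\<alpha> V \<xi> * \<beta> W (\<zeta> - \<xi>))"
          by (simp only: cancel mult_1_right)
      qed
      \<comment> \<open>The integral is the norm of index 1 = (1 - b) + b, so that Hoelder's
        inequality puts the weight into the dual exponent and keeps b for the weighted
        factors.\<close>
      also have "\<dots> = Lnorm lborel ((1 - b) + b) (\<lambda>\<xi>. ennreal (?w \<xi>) * (\<alpha> V \<xi> * \<beta> W (\<zeta> - \<xi>)))"
        by (simp add: Lnorm_1)
      also have "\<dots> \<le> Lnorm lborel (1 - b) (\<lambda>\<xi>. ennreal (?w \<xi>)) * Lnorm lborel b (\<lambda>\<xi>. \<alpha> V \<xi> * \<beta> W (\<zeta> - \<xi>))"
        using assms by (intro Lnorm_Hoelder) auto
      also have "\<dots> \<le> ennreal C0 * Lnorm lborel b (\<lambda>\<xi>. \<alpha> V \<xi> * \<beta> W (\<zeta> - \<xi>))"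
        by (intro mult_right_mono C0) simp
      finally show ?thesis .
    qed
    then have "Lnorm lborel b (\<lambda>\<zeta>. Lnorm lborel a (\<lambda>x. \<integral>\<^sup>+\<xi>. smear m V x \<xi> * smear m W x (\<zeta> - \<xi>) \<partial>lborel) * ennreal (japanese_bracket \<zeta> powr s0))
      \<le> Lnorm lborel b (\<lambda>\<zeta>. ennreal C0 * Lnorm lborel b (\<lambda>\<xi>. \<alpha> V \<xi> * \<beta> W (\<zeta> - \<xi>)))"
      using assms by (intro Lnorm_mono borel_measurable_times_ennreal lborel.Lnorm_measurable) auto
    also have "\<dots> \<le> ennreal C0 * Lnorm lborel b (\<lambda>\<zeta>. Lnorm lborel b (\<lambda>\<xi>. \<alpha> V \<xi> * \<beta> W (\<zeta> - \<xi>)))"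
      using assms by (intro Lnorm_cmult lborel.Lnorm_measurable) auto
    also have "\<dots> \<le> ennreal C0 * (Lnorm lborel b (\<alpha> V) * Lnorm lborel b (\<beta> W))"
      using assms by (intro mult_left_mono Lnorm_convolution_product) auto
    also have "\<dots> \<le> ennreal C0 * ((ennreal C1 * ?N1) * (ennreal C2 * ?N2))"
      by (intro mult_left_mono mult_mono C1 C2 VW) auto
    also have "\<dots> = ennreal (C0 * (C1 * C2)) * ?N1 * ?N2"
      using C0 C1 C2 by (simp add: ennreal_mult mult_ac)
    finally show "Lnorm lborel b (\<lambda>\<zeta>. Lnorm lborel a (\<lambda>x. \<integral>\<^sup>+\<xi>. smear m V x \<xi> * smear m W x (\<zeta> - \<xi>) \<partial>lborel)
          * ennreal (japanese_bracket \<zeta> powr s0)) \<le> ennreal (C0 * (C1 * C2)) * ?N1 * ?N2" .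
  qed
qed

section \<open>The Schwartz space\<close>

text \<open>The directional derivative as an operator on functions: \<open>partials\<close> is its
  iteration, and closure properties can be stated for a single step.\<close>

definition pd :: "'a \<Rightarrow> ('a::euclidean_space \<Rightarrow> complex) \<Rightarrow> 'a \<Rightarrow> complex" where
  "pd b f x = frechet_derivative f (at x) b"

lemma partials_Cons: "partials (b # bs) f = pd b (partials bs f)"
  by (simp add: pd_def fun_eq_iff)

declare partials.simps(2) [simp del] partials_Cons [simp]

lemma partials_append: "partials (bs @ cs) f = partials bs (partials cs f)"
  by (induction bs) auto

lemma pd_eqI: "(f has_derivative f') (at x) \<Longrightarrow> pd b f x = f' b"
  by (metis frechet_derivative_at pd_def)

lemma has_derivative_pd:
  assumes "f differentiable (at x)"
  shows "(f has_derivative (\<lambda>h. \<Sum>b\<in>Basis. (h \<bullet> b) *\<^sub>R pd b f x)) (at x)"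
proof -
  have d: "(f has_derivative frechet_derivative f (at x)) (at x)"
    using assms frechet_derivative_works by blast
  then interpret bounded_linear "frechet_derivative f (at x)" by (rule has_derivative_bounded_linear)
  have "frechet_derivative f (at x) h = (\<Sum>b\<in>Basis. (h \<bullet> b) *\<^sub>R pd b f x)" for h
  proof -
    have "frechet_derivative f (at x) h = frechet_derivative f (at x) (\<Sum>b\<in>Basis. (h \<bullet> b) *\<^sub>R b)"
      by (simp only: euclidean_representation)
    then show ?thesis by (simp add: sum scaleR pd_def)
  qed
  then show ?thesis using d by (metis (no_types, lifting) ext)
qed

lemma onorm_pd_sum_le: "onorm (\<lambda>h. \<Sum>b\<in>Basis. (h \<bullet> b) *\<^sub>R (g b :: complex)) \<le> (\<Sum>b\<in>(Basis::'a::euclidean_space set). norm (g b))"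
proof (rule onorm_bound)
  fix h :: 'a
  have "norm (\<Sum>b\<in>Basis. (h \<bullet> b) *\<^sub>R g b) \<le> (\<Sum>b\<in>Basis. norm h * norm (g b))"
    by (rule sum_norm_le) (auto intro!: mult_right_mono Basis_le_norm)
  then show "norm (\<Sum>b\<in>Basis. (h \<bullet> b) *\<^sub>R g b) \<le> (\<Sum>b\<in>Basis. norm (g b)) * norm h"
    by (simp add: sum_distrib_left mult.commute)
qed (auto intro: sum_nonneg)

lemma partials_closed:
  assumes "f \<in> A" "\<And>f b. f \<in> A \<Longrightarrow> b \<in> Basis \<Longrightarrow> pd b f \<in> A" "set bs \<subseteq> Basis"
  shows "partials bs f \<in> A"
  using assms(3) by (induction bs) (auto simp: assms)

text \<open>The recursion of \<^const>\<open>partials\<close> makes smoothness and rapid decay coinductive: a set of functions that is closed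
  under partial derivatives only needs to be inspected at order zero.\<close>

lemma smooth_coinduct:
  assumes "f \<in> A" "\<And>f. f \<in> A \<Longrightarrow> f differentiable_on UNIV" "\<And>f b. f \<in> A \<Longrightarrow> b \<in> Basis \<Longrightarrow> pd b f \<in> A"
  shows "smooth f"
  using partials_closed[OF assms(1,3)] assms(2) by (auto simp: smooth_def)

lemma schwartz_coinduct:
  assumes "f \<in> A" "\<And>f. f \<in> A \<Longrightarrow> f differentiable_on UNIV" "\<And>f b. f \<in> A \<Longrightarrow> b \<in> Basis \<Longrightarrow> pd b f \<in> A"
    and "\<And>f k. f \<in> A \<Longrightarrow> \<exists>C. \<forall>x. norm (f x) \<le> C * decay k x"
  shows "f \<in> schwartz_space"
proof -
  have "bounded (range (\<lambda>x. (1 + norm x) ^ k *\<^sub>R partials bs f x))" if bs: "set bs \<subseteq> Basis" for k bs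
  proof -
    obtain C where C: "\<And>x. norm (partials bs f x) \<le> C * decay k x"
      using assms(4)[OF partials_closed[OF assms(1,3) bs]] by blast
    have "norm ((1 + norm x) ^ k *\<^sub>R partials bs f x) \<le> C" for x
    proof -
      have "0 < 1 + norm x" by (simp add: add_pos_nonneg)
      then show ?thesis using C[of x] by (simp add: decay_def field_simps)
    qed
    then show ?thesis by (auto simp: bounded_iff)
  qed
  then show ?thesis using smooth_coinduct[OF assms(1-3)] by (auto simp: schwartz_space_def)
qed

lemma smooth_pd:
  fixes f :: "'a::euclidean_space \<Rightarrow> complex"
  shows "smooth f \<Longrightarrow> b \<in> Basis \<Longrightarrow> smooth (pd b f)"
  unfolding smooth_def
proof (intro allI impI)
  fix bs :: "'a list" assume *: "\<forall>bs. set bs \<subseteq> Basis \<longrightarrow> partials bs f differentiable_on UNIV" "b \<in> Basis" "set bs \<subseteq> Basis"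
  then have "partials (bs @ [b]) f differentiable_on UNIV" by (intro *(1)[rule_format]) auto
  then show "partials bs (pd b f) differentiable_on UNIV" by (simp add: partials_append)
qed

lemma smooth_partials: "smooth f \<Longrightarrow> set bs \<subseteq> Basis \<Longrightarrow> smooth (partials bs f)"
  by (rule partials_closed[of f "Collect smooth", simplified]) (auto intro: smooth_pd)

lemma smooth_differentiable: "smooth f \<Longrightarrow> f differentiable (at x)"
  unfolding smooth_def by (metis empty_iff empty_set partials.simps(1) subsetI differentiable_on_def UNIV_I)

lemma smooth_has_derivative: "smooth f \<Longrightarrow> (f has_derivative (\<lambda>h. \<Sum>b\<in>Basis. (h \<bullet> b) *\<^sub>R pd b f x)) (at x)"
  by (intro has_derivative_pd smooth_differentiable)

lemma smooth_continuous: "smooth f \<Longrightarrow> continuous_on S f"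
  by (meson continuous_at_imp_continuous_on differentiable_imp_continuous_within smooth_differentiable)

lemma smooth_measurable: "smooth f \<Longrightarrow> f \<in> borel_measurable borel"
  by (intro borel_measurable_continuous_onI smooth_continuous)

lemma schwartz_smooth: "f \<in> schwartz_space \<Longrightarrow> smooth f"
  by (simp add: schwartz_space_def)

lemma schwartz_partials: "f \<in> schwartz_space \<Longrightarrow> set bs \<subseteq> Basis \<Longrightarrow> partials bs f \<in> schwartz_space"
  by (auto simp: schwartz_space_def smooth_partials partials_append[symmetric])

lemma schwartz_pd: "f \<in> schwartz_space \<Longrightarrow> b \<in> Basis \<Longrightarrow> pd b f \<in> schwartz_space"
  using schwartz_partials[of f "[b]"] by simp

lemma schwartz_measurable [measurable_dest]: "f \<in> schwartz_space \<Longrightarrow> f \<in> borel_measurable borel"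
  by (intro smooth_measurable schwartz_smooth)

lemma schwartz_decay:
  assumes "f \<in> schwartz_space"
  obtains C where "0 < C" "\<And>x. norm (f x) \<le> C * decay k x"
proof -
  have "bounded (range (\<lambda>x. (1 + norm x) ^ k *\<^sub>R partials [] f x))"
    using assms unfolding schwartz_space_def mem_Collect_eq by (elim conjE allE[of _ k] allE[of _ "[]"]) simp
  then obtain C where C: "0 < C" "\<And>x. norm ((1 + norm x) ^ k *\<^sub>R f x) \<le> C"
    by (auto simp: bounded_pos)
  have "norm (f x) \<le> C * decay k x" for x
  proof -
    have "0 < 1 + norm x" by (simp add: add_pos_nonneg)
    then show ?thesis using C(2)[of x] by (simp add: decay_def field_simps)
  qed
  then show ?thesis using C(1) that by blast
qed

lemma integrable_le_decay:
  fixes f :: "'a::euclidean_space \<Rightarrow> 'b::{banach, second_countable_topology}"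
  assumes "f \<in> borel_measurable borel" "\<And>x. norm (f x) \<le> C * decay (Suc DIM('a)) x"
  shows "integrable lborel f"
proof (rule Bochner_Integration.integrable_bound)
  show "integrable lborel (\<lambda>x. C * decay (Suc DIM('a)) (x::'a))"
    by (intro integrable_mult_right integrable_decay) simp
  show "AE x in lborel. norm (f x) \<le> norm (C * decay (Suc DIM('a)) x)"
  proof (rule AE_I2)
    fix x show "norm (f x) \<le> norm (C * decay (Suc DIM('a)) x)"
      using assms(2)[of x] abs_ge_self[of "C * decay (Suc DIM('a)) x"] by simp
  qed
qed (use assms in simp)

lemma schwartz_integrable: "f \<in> schwartz_space \<Longrightarrow> integrable lborel f"
  by (metis integrable_le_decay schwartz_decay schwartz_measurable)

lemma pd_affine:
  assumes "smooth f"
  shows "pd b (\<lambda>x. a * f (r *\<^sub>R x + v)) = (\<lambda>x. (a * of_real r) * pd b f (r *\<^sub>R x + v))"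
    and "(\<lambda>x. a * f (r *\<^sub>R x + v)) differentiable (at x)"
proof -
  have d': "(f has_derivative frechet_derivative f (at y)) (at y)" for y
    using smooth_differentiable[OF assms] frechet_derivative_works by blast
  have d: "((\<lambda>x. a * f (r *\<^sub>R x + v)) has_derivative (\<lambda>h. a * frechet_derivative f (at (r *\<^sub>R x + v)) (r *\<^sub>R h))) (at x)" for x
  proof (rule has_derivative_mult_right, rule has_derivative_compose[of "\<lambda>x. r *\<^sub>R x + v" "\<lambda>h. r *\<^sub>R h" x UNIV f])
    show "((\<lambda>x. r *\<^sub>R x + v) has_derivative (\<lambda>h. r *\<^sub>R h)) (at x)" by (auto intro!: derivative_eq_intros)
  qed (rule d')
  have "pd b (\<lambda>x. a * f (r *\<^sub>R x + v)) x = (a * of_real r) * pd b f (r *\<^sub>R x + v)" for x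
    using pd_eqI[OF d, of b x] has_derivative_linear[OF d', of "r *\<^sub>R x + v"]
    by (simp add: pd_def linear_cmul scaleR_conv_of_real)
  then show "pd b (\<lambda>x. a * f (r *\<^sub>R x + v)) = (\<lambda>x. (a * of_real r) * pd b f (r *\<^sub>R x + v))" by auto
  show "(\<lambda>x. a * f (r *\<^sub>R x + v)) differentiable (at x)" using d differentiable_def by blast
qed

lemma schwartz_affine:
  fixes f :: "'a::euclidean_space \<Rightarrow> complex"
  assumes "f \<in> schwartz_space" and r: "r \<noteq> 0" shows "(\<lambda>x. a * f (r *\<^sub>R x + v)) \<in> schwartz_space"
\<comment> \<open>The scalar a ranges freely because every derivative contributes a factor
  r.\<close>
proof (rule schwartz_coinduct[where A = "{\<lambda>x. a * f (r *\<^sub>R x + v) | a f. f \<in> schwartz_space}"])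
  show "(\<lambda>x. a * f (r *\<^sub>R x + v)) \<in> {\<lambda>x. a * f (r *\<^sub>R x + v) | a f. f \<in> schwartz_space}" using assms by auto
next
  fix g assume "g \<in> {\<lambda>x. a * f (r *\<^sub>R x + v) | a f. f \<in> schwartz_space}"
  then show "g differentiable_on UNIV" by (auto simp: differentiable_on_def intro!: pd_affine(2) schwartz_smooth)
next
  fix g :: "'a \<Rightarrow> complex" and b :: 'a assume "g \<in> {\<lambda>x. a * f (r *\<^sub>R x + v) | a f. f \<in> schwartz_space}" and b: "b \<in> Basis"
  then obtain a f where g: "g = (\<lambda>x. a * f (r *\<^sub>R x + v))" "f \<in> schwartz_space" by auto
  show "pd b g \<in> {\<lambda>x. a * f (r *\<^sub>R x + v) | a f. f \<in> schwartz_space}"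
    unfolding g(1) pd_affine(1)[OF schwartz_smooth[OF g(2)]] using schwartz_pd[OF g(2) b] by blast
next
  fix g :: "'a \<Rightarrow> complex" and k assume "g \<in> {\<lambda>x. a * f (r *\<^sub>R x + v) | a f. f \<in> schwartz_space}"
  then obtain a f where g: "g = (\<lambda>x. a * f (r *\<^sub>R x + v))" "f \<in> schwartz_space" by auto
  obtain C where C: "0 < C" "\<And>x. norm (f x) \<le> C * decay k x" using schwartz_decay[OF g(2)] by metis
  \<comment> \<open>Solving for x gives 1 + |x| <= R (1 + |r x + v|) (1 + |v|), which turns decay in
    r x + v into decay in x.\<close>
  define R where "R = (1 + 1 / \<bar>r\<bar>)"
  have "norm (g x) \<le> norm a * C * ((R * (1 + norm v)) ^ k) * decay k x" for x
  proof -
    have "x = (1 / r) *\<^sub>R ((r *\<^sub>R x + v) - v)" using r by simp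
    then have "norm x = norm ((r *\<^sub>R x + v) - v) / \<bar>r\<bar>" by (metis norm_scaleR abs_divide abs_one mult.commute times_divide_eq_right mult.right_neutral)
    then have "1 + norm x \<le> R * (1 + norm ((r *\<^sub>R x + v) + (- v)))"
      by (simp add: R_def field_simps)
    also have "\<dots> \<le> R * ((1 + norm (r *\<^sub>R x + v)) * (1 + norm v))"
      using one_plus_norm_add_le[of "r *\<^sub>R x + v" "- v"] by (intro mult_left_mono) (auto simp: R_def)
    finally have "(1 + norm x) ^ k \<le> (R * ((1 + norm (r *\<^sub>R x + v)) * (1 + norm v))) ^ k"
      by (intro power_mono) auto
    then have "(1 + norm x) ^ k \<le> (R * (1 + norm v)) ^ k * (1 + norm (r *\<^sub>R x + v)) ^ k"
      by (simp add: power_mult_distrib mult_ac)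
    moreover have "0 < (1 + norm x) ^ k" "0 < (1 + norm (r *\<^sub>R x + v)) ^ k"
      by (simp_all add: add_pos_nonneg)
    moreover have "1 / Y \<le> c * (1 / X)" if "X \<le> c * Y" "0 < X" "0 < Y" for X Y c :: real
      using that by (simp add: field_simps)
    ultimately have "decay k (r *\<^sub>R x + v) \<le> (R * (1 + norm v)) ^ k * decay k x"
      unfolding decay_def by blast
    then have "C * decay k (r *\<^sub>R x + v) \<le> C * ((R * (1 + norm v)) ^ k * decay k x)"
      using C by (intro mult_left_mono) auto
    then have "norm (f (r *\<^sub>R x + v)) \<le> C * ((R * (1 + norm v)) ^ k * decay k x)"
      using C(2)[of "r *\<^sub>R x + v"] by linarith
    then have "norm a * norm (f (r *\<^sub>R x + v)) \<le> norm a * (C * ((R * (1 + norm v)) ^ k * decay k x))"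
      by (intro mult_left_mono) auto
    then show ?thesis by (simp add: g(1) norm_mult mult_ac)
  qed
  then show "\<exists>C. \<forall>x. norm (g x) \<le> C * decay k x" by blast
qed

lemma schwartz_shift: "f \<in> schwartz_space \<Longrightarrow> (\<lambda>x. f (x - v)) \<in> schwartz_space"
  using schwartz_affine[of f 1 1 "- v"] by simp

lemma schwartz_cmult: "f \<in> schwartz_space \<Longrightarrow> (\<lambda>x. a * f x) \<in> schwartz_space"
  using schwartz_affine[of f 1 a 0] by simp

lemma partials_shift:
  assumes "smooth f" "set bs \<subseteq> Basis"
  shows "partials bs (\<lambda>x. f (x - v)) = (\<lambda>x. partials bs f (x - v))"
  using assms(2)
proof (induction bs)
  case (Cons b bs)
  then have "smooth (partials bs f)" using assms by (intro smooth_partials) auto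
  from pd_affine(1)[OF this, of b 1 1 "- v"] show ?case using Cons by simp
qed simp

lemma partials_cmult:
  assumes "smooth f" "set bs \<subseteq> Basis"
  shows "partials bs (\<lambda>x. a * f x) = (\<lambda>x. a * partials bs f x)"
  using assms(2)
proof (induction bs)
  case (Cons b bs)
  then have "smooth (partials bs f)" using assms by (intro smooth_partials) auto
  from pd_affine(1)[OF this, of b a 1 0] show ?case using Cons by simp
qed simp

lemma pd_add:
  fixes f :: "'a::euclidean_space \<Rightarrow> complex"
  assumes "smooth f" "smooth g"
  shows "pd b (\<lambda>x. f x + g x) = (\<lambda>x. pd b f x + pd b g x)"
    and "(\<lambda>x. f x + g x) differentiable (at x)"
proof -
  have "((\<lambda>x. f x + g x) has_derivative (\<lambda>h. frechet_derivative f (at x) h + frechet_derivative g (at x) h)) (at x)" for x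
    by (intro derivative_intros) (use smooth_differentiable assms frechet_derivative_works in blast)+
  from pd_eqI[OF this] show "pd b (\<lambda>x. f x + g x) = (\<lambda>x. pd b f x + pd b g x)" by (auto simp: pd_def fun_eq_iff)
  show "(\<lambda>x. f x + g x) differentiable (at x)"
    using assms by (intro differentiable_add smooth_differentiable)
qed

lemma partials_add:
  assumes "smooth f" "smooth g" "set bs \<subseteq> Basis"
  shows "partials bs (\<lambda>x. f x + g x) = (\<lambda>x. partials bs f x + partials bs g x)"
  using assms(3)
proof (induction bs)
  case (Cons b bs)
  then show ?case using assms pd_add(1)[of "partials bs f" "partials bs g" b] by (simp add: smooth_partials)
qed simp

lemma schwartz_add:
  fixes f :: "'a::euclidean_space \<Rightarrow> complex"
  assumes "f \<in> schwartz_space" "g \<in> schwartz_space" shows "(\<lambda>x. f x + g x) \<in> schwartz_space"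
proof (rule schwartz_coinduct[where A = "{\<lambda>x. f x + g x | f g. f \<in> schwartz_space \<and> g \<in> schwartz_space}"])
  fix h :: "'a \<Rightarrow> complex" and b :: 'a assume "h \<in> {\<lambda>x. f x + g x | f g. f \<in> schwartz_space \<and> g \<in> schwartz_space}" and b: "b \<in> Basis"
  then obtain f g where h: "h = (\<lambda>x. f x + g x)" "f \<in> schwartz_space" "g \<in> schwartz_space" by auto
  show "pd b h \<in> {\<lambda>x. f x + g x | f g. f \<in> schwartz_space \<and> g \<in> schwartz_space}"
    unfolding h(1) pd_add(1)[OF h(2,3)[THEN schwartz_smooth]] using schwartz_pd[OF h(2) b] schwartz_pd[OF h(3) b] by blast
next
  fix h :: "'a \<Rightarrow> complex" and k assume "h \<in> {\<lambda>x. f x + g x | f g. f \<in> schwartz_space \<and> g \<in> schwartz_space}"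
  then obtain f g where h: "h = (\<lambda>x. f x + g x)" "f \<in> schwartz_space" "g \<in> schwartz_space" by auto
  obtain C where C: "\<And>x. norm (f x) \<le> C * decay k x" using schwartz_decay[OF h(2)] by metis
  obtain D where D: "\<And>x. norm (g x) \<le> D * decay k x" using schwartz_decay[OF h(3)] by metis
  have "norm (h x) \<le> (C + D) * decay k x" for x
    using norm_triangle_ineq[of "f x" "g x"] C[of x] D[of x] by (simp add: h(1) algebra_simps)
  then show "\<exists>C. \<forall>x. norm (h x) \<le> C * decay k x" by blast
qed (use assms in \<open>auto simp: differentiable_on_def intro!: pd_add(2) schwartz_smooth\<close>)

lemma schwartz_zero: "(\<lambda>x::'a::euclidean_space. 0) \<in> schwartz_space"
proof (rule schwartz_coinduct[where A = "{\<lambda>x. 0}"])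
  fix f :: "'a \<Rightarrow> complex" and b :: 'a assume "f \<in> {\<lambda>x. 0}"
  then show "pd b f \<in> {\<lambda>x. 0}" using pd_eqI[OF has_derivative_const[of 0]] by auto
next
  fix f :: "'a \<Rightarrow> complex" and k assume "f \<in> {\<lambda>x. 0}"
  then have "\<forall>x. norm (f x) \<le> 0 * decay k x" by simp
  then show "\<exists>C. \<forall>x. norm (f x) \<le> C * decay k x" by blast
qed auto

lemma schwartz_sum:
  assumes "finite I" "\<And>i. i \<in> I \<Longrightarrow> f i \<in> schwartz_space" shows "(\<lambda>x. \<Sum>i\<in>I. f i x) \<in> schwartz_space"
  using assms by (induction I) (auto simp: schwartz_zero schwartz_add)

lemma partials_sum:
  assumes "finite I" "\<And>i. i \<in> I \<Longrightarrow> f i \<in> schwartz_space" "set bs \<subseteq> Basis"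
  shows "partials bs (\<lambda>x. \<Sum>i\<in>I. f i x) = (\<lambda>x. \<Sum>i\<in>I. partials bs (f i) x)"
  using assms(1,2)
proof (induction I)
  case empty
  show ?case using partials_cmult[OF schwartz_smooth[OF schwartz_zero] assms(3), of 0] by simp
next
  case (insert i I)
  then show ?case using partials_add[of "f i" "\<lambda>x. \<Sum>i\<in>I. f i x" bs] schwartz_sum[of I f] assms(3)
    by (simp add: schwartz_smooth)
qed

lemma pd_cnj:
  assumes "smooth f"
  shows "pd b (\<lambda>x. cnj (f x)) = (\<lambda>x. cnj (pd b f x))" and "(\<lambda>x. cnj (f x)) differentiable (at x)"
proof -
  have d: "((\<lambda>x. cnj (f x)) has_derivative (\<lambda>h. cnj (frechet_derivative f (at x) h))) (at x)" for x
    by (intro derivative_intros) (use smooth_differentiable assms frechet_derivative_works in blast)+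
  from pd_eqI[OF this] show "pd b (\<lambda>x. cnj (f x)) = (\<lambda>x. cnj (pd b f x))" by (auto simp: pd_def fun_eq_iff)
  show "(\<lambda>x. cnj (f x)) differentiable (at x)" using d differentiable_def by blast
qed

lemma schwartz_cnj:
  fixes f :: "'a::euclidean_space \<Rightarrow> complex"
  assumes "f \<in> schwartz_space" shows "(\<lambda>x. cnj (f x)) \<in> schwartz_space"
proof (rule schwartz_coinduct[where A = "{\<lambda>x. cnj (f x) | f. f \<in> schwartz_space}"])
  fix h :: "'a \<Rightarrow> complex" and b :: 'a assume "h \<in> {\<lambda>x. cnj (f x) | f. f \<in> schwartz_space}" and b: "b \<in> Basis"
  then obtain f where h: "h = (\<lambda>x. cnj (f x))" "f \<in> schwartz_space" by auto
  show "pd b h \<in> {\<lambda>x. cnj (f x) | f. f \<in> schwartz_space}"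
    unfolding h(1) pd_cnj(1)[OF schwartz_smooth[OF h(2)]] using schwartz_pd[OF h(2) b] by blast
next
  fix h :: "'a \<Rightarrow> complex" and k assume "h \<in> {\<lambda>x. cnj (f x) | f. f \<in> schwartz_space}"
  then obtain f where h: "h = (\<lambda>x. cnj (f x))" "f \<in> schwartz_space" by auto
  then show "\<exists>C. \<forall>x. norm (h x) \<le> C * decay k x" using schwartz_decay[OF h(2), of k] by (metis complex_mod_cnj)
qed (use assms in \<open>auto simp: differentiable_on_def intro!: pd_cnj(2) schwartz_smooth\<close>)

section \<open>Products and multipliers\<close>

lemma pd_mult:
  assumes "smooth f" "smooth g"
  shows "pd b (\<lambda>x. f x * g x) = (\<lambda>x. pd b f x * g x + f x * pd b g x)"
    and "(\<lambda>x. f x * g x) differentiable (at x)"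
proof -
  have "((\<lambda>x. f x * g x) has_derivative (\<lambda>h. f x * frechet_derivative g (at x) h + frechet_derivative f (at x) h * g x)) (at x)" for x
    by (intro derivative_intros) (use smooth_differentiable assms frechet_derivative_works in blast)+
  from pd_eqI[OF this] show "pd b (\<lambda>x. f x * g x) = (\<lambda>x. pd b f x * g x + f x * pd b g x)" by (auto simp: pd_def fun_eq_iff)
  show "(\<lambda>x. f x * g x) differentiable (at x)"
    using assms by (intro differentiable_mult smooth_differentiable)
qed

text \<open>By the Leibniz rule the derivative of one product is a sum of two, so the products have
  to be closed under addition before they are stable under \<open>pd\<close>.\<close>

inductive_set products :: "('a::euclidean_space \<Rightarrow> complex) set \<Rightarrow> ('a \<Rightarrow> complex) set \<Rightarrow> ('a \<Rightarrow> complex) set"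
  for A B where
  products_mult: "f \<in> A \<Longrightarrow> g \<in> B \<Longrightarrow> (\<lambda>x. f x * g x) \<in> products A B"
| products_add: "f \<in> products A B \<Longrightarrow> g \<in> products A B \<Longrightarrow> (\<lambda>x. f x + g x) \<in> products A B"

lemma products_differentiable:
  assumes "f \<in> products A B" "\<And>f. f \<in> A \<Longrightarrow> smooth f" "\<And>f. f \<in> B \<Longrightarrow> smooth f"
  shows "f differentiable (at x)"
  using assms(1)
proof induction
  case (products_mult f g)
  then show ?case by (intro pd_mult(2) assms)
next
  case (products_add f g)
  then show ?case by (intro differentiable_add)
qed

lemma products_pd:
  assumes "f \<in> products A B" "\<And>f. f \<in> A \<Longrightarrow> smooth f" "\<And>f. f \<in> B \<Longrightarrow> smooth f"
    "\<And>f. f \<in> A \<Longrightarrow> pd b f \<in> A" "\<And>f. f \<in> B \<Longrightarrow> pd b f \<in> B"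
  shows "pd b f \<in> products A B"
  using assms(1)
proof induction
  case (products_mult f g)
  then show ?case
    unfolding pd_mult(1)[OF assms(2)[OF products_mult(1)] assms(3)[OF products_mult(2)]]
    by (intro products.intros assms)
next
  case (products_add f g)
  have "((\<lambda>x. f x + g x) has_derivative (\<lambda>h. frechet_derivative f (at x) h + frechet_derivative g (at x) h)) (at x)" for x
    by (intro derivative_intros)
       (use products_differentiable[OF _ assms(2,3)] products_add frechet_derivative_works in blast)+
  from pd_eqI[OF this, of b] have "pd b (\<lambda>x. f x + g x) = (\<lambda>x. pd b f x + pd b g x)" by (auto simp: pd_def fun_eq_iff)
  then show ?case using products_add by (auto intro: products.intros)
qed

lemma smooth_mult:
  fixes f :: "'a::euclidean_space \<Rightarrow> complex"
  assumes "smooth f" "smooth g" shows "smooth (\<lambda>x. f x * g x)"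
proof (rule smooth_coinduct[where A = "products (Collect smooth) (Collect smooth)"])
  show "(\<lambda>x. f x * g x) \<in> products (Collect smooth) (Collect smooth)" using assms by (auto intro: products.intros)
qed (auto simp: differentiable_on_def intro!: products_differentiable[where A = "Collect smooth" and B = "Collect smooth"]
      products_pd smooth_pd)

text \<open>The space usually written O_M. The order of growth may depend on the derivative.\<close>

definition multipliers :: "('a::euclidean_space \<Rightarrow> complex) set" where
  "multipliers = {f. smooth f \<and> (\<forall>bs. set bs \<subseteq> Basis \<longrightarrow> (\<exists>C k. \<forall>x. norm (partials bs f x) \<le> C * (1 + norm x) ^ k))}"

lemma multipliers_coinduct:
  assumes "f \<in> A" "\<And>f. f \<in> A \<Longrightarrow> f differentiable_on UNIV" "\<And>f b. f \<in> A \<Longrightarrow> b \<in> Basis \<Longrightarrow> pd b f \<in> A"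
    and "\<And>f. f \<in> A \<Longrightarrow> \<exists>C k. \<forall>x. norm (f x) \<le> C * (1 + norm x) ^ k"
  shows "f \<in> multipliers"
  using smooth_coinduct[OF assms(1-3)] partials_closed[OF assms(1,3)] assms(4) unfolding multipliers_def by blast

lemma multipliers_pd:
  fixes f :: "'a::euclidean_space \<Rightarrow> complex"
  shows "f \<in> multipliers \<Longrightarrow> b \<in> Basis \<Longrightarrow> pd b f \<in> multipliers"
  unfolding multipliers_def
proof (safe intro!: smooth_pd)
  fix bs :: "'a list" assume *: "\<forall>bs. set bs \<subseteq> Basis \<longrightarrow> (\<exists>C k. \<forall>x. norm (partials bs f x) \<le> C * (1 + norm x) ^ k)" "b \<in> Basis" "set bs \<subseteq> Basis"
  then have "\<exists>C k. \<forall>x. norm (partials (bs @ [b]) f x) \<le> C * (1 + norm x) ^ k" by (intro *(1)[rule_format]) auto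
  then show "\<exists>C k. \<forall>x. norm (partials bs (pd b f) x) \<le> C * (1 + norm x) ^ k" by (simp add: partials_append)
qed

lemma multipliers_growth:
  assumes "f \<in> multipliers" obtains C k where "0 \<le> C" "\<And>x. norm (f x) \<le> C * (1 + norm x) ^ k"
proof -
  have "\<exists>C k. \<forall>x. norm (partials [] f x) \<le> C * (1 + norm x) ^ k"
    using assms unfolding multipliers_def mem_Collect_eq by (elim conjE allE[of _ "[]"]) simp
  then obtain C k where C: "\<And>x. norm (f x) \<le> C * (1 + norm x) ^ k" by auto
  have "0 \<le> C" using order_trans[OF norm_ge_zero C[of 0]] by simp
  then show ?thesis using C that by blast
qed

lemma schwartz_mult:
  fixes f :: "'a::euclidean_space \<Rightarrow> complex"
  assumes "f \<in> multipliers" "g \<in> schwartz_space" shows "(\<lambda>x. f x * g x) \<in> schwartz_space"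
proof (rule schwartz_coinduct[where A = "products multipliers schwartz_space"])
  show "(\<lambda>x. f x * g x) \<in> products multipliers schwartz_space" using assms by (auto intro: products.intros)
next
  fix f :: "'a \<Rightarrow> complex" and k assume "f \<in> products multipliers schwartz_space"
  then show "\<exists>C. \<forall>x. norm (f x) \<le> C * decay k x"
  proof induction
    case (products_mult f g)
    obtain C m where C: "0 \<le> C" "\<And>x. norm (f x) \<le> C * (1 + norm x) ^ m" using multipliers_growth[OF products_mult(1)] by blast
    \<comment> \<open>Decay of order m + k outweighs the growth of order m and leaves order
      k.\<close>
    obtain D where D: "0 < D" "\<And>x. norm (g x) \<le> D * decay (m + k) x" using schwartz_decay[OF products_mult(2)] by metis
    have "norm (f x * g x) \<le> C * D * decay k x" for x
    proof -
      have "norm (f x * g x) \<le> (C * (1 + norm x) ^ m) * (D * decay (m + k) x)"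
        unfolding norm_mult using C D by (intro mult_mono) auto
      also have "\<dots> = C * D * decay k x" by (simp add: decay_cancel[symmetric, of k x m])
      finally show ?thesis .
    qed
    then show ?case by blast
  next
    case (products_add f g)
    then obtain C D where C: "\<And>x. norm (f x) \<le> C * decay k x" and D: "\<And>x. norm (g x) \<le> D * decay k x" by auto
    have "norm (f x + g x) \<le> (C + D) * decay k x" for x
      using norm_triangle_ineq[of "f x" "g x"] C[of x] D[of x] by (simp add: algebra_simps)
    then show ?case by blast
  qed
qed (auto simp: differentiable_on_def multipliers_def[THEN eqset_imp_iff] schwartz_smooth
   intro!: products_differentiable[where A = multipliers and B = schwartz_space] products_pd multipliers_pd schwartz_pd)

lemma schwartz_multiplier:
  fixes f :: "'a::euclidean_space \<Rightarrow> complex"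
  shows "f \<in> schwartz_space \<Longrightarrow> f \<in> multipliers"
proof (erule multipliers_coinduct)
  fix f :: "'a \<Rightarrow> complex" assume f: "f \<in> schwartz_space"
  obtain C where "\<And>x. norm (f x) \<le> C * decay 0 x" using schwartz_decay[OF f] by metis
  then show "\<exists>C k. \<forall>x. norm (f x) \<le> C * (1 + norm x) ^ k"
    by (intro exI[of _ C] exI[of _ 0]) (simp add: decay_def)
qed (auto simp: differentiable_on_def intro!: smooth_differentiable schwartz_smooth schwartz_pd)

lemma schwartz_times: "f \<in> schwartz_space \<Longrightarrow> g \<in> schwartz_space \<Longrightarrow> (\<lambda>x. f x * g x) \<in> schwartz_space"
  by (intro schwartz_mult schwartz_multiplier)

section \<open>Characters, linear functions and test functions\<close>

definition character :: "'a::euclidean_space \<Rightarrow> 'a \<Rightarrow> complex" where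
  "character \<xi> t = exp (- \<i> * complex_of_real (t \<bullet> \<xi>))"

lemma norm_character [simp]: "norm (character \<xi> t) = 1"
  by (simp add: character_def norm_exp_eq_Re)

lemma character_measurable [measurable]:
  "(\<lambda>(\<xi>, t). character \<xi> t) \<in> borel_measurable (borel \<Otimes>\<^sub>M borel)"
  "character \<xi> \<in> borel_measurable borel"
  unfolding character_def by measurable

lemma character_diff: "character \<xi> (s - t) = character \<xi> s * character (- \<xi>) t"
  by (simp add: character_def exp_add[symmetric] inner_diff_left algebra_simps)

lemma character_add: "character (\<xi> + \<eta>) t = character \<xi> t * character \<eta> t"
  by (simp add: character_def exp_add[symmetric] inner_add_right algebra_simps)

lemma pd_character:
  "pd b (\<lambda>t. a * character \<xi> t) = (\<lambda>t. (- \<i> * of_real (b \<bullet> \<xi>) * a) * character \<xi> t)"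
  "(\<lambda>t. a * character \<xi> t) differentiable (at t)"
proof -
  have d: "((\<lambda>t. a * character \<xi> t) has_derivative (\<lambda>h. a * (character \<xi> t * (- \<i> * of_real (h \<bullet> \<xi>))))) (at t)" for t
  proof -
    have lin: "((\<lambda>t. - \<i> * complex_of_real (t \<bullet> \<xi>)) has_derivative (\<lambda>h. - \<i> * of_real (h \<bullet> \<xi>))) (at t)"
      by (auto intro!: derivative_eq_intros)
    have e: "(exp has_derivative (*) (exp (- \<i> * complex_of_real (t \<bullet> \<xi>)))) (at (- \<i> * complex_of_real (t \<bullet> \<xi>)))"
      using DERIV_exp unfolding has_field_derivative_def by blast
    show ?thesis
      unfolding character_def by (intro has_derivative_mult_right has_derivative_compose[OF lin e])
  qed
  from pd_eqI[OF this, of b] show "pd b (\<lambda>t. a * character \<xi> t) = (\<lambda>t. (- \<i> * of_real (b \<bullet> \<xi>) * a) * character \<xi> t)"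
    by (auto simp: fun_eq_iff)
  show "(\<lambda>t. a * character \<xi> t) differentiable (at t)" using d differentiable_def by blast
qed

lemma multipliers_character: fixes \<xi> :: "'a::euclidean_space" shows "character \<xi> \<in> multipliers"
proof (rule multipliers_coinduct[where A = "{\<lambda>t. a * character \<xi> t | a. True}"])
  show "character \<xi> \<in> {\<lambda>t. a * character \<xi> t | a. True}" by (auto intro!: exI[of _ 1])
next
  fix f :: "'a \<Rightarrow> complex" assume "f \<in> {\<lambda>t. a * character \<xi> t | a. True}"
  then obtain a where f: "f = (\<lambda>t. a * character \<xi> t)" by auto
  then show "\<exists>C k. \<forall>x. norm (f x) \<le> C * (1 + norm x) ^ k"
    by (intro exI[of _ "norm a"] exI[of _ 0]) (simp add: norm_mult)
  show "f differentiable_on UNIV" unfolding f differentiable_on_def by (rule ballI, rule differentiable_at_withinI, rule pd_character(2))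
  fix b :: 'a show "pd b f \<in> {\<lambda>t. a * character \<xi> t | a. True}" unfolding f pd_character by blast
qed

text \<open>Every derivative multiplies the character by - i (b \<bullet> \<xi>). This is the source
  of the polynomial growth in \<xi> of short-time Fourier transforms.\<close>

lemma norm_partials_character:
  assumes "set bs \<subseteq> Basis" "length bs \<le> N"
  shows "norm (partials bs (character \<xi>) t) \<le> (1 + norm \<xi>) ^ N"
proof -
  have "\<exists>a. norm a \<le> (1 + norm \<xi>) ^ length bs \<and> partials bs (character \<xi>) = (\<lambda>t. a * character \<xi> t)"
    using assms(1)
  proof (induction bs)
    case Nil
    show ?case by (intro exI[of _ 1]) auto
  next
    case (Cons b bs)
    then obtain a where a: "norm a \<le> (1 + norm \<xi>) ^ length bs" "partials bs (character \<xi>) = (\<lambda>t. a * character \<xi> t)" by auto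
    have "norm (- \<i> * of_real (b \<bullet> \<xi>) * a) \<le> (1 + norm \<xi>) * (1 + norm \<xi>) ^ length bs"
      unfolding norm_mult using a(1) Basis_le_norm[of b \<xi>] Cons.prems
      by (intro mult_mono) (auto simp: norm_mult inner_commute)
    then show ?case
      by (intro exI[of _ "- \<i> * of_real (b \<bullet> \<xi>) * a"]) (simp add: a(2) pd_character(1) del: mult_minus_left)
  qed
  then obtain a where "norm a \<le> (1 + norm \<xi>) ^ length bs" "partials bs (character \<xi>) = (\<lambda>t. a * character \<xi> t)" by auto
  then show ?thesis using power_increasing[OF assms(2), of "1 + norm \<xi>"] by (simp add: norm_mult)
qed

lemma multipliers_linear: fixes v :: "'a::euclidean_space" shows "(\<lambda>t. of_real (t \<bullet> v)) \<in> multipliers"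
proof (rule multipliers_coinduct[where A = "{\<lambda>t. a * of_real (t \<bullet> v) + c | a c. True}"])
  show "(\<lambda>t. of_real (t \<bullet> v)) \<in> {\<lambda>t. a * of_real (t \<bullet> v) + c | a c. True}"
    by (rule CollectI, rule exI[of _ 1], rule exI[of _ 0]) simp
next
  fix f :: "'a \<Rightarrow> complex" assume "f \<in> {\<lambda>t. a * of_real (t \<bullet> v) + c | a c. True}"
  then obtain a c where f: "f = (\<lambda>t. a * of_real (t \<bullet> v) + c)" by auto
  have d: "(f has_derivative (\<lambda>h. a * of_real (h \<bullet> v))) (at t)" for t
    unfolding f by (auto intro!: derivative_eq_intros)
  then show "f differentiable_on UNIV" by (auto simp: differentiable_on_def differentiable_def)
  show "pd b f \<in> {\<lambda>t. a * of_real (t \<bullet> v) + c | a c. True}" for b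
    by (rule CollectI, rule exI[of _ 0], rule exI[of _ "a * of_real (b \<bullet> v)"]) (simp add: fun_eq_iff pd_eqI[OF d])
  have "norm (f x) \<le> (norm a * norm v + norm c) * (1 + norm x) ^ 1" for x
  proof -
    have "norm (f x) \<le> norm a * \<bar>x \<bullet> v\<bar> + norm c"
      unfolding f using norm_triangle_ineq[of "a * of_real (x \<bullet> v)" c] by (simp add: norm_mult)
    also have "\<dots> \<le> norm a * (norm x * norm v) + norm c"
      by (intro add_mono mult_left_mono Cauchy_Schwarz_ineq2) auto
    also have "\<dots> \<le> (norm a * norm v + norm c) * (1 + norm x) ^ 1"
      by (simp add: algebra_simps)
    finally show ?thesis .
  qed
  then show "\<exists>C k. \<forall>x. norm (f x) \<le> C * (1 + norm x) ^ k" by blast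
qed

lemma test_functions_schwartz:
  fixes f :: "'a::euclidean_space \<Rightarrow> complex"
  assumes "f \<in> test_functions" shows "f \<in> schwartz_space"
\<comment> \<open>Vanishing outside a compact K passes to derivatives with the same K, since the
  complement of K is open.\<close>
proof (rule schwartz_coinduct[where A = "{f. smooth f \<and> (\<exists>K. compact K \<and> (\<forall>x. x \<notin> K \<longrightarrow> f x = 0))}"])
  show "f \<in> {f. smooth f \<and> (\<exists>K. compact K \<and> (\<forall>x. x \<notin> K \<longrightarrow> f x = 0))}"
    using assms closure_subset[of "{x. f x \<noteq> 0}"]
    by (auto simp: test_functions_def intro!: exI[of _ "closure {x. f x \<noteq> 0}"])
next
  fix f :: "'a \<Rightarrow> complex" and b :: 'a assume "f \<in> {f. smooth f \<and> (\<exists>K. compact K \<and> (\<forall>x. x \<notin> K \<longrightarrow> f x = 0))}" "b \<in> Basis"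
  then obtain K where K: "smooth f" "compact K" "\<And>x. x \<notin> K \<Longrightarrow> f x = 0" by auto
  have "pd b f x = 0" if "x \<notin> K" for x
  proof -
    have "(f has_derivative (\<lambda>h. 0)) (at x)"
      by (rule has_derivative_transform_within_open[where s = "- K" and f = "\<lambda>x. 0"])
         (use K that compact_imp_closed in auto)
    then show ?thesis by (rule pd_eqI)
  qed
  then show "pd b f \<in> {f. smooth f \<and> (\<exists>K. compact K \<and> (\<forall>x. x \<notin> K \<longrightarrow> f x = 0))}"
    using K \<open>b \<in> Basis\<close> smooth_pd by blast
next
  fix f :: "'a \<Rightarrow> complex" and k assume "f \<in> {f. smooth f \<and> (\<exists>K. compact K \<and> (\<forall>x. x \<notin> K \<longrightarrow> f x = 0))}"
  then obtain K where K: "smooth f" "compact K" "\<And>x. x \<notin> K \<Longrightarrow> f x = 0" by auto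
  have "compact ((\<lambda>x. (1 + norm x) ^ k *\<^sub>R f x) ` K)"
    using K by (intro compact_continuous_image continuous_intros smooth_continuous)
  then have "bounded ((\<lambda>x. (1 + norm x) ^ k *\<^sub>R f x) ` K)" by (rule compact_imp_bounded)
  then obtain C where C: "0 < C" "\<And>x. x \<in> K \<Longrightarrow> norm ((1 + norm x) ^ k *\<^sub>R f x) \<le> C"
    unfolding bounded_pos by (auto simp del: norm_scaleR)
  have "norm (f x) \<le> C * decay k x" for x
  proof (cases "x \<in> K")
    case True
    have "0 < 1 + norm x" by (simp add: add_pos_nonneg)
    then show ?thesis using C(2)[OF True] by (simp add: decay_def field_simps)
  qed (use K C in auto)
  then show "\<exists>C. \<forall>x. norm (f x) \<le> C * decay k x" by blast
qed (auto simp: differentiable_on_def intro!: smooth_differentiable)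

section \<open>The norms of the Schwartz space and Taylor estimates\<close>

lemma bdd_above_schwartz_norm:
  fixes f :: "'a::euclidean_space \<Rightarrow> complex"
  assumes "f \<in> schwartz_space"
  shows "bdd_above ((\<lambda>(x, bs). (1 + norm x) ^ N * norm (partials bs f x)) ` (UNIV \<times> {bs. set bs \<subseteq> Basis \<and> length bs \<le> N}))"
proof -
  \<comment> \<open>The supremum runs over all points but only finitely many lists of directions, so
    the bounds for the single lists can be added. Boundedness is what gives the real supremum in
    \<open>schwartz_norm\<close> its meaning.\<close>
  have fin: "finite {bs. set bs \<subseteq> (Basis :: 'a set) \<and> length bs \<le> N}"
    by (rule finite_lists_length_le) simp
  have "\<exists>C. \<forall>x. (1 + norm x) ^ N * norm (partials bs f x) \<le> C" if "set bs \<subseteq> Basis" for bs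
  proof -
    have "bounded (range (\<lambda>x. (1 + norm x) ^ N *\<^sub>R partials bs f x))"
      using assms that unfolding schwartz_space_def by blast
    then show ?thesis by (auto simp: bounded_iff add_nonneg_nonneg)
  qed
  then obtain C where C: "\<And>bs x. set bs \<subseteq> Basis \<Longrightarrow> (1 + norm x) ^ N * norm (partials bs f x) \<le> C bs" by metis
  show ?thesis
  proof (rule bdd_aboveI2)
    fix z :: "'a \<times> 'a list" assume z: "z \<in> UNIV \<times> {bs. set bs \<subseteq> Basis \<and> length bs \<le> N}"
    obtain x bs where zz: "z = (x, bs)" by (cases z)
    have "(1 + norm x) ^ N * norm (partials bs f x) \<le> C bs" using z zz C by auto
    also have "\<dots> \<le> (\<Sum>bs\<in>{bs. set bs \<subseteq> (Basis :: 'a set) \<and> length bs \<le> N}. \<bar>C bs\<bar>)"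
      by (rule order_trans[OF abs_ge_self], rule member_le_sum) (use z zz fin in auto)
    finally show "(case z of (x, bs) \<Rightarrow> (1 + norm x) ^ N * norm (partials bs f x))
       \<le> (\<Sum>bs\<in>{bs. set bs \<subseteq> (Basis :: 'a set) \<and> length bs \<le> N}. \<bar>C bs\<bar>)" by (simp add: zz)
  qed
qed

lemma schwartz_norm_upper:
  assumes "f \<in> schwartz_space" "set bs \<subseteq> Basis" "length bs \<le> N"
  shows "norm (partials bs f x) \<le> schwartz_norm N f * decay N x"
proof -
  have "(case (x, bs) of (x, bs) \<Rightarrow> (1 + norm x) ^ N * norm (partials bs f x)) \<le> schwartz_norm N f"
    unfolding schwartz_norm_def using assms by (intro cSUP_upper bdd_above_schwartz_norm) auto
  moreover have "0 < (1 + norm x) ^ N" by (simp add: add_pos_nonneg)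
  ultimately show ?thesis by (simp add: decay_def field_simps)
qed

lemma schwartz_norm_least:
  assumes "\<And>x bs. set bs \<subseteq> Basis \<Longrightarrow> length bs \<le> N \<Longrightarrow> norm (partials bs f x) \<le> C * decay N x"
  shows "schwartz_norm N f \<le> C"
  unfolding schwartz_norm_def
proof (rule cSUP_least)
  show "UNIV \<times> {bs. set bs \<subseteq> Basis \<and> length bs \<le> N} \<noteq> {}" by (auto intro!: exI[of _ "[]"])
  fix z :: "'a \<times> 'a list" assume z: "z \<in> UNIV \<times> {bs. set bs \<subseteq> Basis \<and> length bs \<le> N}"
  obtain x bs where zz: "z = (x, bs)" by (cases z)
  have "norm (partials bs f x) \<le> C * decay N x" using assms z zz by auto
  moreover have "0 < (1 + norm x) ^ N" by (simp add: add_pos_nonneg)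
  ultimately show "(case z of (x, bs) \<Rightarrow> (1 + norm x) ^ N * norm (partials bs f x)) \<le> C"
    by (simp add: zz decay_def field_simps)
qed

lemma schwartz_norm_nonneg: "f \<in> schwartz_space \<Longrightarrow> 0 \<le> schwartz_norm N f"
  using order_trans[OF norm_ge_zero schwartz_norm_upper[of f "[]" N 0]] by (simp add: decay_def)

lemma schwartz_partials_decay:
  fixes f :: "'a::euclidean_space \<Rightarrow> complex"
  assumes "f \<in> schwartz_space"
  obtains C where "0 < C" "\<And>bs x. set bs \<subseteq> Basis \<Longrightarrow> length bs \<le> m \<Longrightarrow> norm (partials bs f x) \<le> C * decay k x"
proof
  let ?N = "max m k"
  show "0 < schwartz_norm ?N f + 1" using schwartz_norm_nonneg[OF assms, of ?N] by linarith
  fix bs :: "'a list" and x assume "set bs \<subseteq> Basis" "length bs \<le> m"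
  then have "norm (partials bs f x) \<le> schwartz_norm ?N f * decay ?N x"
    by (intro schwartz_norm_upper[OF assms]) auto
  also have "\<dots> \<le> (schwartz_norm ?N f + 1) * decay k x"
    using schwartz_norm_nonneg[OF assms, of ?N] by (intro mult_mono decay_mono) auto
  finally show "norm (partials bs f x) \<le> (schwartz_norm ?N f + 1) * decay k x" .
qed

lemma decay_add_le: "norm w \<le> norm h \<Longrightarrow> decay k (x + w) \<le> (1 + norm h) ^ k * decay k x"
  by (rule order_trans[OF decay_peetre[of k x w] mult_right_mono]) (auto intro!: power_mono)

text \<open>The mean value inequality on the segment from x to x + h; the decay of the gradient at
  an intermediate point is compared with the decay at x at the price (1 + |h|)^k.\<close>

lemma schwartz_lipschitz:
  fixes f :: "'a::euclidean_space \<Rightarrow> complex"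
  assumes f: "f \<in> schwartz_space"
  obtains C where "0 < C" "\<And>x h. norm (f (x + h) - f x) \<le> C * norm h * (1 + norm h) ^ k * decay k x"
proof -
  obtain C where C: "0 < C" "\<And>bs x. set bs \<subseteq> Basis \<Longrightarrow> length bs \<le> 1 \<Longrightarrow> norm (partials bs f x) \<le> C * decay k x"
    by (rule schwartz_partials_decay[OF f, where m = 1 and k = k]) blast
  have "norm (f (x + h) - f x) \<le> (C * DIM('a)) * norm h * (1 + norm h) ^ k * decay k x" for x h
  proof -
    have "norm (f (x + h) - f x) \<le> (C * DIM('a)) * ((1 + norm h) ^ k * decay k x) * norm ((x + h) - x)"
    proof (rule differentiable_bound[of "closed_segment x (x + h)" f "\<lambda>s h. \<Sum>b\<in>Basis. (h \<bullet> b) *\<^sub>R pd b f s"])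
      fix s assume s: "s \<in> closed_segment x (x + h)"
      show "(f has_derivative (\<lambda>h. \<Sum>b\<in>Basis. (h \<bullet> b) *\<^sub>R pd b f s)) (at s within closed_segment x (x + h))"
        by (rule has_derivative_at_withinI, rule smooth_has_derivative, rule schwartz_smooth[OF f])
      obtain u where u: "0 \<le> u" "u \<le> 1" "s = x + u *\<^sub>R h"
        using s by (auto simp: in_segment algebra_simps)
      have "norm (u *\<^sub>R h) \<le> norm h" using u by (simp add: mult_left_le_one_le)
      then have d: "decay k s \<le> (1 + norm h) ^ k * decay k x" unfolding u(3) by (rule decay_add_le)
      have "onorm (\<lambda>h. \<Sum>b\<in>Basis. (h \<bullet> b) *\<^sub>R pd b f s) \<le> (\<Sum>b\<in>(Basis::'a set). norm (pd b f s))"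
        by (rule onorm_pd_sum_le)
      also have "\<dots> \<le> (\<Sum>b\<in>(Basis::'a set). C * ((1 + norm h) ^ k * decay k x))"
      proof (rule sum_mono)
        fix b :: 'a assume "b \<in> Basis"
        then have "norm (pd b f s) \<le> C * decay k s" using C(2)[of "[b]" s] by simp
        also have "\<dots> \<le> C * ((1 + norm h) ^ k * decay k x)" using C(1) d by (intro mult_left_mono) auto
        finally show "norm (pd b f s) \<le> C * ((1 + norm h) ^ k * decay k x)" .
      qed
      finally show "onorm (\<lambda>h. \<Sum>b\<in>Basis. (h \<bullet> b) *\<^sub>R pd b f s) \<le> C * real DIM('a) * ((1 + norm h) ^ k * decay k x)"
        by (simp add: mult_ac)
    qed auto
    then show ?thesis by (simp add: mult_ac)
  qed
  then show ?thesis using C(1) by (intro that[of "C * DIM('a)"]) auto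
qed

text \<open>The Lipschitz bound for the first derivatives controls the linearisation error. The
  decay in x is kept so that the error can be integrated over the whole space.\<close>

lemma schwartz_taylor:
  fixes f :: "'a::euclidean_space \<Rightarrow> complex"
  assumes f: "f \<in> schwartz_space"
  obtains C where "0 < C"
    "\<And>x h. norm (f (x + h) - f x - (\<Sum>b\<in>Basis. (h \<bullet> b) *\<^sub>R pd b f x)) \<le> C * (norm h)\<^sup>2 * (1 + norm h) ^ k * decay k x"
proof -
  have "\<exists>C>0. \<forall>x h. norm (pd b f (x + h) - pd b f x) \<le> C * norm h * (1 + norm h) ^ k * decay k x" if "b \<in> Basis" for b
    by (rule schwartz_lipschitz[OF schwartz_pd[OF f that], where k = k]) blast
  then obtain C where C: "\<And>b x h. b \<in> Basis \<Longrightarrow> 0 < C b" "\<And>b x h. b \<in> Basis \<Longrightarrow> norm (pd b f (x + h) - pd b f x) \<le> C b * norm h * (1 + norm h) ^ k * decay k x"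
    by metis
  define D where "D = (\<Sum>b\<in>(Basis::'a set). C b)"
  have "norm (f (x + h) - f x - (\<Sum>b\<in>Basis. (h \<bullet> b) *\<^sub>R pd b f x)) \<le> D * (norm h)\<^sup>2 * (1 + norm h) ^ k * decay k x" for x h
  proof -
    have "norm (f (x + h) - f x - (\<Sum>b\<in>Basis. (((x + h) - x) \<bullet> b) *\<^sub>R pd b f x)) \<le> norm ((x + h) - x) * (D * norm h * (1 + norm h) ^ k * decay k x)"
    proof (rule differentiable_bound_linearization[where S = "closed_segment x (x + h)" and f' = "\<lambda>s h. \<Sum>b\<in>Basis. (h \<bullet> b) *\<^sub>R pd b f s"])
      fix t :: real assume "t \<in> {0..1}"
      then show "x + t *\<^sub>R ((x + h) - x) \<in> closed_segment x (x + h)"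
        by (auto simp: in_segment algebra_simps intro!: exI[of _ t])
    next
      fix s
      show "(f has_derivative (\<lambda>h. \<Sum>b\<in>Basis. (h \<bullet> b) *\<^sub>R pd b f s)) (at s within closed_segment x (x + h))"
        by (rule has_derivative_at_withinI, rule smooth_has_derivative, rule schwartz_smooth[OF f])
      assume s: "s \<in> closed_segment x (x + h)"
      obtain u where u: "0 \<le> u" "u \<le> 1" "s = x + u *\<^sub>R h"
        using s by (auto simp: in_segment algebra_simps)
      have uh: "norm (u *\<^sub>R h) \<le> norm h" using u by (simp add: mult_left_le_one_le)
      have "((\<lambda>h. \<Sum>b\<in>Basis. (h \<bullet> b) *\<^sub>R pd b f s) - (\<lambda>h. \<Sum>b\<in>Basis. (h \<bullet> b) *\<^sub>R pd b f x))
          = (\<lambda>h. \<Sum>b\<in>Basis. (h \<bullet> b) *\<^sub>R (pd b f s - pd b f x))"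
        by (simp add: fun_eq_iff sum_subtractf scaleR_diff_right)
      then have "onorm ((\<lambda>h. \<Sum>b\<in>Basis. (h \<bullet> b) *\<^sub>R pd b f s) - (\<lambda>h. \<Sum>b\<in>Basis. (h \<bullet> b) *\<^sub>R pd b f x))
        \<le> (\<Sum>b\<in>(Basis::'a set). norm (pd b f s - pd b f x))"
        by (simp only: onorm_pd_sum_le)
      also have "\<dots> \<le> (\<Sum>b\<in>(Basis::'a set). C b * norm h * (1 + norm h) ^ k * decay k x)"
      proof (rule sum_mono)
        fix b :: 'a assume b: "b \<in> Basis"
        have "norm (pd b f s - pd b f x) \<le> C b * norm (u *\<^sub>R h) * (1 + norm (u *\<^sub>R h)) ^ k * decay k x"
          unfolding u(3) by (rule C(2)[OF b])
        also have "\<dots> \<le> C b * norm h * (1 + norm h) ^ k * decay k x"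
          using C(1)[OF b] uh by (intro mult_mono power_mono mult_nonneg_nonneg) auto
        finally show "norm (pd b f s - pd b f x) \<le> C b * norm h * (1 + norm h) ^ k * decay k x" .
      qed
      also have "\<dots> = D * norm h * (1 + norm h) ^ k * decay k x" by (simp add: D_def sum_distrib_right)
      finally show "onorm ((\<lambda>h. \<Sum>b\<in>Basis. (h \<bullet> b) *\<^sub>R pd b f s) - (\<lambda>h. \<Sum>b\<in>Basis. (h \<bullet> b) *\<^sub>R pd b f x))
         \<le> D * norm h * (1 + norm h) ^ k * decay k x" .
    qed simp
    then show ?thesis by (simp add: power2_eq_square mult_ac)
  qed
  moreover have "0 < D" unfolding D_def using C(1) by (intro sum_pos) auto
  ultimately show ?thesis using that by blast
qed

section \<open>Lebesgue integrals and convolution\<close>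

lemma lborel_integral_affine:
  fixes f :: "'a::euclidean_space \<Rightarrow> 'b::{banach, second_countable_topology}"
  assumes [measurable]: "f \<in> borel_measurable borel" and c: "c \<noteq> 0"
  shows "(\<integral>x. f x \<partial>lborel) = (\<bar>c\<bar> ^ DIM('a)) *\<^sub>R (\<integral>x. f (t + c *\<^sub>R x) \<partial>lborel)"
  by (subst lborel_affine[OF c, of t]) (simp add: integral_density integral_distr)

lemma lborel_integrable_affine:
  fixes f :: "'a::euclidean_space \<Rightarrow> 'b::{banach, second_countable_topology}"
  assumes "integrable lborel f" and c: "c \<noteq> 0"
  shows "integrable lborel (\<lambda>x. f (t + c *\<^sub>R x))"
proof -
  have [measurable]: "f \<in> borel_measurable borel" using assms(1) by auto
  have "integrable (density (distr lborel borel (\<lambda>x. t + c *\<^sub>R x)) (\<lambda>_. ennreal (\<bar>c\<bar> ^ DIM('a)))) f"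
    using assms(1) lborel_affine[OF c, of t] by simp
  then have "integrable lborel (\<lambda>x. (\<bar>c\<bar> ^ DIM('a)) *\<^sub>R f (t + c *\<^sub>R x))"
    by (subst (asm) integrable_density) (auto simp: integrable_distr_eq)
  then have "integrable lborel (\<lambda>x. (1 / \<bar>c\<bar> ^ DIM('a)) *\<^sub>R ((\<bar>c\<bar> ^ DIM('a)) *\<^sub>R f (t + c *\<^sub>R x)))"
    by (rule integrable_scaleR_right)
  then show ?thesis using c by simp
qed

lemma lborel_integral_shift:
  fixes f :: "'a::euclidean_space \<Rightarrow> 'b::{banach, second_countable_topology}"
  assumes "f \<in> borel_measurable borel"
  shows "(\<integral>x. f (x + c) \<partial>lborel) = (\<integral>x. f x \<partial>lborel)"
    "(\<integral>x. f (x - c) \<partial>lborel) = (\<integral>x. f x \<partial>lborel)"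
    "(\<integral>x. f (c - x) \<partial>lborel) = (\<integral>x. f x \<partial>lborel)"
  using lborel_integral_affine[OF assms, of 1 c, symmetric] lborel_integral_affine[OF assms, of 1 "- c", symmetric]
    lborel_integral_affine[OF assms, of "-1" c, symmetric] by (simp_all add: add.commute)

lemma lborel_integrable_shift:
  fixes f :: "'a::euclidean_space \<Rightarrow> 'b::{banach, second_countable_topology}"
  assumes "integrable lborel f"
  shows "integrable lborel (\<lambda>x. f (x + c))" "integrable lborel (\<lambda>x. f (x - c))" "integrable lborel (\<lambda>x. f (c - x))"
  using lborel_integrable_affine[OF assms, of 1 c] lborel_integrable_affine[OF assms, of 1 "- c"]
    lborel_integrable_affine[OF assms, of "-1" c] by (simp_all add: add.commute)

lemma has_derivative_quadratic:
  assumes "bounded_linear D" "\<And>h. norm (f (x + h) - f x - D h) \<le> C * (norm h)\<^sup>2"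
  shows "(f has_derivative D) (at x)"
  unfolding has_derivative_at
proof (intro conjI assms(1))
  have lim: "((\<lambda>h. C * norm h) \<longlongrightarrow> 0) (at 0)" by (auto intro!: tendsto_eq_intros)
  have bd: "norm (f (x + h) - f x - D h) / norm h \<le> C * norm h" for h
    using assms(2)[of h] by (cases "h = 0") (auto simp: power2_eq_square field_simps)
  show "((\<lambda>h. norm (f (x + h) - f x - D h) / norm h) \<longlongrightarrow> 0) (at 0)"
    by (rule tendsto_sandwich[OF _ _ tendsto_const lim]) (auto intro!: always_eventually bd)
qed

text \<open>If f fails to be integrable, its Bochner integral is 0 by convention, and the bound
  persists because g is nonnegative.\<close>

lemma norm_integral_le:
  fixes f :: "'a \<Rightarrow> 'b::{banach, second_countable_topology}"
  assumes "integrable M g" "\<And>x. norm (f x) \<le> g x"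
  shows "norm (\<integral>x. f x \<partial>M) \<le> (\<integral>x. g x \<partial>M)"
proof (cases "integrable M f")
  case True
  have "norm (\<integral>x. f x \<partial>M) \<le> (\<integral>x. norm (f x) \<partial>M)" by (rule integral_norm_bound)
  also have "\<dots> \<le> (\<integral>x. g x \<partial>M)" using True assms by (intro integral_mono) auto
  finally show ?thesis .
next
  case False
  have "0 \<le> (\<integral>x. g x \<partial>M)"
    using assms(2) order_trans[OF norm_ge_zero] by (intro integral_nonneg_AE AE_I2) blast
  then show ?thesis using False by (simp add: not_integrable_integral_eq)
qed

definition conv :: "('a::euclidean_space \<Rightarrow> complex) \<Rightarrow> ('a \<Rightarrow> complex) \<Rightarrow> 'a \<Rightarrow> complex" where
  "conv f g t = (\<integral>y. f y * g (t - y) \<partial>lborel)"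

lemma integrable_bounded_mult:
  fixes f g :: "'a \<Rightarrow> complex"
  assumes "integrable M f" "g \<in> borel_measurable M" "\<And>x. norm (g x) \<le> C"
  shows "integrable M (\<lambda>x. f x * g x)"
proof (rule Bochner_Integration.integrable_bound)
  show "integrable M (\<lambda>x. C * norm (f x))" using assms(1) by simp
  show "AE x in M. norm (f x * g x) \<le> norm (C * norm (f x))"
  proof (rule AE_I2)
    fix x have "norm (f x) * norm (g x) \<le> norm (f x) * C" by (intro mult_left_mono assms(3)) simp
    then show "norm (f x * g x) \<le> norm (C * norm (f x))"
      by (simp add: norm_mult mult.commute order_trans[OF _ abs_ge_self] del: abs_mult)
  qed
qed (use assms in measurable)

lemma schwartz_measurable_compose:
  assumes "f \<in> schwartz_space" "g \<in> borel_measurable M"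
  shows "(\<lambda>x. f (g x)) \<in> borel_measurable M"
  using measurable_compose[OF assms(2) schwartz_measurable[OF assms(1)]] by simp

lemma schwartz_bounded:
  assumes "f \<in> schwartz_space" obtains C where "0 < C" "\<And>x. norm (f x) \<le> C"
proof -
  obtain C where "0 < C" "\<And>x. norm (f x) \<le> C * decay 0 x" by (rule schwartz_decay[OF assms]) blast
  then show ?thesis using that by (simp add: decay_def)
qed

lemma integrable_conv:
  assumes "f \<in> schwartz_space" "g \<in> schwartz_space"
  shows "integrable lborel (\<lambda>y. f y * g (t - y))"
proof -
  obtain C where "\<And>x. norm (g x) \<le> C" by (rule schwartz_bounded[OF assms(2)]) blast
  then show ?thesis using assms by (intro integrable_bounded_mult schwartz_integrable schwartz_measurable_compose[OF assms(2)]) auto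
qed

lemma conv_commute:
  assumes "f \<in> schwartz_space" "g \<in> schwartz_space" shows "conv f g = conv g f"
proof
  fix t
  have "(\<integral>y. f (t - y) * g (t - (t - y)) \<partial>lborel) = conv f g t"
    unfolding conv_def
    by (rule lborel_integral_shift(3)[where f = "\<lambda>y. f y * g (t - y)"])
      (intro borel_measurable_times schwartz_measurable[OF assms(1)] schwartz_measurable_compose[OF assms(2)], auto)
  then show "conv f g t = conv g f t" by (simp add: conv_def mult.commute)
qed

lemma sum_Basis_delta:
  fixes F :: "'a::euclidean_space \<Rightarrow> 'b::real_vector"
  assumes "b \<in> Basis" shows "(\<Sum>c\<in>Basis. (b \<bullet> c) *\<^sub>R F c) = F b"
proof -
  have "(\<Sum>c\<in>Basis. (b \<bullet> c) *\<^sub>R F c) = (\<Sum>c\<in>Basis. if c = b then F c else 0)"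
    by (rule sum.cong) (use assms in \<open>auto simp: inner_Basis\<close>)
  then show ?thesis using assms by simp
qed

text \<open>Taylor's formula for g, with a remainder uniform in the base point, is integrated
  against f. The derivative falls on the second factor alone, so the convolutions with a fixed f
  form a set that is stable under \<open>pd\<close>.\<close>

lemma pd_conv:
  fixes f :: "'a::euclidean_space \<Rightarrow> complex"
  assumes f: "f \<in> schwartz_space" and g: "g \<in> schwartz_space"
  shows "conv f g differentiable (at t)" and "b \<in> Basis \<Longrightarrow> pd b (conv f g) = conv f (pd b g)"
proof -
  obtain C where C: "0 < C" "\<And>x h. norm (g (x + h) - g x - (\<Sum>b\<in>Basis. (h \<bullet> b) *\<^sub>R pd b g x)) \<le> C * (norm h)\<^sup>2 * (1 + norm h) ^ 0 * decay 0 x"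
    by (rule schwartz_taylor[OF g, where k = 0]) blast
  note [measurable] = f g
  note [simp] = integrable_conv[OF f g]
  have pdi [simp]: "integrable lborel (\<lambda>y. f y * pd b g (t - y))" if "b \<in> Basis" for b t
    by (rule integrable_conv[OF f schwartz_pd[OF g that]])
  have d: "(conv f g has_derivative (\<lambda>h. \<Sum>b\<in>Basis. (h \<bullet> b) *\<^sub>R conv f (pd b g) t)) (at t)" for t
  proof (rule has_derivative_quadratic)
    show "bounded_linear (\<lambda>h. \<Sum>b\<in>Basis. (h \<bullet> b) *\<^sub>R conv f (pd b g) t)"
      by (intro bounded_linear_sum bounded_linear_scaleR_const bounded_linear_inner_left)
    fix h
    have eq: "f y * (g (t - y + h) - g (t - y) - (\<Sum>b\<in>Basis. (h \<bullet> b) *\<^sub>R pd b g (t - y)))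
      = f y * g (t + h - y) - f y * g (t - y) - (\<Sum>b\<in>Basis. (h \<bullet> b) *\<^sub>R (f y * pd b g (t - y)))" for y
      by (simp add: algebra_simps sum_distrib_left)
    have "conv f g (t + h) - conv f g t - (\<Sum>b\<in>Basis. (h \<bullet> b) *\<^sub>R conv f (pd b g) t)
      = (\<integral>y. f y * (g (t - y + h) - g (t - y) - (\<Sum>b\<in>Basis. (h \<bullet> b) *\<^sub>R pd b g (t - y))) \<partial>lborel)"
      unfolding eq conv_def by (subst Bochner_Integration.integral_diff Bochner_Integration.integral_sum | simp)+
    also have "norm \<dots> \<le> (\<integral>y. norm (f y) * (C * (norm h)\<^sup>2) \<partial>lborel)"
    proof (rule norm_integral_le)
      show "integrable lborel (\<lambda>y. norm (f y) * (C * (norm h)\<^sup>2))"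
        using schwartz_integrable[OF f] by simp
      fix y show "norm (f y * (g (t - y + h) - g (t - y) - (\<Sum>b\<in>Basis. (h \<bullet> b) *\<^sub>R pd b g (t - y)))) \<le> norm (f y) * (C * (norm h)\<^sup>2)"
        unfolding norm_mult using C(2)[of "t - y" h] by (intro mult_left_mono) (auto simp: decay_def)
    qed
    finally show "norm (conv f g (t + h) - conv f g t - (\<Sum>b\<in>Basis. (h \<bullet> b) *\<^sub>R conv f (pd b g) t))
      \<le> ((\<integral>y. norm (f y) \<partial>lborel) * C) * (norm h)\<^sup>2"
      by (simp add: mult_ac)
  qed
  show "conv f g differentiable (at t)" using d differentiable_def by blast
  assume b: "b \<in> Basis"
  have "pd b (conv f g) t = conv f (pd b g) t" for t
    using pd_eqI[OF d, of b t] b by (simp add: sum_Basis_delta)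
  then show "pd b (conv f g) = conv f (pd b g)" by auto
qed

lemma decay_mult_le: "decay k y * decay k (t - y) \<le> decay k t"
proof -
  have "(1 + norm t) ^ k \<le> (1 + norm y) ^ k * (1 + norm (t - y)) ^ k"
    using one_plus_norm_power_add_le[of y "t - y" k] by simp
  moreover have "0 < (1 + norm t) ^ k" "0 < (1 + norm y) ^ k" "0 < (1 + norm (t - y)) ^ k" by (simp_all add: add_pos_nonneg)
  ultimately show ?thesis unfolding decay_def by (simp add: field_simps)
qed

lemma schwartz_conv:
  fixes f :: "'a::euclidean_space \<Rightarrow> complex"
  assumes "f \<in> schwartz_space" "g \<in> schwartz_space" shows "conv f g \<in> schwartz_space"
proof (rule schwartz_coinduct[where A = "{conv f g | g. g \<in> schwartz_space}"])
  fix h :: "'a \<Rightarrow> complex" assume "h \<in> {conv f g | g. g \<in> schwartz_space}"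
  then obtain g where h: "h = conv f g" and g: "g \<in> schwartz_space" by auto
  show "h differentiable_on UNIV" unfolding h differentiable_on_def
    by (rule ballI, rule differentiable_at_withinI, rule pd_conv[OF assms(1) g])
  show "pd b h \<in> {conv f g | g. g \<in> schwartz_space}" if "b \<in> Basis" for b
    unfolding h pd_conv(2)[OF assms(1) g that] using schwartz_pd[OF g that] by blast
  fix k
  let ?m = "Suc DIM('a)"
  \<comment> \<open>Of this decay, order k combines with that of g to give decay in t, and the rest
    makes the integral converge.\<close>
  obtain C where C: "0 < C" "\<And>x. norm (f x) \<le> C * decay (k + ?m) x" by (rule schwartz_decay[OF assms(1)]) blast
  obtain D where D: "0 < D" "\<And>x. norm (g x) \<le> D * decay k x" by (rule schwartz_decay[OF g]) blast
  have "norm (conv f g t) \<le> (C * D * (\<integral>y. decay ?m (y::'a) \<partial>lborel)) * decay k t" for t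
  proof -
    have "norm (conv f g t) \<le> (\<integral>y. (C * D * decay k t) * decay ?m (y::'a) \<partial>lborel)"
      unfolding conv_def
    proof (rule norm_integral_le)
      show "integrable lborel (\<lambda>y. (C * D * decay k t) * decay ?m (y::'a))"
        by (intro integrable_mult_right integrable_decay) simp
      fix y
      have "norm (f y * g (t - y)) \<le> (C * decay (k + ?m) y) * (D * decay k (t - y))"
        unfolding norm_mult using C D by (intro mult_mono) auto
      also have "\<dots> = C * D * (decay k y * decay k (t - y)) * decay ?m y" by (simp only: decay_add mult_ac)
      also have "\<dots> \<le> C * D * decay k t * decay ?m y"
        using C D by (intro mult_left_mono mult_right_mono decay_mult_le) auto
      finally show "norm (f y * g (t - y)) \<le> (C * D * decay k t) * decay ?m y" .
    qed
    then show ?thesis by (simp add: mult_ac)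
  qed
  then show "\<exists>C. \<forall>x. norm (h x) \<le> C * decay k x" unfolding h by blast
qed (use assms in auto)

lemma partials_conv:
  assumes "f \<in> schwartz_space" "g \<in> schwartz_space" "set bs \<subseteq> Basis"
  shows "partials bs (conv f g) = conv f (partials bs g)"
  using assms(3) by (induction bs) (simp_all add: pd_conv(2) assms schwartz_partials)

text \<open>The list is reduced from its last element, the derivative taken first, so that the
  induction hypothesis applies to the products of \<open>pd b f\<close> with g and of f with
  \<open>pd b g\<close>. Each step doubles the number of terms, whence the power of 2 instead of
  binomial coefficients.\<close>

lemma norm_partials_mult_le:
  assumes "smooth f" "smooth g" "set bs \<subseteq> Basis"
    "\<And>cs. set cs \<subseteq> Basis \<Longrightarrow> length cs \<le> length bs \<Longrightarrow> norm (partials cs f x) \<le> A"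
    "\<And>cs. set cs \<subseteq> Basis \<Longrightarrow> length cs \<le> length bs \<Longrightarrow> norm (partials cs g x) \<le> B"
  shows "norm (partials bs (\<lambda>x. f x * g x) x) \<le> 2 ^ length bs * (A * B)"
  using assms
proof (induction bs arbitrary: f g rule: rev_induct)
  case Nil
  then have "norm (f x) \<le> A" "norm (g x) \<le> B" using Nil.prems(4)[of "[]"] Nil.prems(5)[of "[]"] by auto
  moreover have "0 \<le> A" using norm_ge_zero order_trans calculation(1) by blast
  ultimately show ?case by (simp add: norm_mult mult_mono)
next
  case (snoc b bs)
  note sm = snoc.prems(1,2)
  have b: "b \<in> Basis" "set bs \<subseteq> Basis" using snoc.prems(3) by auto
  have pdf: "norm (partials cs (pd b f) x) \<le> A" if "set cs \<subseteq> Basis" "length cs \<le> length bs" for cs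
    using snoc.prems(4)[of "cs @ [b]"] that b by (simp add: partials_append)
  have pdg: "norm (partials cs (pd b g) x) \<le> B" if "set cs \<subseteq> Basis" "length cs \<le> length bs" for cs
    using snoc.prems(5)[of "cs @ [b]"] that b by (simp add: partials_append)
  have "partials (bs @ [b]) (\<lambda>x. f x * g x) x = partials bs (\<lambda>x. pd b f x * g x) x + partials bs (\<lambda>x. f x * pd b g x) x"
    using sm b by (simp add: partials_append pd_mult partials_add smooth_mult smooth_pd)
  also have "norm \<dots> \<le> 2 ^ length bs * (A * B) + 2 ^ length bs * (A * B)"
    using snoc.prems(4,5) pdf pdg b sm
    by (intro norm_triangle_mono snoc.IH smooth_pd) auto
  finally show ?case by (simp add: mult_ac)
qed

section \<open>Time-frequency shifts and translations in the Schwartz norms\<close>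

definition tf_shift :: "'a::euclidean_space \<Rightarrow> 'a \<Rightarrow> ('a \<Rightarrow> complex) \<Rightarrow> 'a \<Rightarrow> complex" where
  "tf_shift x \<xi> f = (\<lambda>t. f (t - x) * character \<xi> t)"

lemma schwartz_tf_shift: "f \<in> schwartz_space \<Longrightarrow> tf_shift x \<xi> f \<in> schwartz_space"
  unfolding tf_shift_def using schwartz_mult[OF multipliers_character schwartz_shift] by (simp add: mult.commute)

text \<open>This is why the short-time Fourier transform of a tempered distribution grows at most
  polynomially in both variables.\<close>

lemma schwartz_norm_tf_shift:
  assumes f: "f \<in> schwartz_space"
  obtains C where "0 < C" "\<And>x \<xi>. schwartz_norm N (tf_shift x \<xi> f) \<le> C * (1 + norm x) ^ N * (1 + norm \<xi>) ^ N"
proof -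
  obtain C where C: "0 < C" "\<And>bs x. set bs \<subseteq> Basis \<Longrightarrow> length bs \<le> N \<Longrightarrow> norm (partials bs f x) \<le> C * decay N x"
    by (rule schwartz_partials_decay[OF f, where m = N and k = N]) blast
  have "schwartz_norm N (tf_shift x \<xi> f) \<le> (2 ^ N * C) * (1 + norm x) ^ N * (1 + norm \<xi>) ^ N" for x \<xi>
  proof (rule schwartz_norm_least)
    fix t and bs :: "'a list" assume bs: "set bs \<subseteq> Basis" "length bs \<le> N"
    have sm: "smooth (\<lambda>t. f (t - x))" "smooth (character \<xi>)"
      using schwartz_smooth[OF schwartz_shift[OF f]] multipliers_character[of \<xi>] by (auto simp: multipliers_def)
    have "norm (partials bs (tf_shift x \<xi> f) t) \<le> 2 ^ length bs * ((C * ((1 + norm x) ^ N * decay N t)) * (1 + norm \<xi>) ^ N)"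
      unfolding tf_shift_def
    proof (rule norm_partials_mult_le[OF sm bs(1)])
      fix cs :: "'a list" assume cs: "set cs \<subseteq> Basis" "length cs \<le> length bs"
      show "norm (partials cs (character \<xi>) t) \<le> (1 + norm \<xi>) ^ N"
        using cs bs by (intro norm_partials_character) auto
      have "norm (partials cs (\<lambda>t. f (t - x)) t) = norm (partials cs f (t - x))"
        using partials_shift[OF schwartz_smooth[OF f] cs(1), of x] by simp
      also have "\<dots> \<le> C * decay N (t - x)" using C(2)[of cs "t - x"] cs bs by auto
      also have "\<dots> \<le> C * ((1 + norm x) ^ N * decay N t)"
        using decay_peetre[of N t "- x"] C(1) by (intro mult_left_mono) auto
      finally show "norm (partials cs (\<lambda>t. f (t - x)) t) \<le> C * ((1 + norm x) ^ N * decay N t)" .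
    qed
    also have "\<dots> \<le> 2 ^ N * ((C * ((1 + norm x) ^ N * decay N t)) * (1 + norm \<xi>) ^ N)"
      using C(1) bs by (intro mult_right_mono power_increasing mult_nonneg_nonneg) auto
    finally show "norm (partials bs (tf_shift x \<xi> f) t) \<le> (2 ^ N * C) * (1 + norm x) ^ N * (1 + norm \<xi>) ^ N * decay N t"
      by (simp add: mult_ac)
  qed
  then show ?thesis using C(1) by (intro that[of "2 ^ N * C"]) auto
qed

text \<open>The Lipschitz bound for each of the finitely many derivatives in the norm, with the
  constants added. It makes translation continuous into the Schwartz space and controls the Riemann
  sums of a convolution.\<close>

lemma schwartz_norm_shift_diff:
  fixes f :: "'a::euclidean_space \<Rightarrow> complex"
  assumes f: "f \<in> schwartz_space"
  obtains C where "0 < C" "\<And>v y. schwartz_norm N (\<lambda>t. f (t - v) - f (t - y)) \<le> C * norm (v - y) * (1 + norm (v - y)) ^ N * (1 + norm y) ^ N"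
proof -
  let ?L = "{bs. set bs \<subseteq> (Basis :: 'a set) \<and> length bs \<le> N}"
  have fin: "finite ?L" by (rule finite_lists_length_le) simp
  have "\<exists>C>0. \<forall>x h. norm (partials bs f (x + h) - partials bs f x) \<le> C * norm h * (1 + norm h) ^ N * decay N x" if "set bs \<subseteq> Basis" for bs
    by (rule schwartz_lipschitz[OF schwartz_partials[OF f that], where k = N]) blast
  then obtain C where C: "\<And>bs. set bs \<subseteq> Basis \<Longrightarrow> 0 < C bs" "\<And>bs x h. set bs \<subseteq> Basis \<Longrightarrow> norm (partials bs f (x + h) - partials bs f x) \<le> C bs * norm h * (1 + norm h) ^ N * decay N x"
    by metis
  define D where "D = (\<Sum>bs\<in>?L. C bs)"
  have CD: "C bs \<le> D" if "bs \<in> ?L" for bs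
    unfolding D_def using fin that C(1) by (intro member_le_sum) (auto intro: less_imp_le)
  have D: "0 < D" using CD[of "[]"] C(1)[of "[]"] by auto
  have "schwartz_norm N (\<lambda>t. f (t - v) - f (t - y)) \<le> D * norm (v - y) * (1 + norm (v - y)) ^ N * (1 + norm y) ^ N" for v y
  proof (rule schwartz_norm_least)
    fix t and bs :: "'a list" assume bs: "set bs \<subseteq> Basis" "length bs \<le> N"
    have sm: "smooth (\<lambda>t. f (t - y))" "smooth (\<lambda>t. f (t - v))" for y v
      using schwartz_smooth[OF schwartz_shift[OF f]] by auto
    have "partials bs (\<lambda>t. f (t - v) + (-1) * f (t - y)) t = partials bs f ((t - y) + (y - v)) - partials bs f (t - y)"
      using partials_add[OF sm(2) schwartz_smooth[OF schwartz_cmult[OF schwartz_shift[OF f]]] bs(1), of v "-1" y]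
        partials_cmult[OF sm(1) bs(1), of "-1" y] partials_shift[OF schwartz_smooth[OF f] bs(1)] by simp
    then have "norm (partials bs (\<lambda>t. f (t - v) - f (t - y)) t) \<le> C bs * norm (y - v) * (1 + norm (y - v)) ^ N * decay N (t - y)"
      using C(2)[OF bs(1), of "t - y" "y - v"] by simp
    also have "\<dots> \<le> D * norm (y - v) * (1 + norm (y - v)) ^ N * ((1 + norm y) ^ N * decay N t)"
      using decay_peetre[of N t "- y"] CD[of bs] C(1)[OF bs(1)] bs D
      by (intro mult_mono mult_nonneg_nonneg) auto
    finally show "norm (partials bs (\<lambda>t. f (t - v) - f (t - y)) t)
       \<le> D * norm (v - y) * (1 + norm (v - y)) ^ N * (1 + norm y) ^ N * decay N t"
      by (simp add: norm_minus_commute mult_ac)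
  qed
  then show ?thesis using D that by blast
qed

section \<open>The Fourier transform and Parseval's formula\<close>

lemma integrable_lborel_pair_bound:
  fixes F :: "'a::euclidean_space \<Rightarrow> 'b::euclidean_space \<Rightarrow> complex"
  assumes [measurable]: "case_prod F \<in> borel_measurable (borel \<Otimes>\<^sub>M borel)"
    and f: "integrable lborel f" and g: "integrable lborel g" and bd: "\<And>x y. norm (F x y) \<le> f x * g y"
  shows "integrable (lborel \<Otimes>\<^sub>M lborel) (case_prod F)"
proof (rule integrableI_bounded)
  have "(\<integral>\<^sup>+z. ennreal (norm (case_prod F z)) \<partial>(lborel \<Otimes>\<^sub>M lborel))
      = (\<integral>\<^sup>+x. (\<integral>\<^sup>+y. ennreal (norm (F x y)) \<partial>lborel) \<partial>lborel)"
    by (subst lborel.nn_integral_fst[symmetric]) auto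
  also have "\<dots> \<le> (\<integral>\<^sup>+x. (\<integral>\<^sup>+y. ennreal (norm (f x)) * ennreal (norm (g y)) \<partial>lborel) \<partial>lborel)"
  proof (intro nn_integral_mono)
    fix x y
    have "norm (F x y) \<le> norm (f x) * norm (g y)"
      using bd[of x y] abs_ge_self[of "f x * g y"] by (simp add: abs_mult)
    then show "ennreal (norm (F x y)) \<le> ennreal (norm (f x)) * ennreal (norm (g y))"
      by (simp add: ennreal_mult[symmetric] ennreal_leI)
  qed
  also have "\<dots> = (\<integral>\<^sup>+x. ennreal (norm (f x)) \<partial>lborel) * (\<integral>\<^sup>+y. ennreal (norm (g y)) \<partial>lborel)"
    using borel_measurable_integrable[OF f] borel_measurable_integrable[OF g]
    by (simp add: nn_integral_cmult nn_integral_multc)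
  also have "\<dots> < \<infinity>"
    using f g by (simp add: integrable_iff_bounded ennreal_mult_less_top)
  finally show "(\<integral>\<^sup>+z. ennreal (norm (case_prod F z)) \<partial>(lborel \<Otimes>\<^sub>M lborel)) < \<infinity>" .
qed measurable

lemma Fubini_bound:
  fixes F :: "'a::euclidean_space \<Rightarrow> 'b::euclidean_space \<Rightarrow> complex"
  assumes "case_prod F \<in> borel_measurable (borel \<Otimes>\<^sub>M borel)"
    and "integrable lborel f" "integrable lborel g" "\<And>x y. norm (F x y) \<le> f x * g y"
  shows "(\<integral>x. (\<integral>y. F x y \<partial>lborel) \<partial>lborel) = (\<integral>y. (\<integral>x. F x y \<partial>lborel) \<partial>lborel)"
  by (rule lborel_pair.Fubini_integral[symmetric]) (rule integrable_lborel_pair_bound[OF assms])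

section \<open>The Fourier transform on the Schwartz space\<close>

definition fourier_const :: "'a::euclidean_space itself \<Rightarrow> real" where
  "fourier_const _ = (2 * pi) powr (- real DIM('a) / 2)"

lemma fourier_const_pos: "0 < fourier_const TYPE('a::euclidean_space)"
  by (simp add: fourier_const_def)

lemma fourier_eq:
  fixes f :: "'a::euclidean_space \<Rightarrow> complex"
  shows "fourier f \<xi> = of_real (fourier_const TYPE('a)) * (\<integral>t. f t * character \<xi> t \<partial>lborel)"
  by (simp add: fourier_def fourier_const_def character_def)

lemma inverse_fourier_eq: "inverse_fourier f \<xi> = fourier f (- \<xi>)"
  by (simp add: inverse_fourier_def fourier_def inner_commute)

lemma integrable_character: "integrable lborel f \<Longrightarrow> integrable lborel (\<lambda>t. f t * character \<xi> t)"
  by (rule integrable_bounded_mult[where C = 1]) auto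

lemma norm_fourier_le:
  fixes f :: "'a::euclidean_space \<Rightarrow> complex"
  assumes "integrable lborel f"
  shows "norm (fourier f \<xi>) \<le> fourier_const TYPE('a) * (\<integral>t. norm (f t) \<partial>lborel)"
  unfolding fourier_eq norm_mult using fourier_const_pos[where 'a = 'a] assms
  by (intro mult_mono norm_integral_le) (auto simp: norm_mult intro!: integral_nonneg_AE)

lemma fourier_measurable [measurable]:
  fixes f :: "'a::euclidean_space \<Rightarrow> complex"
  assumes [measurable]: "f \<in> borel_measurable borel"
  shows "fourier f \<in> borel_measurable borel"
  unfolding fourier_eq[abs_def] by measurable

lemma norm_character_taylor:
  "norm (character (\<xi> + h) t - character \<xi> t - (- \<i> * of_real (t \<bullet> h)) * character \<xi> t) \<le> (norm t)\<^sup>2 * (norm h)\<^sup>2"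
proof -
  have "norm (iexp (- (t \<bullet> h)) - (1 + \<i> * of_real (- (t \<bullet> h)))) \<le> \<bar>- (t \<bullet> h)\<bar> ^ 2 / 2"
    using iexp_approx1[of "- (t \<bullet> h)" 1] by (simp add: numeral_2_eq_2)
  also have "\<dots> \<le> (norm t * norm h) ^ 2 / 2"
    using Cauchy_Schwarz_ineq2[of t h] by (intro divide_right_mono power_mono) auto
  also have "\<dots> \<le> (norm t)\<^sup>2 * (norm h)\<^sup>2" by (simp add: power_mult_distrib)
  finally have "norm (character h t - (1 + \<i> * of_real (- (t \<bullet> h)))) \<le> (norm t)\<^sup>2 * (norm h)\<^sup>2"
    by (simp add: character_def)
  moreover have "character (\<xi> + h) t - character \<xi> t - (- \<i> * of_real (t \<bullet> h)) * character \<xi> t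
    = character \<xi> t * (character h t - (1 + \<i> * of_real (- (t \<bullet> h))))"
    by (simp add: character_add algebra_simps)
  ultimately show ?thesis by (simp add: norm_mult)
qed

lemma schwartz_linear_mult: "f \<in> schwartz_space \<Longrightarrow> (\<lambda>t. - \<i> * (of_real (t \<bullet> v) * f t)) \<in> schwartz_space"
  by (intro schwartz_cmult schwartz_mult multipliers_linear)

lemma pd_fourier:
  fixes f :: "'a::euclidean_space \<Rightarrow> complex"
  assumes f: "f \<in> schwartz_space"
  shows "fourier f differentiable (at \<xi>)"
    and "b \<in> Basis \<Longrightarrow> pd b (fourier f) = fourier (\<lambda>t. - \<i> * (of_real (t \<bullet> b) * f t))"
proof -
  define u where "u b t = - \<i> * (of_real (t \<bullet> b) * f t)" for b t
  let ?c = "fourier_const TYPE('a)"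
  have [measurable]: "f \<in> borel_measurable borel" by (rule schwartz_measurable[OF f])
  have ui: "integrable lborel (\<lambda>t. u b t * character \<xi> t)" for b \<xi>
    unfolding u_def by (intro integrable_character schwartz_integrable schwartz_linear_mult f)
  have fi: "integrable lborel (\<lambda>t. f t * character \<xi> t)" for \<xi>
    by (intro integrable_character schwartz_integrable f)
  \<comment> \<open>Two orders of decay absorb the factor |t|^2 in the Taylor remainder of the
    character; the others make the integral converge.\<close>
  obtain C where C: "0 < C" "\<And>x. norm (f x) \<le> C * decay (2 + Suc DIM('a)) x" by (rule schwartz_decay[OF f]) blast
  let ?I = "\<integral>t. decay (Suc DIM('a)) (t::'a) \<partial>lborel"
  have d: "(fourier f has_derivative (\<lambda>h. \<Sum>b\<in>Basis. (h \<bullet> b) *\<^sub>R fourier (u b) \<xi>)) (at \<xi>)" for \<xi>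
  proof (rule has_derivative_quadratic)
    show "bounded_linear (\<lambda>h. \<Sum>b\<in>Basis. (h \<bullet> b) *\<^sub>R fourier (u b) \<xi>)"
      by (intro bounded_linear_sum bounded_linear_scaleR_const bounded_linear_inner_left)
    fix h :: 'a
    have eq: "f t * (character (\<xi> + h) t - character \<xi> t - (- \<i> * of_real (t \<bullet> h)) * character \<xi> t)
      = f t * character (\<xi> + h) t - f t * character \<xi> t - (\<Sum>b\<in>Basis. (h \<bullet> b) *\<^sub>R (u b t * character \<xi> t))" for t
    proof -
      have "(\<Sum>b\<in>Basis. (h \<bullet> b) *\<^sub>R (u b t * character \<xi> t)) = (- \<i> * of_real (\<Sum>b\<in>Basis. (t \<bullet> b) * (h \<bullet> b))) * character \<xi> t * f t"
        by (simp add: u_def scaleR_conv_of_real sum_distrib_left sum_distrib_right mult_ac sum_negf)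
      also have "(\<Sum>b\<in>Basis. (t \<bullet> b) * (h \<bullet> b)) = t \<bullet> h" by (rule euclidean_inner[symmetric])
      finally show ?thesis by (simp add: algebra_simps)
    qed
    have "fourier f (\<xi> + h) - fourier f \<xi> - (\<Sum>b\<in>Basis. (h \<bullet> b) *\<^sub>R fourier (u b) \<xi>)
      = of_real ?c * ((\<integral>t. f t * character (\<xi> + h) t \<partial>lborel) - (\<integral>t. f t * character \<xi> t \<partial>lborel)
         - (\<Sum>b\<in>Basis. (h \<bullet> b) *\<^sub>R (\<integral>t. u b t * character \<xi> t \<partial>lborel)))"
      by (simp add: fourier_eq algebra_simps sum_distrib_left)
    also have "\<dots> = of_real ?c * (\<integral>t. f t * (character (\<xi> + h) t - character \<xi> t - (- \<i> * of_real (t \<bullet> h)) * character \<xi> t) \<partial>lborel)"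
      unfolding eq using ui fi by (subst Bochner_Integration.integral_diff Bochner_Integration.integral_sum | simp)+
    finally have "norm (fourier f (\<xi> + h) - fourier f \<xi> - (\<Sum>b\<in>Basis. (h \<bullet> b) *\<^sub>R fourier (u b) \<xi>))
      = ?c * norm (\<integral>t. f t * (character (\<xi> + h) t - character \<xi> t - (- \<i> * of_real (t \<bullet> h)) * character \<xi> t) \<partial>lborel)"
      using fourier_const_pos[where 'a = 'a] by (simp add: norm_mult)
    also have "\<dots> \<le> ?c * (\<integral>t. (C * (norm h)\<^sup>2) * decay (Suc DIM('a)) (t::'a) \<partial>lborel)"
    proof (intro mult_left_mono norm_integral_le)
      show "integrable lborel (\<lambda>t. (C * (norm h)\<^sup>2) * decay (Suc DIM('a)) (t::'a))"
        by (intro integrable_mult_right integrable_decay) simp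
      fix t
      have "norm (f t * (character (\<xi> + h) t - character \<xi> t - (- \<i> * of_real (t \<bullet> h)) * character \<xi> t))
        \<le> (C * decay (2 + Suc DIM('a)) t) * ((1 + norm t)\<^sup>2 * (norm h)\<^sup>2)"
        unfolding norm_mult[of "f t"]
      proof (intro mult_mono C order_trans[OF norm_character_taylor] mult_right_mono power_mono)
      qed (use C in auto)
      also have "\<dots> = (C * (norm h)\<^sup>2) * ((1 + norm t)\<^sup>2 * decay (2 + Suc DIM('a)) t)" by simp
      also have "\<dots> = (C * (norm h)\<^sup>2) * decay (Suc DIM('a)) t" by (simp only: decay_cancel)
      finally show "norm (f t * (character (\<xi> + h) t - character \<xi> t - (- \<i> * of_real (t \<bullet> h)) * character \<xi> t))
        \<le> (C * (norm h)\<^sup>2) * decay (Suc DIM('a)) t" .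
    qed (use fourier_const_pos[where 'a = 'a] in auto)
    finally show "norm (fourier f (\<xi> + h) - fourier f \<xi> - (\<Sum>b\<in>Basis. (h \<bullet> b) *\<^sub>R fourier (u b) \<xi>))
      \<le> (?c * C * ?I) * (norm h)\<^sup>2"
      by (simp add: mult_ac)
  qed
  show "fourier f differentiable (at \<xi>)" using d differentiable_def by blast
  assume b: "b \<in> Basis"
  have "pd b (fourier f) \<xi> = fourier (u b) \<xi>" for \<xi>
    using pd_eqI[OF d, of b \<xi>] b by (simp add: sum_Basis_delta)
  then have "pd b (fourier f) = fourier (u b)" by auto
  then show "pd b (fourier f) = fourier (\<lambda>t. - \<i> * (of_real (t \<bullet> b) * f t))" unfolding u_def[abs_def] .
qed

text \<open>The integral of \<open>f (x + h b) - f x\<close> vanishes by translation invariance, while to first order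
  in \<open>h\<close> it is \<open>h\<close> times the integral of the derivative.\<close>

lemma integral_pd_zero:
  fixes f :: "'a::euclidean_space \<Rightarrow> complex"
  assumes f: "f \<in> schwartz_space" and b: "b \<in> Basis"
  shows "(\<integral>x. pd b f x \<partial>lborel) = 0"
proof -
  let ?m = "Suc DIM('a)"
  obtain C where C: "0 < C" "\<And>x h. norm (f (x + h) - f x - (\<Sum>b\<in>Basis. (h \<bullet> b) *\<^sub>R pd b f x)) \<le> C * (norm h)\<^sup>2 * (1 + norm h) ^ ?m * decay ?m x"
    by (rule schwartz_taylor[OF f, where k = ?m]) blast
  have [measurable]: "f \<in> borel_measurable borel" by (rule schwartz_measurable[OF f])
  note fi = schwartz_integrable[OF f]
  note pi = schwartz_integrable[OF schwartz_pd[OF f b]]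
  define I where "I = (\<integral>x. decay ?m (x::'a) \<partial>lborel)"
  have I: "0 \<le> I" unfolding I_def by (intro integral_nonneg_AE) simp
  \<comment> \<open>The increment has length e <= 1, which keeps (1 + |h|)^m below 2^m. The
    remainder is quadratic in e, so one factor e survives the division by e.\<close>
  have bound: "norm (\<integral>x. pd b f x \<partial>lborel) \<le> e * (C * 2 ^ ?m * I)" if e: "0 < e" "e \<le> 1" for e :: real
  proof -
    have sum: "(\<Sum>c\<in>Basis. ((e *\<^sub>R b) \<bullet> c) *\<^sub>R pd c f x) = e *\<^sub>R pd b f x" for x
      using sum_Basis_delta[OF b, of "\<lambda>c. pd c f x"] by (simp add: scaleR_scaleR[symmetric] scaleR_sum_right[symmetric] del: scaleR_scaleR)
    have "(\<integral>x. f (x + e *\<^sub>R b) - f x - e *\<^sub>R pd b f x \<partial>lborel) = - (e *\<^sub>R (\<integral>x. pd b f x \<partial>lborel))"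
      using fi pi lborel_integrable_shift(1)[OF fi, of "e *\<^sub>R b"] lborel_integral_shift(1)[of f "e *\<^sub>R b"] by simp
    then have "e * norm (\<integral>x. pd b f x \<partial>lborel) = norm (\<integral>x. f (x + e *\<^sub>R b) - f x - e *\<^sub>R pd b f x \<partial>lborel)"
      using e by simp
    also have "\<dots> \<le> (\<integral>x. (C * e\<^sup>2 * 2 ^ ?m) * decay ?m (x::'a) \<partial>lborel)"
    proof (rule norm_integral_le)
      show "integrable lborel (\<lambda>x. (C * e\<^sup>2 * 2 ^ ?m) * decay ?m (x::'a))"
        by (intro integrable_mult_right integrable_decay) simp
      fix x
      have "norm (f (x + e *\<^sub>R b) - f x - e *\<^sub>R pd b f x) \<le> C * (norm (e *\<^sub>R b))\<^sup>2 * (1 + norm (e *\<^sub>R b)) ^ ?m * decay ?m x"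
        using C(2)[of x "e *\<^sub>R b"] by (simp only: sum)
      also have "\<dots> \<le> C * e\<^sup>2 * 2 ^ ?m * decay ?m x"
        using C(1) e b by (intro mult_right_mono mult_left_mono mult_mono power_mono) (auto simp: norm_Basis)
      finally show "norm (f (x + e *\<^sub>R b) - f x - e *\<^sub>R pd b f x) \<le> (C * e\<^sup>2 * 2 ^ ?m) * decay ?m x" .
    qed
    also have "\<dots> = e * (e * (C * 2 ^ ?m * I))" by (simp add: I_def power2_eq_square)
    finally show ?thesis using e by (simp add: mult_le_cancel_left_pos)
  qed
  have "norm (\<integral>x. pd b f x \<partial>lborel) \<le> 0"
  proof (rule field_le_epsilon)
    fix e :: real assume e: "0 < e"
    define K where "K = C * 2 ^ ?m * I + 1"
    have K: "1 \<le> K" using C(1) I by (simp add: K_def)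
    have "norm (\<integral>x. pd b f x \<partial>lborel) \<le> min 1 (e / K) * (C * 2 ^ ?m * I)" using e K by (intro bound) auto
    also have "\<dots> \<le> (e / K) * K" using e K C(1) I by (intro mult_mono) (auto simp: K_def)
    finally show "norm (\<integral>x. pd b f x \<partial>lborel) \<le> 0 + e" using K by simp
  qed
  then show ?thesis by simp
qed

text \<open>Integration by parts: the derivative of f times the character integrates to zero, and
  the Leibniz rule splits this integral.\<close>

lemma fourier_pd:
  assumes f: "f \<in> schwartz_space" and b: "b \<in> Basis"
  shows "fourier (pd b f) \<xi> = (\<i> * of_real (b \<bullet> \<xi>)) * fourier f \<xi>"
proof -
  have ch: "character \<xi> \<in> multipliers" by (rule multipliers_character)
  then have sm: "smooth (character \<xi>)" by (simp add: multipliers_def)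
  have S: "(\<lambda>t. f t * character \<xi> t) \<in> schwartz_space"
    using schwartz_mult[OF ch f] by (simp add: mult.commute)
  have "pd b (\<lambda>t. f t * character \<xi> t) t = pd b f t * character \<xi> t + (- \<i> * of_real (b \<bullet> \<xi>)) * (f t * character \<xi> t)" for t
    using pd_mult(1)[OF schwartz_smooth[OF f] sm, of b] pd_character(1)[of b 1 \<xi>] by simp
  then have "0 = (\<integral>t. pd b f t * character \<xi> t + (- \<i> * of_real (b \<bullet> \<xi>)) * (f t * character \<xi> t) \<partial>lborel)"
    using integral_pd_zero[OF S b] by simp
  also have "\<dots> = (\<integral>t. pd b f t * character \<xi> t \<partial>lborel) + (- \<i> * of_real (b \<bullet> \<xi>)) * (\<integral>t. f t * character \<xi> t \<partial>lborel)"
    using integrable_character[OF schwartz_integrable[OF schwartz_pd[OF f b]], of \<xi>]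
      integrable_character[OF schwartz_integrable[OF f], of \<xi>]
    by (subst Bochner_Integration.integral_add) auto
  finally show ?thesis by (simp add: fourier_eq algebra_simps eq_neg_iff_add_eq_0)
qed

lemma fourier_partials_replicate:
  assumes f: "f \<in> schwartz_space" and b: "b \<in> Basis"
  shows "fourier (partials (replicate k b) f) \<xi> = (\<i> * of_real (b \<bullet> \<xi>)) ^ k * fourier f \<xi>"
proof (induction k)
  case (Suc k)
  have "partials (replicate k b) f \<in> schwartz_space" using f b by (intro schwartz_partials) auto
  from fourier_pd[OF this b] show ?case using Suc by simp
qed simp

text \<open>The largest coordinate controls the norm. With pure powers of coordinates on the right,
  decay of a Fourier transform follows from derivatives repeated in a single direction.\<close>

lemma one_plus_norm_power_le_sum:
  fixes x :: "'a::euclidean_space"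
  shows "(1 + norm x) ^ k \<le> (1 + real DIM('a)) ^ k * (1 + (\<Sum>b\<in>Basis. \<bar>b \<bullet> x\<bar> ^ k))"
proof -
  define M where "M = Max (insert 1 ((\<lambda>b. \<bar>b \<bullet> x\<bar>) ` Basis))"
  have M1: "1 \<le> M" unfolding M_def by (rule Max_ge) auto
  have Mb: "\<bar>b \<bullet> x\<bar> \<le> M" if "b \<in> Basis" for b unfolding M_def by (rule Max_ge) (use that in auto)
  have "norm x \<le> (\<Sum>b\<in>Basis. \<bar>x \<bullet> b\<bar>)" by (rule norm_le_l1)
  also have "\<dots> \<le> (\<Sum>b\<in>(Basis::'a set). M)" using Mb by (intro sum_mono) (auto simp: inner_commute)
  finally have "1 + norm x \<le> (1 + real DIM('a)) * M" using M1 by (simp add: algebra_simps)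
  then have "(1 + norm x) ^ k \<le> ((1 + real DIM('a)) * M) ^ k" by (intro power_mono) auto
  also have "\<dots> = (1 + real DIM('a)) ^ k * M ^ k" by (simp add: power_mult_distrib)
  also have "M ^ k \<le> 1 + (\<Sum>b\<in>Basis. \<bar>b \<bullet> x\<bar> ^ k)"
  proof -
    have "M \<in> insert 1 ((\<lambda>b. \<bar>b \<bullet> x\<bar>) ` Basis)" unfolding M_def by (intro Max_in) auto
    then consider "M = 1" | b where "b \<in> Basis" "M = \<bar>b \<bullet> x\<bar>" by auto
    then show ?thesis
    proof cases
      case 1 then show ?thesis by (auto intro!: sum_nonneg)
    next
      case (2 b)
      have "\<bar>b \<bullet> x\<bar> ^ k \<le> (\<Sum>b\<in>Basis. \<bar>b \<bullet> x\<bar> ^ k)" using 2 by (intro member_le_sum) auto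
      then show ?thesis using 2 by simp
    qed
  qed
  finally show ?thesis by (simp add: mult_left_mono)
qed

text \<open>The function enters only through integrals of finitely many derivatives; this explicit
  form allows estimates uniform over families such as f times the translates of a window.\<close>

lemma fourier_decay:
  fixes f :: "'a::euclidean_space \<Rightarrow> complex"
  assumes f: "f \<in> schwartz_space"
  shows "norm (fourier f \<omega>) \<le> (1 + real DIM('a)) ^ k * fourier_const TYPE('a) *
    ((\<integral>t. norm (f t) \<partial>lborel) + (\<Sum>b\<in>Basis. \<integral>t. norm (partials (replicate k b) f t) \<partial>lborel)) * decay k \<omega>"
proof -
  let ?c = "fourier_const TYPE('a)"
  have "(1 + norm \<omega>) ^ k * norm (fourier f \<omega>)
     \<le> (1 + real DIM('a)) ^ k * (1 + (\<Sum>b\<in>Basis. \<bar>b \<bullet> \<omega>\<bar> ^ k)) * norm (fourier f \<omega>)"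
    by (intro mult_right_mono one_plus_norm_power_le_sum) simp
  also have "\<dots> = (1 + real DIM('a)) ^ k * (norm (fourier f \<omega>) + (\<Sum>b\<in>Basis. \<bar>b \<bullet> \<omega>\<bar> ^ k * norm (fourier f \<omega>)))"
    by (simp add: algebra_simps sum_distrib_left)
  also have "(\<Sum>b\<in>Basis. \<bar>b \<bullet> \<omega>\<bar> ^ k * norm (fourier f \<omega>)) = (\<Sum>b\<in>Basis. norm (fourier (partials (replicate k b) f) \<omega>))"
    by (intro sum.cong refl) (simp add: fourier_partials_replicate[OF f] norm_mult norm_power)
  also have "norm (fourier f \<omega>) + (\<Sum>b\<in>Basis. norm (fourier (partials (replicate k b) f) \<omega>))
     \<le> ?c * (\<integral>t. norm (f t) \<partial>lborel) + (\<Sum>b\<in>Basis. ?c * (\<integral>t. norm (partials (replicate k b) f t) \<partial>lborel))"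
    using f by (intro add_mono sum_mono norm_fourier_le schwartz_integrable schwartz_partials) auto
  also have "\<dots> = ?c * ((\<integral>t. norm (f t) \<partial>lborel) + (\<Sum>b\<in>Basis. \<integral>t. norm (partials (replicate k b) f t) \<partial>lborel))"
    by (simp add: algebra_simps sum_distrib_left)
  finally have le: "(1 + norm \<omega>) ^ k * norm (fourier f \<omega>) \<le> (1 + real DIM('a)) ^ k * (?c *
    ((\<integral>t. norm (f t) \<partial>lborel) + (\<Sum>b\<in>Basis. \<integral>t. norm (partials (replicate k b) f t) \<partial>lborel)))"
    by (simp add: mult_left_mono)
  have pos: "0 < (1 + norm \<omega>) ^ k" by (simp add: add_pos_nonneg)
  have frac: "N \<le> K * (1 / X)" if "X * N \<le> K" "0 < X" for X N K :: real
    using that by (simp add: field_simps)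
  from frac[OF le pos] show ?thesis unfolding decay_def by (simp only: mult.assoc)
qed

lemma schwartz_fourier:
  fixes f :: "'a::euclidean_space \<Rightarrow> complex"
  assumes "f \<in> schwartz_space" shows "fourier f \<in> schwartz_space"
proof (rule schwartz_coinduct[where A = "fourier ` schwartz_space"])
  fix h :: "'a \<Rightarrow> complex" assume "h \<in> fourier ` schwartz_space"
  then obtain g where h: "h = fourier g" and g: "g \<in> schwartz_space" by auto
  show "h differentiable_on UNIV" unfolding h differentiable_on_def
    by (rule ballI, rule differentiable_at_withinI, rule pd_fourier[OF g])
  show "pd b h \<in> fourier ` schwartz_space" if "b \<in> Basis" for b
    unfolding h pd_fourier(2)[OF g that] using schwartz_linear_mult[OF g] by blast
  show "\<exists>C. \<forall>x. norm (h x) \<le> C * decay k x" for k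
    unfolding h using fourier_decay[OF g] by blast
qed (use assms in auto)

lemma schwartz_inverse_fourier: "f \<in> schwartz_space \<Longrightarrow> inverse_fourier f \<in> schwartz_space"
  using schwartz_affine[OF schwartz_fourier, of f "-1" 1 0] by (simp add: inverse_fourier_eq[abs_def])

text \<open>Decay in \<omega> comes from derivatives of the product, decay in x from the separation
  of f and the translated window. The dependence on f through one Schwartz norm is what later makes
  the product a continuous functional.\<close>

lemma windowed_fourier_decay:
  fixes g :: "'a::euclidean_space \<Rightarrow> complex"
  assumes g: "g \<in> schwartz_space"
  obtains C N where "0 < C" "\<And>(f :: 'a \<Rightarrow> complex) x \<omega>. f \<in> schwartz_space \<Longrightarrow>
    norm (fourier (\<lambda>t. f t * g (t - x)) \<omega>) \<le> C * schwartz_norm N f * decay k x * decay k \<omega>"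
proof -
  let ?m = "Suc DIM('a)"
  \<comment> \<open>The decay of order k of f is combined with that of the window into decay in x,
    and the other orders make the integral converge; N also covers the k derivatives.\<close>
  define N where "N = k + ?m"
  obtain D where D: "0 < D" "\<And>bs x. set bs \<subseteq> Basis \<Longrightarrow> length bs \<le> k \<Longrightarrow> norm (partials bs g x) \<le> D * decay k x"
    by (rule schwartz_partials_decay[OF g, where m = k and k = k]) blast
  define I where "I = (\<integral>x. decay ?m (x::'a) \<partial>lborel)"
  have I: "0 \<le> I" unfolding I_def by (intro integral_nonneg_AE) simp
  define C where "C = (1 + real DIM('a)) ^ k * fourier_const TYPE('a) * ((1 + real DIM('a)) * (2 ^ k * D * I)) + 1"
  show ?thesis
  proof (rule that[of C N])
    show "0 < C" using D I fourier_const_pos[where 'a = 'a] by (auto simp: C_def intro!: add_nonneg_pos)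
    fix f :: "'a \<Rightarrow> complex" and x \<omega> :: 'a assume f: "f \<in> schwartz_space"
    have nn: "0 \<le> schwartz_norm N f" by (rule schwartz_norm_nonneg[OF f])
    have gx: "(\<lambda>t. g (t - x)) \<in> schwartz_space" by (rule schwartz_shift[OF g])
    have fg: "(\<lambda>t. f t * g (t - x)) \<in> schwartz_space" by (rule schwartz_times[OF f gx])
    have int: "(\<integral>t. norm (partials bs (\<lambda>t. f t * g (t - x)) t) \<partial>lborel) \<le> 2 ^ k * schwartz_norm N f * D * I * decay k x"
      if bs: "set bs \<subseteq> Basis" "length bs \<le> k" for bs
    proof -
      have "(\<integral>t. norm (partials bs (\<lambda>t. f t * g (t - x)) t) \<partial>lborel)
        \<le> (\<integral>t. (2 ^ k * schwartz_norm N f * D * decay k x) * decay ?m (t::'a) \<partial>lborel)"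
      proof (rule integral_mono)
        show "integrable lborel (\<lambda>t. norm (partials bs (\<lambda>t. f t * g (t - x)) t))"
          using fg bs by (intro integrable_norm schwartz_integrable schwartz_partials)
        show "integrable lborel (\<lambda>t. (2 ^ k * schwartz_norm N f * D * decay k x) * decay ?m (t::'a))"
          by (intro integrable_mult_right integrable_decay) simp
        fix t
        have "norm (partials bs (\<lambda>t. f t * g (t - x)) t) \<le> 2 ^ length bs * ((schwartz_norm N f * decay N t) * (D * decay k (t - x)))"
        proof (rule norm_partials_mult_le[OF schwartz_smooth[OF f] schwartz_smooth[OF gx] bs(1)])
          fix cs assume cs: "set cs \<subseteq> (Basis :: 'a set)" "length cs \<le> length bs"
          show "norm (partials cs f t) \<le> schwartz_norm N f * decay N t"
            using cs bs by (intro schwartz_norm_upper f) (auto simp: N_def)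
          show "norm (partials cs (\<lambda>t. g (t - x)) t) \<le> D * decay k (t - x)"
            using D(2)[of cs "t - x"] cs bs partials_shift[OF schwartz_smooth[OF g] cs(1), of x] by auto
        qed
        also have "\<dots> \<le> 2 ^ k * ((schwartz_norm N f * decay N t) * (D * decay k (t - x)))"
          using nn D bs by (intro mult_right_mono power_increasing mult_nonneg_nonneg) auto
        also have "\<dots> = 2 ^ k * schwartz_norm N f * D * (decay k t * decay k (x - t)) * decay ?m t"
          by (simp only: N_def decay_add decay_minus_commute[of k t x] mult_ac)
        also have "\<dots> \<le> 2 ^ k * schwartz_norm N f * D * decay k x * decay ?m t"
          using nn D by (intro mult_right_mono mult_left_mono decay_mult_le) auto
        finally show "norm (partials bs (\<lambda>t. f t * g (t - x)) t) \<le> (2 ^ k * schwartz_norm N f * D * decay k x) * decay ?m t" .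
      qed
      then show ?thesis by (simp add: I_def mult_ac)
    qed
    let ?B = "2 ^ k * schwartz_norm N f * D * I * decay k x"
    have "norm (fourier (\<lambda>t. f t * g (t - x)) \<omega>) \<le> (1 + real DIM('a)) ^ k * fourier_const TYPE('a) *
      ((\<integral>t. norm (partials [] (\<lambda>t. f t * g (t - x)) t) \<partial>lborel)
        + (\<Sum>b\<in>Basis. \<integral>t. norm (partials (replicate k b) (\<lambda>t. f t * g (t - x)) t) \<partial>lborel)) * decay k \<omega>"
      using fourier_decay[OF fg, of \<omega> k] by simp
    also have "\<dots> \<le> (1 + real DIM('a)) ^ k * fourier_const TYPE('a) * (?B + (\<Sum>b\<in>(Basis::'a set). ?B)) * decay k \<omega>"
      using fourier_const_pos[where 'a = 'a] by (intro mult_right_mono mult_left_mono add_mono sum_mono int) auto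
    also have "\<dots> = ((1 + real DIM('a)) ^ k * fourier_const TYPE('a) * ((1 + real DIM('a)) * (2 ^ k * D * I))) * (schwartz_norm N f * decay k x * decay k \<omega>)"
      by (simp add: algebra_simps)
    also have "\<dots> \<le> C * (schwartz_norm N f * decay k x * decay k \<omega>)"
      using nn by (intro mult_right_mono mult_nonneg_nonneg) (auto simp: C_def)
    finally show "norm (fourier (\<lambda>t. f t * g (t - x)) \<omega>) \<le> C * schwartz_norm N f * decay k x * decay k \<omega>"
      by (simp add: mult.assoc)
  qed
qed

section \<open>Gaussians, Fourier inversion and Parseval's formula\<close>

lemma lborel_integral_prod:
  fixes F :: "'a::euclidean_space \<Rightarrow> real \<Rightarrow> 'b::{real_normed_field, banach, second_countable_topology}"
  assumes F: "\<And>b. b \<in> Basis \<Longrightarrow> integrable lborel (F b)"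
  shows "integrable lborel (\<lambda>x::'a. \<Prod>b\<in>Basis. F b (x \<bullet> b))"
    and "(\<integral>x. (\<Prod>b\<in>Basis. F b ((x::'a) \<bullet> b)) \<partial>lborel) = (\<Prod>b\<in>Basis. \<integral>x. F b x \<partial>lborel)"
proof -
  interpret P: product_sigma_finite "\<lambda>_::'a. lborel :: real measure" ..
  have [measurable]: "F b \<in> borel_measurable borel" if "b \<in> Basis" for b
    using borel_measurable_integrable[OF F[OF that]] by simp
  let ?T = "\<lambda>f::'a \<Rightarrow> real. \<Sum>b\<in>Basis. f b *\<^sub>R b"
  have T: "?T \<in> (\<Pi>\<^sub>M b\<in>Basis. lborel) \<rightarrow>\<^sub>M borel" by measurable
  have m: "(\<lambda>x::'a. \<Prod>b\<in>Basis. F b (x \<bullet> b)) \<in> borel_measurable borel" by measurable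
  have eq: "(\<Prod>b\<in>Basis. F b (?T f \<bullet> b)) = (\<Prod>b\<in>Basis. F b (f b))" for f
    by (intro prod.cong refl) simp
  have i: "integrable (\<Pi>\<^sub>M b\<in>(Basis::'a set). lborel) (\<lambda>f. \<Prod>b\<in>Basis. F b (f b))"
    using F by (intro P.product_integrable_prod) auto
  show "integrable lborel (\<lambda>x::'a. \<Prod>b\<in>Basis. F b (x \<bullet> b))"
    unfolding lborel_eq[where 'a = 'a] by (subst integrable_distr_eq[OF T m]) (simp only: eq i)
  have "(\<integral>x. (\<Prod>b\<in>Basis. F b ((x::'a) \<bullet> b)) \<partial>lborel) = (\<integral>f. (\<Prod>b\<in>Basis. F b (f b)) \<partial>(\<Pi>\<^sub>M b\<in>(Basis::'a set). lborel))"
    unfolding lborel_eq[where 'a = 'a] by (subst integral_distr[OF T m]) (simp only: eq)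
  also have "\<dots> = (\<Prod>b\<in>Basis. \<integral>x. F b x \<partial>lborel)"
    using F by (intro P.product_integral_prod) auto
  finally show "(\<integral>x. (\<Prod>b\<in>Basis. F b ((x::'a) \<bullet> b)) \<partial>lborel) = (\<Prod>b\<in>Basis. \<integral>x. F b x \<partial>lborel)" .
qed

definition gauss :: "'a::euclidean_space \<Rightarrow> real" where
  "gauss x = exp (- (norm x)\<^sup>2 / 2)"

lemma gauss_measurable [measurable]: "gauss \<in> borel_measurable borel"
  unfolding gauss_def by measurable

lemma gauss_nonneg [simp]: "0 \<le> gauss x" and gauss_le_1: "gauss x \<le> 1" and gauss_0 [simp]: "gauss 0 = 1"
  by (simp_all add: gauss_def)

lemma continuous_on_gauss: "continuous_on S gauss"
  unfolding gauss_def by (intro continuous_intros) auto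

lemma gauss_prod: "gauss (x::'a::euclidean_space) = (\<Prod>b\<in>Basis. exp (- (x \<bullet> b)\<^sup>2 / 2))"
proof -
  have "(norm x)\<^sup>2 = (\<Sum>b\<in>Basis. (x \<bullet> b)\<^sup>2)"
    unfolding power2_norm_eq_inner by (subst euclidean_inner) (simp add: power2_eq_square)
  then show ?thesis by (simp add: gauss_def exp_sum[symmetric] sum_negf sum_divide_distrib)
qed

text \<open>Up to the factor sqrt (2 pi) this is the characteristic function of the standard normal
  distribution.\<close>

lemma gauss_character_real:
  fixes t :: real
  shows "integrable lborel (\<lambda>x. of_real (exp (- x\<^sup>2 / 2)) * exp (- \<i> * of_real (x * t)))"
    and "(\<integral>x. of_real (exp (- x\<^sup>2 / 2)) * exp (- \<i> * of_real (x * t)) \<partial>lborel) = of_real (sqrt (2 * pi) * exp (- t\<^sup>2 / 2))"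
proof -
  have e: "of_real (exp (- x\<^sup>2 / 2)) * exp (- \<i> * of_real (x * t)) = of_real (sqrt (2 * pi)) * (std_normal_density x *\<^sub>R iexp (- t * x))" for x
    by (simp add: std_normal_density_def scaleR_conv_of_real mult_ac)
  have n: "norm (iexp (- t * x)) = 1" for x by (simp add: norm_exp_eq_Re)
  have d: "integrable lborel std_normal_density" by (rule integrable_normal_density) simp
  have i: "integrable lborel (\<lambda>x. std_normal_density x *\<^sub>R iexp (- t * x))"
    by (rule Bochner_Integration.integrable_bound[OF d]) (auto simp: n)
  show "integrable lborel (\<lambda>x. of_real (exp (- x\<^sup>2 / 2)) * exp (- \<i> * of_real (x * t)))"
    unfolding e using i by (rule integrable_mult_right)
  have "(\<integral>x. std_normal_density x *\<^sub>R iexp (- t * x) \<partial>lborel) = char std_normal_distribution (- t)"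
    unfolding char_def by (subst integral_density) auto
  also have "\<dots> = of_real (exp (- t\<^sup>2 / 2))" by (simp add: char_std_normal_distribution)
  finally show "(\<integral>x. of_real (exp (- x\<^sup>2 / 2)) * exp (- \<i> * of_real (x * t)) \<partial>lborel) = of_real (sqrt (2 * pi) * exp (- t\<^sup>2 / 2))"
    unfolding e by (simp only: Bochner_Integration.integral_mult_right_zero of_real_mult)
qed

text \<open>Both the Gaussian and the character are products over the coordinates. With this
  normalisation the Gaussian is its own Fourier transform.\<close>

lemma gauss_character:
  fixes t :: "'a::euclidean_space"
  shows "integrable lborel (\<lambda>x. of_real (gauss x) * character t x)"
    and "of_real (fourier_const TYPE('a)) * (\<integral>x. of_real (gauss x) * character t x \<partial>lborel) = of_real (gauss t)"
proof -
  let ?F = "\<lambda>b x. of_real (exp (- x\<^sup>2 / 2)) * exp (- \<i> * of_real (x * (t \<bullet> b))) :: complex"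
  have eq: "of_real (gauss x) * character t x = (\<Prod>b\<in>Basis. ?F b (x \<bullet> b))" for x :: 'a
  proof -
    have "character t x = (\<Prod>b\<in>Basis. exp (- \<i> * of_real ((x \<bullet> b) * (t \<bullet> b))))"
      by (simp add: character_def euclidean_inner[of x t] exp_sum[symmetric] sum_negf[symmetric] sum_distrib_left)
    then show ?thesis by (simp add: prod.distrib gauss_prod)
  qed
  show "integrable lborel (\<lambda>x. of_real (gauss x) * character t x)"
    unfolding eq by (rule lborel_integral_prod) (rule gauss_character_real)
  have "(\<integral>x. of_real (gauss x) * character t x \<partial>lborel) = (\<Prod>b\<in>(Basis::'a set). of_real (sqrt (2 * pi) * exp (- (t \<bullet> b)\<^sup>2 / 2)))"
    unfolding eq by (subst lborel_integral_prod(2)) (simp_all only: gauss_character_real)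
  also have "\<dots> = of_real (sqrt (2 * pi) ^ DIM('a) * (\<Prod>b\<in>(Basis::'a set). exp (- (t \<bullet> b)\<^sup>2 / 2)))"
    by (simp add: prod.distrib)
  also have "(\<Prod>b\<in>(Basis::'a set). exp (- (t \<bullet> b)\<^sup>2 / 2)) = gauss t"
    by (rule gauss_prod[symmetric])
  also have "sqrt (2 * pi) ^ DIM('a) = (2 * pi) powr (real DIM('a) / 2)"
    by (simp add: powr_half_sqrt[symmetric] powr_power mult.commute)
  finally have "of_real (fourier_const TYPE('a)) * (\<integral>x. of_real (gauss x) * character t x \<partial>lborel)
     = of_real (((2 * pi) powr (- real DIM('a) / 2) * (2 * pi) powr (real DIM('a) / 2)) * gauss t)"
    by (simp add: fourier_const_def mult.assoc)
  also have "(2 * pi) powr (- real DIM('a) / 2) * (2 * pi) powr (real DIM('a) / 2) = 1"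
    by (simp add: powr_add[symmetric])
  finally show "of_real (fourier_const TYPE('a)) * (\<integral>x. of_real (gauss x) * character t x \<partial>lborel) = of_real (gauss t)"
    by simp
qed

lemma integrable_gauss: "integrable lborel (gauss :: 'a::euclidean_space \<Rightarrow> real)"
proof -
  have "integrable lborel (\<lambda>x::'a. norm (of_real (gauss x) * character 0 x))"
    by (rule integrable_norm[OF gauss_character(1)])
  then show ?thesis by (simp add: norm_mult)
qed

lemma integral_gauss: "fourier_const TYPE('a) * (\<integral>x. gauss (x::'a::euclidean_space) \<partial>lborel) = 1"
proof -
  have "of_real (fourier_const TYPE('a)) * (\<integral>x. of_real (gauss (x::'a)) * character 0 x \<partial>lborel) = of_real 1"
    using gauss_character(2)[of "0::'a"] by simp
  moreover have "character 0 x = 1" for x :: 'a by (simp add: character_def)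
  ultimately have "complex_of_real (fourier_const TYPE('a) * (\<integral>x. gauss (x::'a) \<partial>lborel)) = of_real 1"
    by simp
  then show ?thesis by (simp only: of_real_eq_iff)
qed

lemma integrable_gauss_scaled: "e \<noteq> 0 \<Longrightarrow> integrable lborel (\<lambda>x. gauss (e *\<^sub>R (x::'a::euclidean_space)))"
  using lborel_integrable_affine[OF integrable_gauss, of e 0] by simp

text \<open>Multiplying the Fourier transform by a Gaussian of width \<open>1/e\<close> averages \<open>u\<close> over
  distances of order \<open>e\<close>.\<close>

lemma fourier_gauss_mean:
  fixes u :: "'a::euclidean_space \<Rightarrow> complex"
  assumes u: "integrable lborel u" and e: "0 < e"
  shows "of_real (fourier_const TYPE('a)) * (\<integral>\<xi>. fourier u \<xi> * character (- t) \<xi> * of_real (gauss (e *\<^sub>R \<xi>)) \<partial>lborel)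
    = of_real (fourier_const TYPE('a)) * (\<integral>r. u (t - e *\<^sub>R r) * of_real (gauss r) \<partial>lborel)"
proof -
  let ?c = "complex_of_real (fourier_const TYPE('a))"
  have [measurable]: "u \<in> borel_measurable borel" using borel_measurable_integrable[OF u] by simp
  define K where "K s = (\<integral>\<xi>. character (s - t) \<xi> * of_real (gauss (e *\<^sub>R \<xi>)) \<partial>lborel)" for s
  \<comment> \<open>After the interchange of the integrals the kernel in s is a Gaussian of width e
    centred at t; the substitution s = t - e r brings it to unit width, and the last factor is the
    Jacobian.\<close>
  have K: "?c * K (t - e *\<^sub>R r) * of_real (e ^ DIM('a)) = of_real (gauss r)" for r :: 'a
  proof -
    have "(\<integral>\<zeta>. of_real (gauss \<zeta>) * character (- r) \<zeta> \<partial>lborel)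
      = (\<bar>e\<bar> ^ DIM('a)) *\<^sub>R (\<integral>\<xi>. of_real (gauss (0 + e *\<^sub>R \<xi>)) * character (- r) (0 + e *\<^sub>R \<xi>) \<partial>lborel)"
      by (rule lborel_integral_affine[OF _ less_imp_neq[OF e, symmetric]]) measurable
    also have "\<dots> = of_real (e ^ DIM('a)) * K (t - e *\<^sub>R r)"
      using e by (simp add: K_def character_def scaleR_conv_of_real mult_ac)
    finally show ?thesis using gauss_character(2)[of "- r"] by (simp add: mult_ac gauss_def)
  qed
  have "(\<integral>\<xi>. fourier u \<xi> * character (- t) \<xi> * of_real (gauss (e *\<^sub>R \<xi>)) \<partial>lborel)
    = (\<integral>\<xi>. (\<integral>s. ?c * (u s * (character (s - t) \<xi> * of_real (gauss (e *\<^sub>R \<xi>)))) \<partial>lborel) \<partial>lborel)"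
  proof (intro Bochner_Integration.integral_cong refl)
    fix \<xi> :: 'a
    have ch: "character \<xi> s * character (- t) \<xi> = character (s - t) \<xi>" for s
      by (simp add: character_def exp_add[symmetric] inner_diff_right inner_commute algebra_simps)
    have "fourier u \<xi> * character (- t) \<xi> * of_real (gauss (e *\<^sub>R \<xi>))
      = (\<integral>s. (u s * character \<xi> s) * (?c * (character (- t) \<xi> * of_real (gauss (e *\<^sub>R \<xi>)))) \<partial>lborel)"
      by (simp only: fourier_eq Bochner_Integration.integral_mult_left_zero) (simp only: mult_ac)
    also have "\<dots> = (\<integral>s. ?c * (u s * (character (s - t) \<xi> * of_real (gauss (e *\<^sub>R \<xi>)))) \<partial>lborel)"
      by (simp add: ch[symmetric] mult_ac)
    finally show "fourier u \<xi> * character (- t) \<xi> * of_real (gauss (e *\<^sub>R \<xi>))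
      = (\<integral>s. ?c * (u s * (character (s - t) \<xi> * of_real (gauss (e *\<^sub>R \<xi>)))) \<partial>lborel)" .
  qed
  also have "\<dots> = (\<integral>s. (\<integral>\<xi>. ?c * (u s * (character (s - t) \<xi> * of_real (gauss (e *\<^sub>R \<xi>)))) \<partial>lborel) \<partial>lborel)"
  proof (rule Fubini_bound[where f = "\<lambda>\<xi>. norm ?c * gauss (e *\<^sub>R \<xi>)" and g = "\<lambda>s. norm (u s)"])
    show "integrable lborel (\<lambda>\<xi>. norm ?c * gauss (e *\<^sub>R (\<xi>::'a)))"
      using integrable_gauss_scaled[of e] e by (intro integrable_mult_right) auto
    have [measurable]: "(\<lambda>(\<xi>, s). character (s - t) \<xi>) \<in> borel_measurable (borel \<Otimes>\<^sub>M borel)"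
      unfolding character_def by measurable
    show "(\<lambda>(\<xi>, s). ?c * (u s * (character (s - t) \<xi> * of_real (gauss (e *\<^sub>R \<xi>))))) \<in> borel_measurable (borel \<Otimes>\<^sub>M borel)"
      by measurable
  qed (use u in \<open>auto simp: norm_mult\<close>)
  also have "\<dots> = (\<integral>s. ?c * (u s * K s) \<partial>lborel)"
    by (simp add: K_def)
  also have "\<dots> = (\<bar>- e\<bar> ^ DIM('a)) *\<^sub>R (\<integral>r. ?c * (u (t + (- e) *\<^sub>R r) * K (t + (- e) *\<^sub>R r)) \<partial>lborel)"
  proof (rule lborel_integral_affine)
    have "(\<lambda>s. \<integral>\<xi>. character (s - t) \<xi> * of_real (gauss (e *\<^sub>R \<xi>)) \<partial>lborel) \<in> borel_measurable borel"
      unfolding character_def by measurable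
    then have [measurable]: "K \<in> borel_measurable borel" by (simp add: K_def[abs_def])
    show "(\<lambda>s. ?c * (u s * K s)) \<in> borel_measurable borel" by measurable
  qed (use e in simp)
  also have "\<dots> = (\<integral>r. u (t - e *\<^sub>R r) * (?c * K (t - e *\<^sub>R r) * of_real (e ^ DIM('a))) \<partial>lborel)"
    using e by (simp add: scaleR_conv_of_real mult_ac)
  also have "\<dots> = (\<integral>r. u (t - e *\<^sub>R r) * of_real (gauss r) \<partial>lborel)" by (simp only: K)
  finally show ?thesis by simp
qed

text \<open>Fourier inversion for u at t with a Gaussian convergence factor. By
  \<open>fourier_gauss_mean\<close> this is an average of u over distances of order 1 / (m +
  1).\<close>

definition gauss_mean :: "('a::euclidean_space \<Rightarrow> complex) \<Rightarrow> nat \<Rightarrow> 'a \<Rightarrow> complex" where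
  "gauss_mean u m t = of_real (fourier_const TYPE('a)) *
     (\<integral>\<xi>. fourier u \<xi> * character (- t) \<xi> * of_real (gauss ((1 / Suc m) *\<^sub>R \<xi>)) \<partial>lborel)"

lemma gauss_mean_bound:
  fixes u :: "'a::euclidean_space \<Rightarrow> complex"
  assumes u: "integrable lborel u" and B: "\<And>x. norm (u x) \<le> B"
  shows "norm (gauss_mean u m t) \<le> B"
proof -
  have "norm (gauss_mean u m t) = fourier_const TYPE('a) * norm (\<integral>r. u (t - (1 / Suc m) *\<^sub>R r) * of_real (gauss r) \<partial>lborel)"
    unfolding gauss_mean_def using fourier_const_pos[where 'a = 'a] by (subst fourier_gauss_mean[OF u]) (simp_all add: norm_mult)
  also have "\<dots> \<le> fourier_const TYPE('a) * (\<integral>r. B * gauss (r::'a) \<partial>lborel)"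
    using integrable_gauss[where 'a = 'a] fourier_const_pos[where 'a = 'a] B
    by (intro mult_left_mono norm_integral_le) (auto simp: norm_mult intro!: mult_right_mono)
  also have "\<dots> = B" using integral_gauss[where 'a = 'a] by (simp add: mult.left_commute)
  finally show ?thesis .
qed

lemma gauss_mean_tendsto:
  fixes u :: "'a::euclidean_space \<Rightarrow> complex"
  assumes u: "integrable lborel u" and B: "\<And>x. norm (u x) \<le> B" and c: "continuous_on UNIV u"
  shows "(\<lambda>m. gauss_mean u m t) \<longlonglongrightarrow> u t"
proof -
  have [measurable]: "u \<in> borel_measurable borel" using borel_measurable_integrable[OF u] by simp
  have "(\<lambda>m. \<integral>r. u (t - (1 / Suc m) *\<^sub>R r) * of_real (gauss r) \<partial>lborel) \<longlonglongrightarrow> (\<integral>r. u t * of_real (gauss (r::'a)) \<partial>lborel)"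
  proof (rule integral_dominated_convergence)
    show "integrable lborel (\<lambda>r::'a. B * gauss r)" using integrable_gauss[where 'a = 'a] by simp
    show "AE r in lborel. norm (u (t - (1 / Suc m) *\<^sub>R r) * of_real (gauss r)) \<le> B * gauss r" for m
      using B by (auto simp: norm_mult intro!: mult_right_mono)
    show "AE r in lborel. (\<lambda>m. u (t - (1 / Suc m) *\<^sub>R r) * of_real (gauss r)) \<longlonglongrightarrow> u t * of_real (gauss r)"
    proof (rule AE_I2)
      fix r :: 'a
      have "(\<lambda>m. 1 / real (Suc m)) \<longlonglongrightarrow> 0" using LIMSEQ_inverse_real_of_nat by (simp add: inverse_eq_divide)
      then have "(\<lambda>m. t - (1 / Suc m) *\<^sub>R r) \<longlonglongrightarrow> t - 0 *\<^sub>R r" by (intro tendsto_intros)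
      moreover have "isCont u t" using c by (simp add: continuous_on_eq_continuous_at)
      ultimately have "(\<lambda>m. u (t - (1 / Suc m) *\<^sub>R r)) \<longlonglongrightarrow> u t"
        by (intro isCont_tendsto_compose[of t u]) auto
      then show "(\<lambda>m. u (t - (1 / Suc m) *\<^sub>R r) * of_real (gauss r)) \<longlonglongrightarrow> u t * of_real (gauss r)"
        by (intro tendsto_intros)
    qed
  qed measurable
  then have "(\<lambda>m. of_real (fourier_const TYPE('a)) * (\<integral>r. u (t - (1 / Suc m) *\<^sub>R r) * of_real (gauss r) \<partial>lborel))
    \<longlonglongrightarrow> of_real (fourier_const TYPE('a)) * (\<integral>r. u t * of_real (gauss (r::'a)) \<partial>lborel)"
    by (intro tendsto_intros)
  also have "of_real (fourier_const TYPE('a)) * (\<integral>r. u t * of_real (gauss (r::'a)) \<partial>lborel)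
     = u t * of_real (fourier_const TYPE('a) * (\<integral>r. gauss (r::'a) \<partial>lborel))" by simp
  also have "\<dots> = u t" unfolding integral_gauss by simp
  finally show ?thesis unfolding gauss_mean_def by (subst fourier_gauss_mean[OF u]) simp_all
qed

lemma gauss_scaled_tendsto: fixes \<xi> :: "'a::euclidean_space" shows "(\<lambda>m. gauss ((1 / real (Suc m)) *\<^sub>R \<xi>)) \<longlonglongrightarrow> 1"
proof -
  have "(\<lambda>m. 1 / real (Suc m)) \<longlonglongrightarrow> 0" using LIMSEQ_inverse_real_of_nat by (simp add: inverse_eq_divide)
  then have "(\<lambda>m. (1 / real (Suc m)) *\<^sub>R \<xi>) \<longlonglongrightarrow> 0 *\<^sub>R \<xi>" by (intro tendsto_intros)
  moreover have "isCont gauss (0 *\<^sub>R \<xi>)" using continuous_on_gauss[of "UNIV :: 'a set"] by (simp add: continuous_on_eq_continuous_at)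
  ultimately have "(\<lambda>m. gauss ((1 / real (Suc m)) *\<^sub>R \<xi>)) \<longlonglongrightarrow> gauss (0 *\<^sub>R \<xi>)"
    by (rule isCont_tendsto_compose[rotated])
  then show ?thesis by simp
qed

text \<open>For the Gaussian means of u the formula is Fubini's theorem. The Gaussian is then
  removed by dominated convergence, with majorant B |k| on the left and the integrable product on
  the right. Integrability is asked of the product of the transforms rather than of each, because
  the transform of a windowed low-pass function is only known to be bounded. The pairing is
  bilinear, hence the argument - \<xi>.\<close>

theorem fourier_parseval:
  fixes u k :: "'a::euclidean_space \<Rightarrow> complex"
  assumes u: "integrable lborel u" and B: "\<And>x. norm (u x) \<le> B" and c: "continuous_on UNIV u"
    and k: "integrable lborel k" and uk: "integrable lborel (\<lambda>\<xi>. fourier u \<xi> * fourier k (- \<xi>))"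
  shows "(\<integral>x. u x * k x \<partial>lborel) = (\<integral>\<xi>. fourier u \<xi> * fourier k (- \<xi>) \<partial>lborel)"
proof (rule LIMSEQ_unique)
  let ?c = "complex_of_real (fourier_const TYPE('a))"
  have [measurable]: "u \<in> borel_measurable borel" "k \<in> borel_measurable borel"
    using borel_measurable_integrable[OF u] borel_measurable_integrable[OF k] by auto
  have gm [measurable]: "gauss_mean u m \<in> borel_measurable borel" for m
  proof -
    have "(\<lambda>t. \<integral>\<xi>. fourier u \<xi> * character (- t) \<xi> * of_real (gauss ((1 / Suc m) *\<^sub>R \<xi>)) \<partial>lborel) \<in> borel_measurable borel"
      unfolding character_def by measurable
    then show ?thesis unfolding gauss_mean_def[abs_def] by measurable
  qed
  show "(\<lambda>m. \<integral>t. gauss_mean u m t * k t \<partial>lborel) \<longlonglongrightarrow> (\<integral>x. u x * k x \<partial>lborel)"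
  proof (rule integral_dominated_convergence)
    show "integrable lborel (\<lambda>t. B * norm (k t))" using k by simp
    show "AE t in lborel. norm (gauss_mean u m t * k t) \<le> B * norm (k t)" for m
      using gauss_mean_bound[OF u B] by (auto simp: norm_mult intro!: mult_right_mono)
    show "AE t in lborel. (\<lambda>m. gauss_mean u m t * k t) \<longlonglongrightarrow> u t * k t"
      by (intro AE_I2 tendsto_intros gauss_mean_tendsto[OF u B c])
  qed measurable
  have eq: "(\<integral>t. gauss_mean u m t * k t \<partial>lborel)
     = (\<integral>\<xi>. of_real (gauss ((1 / Suc m) *\<^sub>R \<xi>)) * (fourier u \<xi> * fourier k (- \<xi>)) \<partial>lborel)" for m
  proof -
    have [measurable]: "(\<lambda>(t, \<xi>). character (- t) \<xi>) \<in> borel_measurable (borel \<Otimes>\<^sub>M borel)"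
      unfolding character_def by measurable
    obtain D where D: "\<And>\<xi>. norm (fourier u \<xi>) \<le> D" using norm_fourier_le[OF u] by blast
    have "(\<integral>t. gauss_mean u m t * k t \<partial>lborel)
      = (\<integral>t. (\<integral>\<xi>. ?c * (fourier u \<xi> * character (- t) \<xi> * of_real (gauss ((1 / Suc m) *\<^sub>R \<xi>)) * k t) \<partial>lborel) \<partial>lborel)"
      by (simp only: gauss_mean_def Bochner_Integration.integral_mult_left_zero Bochner_Integration.integral_mult_right_zero)
        (simp only: mult.assoc Bochner_Integration.integral_mult_right_zero)
    also have "\<dots> = (\<integral>\<xi>. (\<integral>t. ?c * (fourier u \<xi> * character (- t) \<xi> * of_real (gauss ((1 / Suc m) *\<^sub>R \<xi>)) * k t) \<partial>lborel) \<partial>lborel)"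
    proof (rule Fubini_bound[where f = "\<lambda>t. norm (k t)" and g = "\<lambda>\<xi>. norm ?c * D * gauss ((1 / Suc m) *\<^sub>R \<xi>)"])
      show "integrable lborel (\<lambda>\<xi>. norm ?c * D * gauss ((1 / Suc m) *\<^sub>R (\<xi>::'a)))"
        using integrable_gauss_scaled[of "1 / Suc m"] by (intro integrable_mult_right) auto
      show "norm (?c * (fourier u \<xi> * character (- t) \<xi> * of_real (gauss ((1 / Suc m) *\<^sub>R \<xi>)) * k t))
        \<le> norm (k t) * (norm ?c * D * gauss ((1 / Suc m) *\<^sub>R \<xi>))" for t \<xi>
      proof -
        have "norm (fourier u \<xi>) * (norm ?c * gauss ((1 / Suc m) *\<^sub>R \<xi>) * norm (k t)) \<le> D * (norm ?c * gauss ((1 / Suc m) *\<^sub>R \<xi>) * norm (k t))"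
          by (intro mult_right_mono D) auto
        then show ?thesis by (simp add: norm_mult mult_ac)
      qed
    qed (use k in \<open>measurable, simp\<close>)
    also have "\<dots> = (\<integral>\<xi>. of_real (gauss ((1 / Suc m) *\<^sub>R \<xi>)) * (fourier u \<xi> * fourier k (- \<xi>)) \<partial>lborel)"
    proof (intro Bochner_Integration.integral_cong refl)
      fix \<xi> :: 'a
      have ch: "character (- t) \<xi> = character (- \<xi>) t" for t :: 'a by (simp add: character_def inner_commute)
      have "(\<integral>t. ?c * (fourier u \<xi> * character (- t) \<xi> * of_real (gauss ((1 / Suc m) *\<^sub>R \<xi>)) * k t) \<partial>lborel)
        = (\<integral>t. (k t * character (- \<xi>) t) * (?c * fourier u \<xi> * of_real (gauss ((1 / Suc m) *\<^sub>R \<xi>))) \<partial>lborel)"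
        by (simp only: ch mult_ac)
      also have "\<dots> = of_real (gauss ((1 / Suc m) *\<^sub>R \<xi>)) * (fourier u \<xi> * fourier k (- \<xi>))"
        by (simp only: fourier_eq Bochner_Integration.integral_mult_left_zero) (simp only: mult_ac)
      finally show "(\<integral>t. ?c * (fourier u \<xi> * character (- t) \<xi> * of_real (gauss ((1 / Suc m) *\<^sub>R \<xi>)) * k t) \<partial>lborel)
        = of_real (gauss ((1 / Suc m) *\<^sub>R \<xi>)) * (fourier u \<xi> * fourier k (- \<xi>))" .
    qed
    finally show ?thesis .
  qed
  show "(\<lambda>m. \<integral>t. gauss_mean u m t * k t \<partial>lborel) \<longlonglongrightarrow> (\<integral>\<xi>. fourier u \<xi> * fourier k (- \<xi>) \<partial>lborel)"
    unfolding eq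
  proof (rule integral_dominated_convergence)
    show "integrable lborel (\<lambda>\<xi>. norm (fourier u \<xi> * fourier k (- \<xi>)))" using uk by (rule integrable_norm)
    show "AE \<xi> in lborel. norm (of_real (gauss ((1 / Suc m) *\<^sub>R \<xi>)) * (fourier u \<xi> * fourier k (- \<xi>))) \<le> norm (fourier u \<xi> * fourier k (- \<xi>))" for m
      by (intro AE_I2) (simp add: norm_mult mult_left_le_one_le gauss_le_1)
    show "AE \<xi> in lborel. (\<lambda>m. of_real (gauss ((1 / Suc m) *\<^sub>R \<xi>)) * (fourier u \<xi> * fourier k (- \<xi>))) \<longlonglongrightarrow> fourier u \<xi> * fourier k (- \<xi>)"
    proof (rule AE_I2)
      fix \<xi> :: 'a
      have "(\<lambda>m. of_real (gauss ((1 / Suc m) *\<^sub>R \<xi>)) * (fourier u \<xi> * fourier k (- \<xi>))) \<longlonglongrightarrow> of_real 1 * (fourier u \<xi> * fourier k (- \<xi>))"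
        by (intro tendsto_mult tendsto_of_real gauss_scaled_tendsto tendsto_const)
      then show "(\<lambda>m. of_real (gauss ((1 / Suc m) *\<^sub>R \<xi>)) * (fourier u \<xi> * fourier k (- \<xi>))) \<longlonglongrightarrow> fourier u \<xi> * fourier k (- \<xi>)"
        by simp
    qed
  qed measurable
qed

text \<open>Fourier inversion at the origin: the Gaussian means at 0 tend to u 0 by continuity, and
  to the left-hand side by dominated convergence.\<close>

lemma integral_fourier:
  fixes u :: "'a::euclidean_space \<Rightarrow> complex"
  assumes u: "u \<in> schwartz_space"
  shows "of_real (fourier_const TYPE('a)) * (\<integral>\<xi>. fourier u \<xi> \<partial>lborel) = u 0"
proof (rule LIMSEQ_unique)
  note i = schwartz_integrable[OF schwartz_fourier[OF u]]
  have [measurable]: "fourier u \<in> borel_measurable borel" by (rule schwartz_measurable[OF schwartz_fourier[OF u]])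
  obtain B where B: "\<And>x. norm (u x) \<le> B" by (rule schwartz_bounded[OF u]) blast
  show "(\<lambda>m. gauss_mean u m 0) \<longlonglongrightarrow> u 0"
    by (rule gauss_mean_tendsto[OF schwartz_integrable[OF u] B smooth_continuous[OF schwartz_smooth[OF u]]])
  have "(\<lambda>m. \<integral>\<xi>. fourier u \<xi> * character (- 0) \<xi> * of_real (gauss ((1 / Suc m) *\<^sub>R \<xi>)) \<partial>lborel) \<longlonglongrightarrow> (\<integral>\<xi>. fourier u \<xi> \<partial>lborel)"
  proof (rule integral_dominated_convergence[OF _ _ integrable_norm[OF i]])
    show "AE \<xi> in lborel. norm (fourier u \<xi> * character (- 0) \<xi> * of_real (gauss ((1 / Suc m) *\<^sub>R \<xi>))) \<le> norm (fourier u \<xi>)" for m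
      by (intro AE_I2) (simp add: norm_mult mult_left_le gauss_le_1)
    show "AE \<xi> in lborel. (\<lambda>m. fourier u \<xi> * character (- 0) \<xi> * of_real (gauss ((1 / Suc m) *\<^sub>R \<xi>))) \<longlonglongrightarrow> fourier u \<xi>"
    proof (rule AE_I2)
      fix \<xi> :: 'a
      have "(\<lambda>m. fourier u \<xi> * character (- 0) \<xi> * of_real (gauss ((1 / Suc m) *\<^sub>R \<xi>))) \<longlonglongrightarrow> fourier u \<xi> * character (- 0) \<xi> * of_real 1"
        by (intro tendsto_mult tendsto_of_real gauss_scaled_tendsto tendsto_const)
      then show "(\<lambda>m. fourier u \<xi> * character (- 0) \<xi> * of_real (gauss ((1 / Suc m) *\<^sub>R \<xi>))) \<longlonglongrightarrow> fourier u \<xi>"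
        by (simp add: character_def)
    qed
  qed measurable
  then show "(\<lambda>m. gauss_mean u m 0) \<longlonglongrightarrow> of_real (fourier_const TYPE('a)) * (\<integral>\<xi>. fourier u \<xi> \<partial>lborel)"
    unfolding gauss_mean_def by (intro tendsto_intros)
qed

section \<open>Tempered distributions\<close>

lemma tempered_add:
  assumes "f \<in> tempered_distributions" "\<phi> \<in> schwartz_space" "\<eta> \<in> schwartz_space"
  shows "f (\<lambda>x. \<phi> x + \<eta> x) = f \<phi> + f \<eta>"
  using assms by (auto simp: tempered_distributions_def)

lemma tempered_cmult:
  assumes "f \<in> tempered_distributions" "\<phi> \<in> schwartz_space"
  shows "f (\<lambda>x. a * \<phi> x) = a * f \<phi>"
  using assms by (auto simp: tempered_distributions_def)

lemma schwartz_diff: "\<phi> \<in> schwartz_space \<Longrightarrow> \<eta> \<in> schwartz_space \<Longrightarrow> (\<lambda>x. \<phi> x - \<eta> x) \<in> schwartz_space"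
  using schwartz_add[of \<phi> "\<lambda>x. (-1) * \<eta> x"] schwartz_cmult[of \<eta> "-1"] by simp

lemma tempered_diff:
  assumes "f \<in> tempered_distributions" "\<phi> \<in> schwartz_space" "\<eta> \<in> schwartz_space"
  shows "f (\<lambda>x. \<phi> x - \<eta> x) = f \<phi> - f \<eta>"
  using tempered_add[OF assms(1,2) schwartz_cmult[OF assms(3)], of "-1"] tempered_cmult[OF assms(1,3), of "-1"] by simp

lemma tempered_sum:
  assumes f: "f \<in> tempered_distributions" and "finite I" "\<And>i. i \<in> I \<Longrightarrow> \<phi> i \<in> schwartz_space"
  shows "f (\<lambda>x. \<Sum>i\<in>I. a i * \<phi> i x) = (\<Sum>i\<in>I. a i * f (\<phi> i))"
  using assms(2,3)
proof (induction I)
  case empty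
  show ?case using tempered_cmult[OF f schwartz_zero, of 0] by simp
next
  case (insert i I)
  have "(\<lambda>x. \<Sum>i\<in>I. a i * \<phi> i x) \<in> schwartz_space"
    using insert by (intro schwartz_sum schwartz_cmult) auto
  then show ?case
    using insert tempered_add[OF f, of "\<lambda>x. a i * \<phi> i x" "\<lambda>x. \<Sum>i\<in>I. a i * \<phi> i x"] tempered_cmult[OF f, of "\<phi> i" "a i"]
    by (simp add: schwartz_cmult)
qed

lemma tempered_bound:
  assumes "f \<in> tempered_distributions"
  obtains C N where "0 \<le> C" "\<And>\<phi>. \<phi> \<in> schwartz_space \<Longrightarrow> norm (f \<phi>) \<le> C * schwartz_norm N \<phi>"
proof -
  obtain C N where C: "\<And>\<phi>. \<phi> \<in> schwartz_space \<Longrightarrow> norm (f \<phi>) \<le> C * schwartz_norm N \<phi>"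
    using assms unfolding tempered_distributions_def by blast
  have "norm (f \<phi>) \<le> max C 0 * schwartz_norm N \<phi>" if "\<phi> \<in> schwartz_space" for \<phi>
    using C[OF that] schwartz_norm_nonneg[OF that, of N] mult_right_mono[of C "max C 0" "schwartz_norm N \<phi>"] by simp
  then show ?thesis by (intro that[of "max C 0" N]) auto
qed

lemma tempered_tf_shift_bound:
  assumes f: "f \<in> tempered_distributions" and g: "g \<in> schwartz_space"
  obtains C N where "0 \<le> C" "\<And>x \<xi>. norm (f (tf_shift x \<xi> g)) \<le> C * (1 + norm x) ^ N * (1 + norm \<xi>) ^ N"
proof -
  obtain C N where C: "0 \<le> C" "\<And>\<phi>. \<phi> \<in> schwartz_space \<Longrightarrow> norm (f \<phi>) \<le> C * schwartz_norm N \<phi>"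
    by (rule tempered_bound[OF f]) blast
  obtain D where D: "0 < D" "\<And>x \<xi>. schwartz_norm N (tf_shift x \<xi> g) \<le> D * (1 + norm x) ^ N * (1 + norm \<xi>) ^ N"
    by (rule schwartz_norm_tf_shift[OF g, where N = N]) blast
  have "norm (f (tf_shift x \<xi> g)) \<le> (C * D) * (1 + norm x) ^ N * (1 + norm \<xi>) ^ N" for x \<xi>
    using order_trans[OF C(2)[OF schwartz_tf_shift[OF g]] mult_left_mono[OF D(2) C(1)]] by (simp add: mult.assoc)
  then show ?thesis using C D by (intro that[of "C * D" N]) auto
qed

lemma tf_shift_0: "tf_shift x 0 g = (\<lambda>t. g (t - x))"
  by (simp add: tf_shift_def character_def)

lemma tempered_shift_diff:
  assumes f: "f \<in> tempered_distributions" and g: "g \<in> schwartz_space"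
  obtains C N where "0 \<le> C" "\<And>v y. norm (f (\<lambda>t. g (t - v)) - f (\<lambda>t. g (t - y))) \<le> C * norm (v - y) * (1 + norm (v - y)) ^ N * (1 + norm y) ^ N"
proof -
  obtain C N where C: "0 \<le> C" "\<And>\<phi>. \<phi> \<in> schwartz_space \<Longrightarrow> norm (f \<phi>) \<le> C * schwartz_norm N \<phi>"
    by (rule tempered_bound[OF f]) blast
  obtain D where D: "0 < D" "\<And>v y. schwartz_norm N (\<lambda>t. g (t - v) - g (t - y)) \<le> D * norm (v - y) * (1 + norm (v - y)) ^ N * (1 + norm y) ^ N"
    by (rule schwartz_norm_shift_diff[OF g, where N = N]) blast
  have "norm (f (\<lambda>t. g (t - v)) - f (\<lambda>t. g (t - y))) \<le> (C * D) * norm (v - y) * (1 + norm (v - y)) ^ N * (1 + norm y) ^ N" for v y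
  proof -
    have "norm (f (\<lambda>t. g (t - v)) - f (\<lambda>t. g (t - y))) \<le> C * schwartz_norm N (\<lambda>t. g (t - v) - g (t - y))"
      using C(2)[OF schwartz_diff[OF schwartz_shift[OF g] schwartz_shift[OF g]], of v y]
        tempered_diff[OF f schwartz_shift[OF g] schwartz_shift[OF g], of v y] by simp
    also have "\<dots> \<le> C * (D * norm (v - y) * (1 + norm (v - y)) ^ N * (1 + norm y) ^ N)"
      by (intro mult_left_mono D C)
    finally show ?thesis by (simp add: mult_ac)
  qed
  then show ?thesis using C D by (intro that[of "C * D" N]) auto
qed

lemma tempered_shift_continuous:
  fixes f :: "'a::euclidean_space functional"
  assumes f: "f \<in> tempered_distributions" and g: "g \<in> schwartz_space"
  shows "continuous_on UNIV (\<lambda>y. f (\<lambda>t. g (t - y)))"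
  unfolding continuous_on_eq_continuous_at[OF open_UNIV]
proof
  fix y :: 'a
  obtain C N where C: "0 \<le> C" "\<And>v y. norm (f (\<lambda>t. g (t - v)) - f (\<lambda>t. g (t - y))) \<le> C * norm (v - y) * (1 + norm (v - y)) ^ N * (1 + norm y) ^ N"
    by (rule tempered_shift_diff[OF f g]) blast
  have "((\<lambda>v. C * norm (v - y) * (1 + norm (v - y)) ^ N * (1 + norm y) ^ N) \<longlongrightarrow> C * norm (y - y) * (1 + norm (y - y)) ^ N * (1 + norm y) ^ N) (at y)"
    by (intro tendsto_intros)
  then have lim: "((\<lambda>v. C * norm (v - y) * (1 + norm (v - y)) ^ N * (1 + norm y) ^ N) \<longlongrightarrow> 0) (at y)" by simp
  have "((\<lambda>v. f (\<lambda>t. g (t - v)) - f (\<lambda>t. g (t - y))) \<longlongrightarrow> 0) (at y)"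
    by (rule Lim_null_comparison[OF _ lim]) (simp add: C)
  then show "isCont (\<lambda>y. f (\<lambda>t. g (t - y))) y"
    unfolding isCont_def by (rule LIM_zero_cancel)
qed

lemma schwartz_integrable_growth:
  fixes f :: "'a::euclidean_space \<Rightarrow> complex"
  assumes f: "f \<in> schwartz_space"
  shows "integrable lborel (\<lambda>x. norm (f x) * (C * (1 + norm x) ^ N))"
proof -
  obtain D where D: "0 < D" "\<And>x. norm (f x) \<le> D * decay (N + Suc DIM('a)) x" by (rule schwartz_decay[OF f]) blast
  have [measurable]: "f \<in> borel_measurable borel" by (rule schwartz_measurable[OF f])
  have "norm (norm (f x) * (1 + norm x) ^ N) \<le> D * decay (Suc DIM('a)) x" for x
  proof -
    have "norm (f x) * (1 + norm x) ^ N \<le> (D * decay (N + Suc DIM('a)) x) * (1 + norm x) ^ N"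
      using D by (intro mult_right_mono) auto
    also have "\<dots> = D * ((1 + norm x) ^ N * decay (N + Suc DIM('a)) x)" by (simp only: mult_ac)
    also have "\<dots> = D * decay (Suc DIM('a)) x" by (simp only: decay_cancel)
    finally show ?thesis by (simp add: abs_mult)
  qed
  then have "integrable lborel (\<lambda>x. norm (f x) * (1 + norm x) ^ N)"
    by (rule integrable_le_decay[rotated]) measurable
  then have "integrable lborel (\<lambda>x. C * (norm (f x) * (1 + norm x) ^ N))" by (rule integrable_mult_right)
  then show ?thesis by (simp add: mult_ac)
qed

text \<open>A tempered distribution commutes with a convolution integral: the Riemann sums obtained from
  simple functions \<open>s i \<rightarrow> id\<close> converge in every Schwartz norm.\<close>

theorem tempered_conv:
  fixes f :: "'a::euclidean_space functional"
  assumes f: "f \<in> tempered_distributions" and c: "\<rho> \<in> schwartz_space" and k: "\<kappa> \<in> schwartz_space"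
  shows "f (conv \<rho> \<kappa>) = (\<integral>y. \<rho> y * f (\<lambda>t. \<kappa> (t - y)) \<partial>lborel)"
proof -
  have [measurable]: "\<rho> \<in> borel_measurable borel" "\<kappa> \<in> borel_measurable borel"
    using schwartz_measurable c k by auto
  \<comment> \<open>Besides pointwise convergence, the bound 2 |y| on s i y matters: functions of s
    i y of polynomial growth then have a common integrable majorant against \<rho>.\<close>
  obtain s where s: "\<And>i. simple_function lborel (s i)" "\<And>y::'a. (\<lambda>i. s i y) \<longlonglongrightarrow> y" "\<And>i y. dist (s i y) 0 \<le> 2 * dist y 0"
    using borel_measurable_implies_sequence_metric[of "\<lambda>x::'a. x" lborel 0] by auto
  have s_norm: "norm (s i y) \<le> 2 * norm y" for i y using s(3)[of i y] by simp
  have fin: "finite (range (s i))" for i using s(1)[of i] by (simp add: simple_function_def)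
  have meas: "s i -` {v} \<in> sets borel" for i v
  proof (cases "v \<in> range (s i)")
    case False
    then have "s i -` {v} = {}" by auto
    then show ?thesis by simp
  qed (use s(1)[of i] in \<open>auto simp: simple_function_def\<close>)
  have [measurable]: "s i \<in> borel_measurable borel" for i
    using borel_measurable_simple_function[OF s(1)[of i]] by simp
  \<comment> \<open>The weights of the Riemann sum: the integral of \<rho> over the cell on which s
    i takes the value v.\<close>
  define a where "a i v = (\<integral>y. \<rho> y * indicator (s i -` {v}) y \<partial>lborel)" for i v
  have ind: "integrable lborel (\<lambda>y. \<rho> y * (indicator (s i -` {v}) y :: complex))" for i v
    using meas by (intro integrable_bounded_mult[where C = 1] schwartz_integrable c) (auto simp: indicator_def)
  have simple: "(\<Sum>v\<in>range (s i). a i v * F v) = (\<integral>y. \<rho> y * F (s i y) \<partial>lborel)" for i and F :: "'a \<Rightarrow> complex"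
  proof -
    have "\<rho> y * F (s i y) = (\<Sum>v\<in>range (s i). (\<rho> y * indicator (s i -` {v}) y) * F v)" for y
    proof -
      have "(\<Sum>v\<in>range (s i). (\<rho> y * indicator (s i -` {v}) y) * F v) = (\<Sum>v\<in>range (s i). if v = s i y then \<rho> y * F v else 0)"
        by (intro sum.cong) (auto simp: indicator_def)
      then show ?thesis using fin[of i] by simp
    qed
    then have "(\<integral>y. \<rho> y * F (s i y) \<partial>lborel) = (\<Sum>v\<in>range (s i). (\<integral>y. (\<rho> y * indicator (s i -` {v}) y) * F v \<partial>lborel))"
      by (simp add: Bochner_Integration.integral_sum ind)
    then show ?thesis by (simp add: a_def)
  qed
  define k' where "k' i = (\<lambda>t. \<Sum>v\<in>range (s i). a i v * \<kappa> (t - v))" for i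
  have k'S: "k' i \<in> schwartz_space" for i
    unfolding k'_def using fin by (intro schwartz_sum schwartz_cmult schwartz_shift k) auto
  have fk': "f (k' i) = (\<integral>y. \<rho> y * f (\<lambda>t. \<kappa> (t - s i y)) \<partial>lborel)" for i
    unfolding k'_def using fin by (subst tempered_sum[OF f]) (auto simp: simple intro!: schwartz_shift k)
  have cont: "continuous_on UNIV (\<lambda>y. f (\<lambda>t. \<kappa> (t - y)))" by (rule tempered_shift_continuous[OF f k])
  have [measurable]: "(\<lambda>y. f (\<lambda>t. \<kappa> (t - y))) \<in> borel_measurable borel"
    using cont by (rule borel_measurable_continuous_onI)
  have lim1: "(\<lambda>i. f (k' i)) \<longlonglongrightarrow> (\<integral>y. \<rho> y * f (\<lambda>t. \<kappa> (t - y)) \<partial>lborel)"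
    unfolding fk'
  proof -
    obtain C N where C: "0 \<le> C" "\<And>x \<xi>. norm (f (tf_shift x \<xi> \<kappa>)) \<le> C * (1 + norm x) ^ N * (1 + norm \<xi>) ^ N"
      by (rule tempered_tf_shift_bound[OF f k]) blast
    have C': "norm (f (\<lambda>t. \<kappa> (t - y))) \<le> C * (1 + norm y) ^ N" for y
      using C(2)[of y 0] by (simp add: tf_shift_0)
    show "(\<lambda>i. \<integral>y. \<rho> y * f (\<lambda>t. \<kappa> (t - s i y)) \<partial>lborel) \<longlonglongrightarrow> (\<integral>y. \<rho> y * f (\<lambda>t. \<kappa> (t - y)) \<partial>lborel)"
    proof (rule integral_dominated_convergence[OF _ _ schwartz_integrable_growth[OF c, of "C * 2 ^ N" N]])
      show "(\<lambda>y. \<rho> y * f (\<lambda>t. \<kappa> (t - s i y))) \<in> borel_measurable lborel" for i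
        using measurable_compose[of "s i" borel borel "\<lambda>y. f (\<lambda>t. \<kappa> (t - y))" borel] by measurable
      show "AE y in lborel. (\<lambda>i. \<rho> y * f (\<lambda>t. \<kappa> (t - s i y))) \<longlonglongrightarrow> \<rho> y * f (\<lambda>t. \<kappa> (t - y))"
      proof (intro AE_I2 tendsto_mult tendsto_const)
        fix y
        have "isCont (\<lambda>y. f (\<lambda>t. \<kappa> (t - y))) y" using cont by (simp add: continuous_on_eq_continuous_at)
        then show "(\<lambda>i. f (\<lambda>t. \<kappa> (t - s i y))) \<longlonglongrightarrow> f (\<lambda>t. \<kappa> (t - y))"
          by (rule isCont_tendsto_compose[OF _ s(2)])
      qed
      show "AE y in lborel. norm (\<rho> y * f (\<lambda>t. \<kappa> (t - s i y))) \<le> norm (\<rho> y) * (C * 2 ^ N * (1 + norm y) ^ N)" for i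
      proof (rule AE_I2)
        fix y
        have "(1 + norm (s i y)) ^ N \<le> (2 * (1 + norm y)) ^ N" using s_norm[of i y] by (intro power_mono) auto
        then have "C * (1 + norm (s i y)) ^ N \<le> C * (2 * (1 + norm y)) ^ N" using C(1) by (rule mult_left_mono)
        also have "\<dots> = C * 2 ^ N * (1 + norm y) ^ N" by (simp only: power_mult_distrib mult.assoc)
        finally have "C * (1 + norm (s i y)) ^ N \<le> C * 2 ^ N * (1 + norm y) ^ N" .
        then show "norm (\<rho> y * f (\<lambda>t. \<kappa> (t - s i y))) \<le> norm (\<rho> y) * (C * 2 ^ N * (1 + norm y) ^ N)"
          unfolding norm_mult using C'[of "s i y"] by (intro mult_left_mono) auto
      qed
    qed measurable
  qed
  obtain C N where C: "0 \<le> C" "\<And>\<phi>. \<phi> \<in> schwartz_space \<Longrightarrow> norm (f \<phi>) \<le> C * schwartz_norm N \<phi>"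
    by (rule tempered_bound[OF f]) blast
  obtain D where D: "0 < D" "\<And>v y. schwartz_norm N (\<lambda>t. \<kappa> (t - v) - \<kappa> (t - y)) \<le> D * norm (v - y) * (1 + norm (v - y)) ^ N * (1 + norm y) ^ N"
    by (rule schwartz_norm_shift_diff[OF k, where N = N]) blast
  \<comment> \<open>This number bounds the Schwartz norm of order N of the difference between the
    Riemann sum and the convolution, for all derivatives in that norm at once.\<close>
  define J where "J i = (\<integral>y. norm (\<rho> y) * (D * norm (s i y - y) * (1 + norm (s i y - y)) ^ N * (1 + norm y) ^ N) \<partial>lborel)" for i
  have diff_le: "norm (s i y - y) \<le> 3 * norm y" for i y using norm_triangle_ineq4[of "s i y" y] s_norm[of i y] by simp
  have Jdom: "norm (\<rho> y) * (D * norm (s i y - y) * (1 + norm (s i y - y)) ^ N * (1 + norm y) ^ N)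
      \<le> norm (\<rho> y) * ((D * 3 * 3 ^ N) * (1 + norm y) ^ (1 + N + N))" for i y
  proof -
    have "(1 + norm (s i y - y)) ^ N \<le> (3 * (1 + norm y)) ^ N" using diff_le[of i y] by (intro power_mono) auto
    then have "D * norm (s i y - y) * (1 + norm (s i y - y)) ^ N * (1 + norm y) ^ N
       \<le> D * (3 * (1 + norm y)) * (3 * (1 + norm y)) ^ N * (1 + norm y) ^ N"
      using diff_le[of i y] D(1) by (intro mult_mono mult_nonneg_nonneg) auto
    also have "\<dots> = (D * 3 * 3 ^ N) * (1 + norm y) ^ (1 + N + N)"
      by (simp only: power_mult_distrib power_add power_one_right mult_ac)
    finally show ?thesis by (intro mult_left_mono) auto
  qed
  have Jint: "integrable lborel (\<lambda>y. norm (\<rho> y) * (D * norm (s i y - y) * (1 + norm (s i y - y)) ^ N * (1 + norm y) ^ N))" for i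
    using D(1) Jdom by (intro Bochner_Integration.integrable_bound[OF schwartz_integrable_growth[OF c, of "D * 3 * 3 ^ N" "1 + N + N"]])
      (auto simp: abs_mult intro!: AE_I2)
  have J0: "J \<longlonglongrightarrow> 0"
  proof -
    have "(\<lambda>i. \<integral>y. norm (\<rho> y) * (D * norm (s i y - y) * (1 + norm (s i y - y)) ^ N * (1 + norm y) ^ N) \<partial>lborel) \<longlonglongrightarrow> (\<integral>y. 0 \<partial>(lborel :: 'a measure))"
    proof (rule integral_dominated_convergence[OF _ _ schwartz_integrable_growth[OF c, of "D * 3 * 3 ^ N" "1 + N + N"]])
      show "AE y in lborel. (\<lambda>i. norm (\<rho> y) * (D * norm (s i y - y) * (1 + norm (s i y - y)) ^ N * (1 + norm y) ^ N)) \<longlonglongrightarrow> 0"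
      proof (rule AE_I2)
        fix y
        have "(\<lambda>i. norm (\<rho> y) * (D * norm (s i y - y) * (1 + norm (s i y - y)) ^ N * (1 + norm y) ^ N))
          \<longlonglongrightarrow> norm (\<rho> y) * (D * norm (y - y) * (1 + norm (y - y)) ^ N * (1 + norm y) ^ N)"
          by (intro tendsto_intros s)
        then show "(\<lambda>i. norm (\<rho> y) * (D * norm (s i y - y) * (1 + norm (s i y - y)) ^ N * (1 + norm y) ^ N)) \<longlonglongrightarrow> 0" by simp
      qed
      show "AE y in lborel. norm (norm (\<rho> y) * (D * norm (s i y - y) * (1 + norm (s i y - y)) ^ N * (1 + norm y) ^ N))
        \<le> norm (\<rho> y) * ((D * 3 * 3 ^ N) * (1 + norm y) ^ (1 + N + N))" for i
      proof (rule AE_I2)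
        fix y
        have "0 \<le> norm (\<rho> y) * (D * norm (s i y - y) * (1 + norm (s i y - y)) ^ N * (1 + norm y) ^ N)" using D(1) by simp
        then show "norm (norm (\<rho> y) * (D * norm (s i y - y) * (1 + norm (s i y - y)) ^ N * (1 + norm y) ^ N))
        \<le> norm (\<rho> y) * ((D * 3 * 3 ^ N) * (1 + norm y) ^ (1 + N + N))"
          using Jdom[of y i] by (simp only: real_norm_def abs_of_nonneg)
      qed
    qed measurable
    then show ?thesis by (simp add: J_def[abs_def])
  qed
  have convS: "conv \<rho> \<kappa> \<in> schwartz_space" by (rule schwartz_conv[OF c k])
  have norm_le: "schwartz_norm N (\<lambda>t. k' i t - conv \<rho> \<kappa> t) \<le> J i" for i
  proof (rule schwartz_norm_least)
    fix t and bs :: "'a list" assume bs: "set bs \<subseteq> Basis" "length bs \<le> N"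
    note pk = schwartz_partials[OF k bs(1)]
    have [measurable]: "partials bs \<kappa> \<in> borel_measurable borel" by (rule schwartz_measurable[OF pk])
    obtain B where B: "\<And>x. norm (partials bs \<kappa> x) \<le> B" by (rule schwartz_bounded[OF pk]) blast
    have "partials bs (k' i) t = (\<Sum>v\<in>range (s i). a i v * partials bs \<kappa> (t - v))"
      unfolding k'_def using fin[of i] bs k
      by (subst partials_sum) (auto intro!: schwartz_cmult schwartz_shift sum.cong
          simp: partials_cmult[OF schwartz_smooth[OF schwartz_shift[OF k]]] partials_shift[OF schwartz_smooth[OF k]])
    also have "\<dots> = (\<integral>y. \<rho> y * partials bs \<kappa> (t - s i y) \<partial>lborel)" by (rule simple)
    finally have p1: "partials bs (k' i) t = (\<integral>y. \<rho> y * partials bs \<kappa> (t - s i y) \<partial>lborel)" .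
    have i1: "integrable lborel (\<lambda>y. \<rho> y * partials bs \<kappa> (t - s i y))"
      by (rule integrable_bounded_mult[OF schwartz_integrable[OF c] _ B]) measurable
    have i2: "integrable lborel (\<lambda>y. \<rho> y * partials bs \<kappa> (t - y))"
      by (rule integrable_bounded_mult[OF schwartz_integrable[OF c] _ B]) measurable
    have pd: "partials bs (\<lambda>t. u t - v t) t = partials bs u t - partials bs v t" if "u \<in> schwartz_space" "v \<in> schwartz_space" for u v t
      using partials_add[OF schwartz_smooth[OF that(1)] schwartz_smooth[OF schwartz_cmult[OF that(2)]] bs(1), of "-1"]
        partials_cmult[OF schwartz_smooth[OF that(2)] bs(1), of "-1"] by simp
    have "partials bs (\<lambda>t. k' i t - conv \<rho> \<kappa> t) t = (\<integral>y. \<rho> y * (partials bs \<kappa> (t - s i y) - partials bs \<kappa> (t - y)) \<partial>lborel)"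
      unfolding pd[OF k'S convS] p1 partials_conv[OF c k bs(1)] conv_def[of _ "partials bs \<kappa>"] using i1 i2
      by (simp add: right_diff_distrib)
    also have "norm \<dots> \<le> (\<integral>y. norm (\<rho> y) * (D * norm (s i y - y) * (1 + norm (s i y - y)) ^ N * (1 + norm y) ^ N) * decay N t \<partial>lborel)"
    proof (rule norm_integral_le)
      show "integrable lborel (\<lambda>y. norm (\<rho> y) * (D * norm (s i y - y) * (1 + norm (s i y - y)) ^ N * (1 + norm y) ^ N) * decay N t)"
        by (rule integrable_mult_left[OF Jint])
      fix y
      have "partials bs \<kappa> (t - s i y) - partials bs \<kappa> (t - y) = partials bs (\<lambda>t. \<kappa> (t - s i y) - \<kappa> (t - y)) t"
        using pd[OF schwartz_shift[OF k] schwartz_shift[OF k], of "s i y" y t] partials_shift[OF schwartz_smooth[OF k] bs(1)] by simp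
      also have "norm \<dots> \<le> schwartz_norm N (\<lambda>t. \<kappa> (t - s i y) - \<kappa> (t - y)) * decay N t"
        by (intro schwartz_norm_upper schwartz_diff schwartz_shift k bs)
      also have "\<dots> \<le> (D * norm (s i y - y) * (1 + norm (s i y - y)) ^ N * (1 + norm y) ^ N) * decay N t"
        by (intro mult_right_mono D) simp
      finally show "norm (\<rho> y * (partials bs \<kappa> (t - s i y) - partials bs \<kappa> (t - y)))
        \<le> norm (\<rho> y) * (D * norm (s i y - y) * (1 + norm (s i y - y)) ^ N * (1 + norm y) ^ N) * decay N t"
        unfolding norm_mult mult.assoc[of "norm (\<rho> y)"] by (intro mult_left_mono) auto
    qed
    also have "\<dots> = J i * decay N t" by (simp add: J_def)
    finally show "norm (partials bs (\<lambda>t. k' i t - conv \<rho> \<kappa> t) t) \<le> J i * decay N t" .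
  qed
  have "(\<lambda>i. f (k' i) - f (conv \<rho> \<kappa>)) \<longlonglongrightarrow> 0"
  proof (rule Lim_null_comparison)
    show "\<forall>\<^sub>F i in sequentially. norm (f (k' i) - f (conv \<rho> \<kappa>)) \<le> C * J i"
    proof (intro always_eventually allI)
      fix i
      have "norm (f (k' i) - f (conv \<rho> \<kappa>)) \<le> C * schwartz_norm N (\<lambda>t. k' i t - conv \<rho> \<kappa> t)"
        using C(2)[OF schwartz_diff[OF k'S convS]] tempered_diff[OF f k'S convS] by simp
      also have "\<dots> \<le> C * J i" by (intro mult_left_mono norm_le C)
      finally show "norm (f (k' i) - f (conv \<rho> \<kappa>)) \<le> C * J i" .
    qed
    show "(\<lambda>i. C * J i) \<longlonglongrightarrow> 0" using tendsto_mult_right_zero[OF J0] by simp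
  qed
  then have "(\<lambda>i. f (k' i)) \<longlonglongrightarrow> f (conv \<rho> \<kappa>)" by (rule LIM_zero_cancel)
  then show ?thesis using lim1 by (rule LIMSEQ_unique)
qed

section \<open>Low-pass approximations and short-time Fourier transforms\<close>

definition lp_kernel :: "('a::euclidean_space \<Rightarrow> complex) \<Rightarrow> nat \<Rightarrow> 'a \<Rightarrow> complex" where
  "lp_kernel \<psi> j = fourier (\<lambda>\<xi>. \<psi> (\<xi> /\<^sub>R 2 ^ j))"

text \<open>The value of S^j f at s, see \<open>low_pass_eq_dist_of_fun\<close>. The kernel is
  evaluated at t - s, the negative of the usual convolution argument, which is why
  \<open>lp_kernel\<close> uses the forward Fourier transform and not the inverse one.\<close>

definition lp_fun :: "('a::euclidean_space \<Rightarrow> complex) \<Rightarrow> 'a functional \<Rightarrow> nat \<Rightarrow> 'a \<Rightarrow> complex" where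
  "lp_fun \<psi> f j s = of_real (fourier_const TYPE('a)) * f (\<lambda>t. lp_kernel \<psi> j (t - s))"

lemma cutoff_schwartz: "cutoff_function \<psi> \<Longrightarrow> \<psi> \<in> schwartz_space"
  by (simp add: cutoff_function_def test_functions_schwartz)

lemma cutoff_0: "cutoff_function \<psi> \<Longrightarrow> \<psi> 0 = 1"
  unfolding cutoff_function_def by (auto dest: eventually_nhds_x_imp_x)

lemma schwartz_dilation: "f \<in> schwartz_space \<Longrightarrow> (\<lambda>\<xi>. f (\<xi> /\<^sub>R 2 ^ j)) \<in> schwartz_space"
  using schwartz_affine[of f "inverse (2 ^ j)" 1 0] by simp

lemma schwartz_lp_kernel: "cutoff_function \<psi> \<Longrightarrow> lp_kernel \<psi> j \<in> schwartz_space"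
  unfolding lp_kernel_def by (intro schwartz_fourier schwartz_dilation cutoff_schwartz)

lemma lp_kernel_scale:
  fixes \<psi> :: "'a::euclidean_space \<Rightarrow> complex"
  assumes "cutoff_function \<psi>"
  shows "lp_kernel \<psi> j u = of_real ((2 ^ j) ^ DIM('a)) * fourier \<psi> (2 ^ j *\<^sub>R u)"
proof -
  have [measurable]: "\<psi> \<in> borel_measurable borel" by (rule schwartz_measurable[OF cutoff_schwartz[OF assms]])
  have "(\<integral>t. \<psi> (t /\<^sub>R 2 ^ j) * character u t \<partial>lborel)
    = (\<bar>2 ^ j\<bar> ^ DIM('a)) *\<^sub>R (\<integral>t. \<psi> ((0 + 2 ^ j *\<^sub>R t) /\<^sub>R 2 ^ j) * character u (0 + 2 ^ j *\<^sub>R t) \<partial>lborel)"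
    by (rule lborel_integral_affine) auto
  also have "\<dots> = of_real ((2 ^ j) ^ DIM('a)) * (\<integral>t. \<psi> t * character (2 ^ j *\<^sub>R u) t \<partial>lborel)"
    by (simp add: character_def scaleR_conv_of_real)
  finally show ?thesis by (simp add: lp_kernel_def fourier_eq)
qed

text \<open>The substitution of v / 2^j for u frees the kernel of j and moves the scale into the
  argument of H, which makes the later estimates uniform in j.\<close>

lemma integral_lp_kernel:
  fixes \<psi> :: "'a::euclidean_space \<Rightarrow> complex"
  assumes \<psi>: "cutoff_function \<psi>" and [measurable]: "H \<in> borel_measurable borel"
  shows "(\<integral>u. lp_kernel \<psi> j u * H u \<partial>lborel) = (\<integral>v. fourier \<psi> v * H (v /\<^sub>R 2 ^ j) \<partial>lborel)"
proof -
  have [measurable]: "lp_kernel \<psi> j \<in> borel_measurable borel" by (rule schwartz_measurable[OF schwartz_lp_kernel[OF \<psi>]])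
  have "(\<integral>u. lp_kernel \<psi> j u * H u \<partial>lborel)
    = (\<bar>inverse (2 ^ j)\<bar> ^ DIM('a)) *\<^sub>R (\<integral>v. lp_kernel \<psi> j (0 + v /\<^sub>R 2 ^ j) * H (0 + v /\<^sub>R 2 ^ j) \<partial>lborel)"
    by (rule lborel_integral_affine) auto
  also have "(\<integral>v. lp_kernel \<psi> j (0 + v /\<^sub>R 2 ^ j) * H (0 + v /\<^sub>R 2 ^ j) \<partial>lborel)
     = of_real ((2 ^ j) ^ DIM('a)) * (\<integral>v. fourier \<psi> v * H (v /\<^sub>R 2 ^ j) \<partial>lborel)"
    by (simp add: lp_kernel_scale[OF \<psi>] mult.assoc)
  finally show ?thesis by (simp add: scaleR_conv_of_real power_inverse)
qed

text \<open>An approximate identity: by \<open>integral_fourier\<close> its total mass is \<psi> 0 =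
  1. The growth bound on H gives a majorant independent of j because |v / 2^j| <= |v|.\<close>

lemma lp_kernel_tendsto:
  fixes \<psi> :: "'a::euclidean_space \<Rightarrow> complex"
  assumes \<psi>: "cutoff_function \<psi>" and c: "continuous_on UNIV H" and bd: "\<And>u. norm (H u) \<le> C * (1 + norm u) ^ N" and C: "0 \<le> C"
  shows "(\<lambda>j. of_real (fourier_const TYPE('a)) * (\<integral>u. lp_kernel \<psi> j u * H u \<partial>lborel)) \<longlonglongrightarrow> H 0"
proof -
  have fS: "fourier \<psi> \<in> schwartz_space" by (rule schwartz_fourier[OF cutoff_schwartz[OF \<psi>]])
  have [measurable]: "H \<in> borel_measurable borel" using c by (rule borel_measurable_continuous_onI)
  have [measurable]: "fourier \<psi> \<in> borel_measurable borel" by (rule schwartz_measurable[OF fS])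
  have "(\<lambda>j. \<integral>v. fourier \<psi> v * H (v /\<^sub>R 2 ^ j) \<partial>lborel) \<longlonglongrightarrow> (\<integral>v. fourier \<psi> v * H 0 \<partial>lborel)"
  proof (rule integral_dominated_convergence[OF _ _ schwartz_integrable_growth[OF fS, of C N]])
    show "AE v in lborel. (\<lambda>j. fourier \<psi> v * H (v /\<^sub>R 2 ^ j)) \<longlonglongrightarrow> fourier \<psi> v * H 0"
    proof (intro AE_I2 tendsto_mult tendsto_const)
      fix v :: 'a
      have "(\<lambda>j. inverse (2 ^ j) :: real) \<longlonglongrightarrow> 0" using LIMSEQ_inverse_realpow_zero[of 2] by simp
      then have "(\<lambda>j. v /\<^sub>R 2 ^ j) \<longlonglongrightarrow> 0 *\<^sub>R v" by (intro tendsto_intros)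
      moreover have "isCont H 0" using c by (simp add: continuous_on_eq_continuous_at)
      ultimately show "(\<lambda>j. H (v /\<^sub>R 2 ^ j)) \<longlonglongrightarrow> H 0" by (intro isCont_tendsto_compose[of 0 H]) auto
    qed
    show "AE v in lborel. norm (fourier \<psi> v * H (v /\<^sub>R 2 ^ j)) \<le> norm (fourier \<psi> v) * (C * (1 + norm v) ^ N)" for j
    proof (rule AE_I2)
      fix v :: 'a
      have "norm (v /\<^sub>R 2 ^ j) \<le> norm v" by (simp add: mult_left_le_one_le inverse_le_1_iff)
      then have "C * (1 + norm (v /\<^sub>R 2 ^ j)) ^ N \<le> C * (1 + norm v) ^ N" using C by (intro mult_left_mono power_mono) auto
      then show "norm (fourier \<psi> v * H (v /\<^sub>R 2 ^ j)) \<le> norm (fourier \<psi> v) * (C * (1 + norm v) ^ N)"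
        unfolding norm_mult using bd[of "v /\<^sub>R 2 ^ j"] by (intro mult_left_mono) auto
    qed
  qed measurable
  then have "(\<lambda>j. of_real (fourier_const TYPE('a)) * (\<integral>u. lp_kernel \<psi> j u * H u \<partial>lborel))
     \<longlonglongrightarrow> of_real (fourier_const TYPE('a)) * (\<integral>v. fourier \<psi> v * H 0 \<partial>lborel)"
    by (subst integral_lp_kernel[OF \<psi>]) (auto intro!: tendsto_intros)
  also have "of_real (fourier_const TYPE('a)) * (\<integral>v. fourier \<psi> v * H 0 \<partial>lborel)
    = (of_real (fourier_const TYPE('a)) * (\<integral>v. fourier \<psi> v \<partial>lborel)) * H 0" by simp
  also have "\<dots> = H 0" by (simp add: integral_fourier[OF cutoff_schwartz[OF \<psi>]] cutoff_0[OF \<psi>])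
  finally show ?thesis .
qed

section \<open>Low-pass approximations as continuous functions\<close>

lemma integrable_growth_schwartz:
  fixes F :: "'a::euclidean_space \<Rightarrow> complex"
  assumes "continuous_on UNIV F" "\<And>x. norm (F x) \<le> C * (1 + norm x) ^ N" "g \<in> schwartz_space"
  shows "integrable lborel (\<lambda>x. F x * g x)"
proof (rule Bochner_Integration.integrable_bound[OF schwartz_integrable_growth[OF assms(3), of C N]])
  have [measurable]: "F \<in> borel_measurable borel" using assms(1) by (rule borel_measurable_continuous_onI)
  have [measurable]: "g \<in> borel_measurable borel" by (rule schwartz_measurable[OF assms(3)])
  show "(\<lambda>x. F x * g x) \<in> borel_measurable lborel" by measurable
  show "AE x in lborel. norm (F x * g x) \<le> norm (norm (g x) * (C * (1 + norm x) ^ N))"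
  proof (rule AE_I2)
    fix x
    have "norm (F x * g x) \<le> norm (g x) * (C * (1 + norm x) ^ N)"
      unfolding norm_mult using assms(2)[of x] by (subst mult.commute) (intro mult_left_mono, auto)
    then show "norm (F x * g x) \<le> norm (norm (g x) * (C * (1 + norm x) ^ N))"
      unfolding real_norm_def by (rule order_trans[OF _ abs_ge_self])
  qed
qed

text \<open>Convolving with the kernels \<^const>\<open>lp_kernel\<close>, which form an approximate identity, recovers a continuous
  function from its distribution.\<close>

lemma dist_of_fun_inject:
  fixes \<psi> F G :: "'a::euclidean_space \<Rightarrow> complex"
  assumes \<psi>: "cutoff_function \<psi>"
    and F: "continuous_on UNIV F" "\<And>x. norm (F x) \<le> C * (1 + norm x) ^ N"
    and G: "continuous_on UNIV G" "\<And>x. norm (G x) \<le> D * (1 + norm x) ^ M"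
    and eq: "dist_of_fun F = dist_of_fun G"
  shows "F = G"
proof
  fix x :: 'a
  have C: "0 \<le> C" using order_trans[OF norm_ge_zero F(2)[of 0]] by simp
  have D: "0 \<le> D" using order_trans[OF norm_ge_zero G(2)[of 0]] by simp
  have lim: "(\<lambda>j. of_real (fourier_const TYPE('a)) * (\<integral>u. lp_kernel \<psi> j (u - x) * F u \<partial>lborel)) \<longlonglongrightarrow> F x"
    if F: "continuous_on UNIV F" "\<And>x. norm (F x) \<le> C * (1 + norm x) ^ N" and C: "0 \<le> C" for F :: "'a \<Rightarrow> complex" and C N
  proof -
    have [measurable]: "F \<in> borel_measurable borel" using F(1) by (rule borel_measurable_continuous_onI)
    have "(\<integral>u. lp_kernel \<psi> j u * F (u + x) \<partial>lborel) = (\<integral>u. lp_kernel \<psi> j (u - x) * F u \<partial>lborel)" for j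
    proof -
      have [measurable]: "lp_kernel \<psi> j \<in> borel_measurable borel" by (rule schwartz_measurable[OF schwartz_lp_kernel[OF \<psi>]])
      show ?thesis using lborel_integral_shift(2)[of "\<lambda>u. lp_kernel \<psi> j u * F (u + x)" x] by simp
    qed
    moreover have "(\<lambda>j. of_real (fourier_const TYPE('a)) * (\<integral>u. lp_kernel \<psi> j u * F (u + x) \<partial>lborel)) \<longlonglongrightarrow> F (0 + x)"
    proof (rule lp_kernel_tendsto[OF \<psi>, where C = "C * (1 + norm x) ^ N" and N = N])
      show "continuous_on UNIV (\<lambda>u. F (u + x))" by (intro continuous_on_compose2[OF F(1)] continuous_intros) auto
      show "norm (F (u + x)) \<le> C * (1 + norm x) ^ N * (1 + norm u) ^ N" for u
        using order_trans[OF F(2) mult_left_mono[OF one_plus_norm_power_add_le C]] by (simp add: mult_ac)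
    qed (use C in simp)
    ultimately show ?thesis by simp
  qed
  have "(\<integral>u. lp_kernel \<psi> j (u - x) * F u \<partial>lborel) = (\<integral>u. lp_kernel \<psi> j (u - x) * G u \<partial>lborel)" for j
    using fun_cong[OF eq, of "\<lambda>u. lp_kernel \<psi> j (u - x)"] schwartz_shift[OF schwartz_lp_kernel[OF \<psi>], of j x]
    by (simp add: dist_of_fun_def mult.commute)
  then show "F x = G x" using lim[OF F C] lim[OF G D] by (simp add: LIMSEQ_unique)
qed

text \<open>This evaluates the definite description in \<open>fun_of_dist\<close>; the cutoff
  supplies the kernels that prove uniqueness.\<close>

lemma fun_of_dist_of_fun:
  fixes \<psi> F :: "'a::euclidean_space \<Rightarrow> complex"
  assumes \<psi>: "cutoff_function \<psi>" and F: "continuous_on UNIV F" "\<And>x. norm (F x) \<le> C * (1 + norm x) ^ N"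
  shows "fun_of_dist (dist_of_fun F) = F"
  unfolding fun_of_dist_def
proof (rule the_equality)
  show "continuous_on UNIV F \<and> (\<exists>C N. \<forall>x. norm (F x) \<le> C * (1 + norm x) ^ N) \<and> dist_of_fun F = dist_of_fun F"
    using F by blast
  fix G :: "'a \<Rightarrow> complex"
  assume "continuous_on UNIV G \<and> (\<exists>C N. \<forall>x. norm (G x) \<le> C * (1 + norm x) ^ N) \<and> dist_of_fun F = dist_of_fun G"
  then obtain D M where G: "continuous_on UNIV G" "\<And>x. norm (G x) \<le> D * (1 + norm x) ^ M" and eq: "dist_of_fun G = dist_of_fun F" by auto
  show "G = F" by (rule dist_of_fun_inject[OF \<psi> G F eq])
qed

lemma lp_fun_continuous:
  assumes "cutoff_function \<psi>" "f \<in> tempered_distributions"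
  shows "continuous_on UNIV (lp_fun \<psi> f j)"
  unfolding lp_fun_def[abs_def] by (intro continuous_intros tempered_shift_continuous assms schwartz_lp_kernel)

lemma lp_fun_bound:
  fixes \<psi> :: "'a::euclidean_space \<Rightarrow> complex"
  assumes "cutoff_function \<psi>" "f \<in> tempered_distributions"
  obtains C N where "0 \<le> C" "\<And>x. norm (lp_fun \<psi> f j x) \<le> C * (1 + norm x) ^ N"
proof -
  obtain C N where C: "0 \<le> C" "\<And>x \<xi>. norm (f (tf_shift x \<xi> (lp_kernel \<psi> j))) \<le> C * (1 + norm x) ^ N * (1 + norm \<xi>) ^ N"
    by (rule tempered_tf_shift_bound[OF assms(2) schwartz_lp_kernel[OF assms(1)]]) blast
  have "norm (lp_fun \<psi> f j x) \<le> (fourier_const TYPE('a) * C) * (1 + norm x) ^ N" for x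
    using mult_left_mono[OF C(2)[of x 0], of "fourier_const TYPE('a)"] fourier_const_pos[where 'a = 'a]
    by (simp add: lp_fun_def tf_shift_0 norm_mult mult.assoc)
  then show ?thesis using C fourier_const_pos[where 'a = 'a] by (intro that[of "fourier_const TYPE('a) * C" N]) auto
qed

lemma fourier_mult_inverse_fourier:
  fixes m :: "'a::euclidean_space \<Rightarrow> complex"
  assumes m: "m \<in> schwartz_space" and c: "\<rho> \<in> schwartz_space"
  shows "fourier (\<lambda>\<xi>. m \<xi> * inverse_fourier \<rho> \<xi>) = (\<lambda>t. of_real (fourier_const TYPE('a)) * conv \<rho> (fourier m) t)"
proof
  fix t :: 'a
  let ?c = "complex_of_real (fourier_const TYPE('a))"
  have [measurable]: "m \<in> borel_measurable borel" "\<rho> \<in> borel_measurable borel" using m c schwartz_measurable by auto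
  have ch: "character (- \<xi>) s * character t \<xi> = character (t - s) \<xi>" for \<xi> s :: 'a
    by (simp add: character_def exp_add[symmetric] inner_diff_right inner_commute algebra_simps)
  have "(\<integral>\<xi>. m \<xi> * inverse_fourier \<rho> \<xi> * character t \<xi> \<partial>lborel)
    = (\<integral>\<xi>. (\<integral>s. ?c * (m \<xi> * (\<rho> s * character (t - s) \<xi>)) \<partial>lborel) \<partial>lborel)"
  proof (intro Bochner_Integration.integral_cong refl)
    fix \<xi> :: 'a
    have "m \<xi> * inverse_fourier \<rho> \<xi> * character t \<xi> = ?c * m \<xi> * character t \<xi> * (\<integral>s. \<rho> s * character (- \<xi>) s \<partial>lborel)"
      by (simp only: inverse_fourier_eq fourier_eq mult_ac)
    also have "\<dots> = (\<integral>s. ?c * m \<xi> * character t \<xi> * (\<rho> s * character (- \<xi>) s) \<partial>lborel)"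
      by (simp only: Bochner_Integration.integral_mult_right_zero)
    also have "\<dots> = (\<integral>s. ?c * (m \<xi> * (\<rho> s * character (t - s) \<xi>)) \<partial>lborel)"
      unfolding ch[symmetric] by (simp only: mult_ac)
    finally show "m \<xi> * inverse_fourier \<rho> \<xi> * character t \<xi> = (\<integral>s. ?c * (m \<xi> * (\<rho> s * character (t - s) \<xi>)) \<partial>lborel)" .
  qed
  also have "\<dots> = (\<integral>s. (\<integral>\<xi>. ?c * (m \<xi> * (\<rho> s * character (t - s) \<xi>)) \<partial>lborel) \<partial>lborel)"
  proof (rule Fubini_bound[where f = "\<lambda>\<xi>. norm ?c * norm (m \<xi>)" and g = "\<lambda>s. norm (\<rho> s)"])
    show "(\<lambda>(\<xi>, s). ?c * (m \<xi> * (\<rho> s * character (t - s) \<xi>))) \<in> borel_measurable (borel \<Otimes>\<^sub>M borel)"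
      unfolding character_def by measurable
  qed (use schwartz_integrable[OF m] schwartz_integrable[OF c] in \<open>auto simp: norm_mult\<close>)
  also have "\<dots> = conv \<rho> (fourier m) t"
    by (simp only: conv_def fourier_eq Bochner_Integration.integral_mult_right_zero[symmetric] mult_ac)
  finally show "fourier (\<lambda>\<xi>. m \<xi> * inverse_fourier \<rho> \<xi>) t = ?c * conv \<rho> (fourier m) t"
    by (simp only: fourier_eq[of "\<lambda>\<xi>. m \<xi> * inverse_fourier \<rho> \<xi>"])
qed

text \<open>All three operations in \<open>low_pass\<close> are defined by transposition, so they
  act on the test function, where \<open>fourier_mult_inverse_fourier\<close> turns them into a
  convolution.\<close>

lemma low_pass_conv:
  fixes \<psi> :: "'a::euclidean_space \<Rightarrow> complex"
  assumes \<psi>: "cutoff_function \<psi>" and f: "f \<in> tempered_distributions" and c: "\<rho> \<in> schwartz_space"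
  shows "low_pass \<psi> j f \<rho> = of_real (fourier_const TYPE('a)) * f (conv \<rho> (lp_kernel \<psi> j))"
proof -
  let ?m = "\<lambda>\<xi>. \<psi> (\<xi> /\<^sub>R 2 ^ j)"
  have m: "?m \<in> schwartz_space" by (rule schwartz_dilation[OF cutoff_schwartz[OF \<psi>]])
  have i: "inverse_fourier \<rho> \<in> schwartz_space" by (rule schwartz_inverse_fourier[OF c])
  have mi: "(\<lambda>\<xi>. ?m \<xi> * inverse_fourier \<rho> \<xi>) \<in> schwartz_space" by (rule schwartz_times[OF m i])
  have "low_pass \<psi> j f \<rho> = f (fourier (\<lambda>\<xi>. ?m \<xi> * inverse_fourier \<rho> \<xi>))"
    using c i mi by (simp add: low_pass_def dist_inverse_fourier_def dist_mult_def dist_fourier_def)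
  also have "\<dots> = f (\<lambda>t. of_real (fourier_const TYPE('a)) * conv \<rho> (lp_kernel \<psi> j) t)"
    unfolding fourier_mult_inverse_fourier[OF m c] lp_kernel_def ..
  also have "\<dots> = of_real (fourier_const TYPE('a)) * f (conv \<rho> (lp_kernel \<psi> j))"
    by (rule tempered_cmult[OF f schwartz_conv[OF c schwartz_lp_kernel[OF \<psi>]]])
  finally show ?thesis .
qed

lemma low_pass_eq_dist_of_fun:
  fixes \<psi> :: "'a::euclidean_space \<Rightarrow> complex"
  assumes \<psi>: "cutoff_function \<psi>" and f: "f \<in> tempered_distributions"
  shows "low_pass \<psi> j f = dist_of_fun (lp_fun \<psi> f j)"
proof
  fix \<rho> :: "'a \<Rightarrow> complex"
  show "low_pass \<psi> j f \<rho> = dist_of_fun (lp_fun \<psi> f j) \<rho>"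
  proof (cases "\<rho> \<in> schwartz_space")
    case True
    then show ?thesis
      unfolding low_pass_conv[OF \<psi> f True] tempered_conv[OF f True schwartz_lp_kernel[OF \<psi>]]
      by (simp add: dist_of_fun_def lp_fun_def Bochner_Integration.integral_mult_right_zero[symmetric] mult_ac
          del: Bochner_Integration.integral_mult_right_zero)
  next
    case False
    then show ?thesis by (simp add: low_pass_def dist_inverse_fourier_def dist_of_fun_def)
  qed
qed

lemma fun_of_dist_low_pass:
  fixes \<psi> :: "'a::euclidean_space \<Rightarrow> complex"
  assumes \<psi>: "cutoff_function \<psi>" and f: "f \<in> tempered_distributions"
  shows "fun_of_dist (low_pass \<psi> j f) = lp_fun \<psi> f j"
proof -
  obtain C N where C: "\<And>x. norm (lp_fun \<psi> f j x) \<le> C * (1 + norm x) ^ N"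
    by (rule lp_fun_bound[OF \<psi> f, where j = j]) blast
  show ?thesis
    unfolding low_pass_eq_dist_of_fun[OF \<psi> f]
    by (rule fun_of_dist_of_fun[OF \<psi> lp_fun_continuous[OF \<psi> f] C])
qed

text \<open>Commuting the convolution puts the translations on \<rho> instead of the kernel: f is
  tested against translates of one fixed function, and j occurs in the weight alone.\<close>

lemma integral_lp_fun:
  fixes \<psi> :: "'a::euclidean_space \<Rightarrow> complex"
  assumes \<psi>: "cutoff_function \<psi>" and f: "f \<in> tempered_distributions" and c: "\<rho> \<in> schwartz_space"
  shows "(\<integral>t. lp_fun \<psi> f j t * \<rho> t \<partial>lborel)
    = of_real (fourier_const TYPE('a)) * (\<integral>u. lp_kernel \<psi> j u * f (\<lambda>t. \<rho> (t - u)) \<partial>lborel)"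
proof -
  have "(\<integral>t. lp_fun \<psi> f j t * \<rho> t \<partial>lborel) = low_pass \<psi> j f \<rho>"
    using c by (simp add: low_pass_eq_dist_of_fun[OF \<psi> f] dist_of_fun_def)
  also have "\<dots> = of_real (fourier_const TYPE('a)) * f (conv (lp_kernel \<psi> j) \<rho>)"
    unfolding low_pass_conv[OF \<psi> f c] conv_commute[OF c schwartz_lp_kernel[OF \<psi>]] ..
  also have "\<dots> = of_real (fourier_const TYPE('a)) * (\<integral>u. lp_kernel \<psi> j u * f (\<lambda>t. \<rho> (t - u)) \<partial>lborel)"
    unfolding tempered_conv[OF f schwartz_lp_kernel[OF \<psi>] c] ..
  finally show ?thesis .
qed

lemma integral_lp_fun_tendsto:
  fixes \<psi> :: "'a::euclidean_space \<Rightarrow> complex"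
  assumes \<psi>: "cutoff_function \<psi>" and f: "f \<in> tempered_distributions" and c: "\<rho> \<in> schwartz_space"
  shows "(\<lambda>j. \<integral>t. lp_fun \<psi> f j t * \<rho> t \<partial>lborel) \<longlonglongrightarrow> f \<rho>"
proof -
  obtain C N where C: "0 \<le> C" "\<And>x \<xi>. norm (f (tf_shift x \<xi> \<rho>)) \<le> C * (1 + norm x) ^ N * (1 + norm \<xi>) ^ N"
    by (rule tempered_tf_shift_bound[OF f c]) blast
  have "(\<lambda>j. of_real (fourier_const TYPE('a)) * (\<integral>u. lp_kernel \<psi> j u * f (\<lambda>t. \<rho> (t - u)) \<partial>lborel)) \<longlonglongrightarrow> f (\<lambda>t. \<rho> (t - 0))"
  proof (rule lp_kernel_tendsto[OF \<psi> tempered_shift_continuous[OF f c] _ C(1)])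
    show "norm (f (\<lambda>t. \<rho> (t - u))) \<le> C * (1 + norm u) ^ N" for u using C(2)[of u 0] by (simp add: tf_shift_0)
  qed
  then show ?thesis unfolding integral_lp_fun[OF \<psi> f c] by simp
qed

section \<open>Short-time Fourier transforms of distributions and of their low-pass
  approximations\<close>

definition gstft :: "('a::euclidean_space \<Rightarrow> complex) \<Rightarrow> 'a functional \<Rightarrow> 'a \<Rightarrow> 'a \<Rightarrow> complex" where
  "gstft g f x \<xi> = of_real (fourier_const TYPE('a)) * f (tf_shift x \<xi> g)"

text \<open>\<open>gstft\<close> leaves the window unconjugated: the pairing with distributions is
  bilinear, and the auxiliary windows enter without conjugation.\<close>

lemma stft_eq_gstft: "stft \<phi> f x \<xi> = gstft (\<lambda>t. cnj (\<phi> t)) f x \<xi>"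
  by (simp add: stft_def gstft_def fourier_const_def tf_shift_def character_def)

definition lp_stft :: "('a::euclidean_space \<Rightarrow> complex) \<Rightarrow> ('a \<Rightarrow> complex) \<Rightarrow> 'a functional \<Rightarrow> nat \<Rightarrow> 'a \<Rightarrow> 'a \<Rightarrow> complex" where
  "lp_stft \<psi> g f j x \<xi> = fourier (\<lambda>t. lp_fun \<psi> f j t * g (t - x)) \<xi>"

lemma fourier_windowed_measurable:
  fixes F g :: "'a::euclidean_space \<Rightarrow> complex"
  assumes [measurable]: "F \<in> borel_measurable borel" "g \<in> borel_measurable borel"
  shows "(\<lambda>(x, \<xi>). fourier (\<lambda>t. F t * g (t - x)) \<xi>) \<in> borel_measurable (borel \<Otimes>\<^sub>M borel)"
  unfolding fourier_eq character_def by measurable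

lemma lp_stft_measurable:
  fixes \<psi> g :: "'a::euclidean_space \<Rightarrow> complex"
  assumes "cutoff_function \<psi>" "f \<in> tempered_distributions" "g \<in> schwartz_space"
  shows "(\<lambda>(x, \<xi>). lp_stft \<psi> g f j x \<xi>) \<in> borel_measurable (borel \<Otimes>\<^sub>M borel)"
  unfolding lp_stft_def
  by (intro fourier_windowed_measurable borel_measurable_continuous_onI lp_fun_continuous schwartz_measurable assms)

lemma lp_stft_eq:
  fixes \<psi> :: "'a::euclidean_space \<Rightarrow> complex"
  shows "lp_stft \<psi> g f j x \<xi> = of_real (fourier_const TYPE('a)) * (\<integral>t. lp_fun \<psi> f j t * tf_shift x \<xi> g t \<partial>lborel)"
  by (simp add: lp_stft_def fourier_eq tf_shift_def mult.assoc)

lemma lp_stft_tendsto: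
  fixes \<psi> g :: "'a::euclidean_space \<Rightarrow> complex"
  assumes "cutoff_function \<psi>" "f \<in> tempered_distributions" "g \<in> schwartz_space"
  shows "(\<lambda>j. lp_stft \<psi> g f j x \<xi>) \<longlonglongrightarrow> gstft g f x \<xi>"
  unfolding lp_stft_eq gstft_def by (intro tendsto_intros integral_lp_fun_tendsto assms schwartz_tf_shift)

text \<open>The transform is a pointwise limit of those of the low-pass approximations, which are
  Lebesgue integrals depending on parameters; the cutoff produces these approximations.\<close>

lemma gstft_measurable:
  fixes \<psi> g :: "'a::euclidean_space \<Rightarrow> complex"
  assumes "cutoff_function \<psi>" "f \<in> tempered_distributions" "g \<in> schwartz_space"
  shows "(\<lambda>(x, \<xi>). gstft g f x \<xi>) \<in> borel_measurable (borel \<Otimes>\<^sub>M borel)"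
  by (rule borel_measurable_LIMSEQ_metric[OF lp_stft_measurable[OF assms]])
     (auto intro: lp_stft_tendsto assms)

text \<open>Translation moves the position and creates a phase that does not depend on t, so the
  modulus of a short-time Fourier transform is merely translated.\<close>

lemma tf_shift_shift: "tf_shift x \<xi> g (t - u) = character (- \<xi>) u * tf_shift (x + u) \<xi> g t"
  by (simp add: tf_shift_def character_diff algebra_simps)

lemma norm_tempered_tf_shift_shift:
  assumes "f \<in> tempered_distributions" "g \<in> schwartz_space"
  shows "norm (f (\<lambda>t. tf_shift x \<xi> g (t - u))) = norm (f (tf_shift (x + u) \<xi> g))"
  unfolding tf_shift_shift using tempered_cmult[OF assms(1) schwartz_tf_shift[OF assms(2)]] by (simp add: norm_mult)

text \<open>Up to phases, the low-pass filter acts on the short-time Fourier transform by averaging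
  in position at fixed frequency. The averaging weight is integrable and independent of j; the scale
  enters only through the displacement v / 2^j.\<close>

lemma lp_stft_bound:
  fixes \<psi> :: "'a::euclidean_space \<Rightarrow> complex"
  assumes \<psi>: "cutoff_function \<psi>" and f: "f \<in> tempered_distributions" and g: "g \<in> schwartz_space"
  shows "ennreal (norm (lp_stft \<psi> g f j x \<xi>))
    \<le> (\<integral>\<^sup>+v. ennreal (fourier_const TYPE('a) * norm (fourier \<psi> v)) * ennreal (norm (gstft g f (x + v /\<^sub>R 2 ^ j) \<xi>)) \<partial>lborel)"
proof -
  let ?c = "fourier_const TYPE('a)"
  let ?H = "\<lambda>u. f (\<lambda>t. tf_shift x \<xi> g (t - u))"
  note gS = schwartz_tf_shift[OF g, of x \<xi>]
  have fS: "fourier \<psi> \<in> schwartz_space" by (rule schwartz_fourier[OF cutoff_schwartz[OF \<psi>]])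
  have [measurable]: "?H \<in> borel_measurable borel"
    by (rule borel_measurable_continuous_onI[OF tempered_shift_continuous[OF f gS]])
  have [measurable]: "fourier \<psi> \<in> borel_measurable borel" by (rule schwartz_measurable[OF fS])
  have eq: "lp_stft \<psi> g f j x \<xi> = of_real (?c * ?c) * (\<integral>v. fourier \<psi> v * ?H (v /\<^sub>R 2 ^ j) \<partial>lborel)"
    unfolding lp_stft_eq integral_lp_fun[OF \<psi> f gS] by (subst integral_lp_kernel[OF \<psi>]) (simp_all add: mult.assoc)
  have "ennreal (norm (lp_stft \<psi> g f j x \<xi>)) = ennreal (?c * ?c) * ennreal (norm (\<integral>v. fourier \<psi> v * ?H (v /\<^sub>R 2 ^ j) \<partial>lborel))"
    using fourier_const_pos[where 'a = 'a] by (simp add: eq norm_mult ennreal_mult[symmetric])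
  also have "\<dots> \<le> ennreal (?c * ?c) * (\<integral>\<^sup>+v. ennreal (norm (fourier \<psi> v * ?H (v /\<^sub>R 2 ^ j))) \<partial>lborel)"
  proof (rule mult_left_mono)
    show "ennreal (norm (\<integral>v. fourier \<psi> v * ?H (v /\<^sub>R 2 ^ j) \<partial>lborel)) \<le> (\<integral>\<^sup>+v. ennreal (norm (fourier \<psi> v * ?H (v /\<^sub>R 2 ^ j))) \<partial>lborel)"
      by (cases "integrable lborel (\<lambda>v. fourier \<psi> v * ?H (v /\<^sub>R 2 ^ j))")
         (auto simp: not_integrable_integral_eq intro: integral_norm_bound_ennreal)
  qed simp
  also have "\<dots> = (\<integral>\<^sup>+v. ennreal (?c * ?c) * ennreal (norm (fourier \<psi> v * ?H (v /\<^sub>R 2 ^ j))) \<partial>lborel)"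
    by (rule nn_integral_cmult[symmetric]) measurable
  also have "\<dots> = (\<integral>\<^sup>+v. ennreal (?c * norm (fourier \<psi> v)) * ennreal (norm (gstft g f (x + v /\<^sub>R 2 ^ j) \<xi>)) \<partial>lborel)"
    using fourier_const_pos[where 'a = 'a]
    by (intro nn_integral_cong)
       (simp add: norm_mult norm_tempered_tf_shift_shift[OF f g] gstft_def ennreal_mult[symmetric] mult_ac)
  finally show ?thesis .
qed

lemma gstft_growth:
  fixes f :: "'a::euclidean_space functional"
  assumes f: "f \<in> tempered_distributions" and g: "g \<in> schwartz_space"
  obtains C N where "0 \<le> C" "\<And>x \<xi>. norm (gstft g f x \<xi>) \<le> C * (1 + norm x) ^ N * (1 + norm \<xi>) ^ N"
proof -
  obtain C N where C: "0 \<le> C" "\<And>x \<xi>. norm (f (tf_shift x \<xi> g)) \<le> C * (1 + norm x) ^ N * (1 + norm \<xi>) ^ N"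
    by (rule tempered_tf_shift_bound[OF f g]) blast
  have "norm (gstft g f x \<xi>) \<le> (fourier_const TYPE('a) * C) * (1 + norm x) ^ N * (1 + norm \<xi>) ^ N" for x \<xi>
    using mult_left_mono[OF C(2)[of x \<xi>], of "fourier_const TYPE('a)"] fourier_const_pos[where 'a = 'a]
    by (simp add: gstft_def norm_mult mult.assoc)
  then show ?thesis using C fourier_const_pos[where 'a = 'a] by (intro that[of "fourier_const TYPE('a) * C" N]) auto
qed

text \<open>Uniform in j since |v / 2^j| <= |v|. This crude bound justifies the limit in the
  reproducing formula, from which the sharper majorant is derived.\<close>

lemma lp_stft_growth:
  fixes \<psi> :: "'a::euclidean_space \<Rightarrow> complex"
  assumes \<psi>: "cutoff_function \<psi>" and f: "f \<in> tempered_distributions" and g: "g \<in> schwartz_space"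
  obtains C N where "0 \<le> C" "\<And>j x \<xi>. norm (lp_stft \<psi> g f j x \<xi>) \<le> C * (1 + norm x) ^ N * (1 + norm \<xi>) ^ N"
proof -
  let ?c = "fourier_const TYPE('a)"
  obtain C N where C: "0 \<le> C" "\<And>x \<xi>. norm (gstft g f x \<xi>) \<le> C * (1 + norm x) ^ N * (1 + norm \<xi>) ^ N"
    by (rule gstft_growth[OF f g]) blast
  have fS: "fourier \<psi> \<in> schwartz_space" by (rule schwartz_fourier[OF cutoff_schwartz[OF \<psi>]])
  note int = schwartz_integrable_growth[OF fS, of "?c * C" N]
  define I where "I = (\<integral>v. norm (fourier \<psi> v) * (?c * C * (1 + norm v) ^ N) \<partial>lborel)"
  have I: "0 \<le> I" unfolding I_def using C fourier_const_pos[where 'a = 'a] by (intro integral_nonneg_AE AE_I2) auto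
  have "norm (lp_stft \<psi> g f j x \<xi>) \<le> I * (1 + norm x) ^ N * (1 + norm \<xi>) ^ N" for j x \<xi>
  proof -
    have "ennreal (norm (lp_stft \<psi> g f j x \<xi>))
      \<le> (\<integral>\<^sup>+v. ennreal (norm (fourier \<psi> v) * (?c * C * (1 + norm v) ^ N) * ((1 + norm x) ^ N * (1 + norm \<xi>) ^ N)) \<partial>lborel)"
    proof (rule order_trans[OF lp_stft_bound[OF \<psi> f g] nn_integral_mono])
      fix v :: 'a
      have "norm (v /\<^sub>R 2 ^ j) \<le> norm v" by (simp add: mult_left_le_one_le inverse_le_1_iff)
      then have "(1 + norm (x + v /\<^sub>R 2 ^ j)) ^ N \<le> (1 + norm x) ^ N * (1 + norm v) ^ N"
        by (intro order_trans[OF one_plus_norm_power_add_le] mult_left_mono power_mono) auto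
      then have "C * (1 + norm (x + v /\<^sub>R 2 ^ j)) ^ N * (1 + norm \<xi>) ^ N \<le> C * ((1 + norm x) ^ N * (1 + norm v) ^ N) * (1 + norm \<xi>) ^ N"
        using C by (intro mult_right_mono mult_left_mono) auto
      then have "norm (gstft g f (x + v /\<^sub>R 2 ^ j) \<xi>) \<le> C * ((1 + norm x) ^ N * (1 + norm v) ^ N) * (1 + norm \<xi>) ^ N"
        using C(2) order_trans by blast
      then have "?c * norm (fourier \<psi> v) * norm (gstft g f (x + v /\<^sub>R 2 ^ j) \<xi>)
        \<le> ?c * norm (fourier \<psi> v) * (C * ((1 + norm x) ^ N * (1 + norm v) ^ N) * (1 + norm \<xi>) ^ N)"
        using fourier_const_pos[where 'a = 'a] by (intro mult_left_mono) auto
      also have "\<dots> = norm (fourier \<psi> v) * (?c * C * (1 + norm v) ^ N) * ((1 + norm x) ^ N * (1 + norm \<xi>) ^ N)"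
        by (simp only: mult_ac)
      finally show "ennreal (?c * norm (fourier \<psi> v)) * ennreal (norm (gstft g f (x + v /\<^sub>R 2 ^ j) \<xi>))
        \<le> ennreal (norm (fourier \<psi> v) * (?c * C * (1 + norm v) ^ N) * ((1 + norm x) ^ N * (1 + norm \<xi>) ^ N))"
        using fourier_const_pos[where 'a = 'a] by (simp add: ennreal_mult[symmetric] ennreal_leI)
    qed
    also have "\<dots> = ennreal (I * ((1 + norm x) ^ N * (1 + norm \<xi>) ^ N))"
      using C fourier_const_pos[where 'a = 'a] int
      by (subst nn_integral_eq_integral) (auto simp: I_def)
    finally show ?thesis using I by (subst (asm) ennreal_le_iff) (auto simp: mult_ac)
  qed
  then show ?thesis using I that by blast
qed

section \<open>The reproducing formula and the majorant for short-time Fourier transforms\<close>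

text \<open>A continuous partition: the translates of w at t - x, integrated over x, give the
  constant on the left for every t. The rest is Fubini's theorem.\<close>

lemma window_split:
  fixes F w \<rho> :: "'a::euclidean_space \<Rightarrow> complex"
  assumes F: "continuous_on UNIV F" "\<And>x. norm (F x) \<le> C * (1 + norm x) ^ N"
    and w: "w \<in> schwartz_space" and r: "\<rho> \<in> schwartz_space"
  shows "(\<integral>s. w s \<partial>lborel) * (\<integral>t. F t * \<rho> t \<partial>lborel) = (\<integral>x. (\<integral>t. F t * \<rho> t * w (t - x) \<partial>lborel) \<partial>lborel)"
proof -
  let ?m = "Suc DIM('a)"
  have [measurable]: "F \<in> borel_measurable borel" using F(1) by (rule borel_measurable_continuous_onI)
  have [measurable]: "w \<in> borel_measurable borel" "\<rho> \<in> borel_measurable borel" using w r schwartz_measurable by auto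
  have C: "0 \<le> C" using order_trans[OF norm_ge_zero F(2)[of 0]] by simp
  obtain D where D: "0 < D" "\<And>x. norm (w x) \<le> D * decay ?m x" by (rule schwartz_decay[OF w]) blast
  have "(\<integral>x. w (t - x) \<partial>lborel) = (\<integral>s. w s \<partial>lborel)" for t by (rule lborel_integral_shift(3)) measurable
  then have "(\<integral>s. w s \<partial>lborel) * (\<integral>t. F t * \<rho> t \<partial>lborel) = (\<integral>t. (\<integral>x. F t * \<rho> t * w (t - x) \<partial>lborel) \<partial>lborel)"
    by (simp add: mult.commute)
  also have "\<dots> = (\<integral>x. (\<integral>t. F t * \<rho> t * w (t - x) \<partial>lborel) \<partial>lborel)"
  proof (rule Fubini_bound[where f = "\<lambda>t. norm (\<rho> t) * ((C * D) * (1 + norm t) ^ (N + ?m))" and g = "decay ?m"])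
    show "integrable lborel (\<lambda>t. norm (\<rho> t) * ((C * D) * (1 + norm t) ^ (N + ?m)))" by (rule schwartz_integrable_growth[OF r])
    show "integrable lborel (decay ?m :: 'a \<Rightarrow> real)" by (rule integrable_decay) simp
    fix t x :: 'a
    have "decay ?m (t - x) \<le> (1 + norm t) ^ ?m * decay ?m x" using decay_peetre[of ?m "- x" t] by simp
    then have w': "norm (w (t - x)) \<le> D * ((1 + norm t) ^ ?m * decay ?m x)"
      using D(2)[of "t - x"] D(1) by (meson order_trans mult_left_mono less_imp_le)
    have "norm (F t * \<rho> t * w (t - x)) \<le> (C * (1 + norm t) ^ N) * norm (\<rho> t) * (D * ((1 + norm t) ^ ?m * decay ?m x))"
      unfolding norm_mult using w' F(2)[of t] C D(1) by (intro mult_mono) auto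
    also have "\<dots> = norm (\<rho> t) * ((C * D) * (1 + norm t) ^ (N + ?m)) * decay ?m x"
      by (simp only: power_add mult_ac)
    finally show "norm (F t * \<rho> t * w (t - x)) \<le> norm (\<rho> t) * ((C * D) * (1 + norm t) ^ (N + ?m)) * decay ?m x" .
  qed measurable
  finally show ?thesis .
qed

lemma windowed_growth:
  fixes F g :: "'a::euclidean_space \<Rightarrow> complex"
  assumes F: "continuous_on UNIV F" "\<And>x. norm (F x) \<le> C * (1 + norm x) ^ N" and g: "g \<in> schwartz_space"
  shows "integrable lborel (\<lambda>t. F t * g (t - x))" and "continuous_on UNIV (\<lambda>t. F t * g (t - x))"
    and "\<exists>B. \<forall>t. norm (F t * g (t - x)) \<le> B"
proof -
  note gx = schwartz_shift[OF g, of x]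
  show "integrable lborel (\<lambda>t. F t * g (t - x))" by (rule integrable_growth_schwartz[OF F gx])
  show "continuous_on UNIV (\<lambda>t. F t * g (t - x))"
    by (rule continuous_on_mult[OF F(1) smooth_continuous[OF schwartz_smooth[OF gx]]])
  have C: "0 \<le> C" using order_trans[OF norm_ge_zero F(2)[of 0]] by simp
  obtain D where D: "0 < D" "\<And>t. norm (g (t - x)) \<le> D * decay N t" by (rule schwartz_decay[OF gx]) blast
  have "norm (F t * g (t - x)) \<le> C * D" for t
  proof -
    have "norm (F t * g (t - x)) \<le> (C * (1 + norm t) ^ N) * (D * decay N t)"
      unfolding norm_mult using F(2)[of t] D C by (intro mult_mono) auto
    also have "\<dots> = C * D * ((1 + norm t) ^ N * decay (N + 0) t)" by (simp add: mult_ac)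
    also have "\<dots> = C * D" by (simp only: decay_cancel) (simp add: decay_def)
    finally show ?thesis .
  qed
  then show "\<exists>B. \<forall>t. norm (F t * g (t - x)) \<le> B" by blast
qed

lemma integrable_fourier_mult_schwartz:
  fixes u w :: "'a::euclidean_space \<Rightarrow> complex"
  assumes u: "integrable lborel u" and w: "w \<in> schwartz_space"
  shows "integrable lborel (\<lambda>\<xi>. fourier u \<xi> * w (- \<xi> - c))"
proof -
  have [measurable]: "u \<in> borel_measurable borel" using borel_measurable_integrable[OF u] by simp
  have "(\<lambda>\<xi>. w (- \<xi> - c)) \<in> schwartz_space" using schwartz_affine[OF w, of "-1" 1 "- c"] by simp
  then have "integrable lborel (\<lambda>\<xi>. w (- \<xi> - c) * fourier u \<xi>)"
    by (intro integrable_bounded_mult[OF schwartz_integrable _ norm_fourier_le[OF u]]) measurable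
  then show ?thesis by (simp add: mult.commute)
qed

text \<open>The reproducing formula in weak form. One window is given to F and the other to \<rho>,
  and Parseval's formula is applied at every position x.\<close>

lemma windowed_parseval:
  fixes F g \<gamma> \<rho> :: "'a::euclidean_space \<Rightarrow> complex"
  assumes F: "continuous_on UNIV F" "\<And>x. norm (F x) \<le> C * (1 + norm x) ^ N"
    and g: "g \<in> schwartz_space" and \<gamma>: "\<gamma> \<in> schwartz_space" and r: "\<rho> \<in> schwartz_space"
  shows "(\<integral>s. g s * \<gamma> s \<partial>lborel) * (\<integral>t. F t * \<rho> t \<partial>lborel)
    = (\<integral>x. (\<integral>\<xi>. fourier (\<lambda>t. F t * g (t - x)) \<xi> * fourier (\<lambda>t. \<rho> t * \<gamma> (t - x)) (- \<xi>) \<partial>lborel) \<partial>lborel)"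
proof -
  have "(\<integral>t. F t * \<rho> t * (g (t - x) * \<gamma> (t - x)) \<partial>lborel)
    = (\<integral>\<xi>. fourier (\<lambda>t. F t * g (t - x)) \<xi> * fourier (\<lambda>t. \<rho> t * \<gamma> (t - x)) (- \<xi>) \<partial>lborel)" for x
  proof -
    obtain B where B: "\<And>t. norm (F t * g (t - x)) \<le> B" using windowed_growth(3)[OF F g] by blast
    have k: "(\<lambda>t. \<rho> t * \<gamma> (t - x)) \<in> schwartz_space" by (rule schwartz_times[OF r schwartz_shift[OF \<gamma>]])
    have "(\<integral>t. F t * \<rho> t * (g (t - x) * \<gamma> (t - x)) \<partial>lborel) = (\<integral>t. (F t * g (t - x)) * (\<rho> t * \<gamma> (t - x)) \<partial>lborel)"
      by (simp only: mult_ac)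
    also have "\<dots> = (\<integral>\<xi>. fourier (\<lambda>t. F t * g (t - x)) \<xi> * fourier (\<lambda>t. \<rho> t * \<gamma> (t - x)) (- \<xi>) \<partial>lborel)"
    proof (rule fourier_parseval[OF windowed_growth(1)[OF F g] B windowed_growth(2)[OF F g] schwartz_integrable[OF k]])
      show "integrable lborel (\<lambda>\<xi>. fourier (\<lambda>t. F t * g (t - x)) \<xi> * fourier (\<lambda>t. \<rho> t * \<gamma> (t - x)) (- \<xi>))"
        using integrable_fourier_mult_schwartz[OF windowed_growth(1)[OF F g] schwartz_fourier[OF k], of x 0] by simp
    qed
    finally show ?thesis .
  qed
  then show ?thesis using window_split[OF F schwartz_times[OF g \<gamma>] r] by simp
qed

lemma nn_integral_lborel_pair:
  fixes f :: "'a::euclidean_space \<times> 'b::euclidean_space \<Rightarrow> ennreal"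
  assumes "f \<in> borel_measurable borel"
  shows "(\<integral>\<^sup>+z. f z \<partial>lborel) = (\<integral>\<^sup>+x. (\<integral>\<^sup>+y. f (x, y) \<partial>lborel) \<partial>lborel)"
proof -
  have "f \<in> borel_measurable (lborel \<Otimes>\<^sub>M lborel)" using assms by (simp add: lborel_prod)
  from lborel.nn_integral_fst[OF this] show ?thesis by (simp add: lborel_prod)
qed

lemma integral_lborel_pair:
  fixes f :: "'a::euclidean_space \<times> 'b::euclidean_space \<Rightarrow> complex"
  assumes "integrable lborel f"
  shows "(\<integral>z. f z \<partial>lborel) = (\<integral>x. (\<integral>y. f (x, y) \<partial>lborel) \<partial>lborel)"
    and "AE x in lborel. integrable lborel (\<lambda>y. f (x, y))"
    and "integrable lborel (\<lambda>x. \<integral>y. f (x, y) \<partial>lborel)"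
proof -
  have i: "integrable (lborel \<Otimes>\<^sub>M lborel) f" using assms by (simp add: lborel_prod)
  show "(\<integral>z. f z \<partial>lborel) = (\<integral>x. (\<integral>y. f (x, y) \<partial>lborel) \<partial>lborel)"
    using lborel_pair.integral_fst'[OF i] by (simp add: lborel_prod)
  show "AE x in lborel. integrable lborel (\<lambda>y. f (x, y))" by (rule lborel_pair.AE_integrable_fst'[OF i])
  show "integrable lborel (\<lambda>x. \<integral>y. f (x, y) \<partial>lborel)" by (rule lborel_pair.integrable_fst'[OF i])
qed

text \<open>Parseval's formula applies to functions, so the identity is first obtained for S^j f and
  then j tends to infinity. The polynomial growth of the transforms, uniform in j, is outweighed by
  the rapid decay of the windowed transform of \<rho>.\<close>

lemma reproducing_bound:
  fixes \<psi> g \<gamma> \<rho> :: "'a::euclidean_space \<Rightarrow> complex"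
  assumes \<psi>: "cutoff_function \<psi>" and f: "f \<in> tempered_distributions"
    and g: "g \<in> schwartz_space" and \<gamma>: "\<gamma> \<in> schwartz_space" and r: "\<rho> \<in> schwartz_space"
  shows "ennreal (norm ((\<integral>s. g s * \<gamma> s \<partial>lborel) * f \<rho>))
    \<le> (\<integral>\<^sup>+x. (\<integral>\<^sup>+\<xi>. ennreal (norm (gstft g f x \<xi>) * norm (fourier (\<lambda>t. \<rho> t * \<gamma> (t - x)) (- \<xi>))) \<partial>lborel) \<partial>lborel)"
proof -
  let ?m = "Suc DIM('a)"
  obtain C N where C: "0 \<le> C" "\<And>j x \<xi>. norm (lp_stft \<psi> g f j x \<xi>) \<le> C * (1 + norm x) ^ N * (1 + norm \<xi>) ^ N"
    by (rule lp_stft_growth[OF \<psi> f g]) blast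
  obtain D K where D: "0 < D" "\<And>(\<rho> :: 'a \<Rightarrow> complex) x \<omega>. \<rho> \<in> schwartz_space \<Longrightarrow>
    norm (fourier (\<lambda>t. \<rho> t * \<gamma> (t - x)) \<omega>) \<le> D * schwartz_norm K \<rho> * decay (N + ?m) x * decay (N + ?m) \<omega>"
    by (rule windowed_fourier_decay[OF \<gamma>, where k = "N + ?m"]) blast
  define E where "E = D * schwartz_norm K \<rho>"
  have E: "0 \<le> E" using D(1) schwartz_norm_nonneg[OF r] by (simp add: E_def)
  define W where "W x \<xi> = fourier (\<lambda>t. \<rho> t * \<gamma> (t - x)) (- \<xi>)" for x \<xi>
  have W: "norm (W x \<xi>) \<le> E * decay (N + ?m) x * decay (N + ?m) \<xi>" for x \<xi>
    using D(2)[OF r, of x "- \<xi>"] by (simp add: W_def E_def)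
  have [measurable]: "\<rho> \<in> borel_measurable borel" "\<gamma> \<in> borel_measurable borel" using r \<gamma> schwartz_measurable by auto
  have [measurable]: "case_prod W \<in> borel_measurable (borel \<Otimes>\<^sub>M borel)"
    unfolding W_def fourier_eq character_def by measurable
  note [measurable] = lp_stft_measurable[OF \<psi> f g] gstft_measurable[OF \<psi> f g]
  define s where "s j z = (case z of (x, \<xi>) \<Rightarrow> lp_stft \<psi> g f j x \<xi> * W x \<xi>)" for j z
  define S where "S z = (case z of (x, \<xi>) \<Rightarrow> gstft g f x \<xi> * W x \<xi>)" for z
  define d where "d z = (case z of (x, \<xi>) \<Rightarrow> complex_of_real (C * E * (decay ?m x * decay ?m \<xi>)))" for z :: "'a \<times> 'a"
  have s_meas [measurable]: "s j \<in> borel_measurable borel" for j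
    unfolding s_def borel_prod[symmetric] by measurable
  have S_meas [measurable]: "S \<in> borel_measurable borel"
    unfolding S_def borel_prod[symmetric] by measurable
  have d: "integrable lborel d"
    unfolding d_def lborel_prod[symmetric]
    by (rule integrable_lborel_pair_bound[where f = "\<lambda>x. C * E * decay ?m x" and g = "decay ?m"])
       (use C E in \<open>auto intro!: integrable_mult_right integrable_decay simp: norm_mult abs_mult\<close>)
  have bd: "norm (s j z) \<le> norm (d z)" for j z
  proof -
    obtain x \<xi> where z: "z = (x, \<xi>)" by (cases z)
    have "norm (s j z) \<le> (C * (1 + norm x) ^ N * (1 + norm \<xi>) ^ N) * (E * decay (N + ?m) x * decay (N + ?m) \<xi>)"
      unfolding z s_def prod.case norm_mult using C W E by (intro mult_mono) auto
    also have "\<dots> = C * E * (((1 + norm x) ^ N * decay (N + ?m) x) * ((1 + norm \<xi>) ^ N * decay (N + ?m) \<xi>))"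
      by (simp only: mult_ac)
    also have "\<dots> = C * E * (decay ?m x * decay ?m \<xi>)" by (simp only: decay_cancel)
    finally show ?thesis using C E by (simp add: z d_def norm_mult abs_mult)
  qed
  have s_int: "integrable lborel (s j)" for j
    by (rule Bochner_Integration.integrable_bound[OF d]) (use bd in auto)
  have lim: "(\<lambda>j. \<integral>z. s j z \<partial>lborel) \<longlonglongrightarrow> (\<integral>z. S z \<partial>lborel)"
  proof (rule integral_dominated_convergence[OF _ _ integrable_norm[OF d]])
    show "AE z in lborel. (\<lambda>j. s j z) \<longlonglongrightarrow> S z"
      unfolding s_def S_def by (auto intro!: AE_I2 tendsto_intros lp_stft_tendsto \<psi> f g)
    show "AE z in lborel. norm (s j z) \<le> norm (d z)" for j using bd by auto
  qed measurable
  have eq: "(\<integral>z. s j z \<partial>lborel) = (\<integral>s. g s * \<gamma> s \<partial>lborel) * (\<integral>t. lp_fun \<psi> f j t * \<rho> t \<partial>lborel)" for j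
  proof -
    obtain C' N' where C': "\<And>x. norm (lp_fun \<psi> f j x) \<le> C' * (1 + norm x) ^ N'"
      by (rule lp_fun_bound[OF \<psi> f, where j = j]) blast
    show ?thesis
      unfolding windowed_parseval[OF lp_fun_continuous[OF \<psi> f] C' g \<gamma> r]
      by (subst integral_lborel_pair(1)[OF s_int]) (simp add: s_def lp_stft_def W_def)
  qed
  have "(\<lambda>j. (\<integral>s. g s * \<gamma> s \<partial>lborel) * (\<integral>t. lp_fun \<psi> f j t * \<rho> t \<partial>lborel)) \<longlonglongrightarrow> (\<integral>s. g s * \<gamma> s \<partial>lborel) * f \<rho>"
    by (intro tendsto_intros integral_lp_fun_tendsto \<psi> f r)
  then have rep: "(\<integral>s. g s * \<gamma> s \<partial>lborel) * f \<rho> = (\<integral>z. S z \<partial>lborel)"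
    using lim unfolding eq by (rule LIMSEQ_unique)
  have "ennreal (norm (\<integral>z. S z \<partial>lborel)) \<le> (\<integral>\<^sup>+z. ennreal (norm (S z)) \<partial>lborel)"
    by (cases "integrable lborel S") (auto simp: not_integrable_integral_eq intro: integral_norm_bound_ennreal)
  also have "\<dots> = (\<integral>\<^sup>+x. (\<integral>\<^sup>+\<xi>. ennreal (norm (S (x, \<xi>))) \<partial>lborel) \<partial>lborel)"
    by (rule nn_integral_lborel_pair) measurable
  also have "\<dots> = (\<integral>\<^sup>+x. (\<integral>\<^sup>+\<xi>. ennreal (norm (gstft g f x \<xi>) * norm (fourier (\<lambda>t. \<rho> t * \<gamma> (t - x)) (- \<xi>))) \<partial>lborel) \<partial>lborel)"
    unfolding S_def W_def prod.case norm_mult ..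
  finally show ?thesis unfolding rep .
qed

lemma norm_fourier_tf_shift_window:
  fixes g \<gamma> :: "'a::euclidean_space \<Rightarrow> complex"
  assumes [measurable]: "g \<in> borel_measurable borel" "\<gamma> \<in> borel_measurable borel"
  shows "norm (fourier (\<lambda>t. tf_shift y \<zeta> g t * \<gamma> (t - x)) \<omega>) = norm (fourier (\<lambda>s. g s * \<gamma> (s - (x - y))) (\<omega> + \<zeta>))"
proof -
  have ch: "character \<zeta> (s + y) * character \<omega> (s + y) = character (\<omega> + \<zeta>) y * character (\<omega> + \<zeta>) s" for s
    by (simp add: character_def exp_add[symmetric] inner_add_left inner_add_right algebra_simps)
  have "(\<integral>t. tf_shift y \<zeta> g t * \<gamma> (t - x) * character \<omega> t \<partial>lborel)
    = (\<integral>s. tf_shift y \<zeta> g (s + y) * \<gamma> ((s + y) - x) * character \<omega> (s + y) \<partial>lborel)"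
    by (rule lborel_integral_shift(1)[symmetric]) (unfold tf_shift_def, measurable)
  also have "\<dots> = (\<integral>s. character (\<omega> + \<zeta>) y * (g s * \<gamma> (s - (x - y)) * character (\<omega> + \<zeta>) s) \<partial>lborel)"
  proof (intro Bochner_Integration.integral_cong refl)
    fix s
    have "tf_shift y \<zeta> g (s + y) * \<gamma> ((s + y) - x) * character \<omega> (s + y)
      = g s * \<gamma> (s - (x - y)) * (character \<zeta> (s + y) * character \<omega> (s + y))"
      by (simp add: tf_shift_def algebra_simps)
    then show "tf_shift y \<zeta> g (s + y) * \<gamma> ((s + y) - x) * character \<omega> (s + y)
      = character (\<omega> + \<zeta>) y * (g s * \<gamma> (s - (x - y)) * character (\<omega> + \<zeta>) s)"
      unfolding ch by (simp only: mult_ac)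
  qed
  finally show ?thesis by (simp add: fourier_eq norm_mult)
qed

text \<open>By \<open>norm_fourier_tf_shift_window\<close> a shift of g translates the modulus of
  the windowed transform, so one constant serves for all y and \<zeta>.\<close>

lemma tf_shift_window_decay:
  fixes g \<gamma> :: "'a::euclidean_space \<Rightarrow> complex"
  assumes g: "g \<in> schwartz_space" and \<gamma>: "\<gamma> \<in> schwartz_space"
  obtains C where "0 < C" "\<And>x y \<zeta> \<omega>. norm (fourier (\<lambda>t. tf_shift y \<zeta> g t * \<gamma> (t - x)) \<omega>) \<le> C * decay k (x - y) * decay k (\<omega> + \<zeta>)"
proof -
  obtain D K where D: "0 < D" "\<And>(\<rho> :: 'a \<Rightarrow> complex) x \<omega>. \<rho> \<in> schwartz_space \<Longrightarrow>
    norm (fourier (\<lambda>t. \<rho> t * \<gamma> (t - x)) \<omega>) \<le> D * schwartz_norm K \<rho> * decay k x * decay k \<omega>"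
    by (rule windowed_fourier_decay[OF \<gamma>, where k = k]) blast
  let ?C = "D * schwartz_norm K g + 1"
  show ?thesis
  proof (rule that[of ?C])
    show "0 < ?C" using D(1) schwartz_norm_nonneg[OF g, of K] by (intro add_nonneg_pos mult_nonneg_nonneg) auto
    fix x y \<zeta> \<omega> :: 'a
    have "norm (fourier (\<lambda>t. tf_shift y \<zeta> g t * \<gamma> (t - x)) \<omega>) = norm (fourier (\<lambda>s. g s * \<gamma> (s - (x - y))) (\<omega> + \<zeta>))"
      by (rule norm_fourier_tf_shift_window) (use g \<gamma> schwartz_measurable in auto)
    also have "\<dots> \<le> D * schwartz_norm K g * decay k (x - y) * decay k (\<omega> + \<zeta>)" by (rule D(2)[OF g])
    also have "\<dots> \<le> ?C * decay k (x - y) * decay k (\<omega> + \<zeta>)" by (intro mult_right_mono) auto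
    finally show "norm (fourier (\<lambda>t. tf_shift y \<zeta> g t * \<gamma> (t - x)) \<omega>) \<le> ?C * decay k (x - y) * decay k (\<omega> + \<zeta>)" .
  qed
qed

text \<open>The integrand is nonnegative, so a vanishing integral forces \<phi> = 0 almost
  everywhere; but the set where \<phi> is nonzero is open and nonempty, hence not
  negligible.\<close>

lemma window_integral_neq_0:
  fixes \<phi> :: "'a::euclidean_space \<Rightarrow> complex"
  assumes "window \<phi>" and w: "(\<lambda>t. of_real (norm (\<phi> t) ^ k)) \<in> schwartz_space"
  shows "(\<integral>t. of_real (norm (\<phi> t) ^ k) \<partial>lborel) \<noteq> (0 :: complex)"
proof
  assume 0: "(\<integral>t. of_real (norm (\<phi> t) ^ k) \<partial>lborel) = (0 :: complex)"
  have \<phi>: "\<phi> \<in> schwartz_space" "\<phi> \<noteq> (\<lambda>x. 0)" using assms(1) by (auto simp: window_def)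
  have "integrable lborel (\<lambda>t. complex_of_real (norm (\<phi> t) ^ k))" by (rule schwartz_integrable[OF w])
  then have i: "integrable lborel (\<lambda>t. norm (\<phi> t) ^ k)" by (simp only: complex_of_real_integrable_eq)
  have "(\<integral>t. norm (\<phi> t) ^ k \<partial>lborel) = 0" using 0 by (simp del: of_real_power)
  then have "AE t in lborel. norm (\<phi> t) ^ k = 0"
    by (subst (asm) integral_nonneg_eq_0_iff_AE[OF i]) auto
  then have "AE t in lborel. t \<notin> {t. \<phi> t \<noteq> 0}" by (auto elim!: eventually_mono)
  moreover have op: "open {t. \<phi> t \<noteq> 0}"
    using smooth_continuous[OF schwartz_smooth[OF \<phi>(1)], of UNIV] by (intro open_Collect_neq) auto
  ultimately have "{t. \<phi> t \<noteq> 0} \<in> null_sets lborel"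
    using AE_iff_null_sets[of "{t. \<phi> t \<noteq> 0}" lborel] by auto
  then have "negligible {t. \<phi> t \<noteq> 0}"
    by (simp add: negligible_iff_null_sets null_sets_completionI)
  then show False using open_not_negligible[OF op] \<phi>(2) by auto
qed

text \<open>The reproducing formula with the windows \<open>cnj \<phi>\<close> and \<phi>, tested on
  a shift of \<theta>. The constant n is the squared L^2 norm of \<phi>, and the windowed transform
  of the shift decays to order m away from (y, \<zeta>), which produces the kernel of
  \<open>smear\<close>.\<close>

lemma gstft_majorant:
  fixes \<psi> \<phi> \<theta> :: "'a::euclidean_space \<Rightarrow> complex"
  assumes \<psi>: "cutoff_function \<psi>" and \<phi>: "window \<phi>" and \<theta>: "\<theta> \<in> schwartz_space"
  obtains C where "0 < C" "\<And>f y \<zeta>. f \<in> tempered_distributions \<Longrightarrow>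
    ennreal (norm (gstft \<theta> f y \<zeta>)) \<le> ennreal C * smear m (\<lambda>x \<xi>. ennreal (norm (stft \<phi> f x \<xi>))) y \<zeta>"
proof -
  let ?c = "fourier_const TYPE('a)"
  have p: "\<phi> \<in> schwartz_space" using \<phi> by (simp add: window_def)
  note pc = schwartz_cnj[OF p]
  obtain D where D: "0 < D" "\<And>x y \<zeta> \<omega>. norm (fourier (\<lambda>t. tf_shift y \<zeta> \<theta> t * \<phi> (t - x)) \<omega>) \<le> D * decay m (x - y) * decay m (\<omega> + \<zeta>)"
    by (rule tf_shift_window_decay[OF \<theta> p, where k = m]) blast
  have n2: "(\<lambda>t. of_real (norm (\<phi> t) ^ 2)) = (\<lambda>t. cnj (\<phi> t) * \<phi> t)"
    by (simp add: fun_eq_iff complex_norm_square mult.commute flip: of_real_power)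
  define n where "n = (\<integral>s. cnj (\<phi> s) * \<phi> s \<partial>lborel)"
  have n: "n \<noteq> 0" using window_integral_neq_0[OF \<phi>, of 2] schwartz_times[OF pc p] unfolding n_def n2[symmetric] by blast
  show ?thesis
  proof (rule that[of "?c * D / norm n"])
    show "0 < ?c * D / norm n" using D n fourier_const_pos[where 'a = 'a] by simp
    fix f :: "'a functional" and y \<zeta> assume f: "f \<in> tempered_distributions"
    let ?V = "\<lambda>x \<xi>. ennreal (norm (stft \<phi> f x \<xi>))"
    have [measurable]: "case_prod ?V \<in> borel_measurable (borel \<Otimes>\<^sub>M borel)"
      unfolding stft_eq_gstft using gstft_measurable[OF \<psi> f pc] by measurable
    have "ennreal (norm n) * ennreal (norm (gstft \<theta> f y \<zeta>)) = ennreal ?c * ennreal (norm (n * f (tf_shift y \<zeta> \<theta>)))"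
      using fourier_const_pos[where 'a = 'a] by (simp add: gstft_def norm_mult ennreal_mult[symmetric] mult_ac)
    also have "\<dots> \<le> ennreal ?c * (\<integral>\<^sup>+x. (\<integral>\<^sup>+\<xi>. ennreal (norm (gstft (\<lambda>t. cnj (\<phi> t)) f x \<xi>) * norm (fourier (\<lambda>t. tf_shift y \<zeta> \<theta> t * \<phi> (t - x)) (- \<xi>))) \<partial>lborel) \<partial>lborel)"
      unfolding n_def by (intro mult_left_mono reproducing_bound[OF \<psi> f pc p schwartz_tf_shift[OF \<theta>]]) simp
    also have "\<dots> \<le> ennreal ?c * (\<integral>\<^sup>+x. (\<integral>\<^sup>+\<xi>. ennreal D * (?V x \<xi> * ennreal (decay m (y - x) * decay m (\<zeta> - \<xi>))) \<partial>lborel) \<partial>lborel)"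
    proof (intro mult_left_mono nn_integral_mono)
      fix x \<xi> :: 'a
      have "norm (stft \<phi> f x \<xi>) * norm (fourier (\<lambda>t. tf_shift y \<zeta> \<theta> t * \<phi> (t - x)) (- \<xi>))
        \<le> norm (stft \<phi> f x \<xi>) * (D * decay m (x - y) * decay m (- \<xi> + \<zeta>))"
        by (intro mult_left_mono D) simp
      also have "\<dots> = D * (norm (stft \<phi> f x \<xi>) * (decay m (y - x) * decay m (\<zeta> - \<xi>)))"
        by (simp add: decay_minus_commute[of m x y] mult_ac)
      finally show "ennreal (norm (gstft (\<lambda>t. cnj (\<phi> t)) f x \<xi>) * norm (fourier (\<lambda>t. tf_shift y \<zeta> \<theta> t * \<phi> (t - x)) (- \<xi>)))
        \<le> ennreal D * (?V x \<xi> * ennreal (decay m (y - x) * decay m (\<zeta> - \<xi>)))"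
        using D(1) by (simp add: stft_eq_gstft ennreal_mult[symmetric] ennreal_leI)
    qed simp
    also have "\<dots> = ennreal (?c * D) * smear m ?V y \<zeta>"
      using D(1) fourier_const_pos[where 'a = 'a] by (simp add: smear_def nn_integral_cmult ennreal_mult mult.assoc)
    finally have "ennreal (1 / norm n) * (ennreal (norm n) * ennreal (norm (gstft \<theta> f y \<zeta>)))
       \<le> ennreal (1 / norm n) * (ennreal (?c * D) * smear m ?V y \<zeta>)" by (rule mult_left_mono) simp
    then show "ennreal (norm (gstft \<theta> f y \<zeta>)) \<le> ennreal (?c * D / norm n) * smear m ?V y \<zeta>"
      using n D(1) fourier_const_pos[where 'a = 'a]
      by (simp add: mult.assoc[symmetric] ennreal_mult[symmetric])
  qed
qed

text \<open>Slow variation removes the displacement v / 2^j of \<open>lp_stft_bound\<close> at the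
  price (1 + |v|)^m, which is integrable against the rapidly decaying \<open>fourier \<psi>\<close>.
  Hence one constant for all j.\<close>

lemma lp_stft_majorant:
  fixes \<psi> \<phi> \<theta> :: "'a::euclidean_space \<Rightarrow> complex"
  assumes \<psi>: "cutoff_function \<psi>" and \<phi>: "window \<phi>" and \<theta>: "\<theta> \<in> schwartz_space"
  obtains C where "0 < C" "\<And>f j y \<zeta>. f \<in> tempered_distributions \<Longrightarrow>
    ennreal (norm (lp_stft \<psi> \<theta> f j y \<zeta>)) \<le> ennreal C * smear m (\<lambda>x \<xi>. ennreal (norm (stft \<phi> f x \<xi>))) y \<zeta>"
proof -
  let ?c = "fourier_const TYPE('a)"
  obtain D where D: "0 < D" "\<And>f y \<zeta>. f \<in> tempered_distributions \<Longrightarrow>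
    ennreal (norm (gstft \<theta> f y \<zeta>)) \<le> ennreal D * smear m (\<lambda>x \<xi>. ennreal (norm (stft \<phi> f x \<xi>))) y \<zeta>"
    by (rule gstft_majorant[OF \<psi> \<phi> \<theta>, where m = m]) blast
  have fS: "fourier \<psi> \<in> schwartz_space" by (rule schwartz_fourier[OF cutoff_schwartz[OF \<psi>]])
  note int = schwartz_integrable_growth[OF fS, of "?c * D" m]
  define I where "I = (\<integral>v. norm (fourier \<psi> v) * (?c * D * (1 + norm v) ^ m) \<partial>lborel)"
  have I: "0 \<le> I" unfolding I_def using D fourier_const_pos[where 'a = 'a] by (intro integral_nonneg_AE AE_I2) auto
  show ?thesis
  proof (rule that[of "I + 1"])
    show "0 < I + 1" using I by simp
    fix f :: "'a functional" and j and y \<zeta> :: 'a assume f: "f \<in> tempered_distributions"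
    let ?V = "\<lambda>x \<xi>. ennreal (norm (stft \<phi> f x \<xi>))"
    have pc: "(\<lambda>t. cnj (\<phi> t)) \<in> schwartz_space" using \<phi> by (intro schwartz_cnj) (simp add: window_def)
    have V: "case_prod ?V \<in> borel_measurable (borel \<Otimes>\<^sub>M borel)"
      unfolding stft_eq_gstft using gstft_measurable[OF \<psi> f pc] by measurable
    have "ennreal (norm (lp_stft \<psi> \<theta> f j y \<zeta>)) \<le> (\<integral>\<^sup>+v. ennreal (norm (fourier \<psi> v) * (?c * D * (1 + norm v) ^ m)) * smear m ?V y \<zeta> \<partial>lborel)"
    proof (rule order_trans[OF lp_stft_bound[OF \<psi> f \<theta>] nn_integral_mono])
      fix v :: 'a
      have "norm (v /\<^sub>R 2 ^ j) \<le> norm v" by (simp add: mult_left_le_one_le inverse_le_1_iff)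
      then have le: "(1 + norm (v /\<^sub>R 2 ^ j)) ^ m \<le> (1 + norm v) ^ m" by (intro power_mono) auto
      have "ennreal (norm (gstft \<theta> f (y + v /\<^sub>R 2 ^ j) \<zeta>)) \<le> ennreal D * smear m ?V (y + v /\<^sub>R 2 ^ j) (\<zeta> + 0)"
        using D(2)[OF f, of "y + v /\<^sub>R 2 ^ j" \<zeta>] by simp
      also have "\<dots> \<le> ennreal D * (ennreal ((1 + norm (v /\<^sub>R 2 ^ j)) ^ m * (1 + norm (0::'a)) ^ m) * smear m ?V y \<zeta>)"
        by (intro mult_left_mono smear_slowly_varying V) simp
      also have "\<dots> \<le> ennreal D * (ennreal ((1 + norm v) ^ m) * smear m ?V y \<zeta>)"
        using le by (intro mult_left_mono mult_right_mono ennreal_leI) auto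
      finally have "ennreal (?c * norm (fourier \<psi> v)) * ennreal (norm (gstft \<theta> f (y + v /\<^sub>R 2 ^ j) \<zeta>))
        \<le> ennreal (?c * norm (fourier \<psi> v)) * (ennreal D * (ennreal ((1 + norm v) ^ m) * smear m ?V y \<zeta>))"
        by (rule mult_left_mono) simp
      also have "\<dots> = ennreal (norm (fourier \<psi> v) * (?c * D * (1 + norm v) ^ m)) * smear m ?V y \<zeta>"
      proof -
        have "norm (fourier \<psi> v) * (?c * D * (1 + norm v) ^ m) = ?c * norm (fourier \<psi> v) * (D * (1 + norm v) ^ m)"
          by (simp only: mult_ac)
        then show ?thesis
          using D(1) fourier_const_pos[where 'a = 'a] by (simp only: ennreal_mult mult.assoc) (simp add: ennreal_mult mult.assoc)
      qed
      finally show "ennreal (?c * norm (fourier \<psi> v)) * ennreal (norm (gstft \<theta> f (y + v /\<^sub>R 2 ^ j) \<zeta>))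
        \<le> ennreal (norm (fourier \<psi> v) * (?c * D * (1 + norm v) ^ m)) * smear m ?V y \<zeta>" .
    qed
    also have "\<dots> = ennreal I * smear m ?V y \<zeta>"
    proof -
      have [measurable]: "fourier \<psi> \<in> borel_measurable borel" by (rule schwartz_measurable[OF fS])
      have "(\<integral>\<^sup>+v. ennreal (norm (fourier \<psi> v) * (?c * D * (1 + norm v) ^ m)) \<partial>lborel) = ennreal I"
        unfolding I_def using D fourier_const_pos[where 'a = 'a] by (intro nn_integral_eq_integral int AE_I2) auto
      then show ?thesis by (subst nn_integral_multc) auto
    qed
    also have "\<dots> \<le> ennreal (I + 1) * smear m ?V y \<zeta>" by (intro mult_right_mono ennreal_leI) auto
    finally show "ennreal (norm (lp_stft \<psi> \<theta> f j y \<zeta>)) \<le> ennreal (I + 1) * smear m ?V y \<zeta>" .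
  qed
qed

text \<open>Parseval's formula for u and the product of v and w, then for each \<xi> for v and w
  modulated by the character of - \<xi>, whose transform is a translate of that of w. Absolute
  convergence of the double integral is the hypothesis \<open>fin\<close>.\<close>

lemma triple_parseval:
  fixes u v w :: "'a::euclidean_space \<Rightarrow> complex"
  assumes u: "integrable lborel u" "\<And>x. norm (u x) \<le> A" "continuous_on UNIV u"
    and v: "integrable lborel v" "\<And>x. norm (v x) \<le> B" "continuous_on UNIV v"
    and w: "w \<in> schwartz_space"
    and fin: "(\<integral>\<^sup>+\<xi>. (\<integral>\<^sup>+\<eta>. ennreal (norm (fourier u \<xi> * fourier v \<eta> * fourier w (- \<xi> - \<eta>))) \<partial>lborel) \<partial>lborel) < \<infinity>"
  shows "(\<integral>t. u t * (v t * w t) \<partial>lborel)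
    = of_real (fourier_const TYPE('a)) * (\<integral>z. fourier u (fst z) * fourier v (snd z) * fourier w (- fst z - snd z) \<partial>lborel)"
proof -
  let ?c = "complex_of_real (fourier_const TYPE('a))"
  have [measurable]: "u \<in> borel_measurable borel" "v \<in> borel_measurable borel" "w \<in> borel_measurable borel"
    using borel_measurable_integrable[OF u(1)] borel_measurable_integrable[OF v(1)] schwartz_measurable[OF w] by auto
  have wi: "integrable lborel w" by (rule schwartz_integrable[OF w])
  define T where "T z = fourier u (fst z) * fourier v (snd z) * fourier w (- fst z - snd z)" for z
  have T_meas: "T \<in> borel_measurable borel"
    unfolding T_def borel_prod[symmetric] by measurable
  have T_int: "integrable lborel T"
  proof (rule integrableI_bounded)
    show "T \<in> borel_measurable lborel" using T_meas by simp
    have "(\<integral>\<^sup>+z. ennreal (norm (T z)) \<partial>lborel) = (\<integral>\<^sup>+\<xi>. (\<integral>\<^sup>+\<eta>. ennreal (norm (T (\<xi>, \<eta>))) \<partial>lborel) \<partial>lborel)"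
      using T_meas by (intro nn_integral_lborel_pair) simp
    then show "(\<integral>\<^sup>+z. ennreal (norm (T z)) \<partial>lborel) < \<infinity>" using fin by (simp add: T_def)
  qed
  have vw: "integrable lborel (\<lambda>t. v t * w t)"
    using integrable_bounded_mult[where f = w and g = v and C = B and M = lborel] wi v(2) by (simp add: mult.commute)
  have inner: "fourier (\<lambda>t. v t * w t) (- \<xi>) = ?c * (\<integral>\<eta>. fourier v \<eta> * fourier w (- \<xi> - \<eta>) \<partial>lborel)" for \<xi>
  proof -
    have shift: "fourier (\<lambda>t. w t * character (- \<xi>) t) (- \<eta>) = fourier w (- \<xi> - \<eta>)" for \<eta>
      by (simp add: fourier_eq character_add[of "- \<xi>" "- \<eta>", simplified] mult.assoc)
    have "(\<integral>t. v t * (w t * character (- \<xi>) t) \<partial>lborel) = (\<integral>\<eta>. fourier v \<eta> * fourier (\<lambda>t. w t * character (- \<xi>) t) (- \<eta>) \<partial>lborel)"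
    proof (rule fourier_parseval[OF v integrable_character[OF wi]])
      show "integrable lborel (\<lambda>\<eta>. fourier v \<eta> * fourier (\<lambda>t. w t * character (- \<xi>) t) (- \<eta>))"
        unfolding shift using integrable_fourier_mult_schwartz[OF v(1) schwartz_fourier[OF w], of \<xi>]
        by (simp only: minus_diff_commute)
    qed
    then show ?thesis unfolding shift by (simp add: fourier_eq[of "\<lambda>t. v t * w t"] mult.assoc)
  qed
  have outer: "(\<integral>\<eta>. T (\<xi>, \<eta>) \<partial>lborel) = fourier u \<xi> * (\<integral>\<eta>. fourier v \<eta> * fourier w (- \<xi> - \<eta>) \<partial>lborel)" for \<xi>
    by (simp add: T_def mult.assoc)
  have "(\<integral>t. u t * (v t * w t) \<partial>lborel) = (\<integral>\<xi>. fourier u \<xi> * fourier (\<lambda>t. v t * w t) (- \<xi>) \<partial>lborel)"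
  proof (rule fourier_parseval[OF u vw])
    have "integrable lborel (\<lambda>\<xi>. ?c * (\<integral>\<eta>. T (\<xi>, \<eta>) \<partial>lborel))"
      by (intro integrable_mult_right integral_lborel_pair(3) T_int)
    then show "integrable lborel (\<lambda>\<xi>. fourier u \<xi> * fourier (\<lambda>t. v t * w t) (- \<xi>))"
      unfolding inner outer by (simp add: mult_ac)
  qed
  also have "\<dots> = ?c * (\<integral>\<xi>. (\<integral>\<eta>. T (\<xi>, \<eta>) \<partial>lborel) \<partial>lborel)"
    unfolding inner outer mult.left_commute[of "fourier u _" ?c] by simp
  also have "\<dots> = ?c * (\<integral>z. T z \<partial>lborel)" by (simp only: integral_lborel_pair(1)[OF T_int])
  finally show ?thesis by (simp add: T_def)
qed

section \<open>Products\<close>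

definition smear_product :: "nat \<Rightarrow> ('a::euclidean_space \<Rightarrow> 'a \<Rightarrow> ennreal) \<Rightarrow> ('a \<Rightarrow> 'a \<Rightarrow> ennreal) \<Rightarrow> 'a \<Rightarrow> 'a \<Rightarrow> ennreal" where
  "smear_product m V W y \<zeta> = (\<integral>\<^sup>+\<xi>. smear m V y \<xi> * smear m W y (\<zeta> - \<xi>) \<partial>lborel)"

text \<open>In position both factors move, in frequency only the second one is charged. Since the
  factor in front is finite, finiteness at one point propagates to all points.\<close>

lemma smear_product_slowly_varying:
  fixes V W :: "'a::euclidean_space \<Rightarrow> 'a \<Rightarrow> ennreal"
  assumes [measurable]: "case_prod V \<in> borel_measurable (borel \<Otimes>\<^sub>M borel)" "case_prod W \<in> borel_measurable (borel \<Otimes>\<^sub>M borel)"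
  shows "smear_product m V W (y + u) (\<zeta> + v)
    \<le> ennreal ((1 + norm u) ^ m * ((1 + norm u) ^ m * (1 + norm v) ^ m)) * smear_product m V W y \<zeta>"
proof -
  let ?c = "ennreal ((1 + norm u) ^ m * ((1 + norm u) ^ m * (1 + norm v) ^ m))"
  have "smear m V (y + u) \<xi> * smear m W (y + u) (\<zeta> + v - \<xi>) \<le> ?c * (smear m V y \<xi> * smear m W y (\<zeta> - \<xi>))" for \<xi> :: 'a
  proof -
    have "smear m V (y + u) (\<xi> + 0) * smear m W (y + u) ((\<zeta> - \<xi>) + v)
      \<le> (ennreal ((1 + norm u) ^ m * (1 + norm (0::'a)) ^ m) * smear m V y \<xi>)
        * (ennreal ((1 + norm u) ^ m * (1 + norm v) ^ m) * smear m W y (\<zeta> - \<xi>))"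
      by (intro mult_mono smear_slowly_varying assms) auto
    also have "\<dots> = ?c * (smear m V y \<xi> * smear m W y (\<zeta> - \<xi>))"
      by (simp add: ennreal_mult mult_ac)
    finally show ?thesis by (simp add: algebra_simps)
  qed
  then have "smear_product m V W (y + u) (\<zeta> + v) \<le> (\<integral>\<^sup>+\<xi>. ?c * (smear m V y \<xi> * smear m W y (\<zeta> - \<xi>)) \<partial>lborel)"
    unfolding smear_product_def by (rule nn_integral_mono)
  also have "\<dots> = ?c * smear_product m V W y \<zeta>"
    unfolding smear_product_def by (rule nn_integral_cmult) measurable
  finally show ?thesis .
qed

text \<open>The kernel concentrates x at y and \<eta> at \<zeta> - \<xi>. Slow variation replaces
  the variables by these values, and the integrals over x and \<eta> then contribute J each. In k,
  the part 2 m absorbs the variation of both factors in x, and the rest gives convergence.\<close>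

lemma smear_product_localised:
  fixes V W :: "'a::euclidean_space \<Rightarrow> 'a \<Rightarrow> ennreal" and m :: nat
  assumes [measurable]: "case_prod V \<in> borel_measurable (borel \<Otimes>\<^sub>M borel)" "case_prod W \<in> borel_measurable (borel \<Otimes>\<^sub>M borel)"
  defines "k \<equiv> 2 * m + Suc DIM('a)" and "J \<equiv> \<integral>u. decay (Suc DIM('a)) (u::'a) \<partial>lborel"
  shows "(\<integral>\<^sup>+x. (\<integral>\<^sup>+\<xi>. (\<integral>\<^sup>+\<eta>. smear m V x \<xi> * smear m W x \<eta> * ennreal (decay k (x - y) * decay k (\<zeta> - \<xi> - \<eta>)) \<partial>lborel) \<partial>lborel) \<partial>lborel)
    \<le> ennreal (J * J) * smear_product m V W y \<zeta>"
proof -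
  let ?d = "Suc DIM('a)"
  have J: "(\<integral>\<^sup>+u. ennreal (decay ?d (u::'a)) \<partial>lborel) = ennreal J" and J0: "0 \<le> J"
    unfolding J_def by (auto intro!: nn_integral_eq_integral integrable_decay integral_nonneg_AE)
  have Jx: "(\<integral>\<^sup>+x. ennreal (decay ?d (x - y)) \<partial>lborel) = ennreal J" for y :: 'a
    using nn_integral_lborel_shift(2)[where f = "\<lambda>u::'a. ennreal (decay ?d u)" and c = y] J by simp
  have J\<eta>: "(\<integral>\<^sup>+\<eta>. ennreal (decay ?d (c - \<eta>)) \<partial>lborel) = ennreal J" for c :: 'a
    using nn_integral_lborel_shift(3)[where f = "\<lambda>u::'a. ennreal (decay ?d u)" and c = c] J by simp
  have pw: "smear m V x \<xi> * smear m W x \<eta> * ennreal (decay k (x - y) * decay k (\<zeta> - \<xi> - \<eta>))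
    \<le> smear m V y \<xi> * smear m W y (\<zeta> - \<xi>) * ennreal (decay ?d (x - y)) * ennreal (decay ?d (\<zeta> - \<xi> - \<eta>))" for x \<xi> \<eta> :: 'a
  proof -
    define u where "u = x - y"
    define v where "v = \<zeta> - \<xi> - \<eta>"
    have dk: "(1 + norm u) ^ m * ((1 + norm u) ^ m * decay k u) = decay ?d u"
      using decay_cancel[of u m "?d"] decay_cancel[of u m "m + ?d"] by (simp add: k_def mult_2 add.assoc)
    have dv: "(1 + norm v) ^ m * decay k v \<le> decay ?d v"
      using decay_cancel[of v m "m + ?d"] decay_mono[of ?d "m + ?d" v] by (simp add: k_def mult_2 add.assoc)
    have "smear m V (y + u) (\<xi> + 0) * smear m W (y + u) ((\<zeta> - \<xi>) + (- v)) * ennreal (decay k u * decay k v)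
      \<le> (ennreal ((1 + norm u) ^ m * (1 + norm (0::'a)) ^ m) * smear m V y \<xi>)
        * (ennreal ((1 + norm u) ^ m * (1 + norm (- v)) ^ m) * smear m W y (\<zeta> - \<xi>)) * ennreal (decay k u * decay k v)"
      by (intro mult_mono smear_slowly_varying assms) auto
    also have "\<dots> = smear m V y \<xi> * smear m W y (\<zeta> - \<xi>) * ennreal (((1 + norm u) ^ m * ((1 + norm u) ^ m * decay k u)) * ((1 + norm v) ^ m * decay k v))"
      by (simp add: ennreal_mult mult_ac)
    also have "\<dots> \<le> smear m V y \<xi> * smear m W y (\<zeta> - \<xi>) * ennreal (decay ?d u * decay ?d v)"
      unfolding dk by (intro mult_left_mono ennreal_leI dv) auto
    finally show ?thesis by (simp add: u_def v_def ennreal_mult mult.assoc)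
  qed
  have "(\<integral>\<^sup>+x. (\<integral>\<^sup>+\<xi>. (\<integral>\<^sup>+\<eta>. smear m V x \<xi> * smear m W x \<eta> * ennreal (decay k (x - y) * decay k (\<zeta> - \<xi> - \<eta>)) \<partial>lborel) \<partial>lborel) \<partial>lborel)
    \<le> (\<integral>\<^sup>+x. (\<integral>\<^sup>+\<xi>. (\<integral>\<^sup>+\<eta>. smear m V y \<xi> * smear m W y (\<zeta> - \<xi>) * ennreal (decay ?d (x - y)) * ennreal (decay ?d (\<zeta> - \<xi> - \<eta>)) \<partial>lborel) \<partial>lborel) \<partial>lborel)"
    by (intro nn_integral_mono pw)
  also have "\<dots> = (\<integral>\<^sup>+x. (\<integral>\<^sup>+\<xi>. smear m V y \<xi> * smear m W y (\<zeta> - \<xi>) * (ennreal (decay ?d (x - y)) * ennreal J) \<partial>lborel) \<partial>lborel)"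
    by (subst nn_integral_cmult) (auto simp: J\<eta> mult.assoc)
  also have "\<dots> = (\<integral>\<^sup>+x. smear_product m V W y \<zeta> * (ennreal (decay ?d (x - y)) * ennreal J) \<partial>lborel)"
    unfolding smear_product_def by (subst nn_integral_multc) auto
  also have "\<dots> = smear_product m V W y \<zeta> * (ennreal J * ennreal J)"
    by (subst nn_integral_cmult, measurable, subst nn_integral_multc) (auto simp: Jx)
  finally show ?thesis using J0 by (simp add: ennreal_mult mult.commute)
qed

text \<open>The majorant may be infinite at some points, as averages of transforms can be; a finite
  integral makes it finite almost everywhere, and its real part then serves as an ordinary
  majorant.\<close>

lemma dominated_convergence_nn:
  fixes s :: "nat \<Rightarrow> 'a \<Rightarrow> complex"
  assumes [measurable]: "\<And>j. s j \<in> borel_measurable M" "S \<in> borel_measurable M" "D \<in> borel_measurable M"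
    and fin: "(\<integral>\<^sup>+z. D z \<partial>M) < \<infinity>"
    and bd: "\<And>j z. ennreal (norm (s j z)) \<le> D z" and lim: "\<And>z. (\<lambda>j. s j z) \<longlonglongrightarrow> S z"
  shows "integrable M (s j)" and "(\<lambda>j. \<integral>z. s j z \<partial>M) \<longlonglongrightarrow> (\<integral>z. S z \<partial>M)"
    and "ennreal (norm (\<integral>z. S z \<partial>M)) \<le> (\<integral>\<^sup>+z. D z \<partial>M)"
proof -
  have ae: "AE z in M. D z \<noteq> \<infinity>" by (rule nn_integral_PInf_AE) (use fin in auto)
  have "(\<integral>\<^sup>+z. ennreal (enn2real (D z)) \<partial>M) = (\<integral>\<^sup>+z. D z \<partial>M)"
    by (rule nn_integral_cong_AE) (use ae in \<open>auto elim!: eventually_mono simp: less_top\<close>)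
  then have d: "integrable M (\<lambda>z. enn2real (D z))" using fin by (intro integrableI_bounded) auto
  have bd': "norm (s j z) \<le> enn2real (D z)" if "D z \<noteq> \<infinity>" for j z
    using enn2real_mono[OF bd[of j z]] that by (simp add: less_top)
  then have ae': "AE z in M. norm (s j z) \<le> enn2real (D z)" for j using ae by (auto elim!: eventually_mono)
  show "integrable M (s j)"
    by (rule Bochner_Integration.integrable_bound[OF d]) (use ae' in \<open>auto elim!: eventually_mono\<close>)
  show "(\<lambda>j. \<integral>z. s j z \<partial>M) \<longlonglongrightarrow> (\<integral>z. S z \<partial>M)"
    by (rule integral_dominated_convergence[OF _ _ d]) (use lim ae' in auto)
  have "ennreal (norm (S z)) \<le> D z" for z
    by (rule LIMSEQ_le_const2[OF tendsto_ennrealI[OF tendsto_norm[OF lim]]]) (use bd in auto)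
  then have le: "(\<integral>\<^sup>+z. ennreal (norm (S z)) \<partial>M) \<le> (\<integral>\<^sup>+z. D z \<partial>M)" by (rule nn_integral_mono)
  have "ennreal (norm (\<integral>z. S z \<partial>M)) \<le> (\<integral>\<^sup>+z. ennreal (norm (S z)) \<partial>M)"
    by (cases "integrable M S") (auto simp: not_integrable_integral_eq intro: integral_norm_bound_ennreal)
  with le show "ennreal (norm (\<integral>z. S z \<partial>M)) \<le> (\<integral>\<^sup>+z. D z \<partial>M)" by (rule order_trans[rotated])
qed

lemma lp_fun_product:
  fixes \<psi> :: "'a::euclidean_space \<Rightarrow> complex"
  assumes \<psi>: "cutoff_function \<psi>" and f: "f \<in> tempered_distributions" and g: "g \<in> tempered_distributions"
  obtains C N where "continuous_on UNIV (\<lambda>x. lp_fun \<psi> f j x * lp_fun \<psi> g j x)"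
    "\<And>x. norm (lp_fun \<psi> f j x * lp_fun \<psi> g j x) \<le> C * (1 + norm x) ^ N"
proof -
  obtain C N where C: "0 \<le> C" "\<And>x. norm (lp_fun \<psi> f j x) \<le> C * (1 + norm x) ^ N"
    by (rule lp_fun_bound[OF \<psi> f, where j = j]) blast
  obtain C' N' where C': "0 \<le> C'" "\<And>x. norm (lp_fun \<psi> g j x) \<le> C' * (1 + norm x) ^ N'"
    by (rule lp_fun_bound[OF \<psi> g, where j = j]) blast
  show ?thesis
  proof
    show "continuous_on UNIV (\<lambda>x. lp_fun \<psi> f j x * lp_fun \<psi> g j x)"
      by (intro continuous_on_mult lp_fun_continuous \<psi> f g)
    have "norm (lp_fun \<psi> f j x * lp_fun \<psi> g j x) \<le> (C * (1 + norm x) ^ N) * (C' * (1 + norm x) ^ N')" for x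
      unfolding norm_mult using C C' by (intro mult_mono) auto
    then show "norm (lp_fun \<psi> f j x * lp_fun \<psi> g j x) \<le> (C * C') * (1 + norm x) ^ (N + N')" for x
      by (simp add: power_add mult_ac)
  qed
qed

text \<open>One window for each of the two factors and one for the test function: their product integrates
  to the third moment of \<open>\<theta>\<close>, hence the cube on the left.\<close>

lemma lp_product_parseval:
  fixes \<psi> \<theta> \<rho> :: "'a::euclidean_space \<Rightarrow> complex" and j :: nat
  assumes \<psi>: "cutoff_function \<psi>" and f: "f \<in> tempered_distributions" and g: "g \<in> tempered_distributions"
    and \<theta>: "\<theta> \<in> schwartz_space" and r: "\<rho> \<in> schwartz_space"
  defines "T \<equiv> \<lambda>z. lp_stft \<psi> \<theta> f j (fst z) (fst (snd z)) * lp_stft \<psi> \<theta> g j (fst z) (snd (snd z))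
    * fourier (\<lambda>t. \<rho> t * \<theta> (t - fst z)) (- fst (snd z) - snd (snd z))"
  assumes T: "integrable lborel T"
  shows "(\<integral>s. \<theta> s * (\<theta> s * \<theta> s) \<partial>lborel) * (\<integral>t. lp_fun \<psi> f j t * lp_fun \<psi> g j t * \<rho> t \<partial>lborel)
    = of_real (fourier_const TYPE('a)) * (\<integral>z. T z \<partial>lborel)"
proof -
  let ?c = "complex_of_real (fourier_const TYPE('a))" and ?F = "lp_fun \<psi> f j" and ?G = "lp_fun \<psi> g j"
  have [measurable]: "\<theta> \<in> borel_measurable borel" "\<rho> \<in> borel_measurable borel"
    using schwartz_measurable \<theta> r by auto
  note cF = lp_fun_continuous[OF \<psi> f, of j] and cG = lp_fun_continuous[OF \<psi> g, of j]
  have [measurable]: "?F \<in> borel_measurable borel" "?G \<in> borel_measurable borel"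
    using cF cG by (auto intro: borel_measurable_continuous_onI)
  obtain C N where FG: "continuous_on UNIV (\<lambda>x. ?F x * ?G x)" "\<And>x. norm (?F x * ?G x) \<le> C * (1 + norm x) ^ N"
    by (rule lp_fun_product[OF \<psi> f g, where j = j]) blast
  obtain C1 N1 where F: "\<And>x. norm (?F x) \<le> C1 * (1 + norm x) ^ N1"
    by (rule lp_fun_bound[OF \<psi> f, where j = j]) blast
  obtain C2 N2 where G: "\<And>x. norm (?G x) \<le> C2 * (1 + norm x) ^ N2"
    by (rule lp_fun_bound[OF \<psi> g, where j = j]) blast
  have Tx: "(\<integral>t. ?F t * ?G t * \<rho> t * (\<theta> (t - x) * (\<theta> (t - x) * \<theta> (t - x))) \<partial>lborel) = ?c * (\<integral>z. T (x, z) \<partial>lborel)"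
    if i: "integrable lborel (\<lambda>z. T (x, z))" for x
  proof -
    obtain A where A: "\<And>t. norm (?F t * \<theta> (t - x)) \<le> A" using windowed_growth(3)[OF cF F \<theta>] by blast
    obtain B where B: "\<And>t. norm (?G t * \<theta> (t - x)) \<le> B" using windowed_growth(3)[OF cG G \<theta>] by blast
    have "(\<integral>\<^sup>+\<xi>. (\<integral>\<^sup>+\<eta>. ennreal (norm (T (x, \<xi>, \<eta>))) \<partial>lborel) \<partial>lborel) = (\<integral>\<^sup>+z. ennreal (norm (T (x, z))) \<partial>lborel)"
      by (rule nn_integral_lborel_pair[symmetric]) (use borel_measurable_integrable[OF i] in simp)
    also have "\<dots> < \<infinity>" using i by (simp add: integrable_iff_bounded)
    finally have fin: "(\<integral>\<^sup>+\<xi>. (\<integral>\<^sup>+\<eta>. ennreal (norm (fourier (\<lambda>t. ?F t * \<theta> (t - x)) \<xi> * fourier (\<lambda>t. ?G t * \<theta> (t - x)) \<eta>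
      * fourier (\<lambda>t. \<rho> t * \<theta> (t - x)) (- \<xi> - \<eta>))) \<partial>lborel) \<partial>lborel) < \<infinity>"
      by (simp add: T_def lp_stft_def)
    have "(\<integral>t. (?F t * \<theta> (t - x)) * ((?G t * \<theta> (t - x)) * (\<rho> t * \<theta> (t - x))) \<partial>lborel)
      = ?c * (\<integral>z. fourier (\<lambda>t. ?F t * \<theta> (t - x)) (fst z) * fourier (\<lambda>t. ?G t * \<theta> (t - x)) (snd z)
        * fourier (\<lambda>t. \<rho> t * \<theta> (t - x)) (- fst z - snd z) \<partial>lborel)"
      by (rule triple_parseval[OF windowed_growth(1)[OF cF F \<theta>] A windowed_growth(2)[OF cF F \<theta>]
            windowed_growth(1)[OF cG G \<theta>] B windowed_growth(2)[OF cG G \<theta>] schwartz_times[OF r schwartz_shift[OF \<theta>]] fin])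
    also have "\<dots> = ?c * (\<integral>z. T (x, z) \<partial>lborel)" by (simp add: T_def lp_stft_def)
    finally show ?thesis by (simp only: mult_ac)
  qed
  have "(\<integral>s. \<theta> s * (\<theta> s * \<theta> s) \<partial>lborel) * (\<integral>t. ?F t * ?G t * \<rho> t \<partial>lborel)
    = (\<integral>x. (\<integral>t. ?F t * ?G t * \<rho> t * (\<theta> (t - x) * (\<theta> (t - x) * \<theta> (t - x))) \<partial>lborel) \<partial>lborel)"
    by (rule window_split[OF FG schwartz_times[OF \<theta> schwartz_times[OF \<theta> \<theta>]] r])
  also have "\<dots> = (\<integral>x. ?c * (\<integral>z. T (x, z) \<partial>lborel) \<partial>lborel)"
  \<comment> \<open>The sections of T are integrable for almost every x, so \<open>Tx\<close> is
    available almost everywhere.\<close>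
  proof (rule integral_cong_AE)
    show "(\<lambda>x. \<integral>t. ?F t * ?G t * \<rho> t * (\<theta> (t - x) * (\<theta> (t - x) * \<theta> (t - x))) \<partial>lborel) \<in> borel_measurable lborel"
      by measurable
    show "(\<lambda>x. ?c * (\<integral>z. T (x, z) \<partial>lborel)) \<in> borel_measurable lborel"
      using borel_measurable_integrable[OF integral_lborel_pair(3)[OF T]] by simp
    show "AE x in lborel. (\<integral>t. ?F t * ?G t * \<rho> t * (\<theta> (t - x) * (\<theta> (t - x) * \<theta> (t - x))) \<partial>lborel) = ?c * (\<integral>z. T (x, z) \<partial>lborel)"
      using integral_lborel_pair(2)[OF T] by (rule eventually_mono) (rule Tx)
  qed
  also have "\<dots> = ?c * (\<integral>z. T z \<partial>lborel)"
    unfolding integral_lborel_pair(1)[OF T] by (simp only: Bochner_Integration.integral_mult_right_zero)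
  finally show ?thesis .
qed

text \<open>The test function may be any one whose windowed transform is concentrated near x = y and
  \<omega> = - \<zeta> with constant E. This serves two purposes: at the origin, an arbitrary
  Schwartz function gives existence and continuity of the limit; at a general point, a shift of the
  window gives the bound on the transform of the product.\<close>

lemma lp_product_pairing:
  fixes \<psi> \<phi> :: "'a::euclidean_space \<Rightarrow> complex" and m :: nat
  assumes \<psi>: "cutoff_function \<psi>" and \<phi>: "window \<phi>"
  defines "\<theta> \<equiv> \<lambda>t. cnj (\<phi> t) * \<phi> t" and "k \<equiv> 2 * m + Suc DIM('a)"
    and "V \<equiv> \<lambda>f x \<xi>. ennreal (norm (stft \<phi> f x \<xi>))"
  obtains K where "0 < K"
    "\<And>f g \<rho> y \<zeta> E. f \<in> tempered_distributions \<Longrightarrow> g \<in> tempered_distributions \<Longrightarrow> \<rho> \<in> schwartz_space \<Longrightarrow> 0 \<le> E \<Longrightarrow>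
      (\<And>x \<omega>. norm (fourier (\<lambda>t. \<rho> t * \<theta> (t - x)) \<omega>) \<le> E * decay k (x - y) * decay k (\<omega> + \<zeta>)) \<Longrightarrow>
      smear_product m (V f) (V g) y \<zeta> < \<infinity> \<Longrightarrow>
      \<exists>L. (\<lambda>j. \<integral>t. lp_fun \<psi> f j t * lp_fun \<psi> g j t * \<rho> t \<partial>lborel) \<longlonglongrightarrow> L
        \<and> ennreal (norm L) \<le> ennreal (K * E) * smear_product m (V f) (V g) y \<zeta>"
proof -
  let ?c = "fourier_const TYPE('a)"
  have p: "\<phi> \<in> schwartz_space" using \<phi> by (simp add: window_def)
  have \<theta>: "\<theta> \<in> schwartz_space" unfolding \<theta>_def by (rule schwartz_times[OF schwartz_cnj[OF p] p])
  have [measurable]: "\<theta> \<in> borel_measurable borel" by (rule schwartz_measurable[OF \<theta>])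
  define n where "n = (\<integral>s. \<theta> s * (\<theta> s * \<theta> s) \<partial>lborel)"
  \<comment> \<open>The cube of \<theta> is |\<phi>|^6, so that \<open>window_integral_neq_0\<close>
    excludes a vanishing normalising constant n.\<close>
  have n6: "(\<lambda>t. of_real (norm (\<phi> t) ^ 6)) = (\<lambda>t. \<theta> t * (\<theta> t * \<theta> t))"
  proof
    fix t
    have "complex_of_real (norm (\<phi> t) ^ 6) = of_real ((norm (\<phi> t))\<^sup>2) * (of_real ((norm (\<phi> t))\<^sup>2) * of_real ((norm (\<phi> t))\<^sup>2))"
      by (simp add: power_add[symmetric])
    then show "complex_of_real (norm (\<phi> t) ^ 6) = \<theta> t * (\<theta> t * \<theta> t)"
      by (simp only: \<theta>_def complex_norm_square[symmetric] mult.commute[of "cnj _"])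
  qed
  have n: "n \<noteq> 0"
    using window_integral_neq_0[OF \<phi>, of 6] schwartz_times[OF \<theta> schwartz_times[OF \<theta> \<theta>]] unfolding n_def n6[symmetric] by blast
  obtain C where C: "0 < C" "\<And>f j y \<zeta>. f \<in> tempered_distributions \<Longrightarrow>
    ennreal (norm (lp_stft \<psi> \<theta> f j y \<zeta>)) \<le> ennreal C * smear m (V f) y \<zeta>"
    unfolding V_def by (rule lp_stft_majorant[OF \<psi> \<phi> \<theta>, where m = m]) blast
  define J where "J = (\<integral>u. decay (Suc DIM('a)) (u::'a) \<partial>lborel)"
  have J: "0 \<le> J" unfolding J_def by (intro integral_nonneg_AE) auto
  \<comment> \<open>The quotient by \<open>norm n\<close> comes from solving Parseval's formula for
    the pairing, each C from the majorant of one factor, and J * J from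
    \<open>smear_product_localised\<close>; the summand 1 secures positivity.\<close>
  define K where "K = ?c / norm n * (C * C * (J * J)) + 1"
  show ?thesis
  proof
    show "0 < K" unfolding K_def using J C(1) fourier_const_pos[where 'a = 'a] by (intro add_nonneg_pos) auto
    fix f g :: "'a functional" and \<rho> :: "'a \<Rightarrow> complex" and y \<zeta> :: 'a and E :: real
    assume f: "f \<in> tempered_distributions" and g: "g \<in> tempered_distributions" and r: "\<rho> \<in> schwartz_space" and E: "0 \<le> E"
      and R: "\<And>x \<omega>. norm (fourier (\<lambda>t. \<rho> t * \<theta> (t - x)) \<omega>) \<le> E * decay k (x - y) * decay k (\<omega> + \<zeta>)"
      and fin: "smear_product m (V f) (V g) y \<zeta> < \<infinity>"
    have V: "case_prod (V f) \<in> borel_measurable (borel \<Otimes>\<^sub>M borel)" if "f \<in> tempered_distributions" for f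
      using gstft_measurable[OF \<psi> that schwartz_cnj[OF p]] unfolding V_def stft_eq_gstft by measurable
    note [measurable] = V[OF f] V[OF g] schwartz_measurable[OF r]
      lp_stft_measurable[OF \<psi> f \<theta>] lp_stft_measurable[OF \<psi> g \<theta>] gstft_measurable[OF \<psi> f \<theta>] gstft_measurable[OF \<psi> g \<theta>]
    define R where "R x \<omega> = fourier (\<lambda>t. \<rho> t * \<theta> (t - x)) \<omega>" for x \<omega>
    have [measurable]: "case_prod R \<in> borel_measurable (borel \<Otimes>\<^sub>M borel)"
      unfolding R_def fourier_eq character_def by measurable
    define T where "T j z = lp_stft \<psi> \<theta> f j (fst z) (fst (snd z)) * lp_stft \<psi> \<theta> g j (fst z) (snd (snd z))
      * R (fst z) (- fst (snd z) - snd (snd z))" for j and z :: "'a \<times> 'a \<times> 'a"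
    define S where "S z = gstft \<theta> f (fst z) (fst (snd z)) * gstft \<theta> g (fst z) (snd (snd z))
      * R (fst z) (- fst (snd z) - snd (snd z))" for z :: "'a \<times> 'a \<times> 'a"
    \<comment> \<open>The majorant for all T j at once. The windowed transform of \<rho> is
      evaluated at - \<xi> - \<eta>, so its decay localises around \<xi> + \<eta> = \<zeta>.\<close>
    define D where "D z = ennreal (C * C * E) * (smear m (V f) (fst z) (fst (snd z)) * smear m (V g) (fst z) (snd (snd z))
      * ennreal (decay k (fst z - y) * decay k (\<zeta> - fst (snd z) - snd (snd z))))" for z :: "'a \<times> 'a \<times> 'a"
    have T_meas: "T j \<in> borel_measurable lborel" for j
      unfolding T_def measurable_lborel2 borel_prod[symmetric] by measurable
    have S_meas: "S \<in> borel_measurable lborel"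
      unfolding S_def measurable_lborel2 borel_prod[symmetric] by measurable
    have D_meas: "D \<in> borel_measurable borel"
      unfolding D_def borel_prod[symmetric] by measurable
    have "(\<integral>\<^sup>+z. D z \<partial>lborel) = (\<integral>\<^sup>+x. (\<integral>\<^sup>+z. D (x, z) \<partial>lborel) \<partial>lborel)"
      by (rule nn_integral_lborel_pair[OF D_meas])
    also have "\<dots> = (\<integral>\<^sup>+x. (\<integral>\<^sup>+\<xi>. (\<integral>\<^sup>+\<eta>. D (x, \<xi>, \<eta>) \<partial>lborel) \<partial>lborel) \<partial>lborel)"
    proof (intro nn_integral_cong nn_integral_lborel_pair)
      show "(\<lambda>z. D (x, z)) \<in> borel_measurable borel" for x
        unfolding D_def fst_conv snd_conv borel_prod[symmetric] by measurable
    qed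
    also have "\<dots> = ennreal (C * C * E) * (\<integral>\<^sup>+x. (\<integral>\<^sup>+\<xi>. (\<integral>\<^sup>+\<eta>. smear m (V f) x \<xi> * smear m (V g) x \<eta>
        * ennreal (decay k (x - y) * decay k (\<zeta> - \<xi> - \<eta>)) \<partial>lborel) \<partial>lborel) \<partial>lborel)"
      by (simp add: D_def nn_integral_cmult)
    also have "\<dots> \<le> ennreal (C * C * E) * (ennreal (J * J) * smear_product m (V f) (V g) y \<zeta>)"
      unfolding k_def J_def by (intro mult_left_mono smear_product_localised V f g) simp
    finally have Dle: "(\<integral>\<^sup>+z. D z \<partial>lborel) \<le> ennreal (C * C * E) * (ennreal (J * J) * smear_product m (V f) (V g) y \<zeta>)" .
    also have "\<dots> < \<infinity>" using fin by (simp add: ennreal_mult_less_top)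
    finally have Dfin: "(\<integral>\<^sup>+z. D z \<partial>lborel) < \<infinity>" .
    have bd: "ennreal (norm (T j z)) \<le> D z" for j z
    proof -
      obtain x \<xi> \<eta> where z: "z = (x, \<xi>, \<eta>)" by (cases z)
      have "decay k (- \<xi> - \<eta> + \<zeta>) = decay k (\<zeta> - \<xi> - \<eta>)" by (simp add: algebra_simps)
      then have "ennreal (norm (R x (- \<xi> - \<eta>))) \<le> ennreal (E * decay k (x - y) * decay k (\<zeta> - \<xi> - \<eta>))"
        using R[of x "- \<xi> - \<eta>"] unfolding R_def by (intro ennreal_leI) simp
      then have "ennreal (norm (T j z)) \<le> (ennreal C * smear m (V f) x \<xi>) * (ennreal C * smear m (V g) x \<eta>)
        * ennreal (E * decay k (x - y) * decay k (\<zeta> - \<xi> - \<eta>))"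
        unfolding T_def z fst_conv snd_conv norm_mult ennreal_mult[OF mult_nonneg_nonneg[OF norm_ge_zero norm_ge_zero] norm_ge_zero]
          ennreal_mult[OF norm_ge_zero norm_ge_zero]
        by (intro mult_mono C(2) f g) auto
      also have "\<dots> = D z" using C(1) E by (simp add: D_def z ennreal_mult mult_ac)
      finally show ?thesis .
    qed
    have lim: "(\<lambda>j. T j z) \<longlonglongrightarrow> S z" for z
      unfolding T_def S_def by (intro tendsto_intros lp_stft_tendsto \<psi> f g \<theta>)
    note dc = dominated_convergence_nn[of T lborel S D, OF T_meas S_meas _ Dfin bd lim]
    have Dm: "D \<in> borel_measurable lborel" using D_meas by simp
    have "n * (\<integral>t. lp_fun \<psi> f j t * lp_fun \<psi> g j t * \<rho> t \<partial>lborel) = of_real ?c * (\<integral>z. T j z \<partial>lborel)" for j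
      unfolding n_def T_def R_def
      by (rule lp_product_parseval[OF \<psi> f g \<theta> r]) (use dc(1)[OF Dm] in \<open>simp add: T_def[abs_def] R_def\<close>)
    then have "(\<integral>t. lp_fun \<psi> f j t * lp_fun \<psi> g j t * \<rho> t \<partial>lborel) = of_real ?c / n * (\<integral>z. T j z \<partial>lborel)" for j
      using n by (simp add: field_simps)
    moreover have "(\<lambda>j. of_real ?c / n * (\<integral>z. T j z \<partial>lborel)) \<longlonglongrightarrow> of_real ?c / n * (\<integral>z. S z \<partial>lborel)"
      by (intro tendsto_intros dc(2)[OF Dm])
    ultimately have "(\<lambda>j. \<integral>t. lp_fun \<psi> f j t * lp_fun \<psi> g j t * \<rho> t \<partial>lborel) \<longlonglongrightarrow> of_real ?c / n * (\<integral>z. S z \<partial>lborel)"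
      by simp
    moreover have "ennreal (norm (of_real ?c / n * (\<integral>z. S z \<partial>lborel))) \<le> ennreal (K * E) * smear_product m (V f) (V g) y \<zeta>"
    proof -
      define d where "d = ?c / norm n"
      have "norm (of_real ?c / n * (\<integral>z. S z \<partial>lborel)) = ?c / norm n * norm (\<integral>z. S z \<partial>lborel)"
        using fourier_const_pos[where 'a = 'a] by (simp add: norm_mult norm_divide)
      then have "ennreal (norm (of_real ?c / n * (\<integral>z. S z \<partial>lborel))) = ennreal (?c / norm n) * ennreal (norm (\<integral>z. S z \<partial>lborel))"
        using fourier_const_pos[where 'a = 'a] by (simp only: ennreal_mult[OF divide_nonneg_nonneg[OF less_imp_le norm_ge_zero] norm_ge_zero])
      also have "\<dots> \<le> ennreal (?c / norm n) * (ennreal (C * C * E) * (ennreal (J * J) * smear_product m (V f) (V g) y \<zeta>))"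
        by (intro mult_left_mono order_trans[OF dc(3)[OF Dm] Dle]) simp
      also have "\<dots> = ennreal (?c / norm n * ((C * C * E) * (J * J))) * smear_product m (V f) (V g) y \<zeta>"
        using divide_nonneg_nonneg[OF less_imp_le[OF fourier_const_pos[where 'a = 'a]] norm_ge_zero[of n]] C(1) E J
        unfolding d_def[symmetric] by (simp add: ennreal_mult mult.assoc)
      also have "\<dots> \<le> ennreal (K * E) * smear_product m (V f) (V g) y \<zeta>"
        using E by (intro mult_right_mono ennreal_leI) (auto simp: K_def algebra_simps)
      finally show ?thesis .
    qed
    ultimately show "\<exists>L. (\<lambda>j. \<integral>t. lp_fun \<psi> f j t * lp_fun \<psi> g j t * \<rho> t \<partial>lborel) \<longlonglongrightarrow> L
        \<and> ennreal (norm L) \<le> ennreal (K * E) * smear_product m (V f) (V g) y \<zeta>" by blast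
  qed
qed

lemma smear_product_majorant:
  fixes \<psi> \<phi> :: "'a::euclidean_space \<Rightarrow> complex" and m :: nat
  assumes \<psi>: "cutoff_function \<psi>" and \<phi>: "window \<phi>"
  defines "V \<equiv> \<lambda>f x \<xi>. ennreal (norm (stft \<phi> f x \<xi>))"
  obtains K where "0 < K"
    "\<And>f g. f \<in> tempered_distributions \<Longrightarrow> g \<in> tempered_distributions \<Longrightarrow> smear_product m (V f) (V g) 0 0 < \<infinity> \<Longrightarrow>
      \<exists>h. is_product \<psi> f g h \<and> (\<forall>y \<zeta>. V h y \<zeta> \<le> ennreal K * smear_product m (V f) (V g) y \<zeta>)"
proof -
  let ?c = "fourier_const TYPE('a)"
  define \<theta> where "\<theta> = (\<lambda>t. cnj (\<phi> t) * \<phi> t)"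
  define k where "k = 2 * m + Suc DIM('a)"
  have p: "\<phi> \<in> schwartz_space" using \<phi> by (simp add: window_def)
  note pc = schwartz_cnj[OF p]
  have \<theta>: "\<theta> \<in> schwartz_space" unfolding \<theta>_def by (rule schwartz_times[OF pc p])
  obtain K where K: "0 < K"
    "\<And>f g \<rho> y \<zeta> E. f \<in> tempered_distributions \<Longrightarrow> g \<in> tempered_distributions \<Longrightarrow> \<rho> \<in> schwartz_space \<Longrightarrow> 0 \<le> E \<Longrightarrow>
      (\<And>x \<omega>. norm (fourier (\<lambda>t. \<rho> t * \<theta> (t - x)) \<omega>) \<le> E * decay k (x - y) * decay k (\<omega> + \<zeta>)) \<Longrightarrow>
      smear_product m (V f) (V g) y \<zeta> < \<infinity> \<Longrightarrow>
      \<exists>L. (\<lambda>j. \<integral>t. lp_fun \<psi> f j t * lp_fun \<psi> g j t * \<rho> t \<partial>lborel) \<longlonglongrightarrow> L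
        \<and> ennreal (norm L) \<le> ennreal (K * E) * smear_product m (V f) (V g) y \<zeta>"
    unfolding V_def \<theta>_def k_def by (rule lp_product_pairing[OF \<psi> \<phi>, where m = m]) blast
  obtain D N where D: "0 < D" "\<And>(\<rho> :: 'a \<Rightarrow> complex) x \<omega>. \<rho> \<in> schwartz_space \<Longrightarrow>
    norm (fourier (\<lambda>t. \<rho> t * \<theta> (t - x)) \<omega>) \<le> D * schwartz_norm N \<rho> * decay k x * decay k \<omega>"
    by (rule windowed_fourier_decay[OF \<theta>, where k = k]) blast
  obtain D' where D': "0 < D'" "\<And>x y \<zeta> \<omega>. norm (fourier (\<lambda>t. tf_shift y \<zeta> (\<lambda>t. cnj (\<phi> t)) t * \<theta> (t - x)) \<omega>)
      \<le> D' * decay k (x - y) * decay k (\<omega> + \<zeta>)"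
    by (rule tf_shift_window_decay[OF pc \<theta>, where k = k]) blast
  show ?thesis
  proof
    show "0 < ?c * (K * D')" using K(1) D'(1) fourier_const_pos[where 'a = 'a] by simp
    fix f g :: "'a functional"
    assume f: "f \<in> tempered_distributions" and g: "g \<in> tempered_distributions" and fin: "smear_product m (V f) (V g) 0 0 < \<infinity>"
    define I where "I j \<rho> = (\<integral>t. lp_fun \<psi> f j t * lp_fun \<psi> g j t * \<rho> t \<partial>lborel)" for j \<rho>
    \<comment> \<open>\<open>lim\<close> is total; that it is a limit here, and that it is bounded
      by a Schwartz norm, is the content of \<open>L\<close>.\<close>
    define h where "h = (\<lambda>\<rho>\<in>schwartz_space. lim (\<lambda>j. I j \<rho>))"
    define b where "b = enn2real (smear_product m (V f) (V g) 0 0)"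
    have b: "smear_product m (V f) (V g) 0 0 = ennreal b" "0 \<le> b" using fin by (simp_all add: b_def less_top)
    have L: "(\<lambda>j. I j \<rho>) \<longlonglongrightarrow> h \<rho>" "norm (h \<rho>) \<le> (K * D * b) * schwartz_norm N \<rho>" if r: "\<rho> \<in> schwartz_space" for \<rho>
    proof -
      \<comment> \<open>For a general test function the point (y, \<zeta>) = (0, 0) is used: there
        the concentration constant is a multiple of a Schwartz norm of \<rho>.\<close>
      have E: "0 \<le> D * schwartz_norm N \<rho>" using D(1) schwartz_norm_nonneg[OF r] by simp
      obtain l where l: "(\<lambda>j. I j \<rho>) \<longlonglongrightarrow> l" "ennreal (norm l) \<le> ennreal (K * (D * schwartz_norm N \<rho>)) * ennreal b"
        unfolding I_def b(1)[symmetric] using K(2)[OF f g r E, of 0 0] D(2)[OF r] fin by auto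
      have hl: "h \<rho> = l" using limI[OF l(1)] r by (simp add: h_def)
      show "(\<lambda>j. I j \<rho>) \<longlonglongrightarrow> h \<rho>" unfolding hl by (rule l(1))
      have "ennreal (norm l) \<le> ennreal (K * (D * schwartz_norm N \<rho>) * b)"
        using l(2) E K(1) b(2) by (simp add: ennreal_mult)
      moreover have "0 \<le> K * (D * schwartz_norm N \<rho>) * b" using E K(1) b(2) by simp
      ultimately have "norm l \<le> K * (D * schwartz_norm N \<rho>) * b" by (rule ennreal_le_iff[THEN iffD1, rotated])
      then show "norm (h \<rho>) \<le> (K * D * b) * schwartz_norm N \<rho>" by (simp add: hl mult_ac)
    qed
    have int: "integrable lborel (\<lambda>t. lp_fun \<psi> f j t * lp_fun \<psi> g j t * \<rho> t)" if "\<rho> \<in> schwartz_space" for \<rho> j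
      by (rule lp_fun_product[OF \<psi> f g, where j = j]) (rule integrable_growth_schwartz[OF _ _ that])
    have "h \<in> tempered_distributions"
      unfolding tempered_distributions_def
    proof (intro CollectI conjI ballI allI)
      show "h \<in> extensional schwartz_space" by (simp add: h_def)
      show "\<exists>C N. \<forall>\<rho>\<in>schwartz_space. norm (h \<rho>) \<le> C * schwartz_norm N \<rho>" using L(2) by blast
      show "h (\<lambda>x. \<rho> x + \<eta> x) = h \<rho> + h \<eta>" if r: "\<rho> \<in> schwartz_space" "\<eta> \<in> schwartz_space" for \<rho> \<eta>
      proof (rule LIMSEQ_unique[OF L(1)[OF schwartz_add[OF r]]])
        have "I j (\<lambda>x. \<rho> x + \<eta> x) = I j \<rho> + I j \<eta>" for j
          unfolding I_def distrib_left by (intro Bochner_Integration.integral_add int r)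
        then show "(\<lambda>j. I j (\<lambda>x. \<rho> x + \<eta> x)) \<longlonglongrightarrow> h \<rho> + h \<eta>"
          using tendsto_add[OF L(1)[OF r(1)] L(1)[OF r(2)]] by simp
      qed
      show "h (\<lambda>x. a * \<rho> x) = a * h \<rho>" if r: "\<rho> \<in> schwartz_space" for a \<rho>
      proof (rule LIMSEQ_unique[OF L(1)[OF schwartz_cmult[OF r]]])
        have "I j (\<lambda>x. a * \<rho> x) = a * I j \<rho>" for j
          unfolding I_def mult.left_commute[of _ a] by simp
        then show "(\<lambda>j. I j (\<lambda>x. a * \<rho> x)) \<longlonglongrightarrow> a * h \<rho>"
          using tendsto_mult_left[OF L(1)[OF r]] by simp
      qed
    qed
    then have prod: "is_product \<psi> f g h"
      using L(1) by (simp add: is_product_def low_pass_product_def dist_of_fun_def fun_of_dist_low_pass[OF \<psi> f] fun_of_dist_low_pass[OF \<psi> g] I_def)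
    have "V h y \<zeta> \<le> ennreal (?c * (K * D')) * smear_product m (V f) (V g) y \<zeta>" for y \<zeta>
    proof (cases "smear_product m (V f) (V g) y \<zeta> < \<infinity>")
      case True
      \<comment> \<open>The value of h on this shift is, up to the Fourier constant, its short-time
        Fourier transform at (y, \<zeta>); the concentration constant D' is the same for all
        points.\<close>
      note r = schwartz_tf_shift[OF pc, of y \<zeta>]
      obtain l where l: "(\<lambda>j. I j (tf_shift y \<zeta> (\<lambda>t. cnj (\<phi> t)))) \<longlonglongrightarrow> l"
        "ennreal (norm l) \<le> ennreal (K * D') * smear_product m (V f) (V g) y \<zeta>"
        unfolding I_def using K(2)[OF f g r less_imp_le[OF D'(1)] D'(2) True] by auto
      have hl: "h (tf_shift y \<zeta> (\<lambda>t. cnj (\<phi> t))) = l" by (rule LIMSEQ_unique[OF L(1)[OF r] l(1)])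
      have "V h y \<zeta> = ennreal ?c * ennreal (norm l)"
        using fourier_const_pos[where 'a = 'a] by (simp add: V_def stft_eq_gstft gstft_def hl norm_mult ennreal_mult)
      also have "\<dots> \<le> ennreal ?c * (ennreal (K * D') * smear_product m (V f) (V g) y \<zeta>)"
        by (intro mult_left_mono l(2)) simp
      finally show ?thesis
        using fourier_const_pos[where 'a = 'a] K(1) D'(1) by (simp add: ennreal_mult mult.assoc)
    next
      case False
      then have "smear_product m (V f) (V g) y \<zeta> = top" by (simp add: top.not_eq_extremum[symmetric])
      then show ?thesis
        using fourier_const_pos[where 'a = 'a] K(1) D'(1) by (simp add: ennreal_mult_top)
    qed
    then show "\<exists>h. is_product \<psi> f g h \<and> (\<forall>y \<zeta>. V h y \<zeta> \<le> ennreal (?c * (K * D')) * smear_product m (V f) (V g) y \<zeta>)"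
      using prod by blast
  qed
qed

section \<open>The exponents as real indices and the final estimate\<close>

lemma enn2real_inverse:
  fixes p :: ennreal
  assumes "1 \<le> p"
  shows "1 / p = ennreal (enn2real (1 / p))" and "enn2real (1 / p) \<le> 1"
proof -
  have "1 / p \<le> 1" using assms by (cases p) (auto simp: ennreal_1[symmetric] divide_ennreal simp del: ennreal_1)
  then show "1 / p = ennreal (enn2real (1 / p))" "enn2real (1 / p) \<le> 1"
    using enn2real_mono[of "1 / p" 1] by (auto simp: less_top[symmetric] dest: neq_top_trans[rotated])
qed

lemma Lnorm_top:
  assumes "0 \<le> a" shows "Lnorm lborel a (\<lambda>x::'a::euclidean_space. top) = top"
  using assms by (auto simp: Lnorm_def ennreal_power_def esssup_const ennreal_mult_top)

text \<open>The weight does not depend on x and is a positive real, so it leaves the inner norm as a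
  factor even if that norm is infinite.\<close>

lemma modulation_norm_eq_Lnorm:
  fixes \<phi> \<psi> :: "'a::euclidean_space \<Rightarrow> complex"
  assumes "cutoff_function \<psi>" "window \<phi>" "f \<in> tempered_distributions" "1 \<le> p" "1 \<le> q"
  shows "modulation_norm \<phi> s p q f = Lnorm lborel (enn2real (1 / q)) (\<lambda>\<xi>.
    Lnorm lborel (enn2real (1 / p)) (\<lambda>x. ennreal (norm (stft \<phi> f x \<xi>))) * ennreal (japanese_bracket \<xi> powr s))"
proof -
  have [measurable]: "(\<lambda>(x, \<xi>). gstft (\<lambda>t. cnj (\<phi> t)) f x \<xi>) \<in> borel_measurable (borel \<Otimes>\<^sub>M borel)"
    using assms(2) by (intro gstft_measurable[OF assms(1,3)] schwartz_cnj) (simp add: window_def)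
  have "Lnorm lborel (enn2real (1 / p)) (\<lambda>x. ennreal (norm (stft \<phi> f x \<xi> * complex_of_real (japanese_bracket \<xi> powr s))))
    = Lnorm lborel (enn2real (1 / p)) (\<lambda>x. ennreal (norm (stft \<phi> f x \<xi>))) * ennreal (japanese_bracket \<xi> powr s)" for \<xi>
    unfolding stft_eq_gstft
    by (subst mult.commute, subst Lnorm_cmult_real[symmetric]) (auto simp: norm_mult ennreal_mult mult.commute)
  then show ?thesis using assms(4,5) by (simp add: modulation_norm_def Lp_norm_eq_Lnorm)
qed

theorem theorem3p22:
  fixes \<phi> \<psi> :: "real ^ 'n \<Rightarrow> complex"
    and p p\<^sub>1 p\<^sub>2 q q' :: ennreal
    and s\<^sub>0 s\<^sub>1 s\<^sub>2 :: real
  assumes "window \<phi>" and "cutoff_function \<psi>"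
    and "1 \<le> p" "1 \<le> p\<^sub>1" "1 \<le> p\<^sub>2"
    and "1 / p \<le> 1 / p\<^sub>1 + 1 / p\<^sub>2"
    and "1 < q" and "1 / q + 1 / q' = 1"
    and "0 \<le> s\<^sub>0" "s\<^sub>0 \<le> min s\<^sub>1 s\<^sub>2"
    and "s\<^sub>1 + s\<^sub>2 - s\<^sub>0 > real CARD('n) * enn2real (1 / q')"
  shows "\<exists>c::real. \<forall>f \<in> modulation_space \<phi> s\<^sub>1 p\<^sub>1 q. \<forall>g \<in> modulation_space \<phi> s\<^sub>2 p\<^sub>2 q.
           product_exists \<psi> f g \<and>
           modulation_norm \<phi> s\<^sub>0 p q (dist_product \<psi> f g)
             \<le> ennreal c * modulation_norm \<phi> s\<^sub>1 p\<^sub>1 q f * modulation_norm \<phi> s\<^sub>2 p\<^sub>2 q g"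
proof -
  define a a1 a2 b where "a = enn2real (1 / p)" and "a1 = enn2real (1 / p\<^sub>1)" and "a2 = enn2real (1 / p\<^sub>2)" and "b = enn2real (1 / q)"
  have q1: "1 \<le> q" using assms by simp
  have ab: "0 \<le> a" "a \<le> 1" "0 \<le> a1" "a1 \<le> 1" "0 \<le> a2" "a2 \<le> 1" "0 \<le> b"
    unfolding a_def a1_def a2_def b_def using assms enn2real_inverse(2) by auto
  \<comment> \<open>Strictness is the hypothesis q > 1; the index 1 - b of the frequency weight has
    to be positive.\<close>
  have b1: "b < 1"
  proof (cases q)
    case (real r)
    have "1 < r" using \<open>1 < q\<close> real by (simp add: ennreal_1[symmetric] ennreal_less_iff del: ennreal_1)
    moreover from this have "b = 1 / r" using real by (simp add: b_def ennreal_1[symmetric] divide_ennreal del: ennreal_1)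
    ultimately show ?thesis by simp
  qed (simp add: b_def)
  have "ennreal a \<le> ennreal a1 + ennreal a2"
    unfolding a_def a1_def a2_def using assms by (simp add: enn2real_inverse(1)[symmetric])
  then have a12: "a \<le> a1 + a2" using ab by (simp add: ennreal_plus[symmetric] del: ennreal_plus)
  \<comment> \<open>In the identity 1/q + 1/q' = 1 both summands are finite, so it can be read in
    the reals and gives 1/q' = 1 - b.\<close>
  have "1 / q' \<le> 1" using assms(8) by (metis add_increasing zero_le order_refl add.commute)
  then have "1 / q' = ennreal (enn2real (1 / q'))" by (auto simp: less_top[symmetric] dest: neq_top_trans[rotated])
  then have "ennreal (b + enn2real (1 / q')) = ennreal 1"
    using assms(8) enn2real_inverse(1)[OF q1] ab by (simp add: b_def ennreal_plus)
  then have "b + enn2real (1 / q') = 1" using ab by (subst (asm) ennreal_inj) auto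
  then have q': "enn2real (1 / q') = 1 - b" by simp
  \<comment> \<open>Absolute values make m exceed the dimension plus either of the two
    weights.\<close>
  obtain m :: nat where m: "real DIM(real ^ 'n) + \<bar>s\<^sub>1\<bar> + \<bar>s\<^sub>2\<bar> < m" using reals_Archimedean2 by blast
  have s: "s\<^sub>0 \<le> s\<^sub>1" "s\<^sub>0 \<le> s\<^sub>2" "real DIM(real ^ 'n) * (1 - b) < s\<^sub>1 + s\<^sub>2 - s\<^sub>0"
    "real DIM(real ^ 'n) + s\<^sub>1 < real m" "real DIM(real ^ 'n) + s\<^sub>2 < real m"
    using assms(10,11) m by (simp_all add: q')
  obtain C where C: "0 < C" "\<And>V W :: real ^ 'n \<Rightarrow> real ^ 'n \<Rightarrow> ennreal.
    case_prod V \<in> borel_measurable (borel \<Otimes>\<^sub>M borel) \<Longrightarrow> case_prod W \<in> borel_measurable (borel \<Otimes>\<^sub>M borel) \<Longrightarrow>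
    Lnorm lborel b (\<lambda>\<zeta>. Lnorm lborel a (\<lambda>x. smear_product m V W x \<zeta>) * ennreal (japanese_bracket \<zeta> powr s\<^sub>0))
    \<le> ennreal C * Lnorm lborel b (\<lambda>\<omega>. Lnorm lborel a1 (\<lambda>x. V x \<omega>) * ennreal (japanese_bracket \<omega> powr s\<^sub>1))
      * Lnorm lborel b (\<lambda>\<omega>. Lnorm lborel a2 (\<lambda>x. W x \<omega>) * ennreal (japanese_bracket \<omega> powr s\<^sub>2))"
    unfolding smear_product_def
    by (rule Lnorm_smear_product[OF ab(1-6) a12 ab(7) b1 assms(9) s]) blast
  define V where "V f x \<xi> = ennreal (norm (stft \<phi> f x \<xi>))" for f x \<xi>
  obtain K where K: "0 < K" "\<And>f g. f \<in> tempered_distributions \<Longrightarrow> g \<in> tempered_distributions \<Longrightarrow> smear_product m (V f) (V g) 0 0 < \<infinity> \<Longrightarrow>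
      \<exists>h. is_product \<psi> f g h \<and> (\<forall>y \<zeta>. V h y \<zeta> \<le> ennreal K * smear_product m (V f) (V g) y \<zeta>)"
    unfolding V_def by (rule smear_product_majorant[OF assms(2,1), where m = m]) blast
  have V: "case_prod (V f) \<in> borel_measurable (borel \<Otimes>\<^sub>M borel)" if "f \<in> tempered_distributions" for f
  proof -
    have [measurable]: "(\<lambda>(x, \<xi>). gstft (\<lambda>t. cnj (\<phi> t)) f x \<xi>) \<in> borel_measurable (borel \<Otimes>\<^sub>M borel)"
      using assms(1) by (intro gstft_measurable[OF assms(2) that] schwartz_cnj) (simp add: window_def)
    show ?thesis unfolding V_def stft_eq_gstft by measurable
  qed
  have norm_eq: "modulation_norm \<phi> s p q f = Lnorm lborel b (\<lambda>\<xi>. Lnorm lborel (enn2real (1 / p)) (\<lambda>x. V f x \<xi>) * ennreal (japanese_bracket \<xi> powr s))"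
    if "f \<in> tempered_distributions" "1 \<le> p" for f s p
    unfolding V_def b_def by (rule modulation_norm_eq_Lnorm[OF assms(2,1) that q1])
  show ?thesis
  proof (intro exI ballI)
    fix f g assume fM: "f \<in> modulation_space \<phi> s\<^sub>1 p\<^sub>1 q" and gM: "g \<in> modulation_space \<phi> s\<^sub>2 p\<^sub>2 q"
    then have f: "f \<in> tempered_distributions" and g: "g \<in> tempered_distributions" by (auto simp: modulation_space_def)
    let ?B = "smear_product m (V f) (V g)"
    note [measurable] = V[OF f] V[OF g]
    have B_meas [measurable]: "case_prod ?B \<in> borel_measurable (borel \<Otimes>\<^sub>M borel)"
      unfolding smear_product_def by measurable
    have le: "Lnorm lborel b (\<lambda>\<zeta>. Lnorm lborel a (\<lambda>x. ?B x \<zeta>) * ennreal (japanese_bracket \<zeta> powr s\<^sub>0))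
      \<le> ennreal C * modulation_norm \<phi> s\<^sub>1 p\<^sub>1 q f * modulation_norm \<phi> s\<^sub>2 p\<^sub>2 q g"
      unfolding norm_eq[OF f assms(4)] norm_eq[OF g assms(5)] a1_def[symmetric] a2_def[symmetric] by (rule C(2)[OF V[OF f] V[OF g]])
    \<comment> \<open>The existence of the product rests on this. An infinite value would spread to
      all points by slow variation and make the left-hand side of \<open>le\<close> infinite, while
      the right-hand side is finite for elements of the modulation spaces.\<close>
    have fin: "?B 0 0 < \<infinity>"
    proof (rule ccontr)
      assume "\<not> ?B 0 0 < \<infinity>"
      then have top: "?B 0 0 = top" by (simp add: top.not_eq_extremum[symmetric])
      have "?B y \<zeta> = top" for y \<zeta>
      proof (rule ccontr)
        assume "?B y \<zeta> \<noteq> top"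
        then show False
          using smear_product_slowly_varying[OF V[OF f] V[OF g], of m y "- y" \<zeta> "- \<zeta>"] top
          by (simp add: top_unique ennreal_mult_eq_top_iff)
      qed
      then have "Lnorm lborel b (\<lambda>\<zeta>. Lnorm lborel a (\<lambda>x. ?B x \<zeta>) * ennreal (japanese_bracket \<zeta> powr s\<^sub>0)) = top"
        using ab by (simp add: Lnorm_top ennreal_top_mult)
      then show False using le fM gM by (auto simp: modulation_space_def ennreal_mult_less_top top_unique ennreal_mult_eq_top_iff)
    qed
    obtain h where h: "is_product \<psi> f g h" "\<And>y \<zeta>. V h y \<zeta> \<le> ennreal K * ?B y \<zeta>" using K(2)[OF f g fin] by blast
    have hT: "h \<in> tempered_distributions" using h(1) by (simp add: is_product_def)
    note [measurable] = V[OF hT]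
    have "modulation_norm \<phi> s\<^sub>0 p q h
      = Lnorm lborel b (\<lambda>\<zeta>. Lnorm lborel a (\<lambda>x. V h x \<zeta>) * ennreal (japanese_bracket \<zeta> powr s\<^sub>0))"
      unfolding a_def by (rule norm_eq[OF hT assms(3)])
    also have "\<dots> \<le> Lnorm lborel b (\<lambda>\<zeta>. ennreal K * (Lnorm lborel a (\<lambda>x. ?B x \<zeta>) * ennreal (japanese_bracket \<zeta> powr s\<^sub>0)))"
    proof (rule Lnorm_mono)
      show "(\<lambda>\<zeta>. Lnorm lborel a (\<lambda>x. V h x \<zeta>) * ennreal (japanese_bracket \<zeta> powr s\<^sub>0)) \<in> borel_measurable lborel" by measurable
      fix \<zeta> :: "real ^ 'n"
      have "Lnorm lborel a (\<lambda>x. V h x \<zeta>) \<le> Lnorm lborel a (\<lambda>x. ennreal K * ?B x \<zeta>)"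
        by (rule Lnorm_mono[OF _ h(2) ab(1)]) measurable
      also have "\<dots> \<le> ennreal K * Lnorm lborel a (\<lambda>x. ?B x \<zeta>)" by (rule Lnorm_cmult[OF _ ab(1)]) measurable
      finally show "Lnorm lborel a (\<lambda>x. V h x \<zeta>) * ennreal (japanese_bracket \<zeta> powr s\<^sub>0)
        \<le> ennreal K * (Lnorm lborel a (\<lambda>x. ?B x \<zeta>) * ennreal (japanese_bracket \<zeta> powr s\<^sub>0))"
        unfolding mult.assoc[symmetric] by (rule mult_right_mono) simp
    qed (rule ab)
    also have "\<dots> \<le> ennreal K * Lnorm lborel b (\<lambda>\<zeta>. Lnorm lborel a (\<lambda>x. ?B x \<zeta>) * ennreal (japanese_bracket \<zeta> powr s\<^sub>0))"
      by (rule Lnorm_cmult[OF _ ab(7)]) measurable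
    also have "\<dots> \<le> ennreal K * (ennreal C * modulation_norm \<phi> s\<^sub>1 p\<^sub>1 q f * modulation_norm \<phi> s\<^sub>2 p\<^sub>2 q g)"
      by (intro mult_left_mono le) simp
    also have "\<dots> = ennreal (K * C) * modulation_norm \<phi> s\<^sub>1 p\<^sub>1 q f * modulation_norm \<phi> s\<^sub>2 p\<^sub>2 q g"
      using K(1) C(1) by (simp add: ennreal_mult mult.assoc)
    finally show "product_exists \<psi> f g \<and> modulation_norm \<phi> s\<^sub>0 p q (dist_product \<psi> f g)
        \<le> ennreal (K * C) * modulation_norm \<phi> s\<^sub>1 p\<^sub>1 q f * modulation_norm \<phi> s\<^sub>2 p\<^sub>2 q g"
      using h(1) by (auto simp: product_exists_def dist_product_eq)
  qed
qed

end
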